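(* Let $\Lambda$ be a measure on $\mathcal{Q}$ satisfying (i) $\Lambda(\{(0,\emptyset)\})+\Lambda(\{\emptyset\})=0$, $\int_{\mathcal{Q}}(1\wedge x_1)\Lambda(\mathrm{d}\bm{x})<\infty$, $\Lambda(\mathcal{Q}^{\star})\in(0,\infty]$; (ii) for all $a>0$, $\int_{\mathcal{Q}}\big|\sharp\{n\ge 1;\ x_n<a\}-1\big|\Lambda(\mathrm{d}\bm{x})<\infty$; (iii) for all $a>0$, $\int_{\mathcal{Q}}\big|\sharp\{n\ge 1;\ x_n<a\}-1\big|^2\Lambda(\mathrm{d}\bm{x})<\infty$. Assume moreover that: (1) there are $\alpha\in(0,1)$ and $C>0$ such that $\phi(\lambda):=\int_{\mathcal{Q}}(1-e^{-\lambda x_1})\Lambda(\mathrm{d}\bm{x})\sim C\lambda^{\alpha}$ as $\lambda\to\infty$; (2) there is $\sigma>0$ such that $$0<\liminf_{a\to\infty}\frac{\log(\mu([0,a)))}{a^{1+\sigma}}\le\limsup_{a\to\infty}\frac{\log(\mu([0,a)))}{a^{1+\sigma}}<\infty;$$ (3) for this $\sigma$, there is $c_0>0$ such that for all $c\in(0,c_0]$, $\limsup_{a\to\infty}\dfrac{M_{2,a}(ca^{\sigma})}{(M_a(ca^{\sigma}))^2}<\infty$; (4) $\Lambda(\{\bm{x}\in\mathcal{Q};\ 0<x_1\le x_2<\infty\})=0$. Let $\gamma:=\dfrac{1}{\alpha+(1-\alpha)(1+\sigma)}$. Then the branching subordinator $Y$ with characteristic couple $(0,\Lambda)$ satisfies,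 $\mathbb{P}$-almost surely, $$0<\liminf_{t\to\infty}\frac{\underline{Y}(t)}{t^{\gamma}}\le\limsup_{t\to\infty}\frac{\underline{Y}(t)}{t^{\gamma}}<\infty.$$
   Context: **The space $\mathcal{Q}$.** $\mathcal{Q}$ is the set of non-decreasing sequences $\bm{x}=(x_n)_{n\ge1}$ in $[0,\infty]$ with $\lim_n x_n=\infty$, identified with the point measures $\sum_{n:x_n<\infty}\delta_{x_n}$ on $[0,\infty)$ giving finite mass to each $[0,a]$; it carries the vague topology and its Borel $\sigma$-field. $\emptyset:=(\infty,\infty,\ldots)$, $(0,\emptyset):=(0,\infty,\infty,\ldots)$, $\mathcal{Q}^{\star}:=\{\bm{x}\in\mathcal{Q};\ x_2<\infty\}$. Convention: $e^{-\lambda\times\infty}=0$ for all $\lambda\ge0$. $\sharp B$ is the cardinality of $B$. **Functionals of $\Lambda$.** $\mu(A):=\int_{\mathcal{Q}}\big(\sum_{k\ge2}\mathds{1}_{\{x_k\in A\}}\big)\Lambda(\mathrm{d}\bm{x})$ for Borel $A\subset[0,\infty)$; for $a,\lambda\ge0$, $$M_a(\lambda):=\int_{\mathcal{Q}}\Big(\sum_{k\ge2}e^{-\lambda x_k}\mathds{1}_{\{x_k<a\}}\Big)\Lambda(\mathrm{d}\bm{x}),\qquad M_{2,a}(\lambda):=\int_{\mathcal{Q}}\Big(\sum_{k\ge2}e^{-\lambda x_k}\mathds{1}_{\{x_k<a\}}\Big)^2\Lambda(\mathrm{d}\bm{x}).$$ **Truncation.** For $a>0$, $T_a:\mathcal{Q}\to\mathcal{Q}$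 keeps $x_1$ unchanged and, for $i\ge2$, keeps $x_i$ if $x_i<a$ and replaces it by $\infty$ if $x_i\ge a$. $\Lambda^a(\mathrm{d}\bm{x}):=\mathds{1}_{\{\bm{x}\ne(0,\emptyset)\}}(T_a\Lambda)(\mathrm{d}\bm{x})$, with $T_a\Lambda$ the image measure. Then $\Lambda^a(\mathcal{Q}^\star)=\Lambda(\{x_2<a\})<\infty$, and one fixes $a_0(\Lambda)\ge0$ such that $\Lambda^a(\mathcal{Q}^\star)>0$ for all $a>a_0(\Lambda)$. **Truncated branching subordinator $Y^a$** with drift parameter $d\ge 0$ ($a>a_0(\Lambda)$; here $d=0$). At time $0$ there is one particle $\varnothing$, at position $0$. Particles never die. A particle $u$ born at time $\mathfrak{b}_u$ has, independently of the other particles, a subordinator $\xi_u$ started at $0$ with drift $d$ and Lévy measure the image of $\Lambda^a(\cdot\cap(\mathcal{Q}\setminus\mathcal{Q}^\star))$ under $\bm{x}\mapsto x_1$, and an independent Poisson point process $\mathcal{P}_u$ of points $(s,\bm{x})$ on $[\mathfrak{b}_u,\infty)\times\mathcal{Q}^\star$ with intensity $\mathrm{d}s\otimes\Lambda^a(\cdot\cap\mathcal{Q}^\star)$. For $t\ge\mathfrak{b}_u$ its position $Y^a_u(t)$ is its birth position plus $\xi_u(t-\mathfrak{b}_u)$ plus the sum of $x_1$ over points $(s,\bm{x})\in\mathcal{P}_u$ with $s\le t$. At each point $(s,\bm{x})\in\mathcal{P}_u$ (a branching), for each $i\ge2$ with $x_i<\infty$ a child of $u$ is born at time $s$ at position $Y^a_u(s-)+x_i$.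 $\mathcal{N}^a(t)$ is the (a.s. finite) set of particles born by time $t$; for $u\in\mathcal{N}^a(t)$ and $s<\mathfrak{b}_u$, $Y^a_u(s)$ is the position at time $s$ of the most recent ancestor of $u$ alive at time $s$. $Y^a(t):=\sum_{u\in\mathcal{N}^a(t)}\delta_{Y^a_u(t)}$. **Branching subordinator $Y$.** The $Y^a$ are constructed jointly so that for $a\le a'$, $Y^a$ is obtained from $Y^{a'}$ by removing, at each branching, every newborn child whose birth position is at distance $\ge a$ from the pre-branching position of its parent, together with all its descendants. The branching subordinator with characteristic couple $(d,\Lambda)$ is $Y(t):=\lim_{a\to\infty}\uparrow Y^a(t)$, with particle set $\mathcal{N}(t):=\bigcup_a\mathcal{N}^a(t)$ and positions $Y_u(t)$. The leftmost position is $\underline{Y}(t):=\min_{u\in\mathcal{N}(t)}Y_u(t)$. *)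

theory Defs
  imports "HOL-Probability.Probability" "HOL-Library.Landau_Symbols" "HOL-Library.Sublist"
begin

section \<open>The space of point configurations\<close>

text \<open>Sequences are indexed from 0: the n-th term of the mathematical sequence
  (numbered from 1) is \<open>x (n - 1)\<close>, so \<open>x 0\<close> is the first atom and \<open>x 1\<close> the second.\<close>

type_synonym conf = "nat \<Rightarrow> ennreal"

definition Qset :: "conf set" where
  "Qset = {x. mono x \<and> x \<longlonglongrightarrow> \<infinity>}"

definition conf_empty :: conf where
  "conf_empty = (\<lambda>_. \<infinity>)"

definition conf_zero :: conf where
  "conf_zero = (\<lambda>n. if n = 0 then 0 else \<infinity>)"

definition Qstar :: "conf set" where
  "Qstar = {x \<in> Qset. x 1 < \<infinity>}"

text \<open>The integral of a compactly supported \<open>f\<close> against the point measure of \<open>x\<close>; for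
  \<open>x \<in> Qset\<close> only finitely many terms are non-zero.\<close>

definition conf_integral :: "(real \<Rightarrow> real) \<Rightarrow> conf \<Rightarrow> real" where
  "conf_integral f x = (\<Sum>n. if x n < \<infinity> then f (enn2real (x n)) else 0)"

text \<open>The vague topology is the coarsest one for which integration against every continuous
  compactly supported function on the half-line is continuous.\<close>

definition vague_topology :: "conf topology" where
  "vague_topology = topology_generated_by
     {{x \<in> Qset. conf_integral f x \<in> U} | f U.
        continuous_on {0..} f \<and> (\<exists>R. \<forall>r>R. f r = 0) \<and> open U}"

definition Qspace :: "conf measure" where
  "Qspace = sigma Qset {U. openin vague_topology U}"


section \<open>Functionals of the branching measure\<close>

definition exp_neg :: "real \<Rightarrow> ennreal \<Rightarrow> real" where
  "exp_neg l y = (if y = \<infinity> then 0 else exp (- l * enn2real y))"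

definition phi :: "conf measure \<Rightarrow> real \<Rightarrow> real" where
  "phi \<Lambda> l = (\<integral>x. 1 - exp_neg l (x 0) \<partial>\<Lambda>)"

definition mu :: "conf measure \<Rightarrow> real set \<Rightarrow> ennreal" where
  "mu \<Lambda> A = (\<integral>\<^sup>+x. (\<Sum>k. indicator (ennreal ` A) (x (Suc k))) \<partial>\<Lambda>)"

definition trunc_laplace :: "real \<Rightarrow> real \<Rightarrow> conf \<Rightarrow> ennreal" where
  "trunc_laplace a l x =
     (\<Sum>k. if x (Suc k) < ennreal a then ennreal (exp_neg l (x (Suc k))) else 0)"

definition M1 :: "conf measure \<Rightarrow> real \<Rightarrow> real \<Rightarrow> ennreal" where
  "M1 \<Lambda> a l = (\<integral>\<^sup>+x. trunc_laplace a l x \<partial>\<Lambda>)"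

definition M2 :: "conf measure \<Rightarrow> real \<Rightarrow> real \<Rightarrow> ennreal" where
  "M2 \<Lambda> a l = (\<integral>\<^sup>+x. (trunc_laplace a l x)\<^sup>2 \<partial>\<Lambda>)"


section \<open>Truncation\<close>

definition trunc :: "real \<Rightarrow> conf \<Rightarrow> conf" where
  "trunc a x = (\<lambda>i. if i = 0 \<or> x i < ennreal a then x i else \<infinity>)"

definition trunc_measure :: "conf measure \<Rightarrow> real \<Rightarrow> conf measure" where
  "trunc_measure \<Lambda> a = density (distr \<Lambda> Qspace (trunc a)) (indicator {x. x \<noteq> conf_zero})"


section \<open>Subordinators and Poisson point processes\<close>

text \<open>The Laplace exponent in the last clause identifies the drift \<open>d\<close> and the Levy measure \<open>\<nu>\<close>.\<close>

definition subordinator ::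
  "'w measure \<Rightarrow> real \<Rightarrow> real measure \<Rightarrow> (real \<Rightarrow> 'w \<Rightarrow> real) \<Rightarrow> bool" where
  "subordinator M d \<nu> \<xi> \<longleftrightarrow>
     (\<forall>t\<ge>0. \<xi> t \<in> borel_measurable M) \<and>
     (AE \<omega> in M. \<xi> 0 \<omega> = 0 \<and> mono_on {0..} (\<lambda>t. \<xi> t \<omega>) \<and>
        (\<forall>t\<ge>0. continuous (at_right t) (\<lambda>s. \<xi> s \<omega>))) \<and>
     (\<forall>t :: nat \<Rightarrow> real. 0 \<le> t 0 \<and> mono t \<longrightarrow>
        prob_space.indep_vars M (\<lambda>_. borel) (\<lambda>i \<omega>. \<xi> (t (Suc i)) \<omega> - \<xi> (t i) \<omega>) UNIV) \<and>
     (\<forall>s\<ge>0. \<forall>t\<ge>0. distr M borel (\<lambda>\<omega>. \<xi> (s + t) \<omega> - \<xi> s \<omega>) = distr M borel (\<xi> t)) \<and>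
     (\<forall>l\<ge>0. \<forall>t\<ge>0. (\<integral>\<omega>. exp (- l * \<xi> t \<omega>) \<partial>M) =
        exp (- t * (d * l + (\<integral>r. 1 - exp (- l * r) \<partial>\<nu>))))"

definition point_count :: "'a set \<Rightarrow> 'a set \<Rightarrow> ennreal" where
  "point_count S B = emeasure (count_space UNIV) (S \<inter> B)"

text \<open>The process is represented by its random set of points, which is adequate for
  intensities without atoms, such as a product with Lebesgue measure.\<close>

definition poisson_process ::
  "'w measure \<Rightarrow> 'a measure \<Rightarrow> ('w \<Rightarrow> 'a set) \<Rightarrow> bool" where
  "poisson_process M \<nu> P \<longleftrightarrow>
     (AE \<omega> in M. P \<omega> \<subseteq> space \<nu>) \<and>
     (\<forall>B\<in>sets \<nu>. (\<lambda>\<omega>. point_count (P \<omega>) B) \<in> borel_measurable M) \<and>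
     (\<forall>B\<in>sets \<nu>. emeasure \<nu> B < \<infinity> \<longrightarrow>
        (\<forall>k::nat. measure M {\<omega> \<in> space M. point_count (P \<omega>) B = of_nat k} =
           exp (- measure \<nu> B) * measure \<nu> B ^ k / fact k)) \<and>
     (\<forall>B\<in>sets \<nu>. emeasure \<nu> B = \<infinity> \<longrightarrow> (AE \<omega> in M. point_count (P \<omega>) B = \<infinity>)) \<and>
     (\<forall>B :: nat \<Rightarrow> 'a set. range B \<subseteq> sets \<nu> \<and> disjoint_family B \<longrightarrow>
        prob_space.indep_vars M (\<lambda>_. borel) (\<lambda>i \<omega>. point_count (P \<omega>) (B i)) UNIV)"

definition process_events :: "'w measure \<Rightarrow> (real \<Rightarrow> 'w \<Rightarrow> real) \<Rightarrow> 'w set set" where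
  "process_events M \<xi> =
     sigma_sets (space M) {\<xi> t -` B \<inter> space M | t B. 0 \<le> t \<and> B \<in> sets borel}"

definition point_events :: "'w measure \<Rightarrow> 'a measure \<Rightarrow> ('w \<Rightarrow> 'a set) \<Rightarrow> 'w set set" where
  "point_events M \<nu> P =
     sigma_sets (space M)
       {(\<lambda>\<omega>. point_count (P \<omega>) B) -` C \<inter> space M | B C. B \<in> sets \<nu> \<and> C \<in> sets borel}"


section \<open>The particle system driven by given noise\<close>

text \<open>The noise is attached to deterministic labels: \<open>(k, i) # u\<close> labels the child
  corresponding to the term of index \<open>i \<ge> 1\<close> (0-based) at the \<open>k\<close>-th branching (in order of time,
  counted from 0) of the particle labelled \<open>u\<close>; the ancestor is \<open>[]\<close>.
  In this section the noise is a fixed realisation: \<open>\<xi> u\<close> is the path of the subordinator of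
  \<open>u\<close>, in the time elapsed since the birth of \<open>u\<close>; \<open>P u\<close> is a set of points \<open>(s, x)\<close> with \<open>s\<close>
  in absolute time, of which only those with \<open>s\<close> not before the birth of \<open>u\<close> are used.\<close>

type_synonym label = "(nat \<times> nat) list"

definition nth_point :: "(real \<times> conf) set \<Rightarrow> nat \<Rightarrow> real \<times> conf" where
  "nth_point S k = (THE p. p \<in> S \<and> finite {q \<in> S. fst q < fst p} \<and>
                           card {q \<in> S. fst q < fst p} = k)"

fun birth :: "(label \<Rightarrow> (real \<times> conf) set) \<Rightarrow> label \<Rightarrow> real" where
  "birth P [] = 0"
| "birth P ((k, i) # u) = fst (nth_point {p \<in> P u. birth P u \<le> fst p} k)"

definition branching :: "(label \<Rightarrow> (real \<times> conf) set) \<Rightarrow> label \<Rightarrow> nat \<Rightarrow> real \<times> conf" where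
  "branching P u k = nth_point {p \<in> P u. birth P u \<le> fst p} k"

fun is_particle :: "(label \<Rightarrow> (real \<times> conf) set) \<Rightarrow> label \<Rightarrow> bool" where
  "is_particle P [] \<longleftrightarrow> True"
| "is_particle P ((k, i) # u) \<longleftrightarrow> is_particle P u \<and> 1 \<le> i \<and> snd (branching P u k) i < \<infinity>"

definition displacement ::
  "(label \<Rightarrow> real \<Rightarrow> real) \<Rightarrow> (label \<Rightarrow> (real \<times> conf) set) \<Rightarrow> label \<Rightarrow> real \<Rightarrow> real" where
  "displacement \<xi> P u t =
     \<xi> u (t - birth P u) + (\<Sum>p | p \<in> P u \<and> birth P u \<le> fst p \<and> fst p \<le> t. enn2real (snd p 0))"

text \<open>Before its birth a particle is located at the position of its ancestor alive at that time.\<close>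

fun position ::
  "(label \<Rightarrow> real \<Rightarrow> real) \<Rightarrow> (label \<Rightarrow> (real \<times> conf) set) \<Rightarrow> label \<Rightarrow> real \<Rightarrow> real" where
  "position \<xi> P [] t = displacement \<xi> P [] t"
| "position \<xi> P ((k, i) # u) t =
     (let (s, x) = branching P u k in
      if t < s then position \<xi> P u t
      else Lim (at_left s) (position \<xi> P u) + enn2real (x i) + displacement \<xi> P ((k, i) # u) t)"

text \<open>The labels above depend on the truncation level, since truncation changes the numbering of
  the branchings. The identity of a particle that is common to all truncation levels records
  instead the birth times (and indices) along the ancestral line.\<close>

type_synonym particle = "(real \<times> nat) list"

fun identity :: "(label \<Rightarrow> (real \<times> conf) set) \<Rightarrow> label \<Rightarrow> particle" where
  "identity P [] = []"
| "identity P ((k, i) # u) = (birth P ((k, i) # u), i) # identity P u"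

fun birth_time :: "particle \<Rightarrow> real" where
  "birth_time [] = 0"
| "birth_time ((s, i) # v) = s"


section \<open>Branching subordinators\<close>

text \<open>A particle system is given by the random set \<open>T\<close> of all particles ever born and by the
  position \<open>Y v \<omega> t\<close> at time \<open>t\<close> of each particle \<open>v\<close>.\<close>

definition alive :: "('w \<Rightarrow> particle set) \<Rightarrow> 'w \<Rightarrow> real \<Rightarrow> particle set" where
  "alive T \<omega> t = {v \<in> T \<omega>. birth_time v \<le> t}"

definition truncated_branching_subordinator ::
  "'w measure \<Rightarrow> real \<Rightarrow> conf measure \<Rightarrow> real \<Rightarrow>
   ('w \<Rightarrow> particle set) \<Rightarrow> (particle \<Rightarrow> 'w \<Rightarrow> real \<Rightarrow> real) \<Rightarrow> bool" where
  "truncated_branching_subordinator M d \<Lambda> a T Y \<longleftrightarrow>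
     (let levy = distr (restrict_space (trunc_measure \<Lambda> a) (Qset - Qstar)) borel
                   (\<lambda>x. enn2real (x 0));
          intensity = restrict_space lborel {0..} \<Otimes>\<^sub>M restrict_space (trunc_measure \<Lambda> a) Qstar
      in \<exists>(\<xi> :: label \<Rightarrow> real \<Rightarrow> 'w \<Rightarrow> real) (P :: label \<Rightarrow> 'w \<Rightarrow> (real \<times> conf) set).
           (\<forall>u. subordinator M d levy (\<xi> u)) \<and>
           (\<forall>u. poisson_process M intensity (P u)) \<and>
           prob_space.indep_sets M
             (case_sum (\<lambda>u. process_events M (\<xi> u)) (\<lambda>u. point_events M intensity (P u))) UNIV \<and>
           (AE \<omega> in M.
              T \<omega> = identity (\<lambda>u. P u \<omega>) ` {u. is_particle (\<lambda>u. P u \<omega>) u} \<and>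
              (\<forall>u. is_particle (\<lambda>u. P u \<omega>) u \<longrightarrow>
                 (\<forall>t\<ge>0. Y (identity (\<lambda>u. P u \<omega>) u) \<omega> t =
                          position (\<lambda>u s. \<xi> u s \<omega>) (\<lambda>u. P u \<omega>) u t))))"

text \<open>The distance between the birth position of \<open>v\<close> and the pre-branching position of its
  parent \<open>tl v\<close>.\<close>

definition birth_distance :: "(particle \<Rightarrow> 'w \<Rightarrow> real \<Rightarrow> real) \<Rightarrow> 'w \<Rightarrow> particle \<Rightarrow> real" where
  "birth_distance Y \<omega> v =
     dist (Y v \<omega> (birth_time v)) (Lim (at_left (birth_time v)) (Y (tl v) \<omega>))"

definition pruned ::
  "real \<Rightarrow> ('w \<Rightarrow> particle set) \<Rightarrow> (particle \<Rightarrow> 'w \<Rightarrow> real \<Rightarrow> real) \<Rightarrow> 'w \<Rightarrow> particle set" where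
  "pruned a T Y \<omega> =
     {v \<in> T \<omega>. \<forall>w. suffix w v \<and> w \<noteq> [] \<longrightarrow> birth_distance Y \<omega> w < a}"

text \<open>Here \<open>a0\<close> is any threshold beyond which the truncated measure charges \<open>Qstar\<close>.\<close>

definition branching_subordinator ::
  "'w measure \<Rightarrow> real \<Rightarrow> conf measure \<Rightarrow>
   ('w \<Rightarrow> particle set) \<Rightarrow> (particle \<Rightarrow> 'w \<Rightarrow> real \<Rightarrow> real) \<Rightarrow> bool" where
  "branching_subordinator M d \<Lambda> T Y \<longleftrightarrow>
     (\<exists>a0 Ta Ya.
        0 \<le> a0 \<and> (\<forall>a>a0. 0 < emeasure (trunc_measure \<Lambda> a) Qstar) \<and>
        (\<forall>a>a0. truncated_branching_subordinator M d \<Lambda> a (Ta a) (Ya a)) \<and>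
        (AE \<omega> in M. \<forall>a a'. a0 < a \<and> a \<le> a' \<longrightarrow>
           Ta a \<omega> = pruned a (Ta a') (Ya a') \<omega> \<and>
           (\<forall>v\<in>Ta a \<omega>. \<forall>t\<ge>0. Ya a v \<omega> t = Ya a' v \<omega> t)) \<and>
        (AE \<omega> in M.
           T \<omega> = (\<Union>a\<in>{a0<..}. Ta a \<omega>) \<and>
           (\<forall>a>a0. \<forall>v\<in>Ta a \<omega>. \<forall>t\<ge>0. Y v \<omega> t = Ya a v \<omega> t)))"

text \<open>The infimum is almost surely a minimum, as only finitely many particles lie in any bounded
  interval.\<close>

definition leftmost ::
  "('w \<Rightarrow> particle set) \<Rightarrow> (particle \<Rightarrow> 'w \<Rightarrow> real \<Rightarrow> real) \<Rightarrow> 'w \<Rightarrow> real \<Rightarrow> real" where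
  "leftmost T Y \<omega> t = (INF v\<in>alive T \<omega> t. Y v \<omega> t)"

end

theory Submission
  imports Defs
begin

text \<open>By assumption (4) a particle does not jump when it branches, so between its branchings it moves as
  a subordinator with Laplace exponent \<open>\<phi>\<close>, at every truncation level.

  Lower bound: give a particle born at time \<open>b\<close> at position \<open>y < x\<close> the weight
  \<open>exp (- l y + \<phi>(l) b / 2)\<close>. The expected total weight of the children of a particle is at most a
  constant multiple of \<open>M\<^sub>x(l) / \<phi>(l)\<close> times the weight of the particle. For \<open>l = c x\<^sup>\<sigma>\<close> with \<open>c\<close> large,
  \<open>M\<^sub>x(l)\<close> stays bounded, so the total weight decays geometrically over the generations, and some particle
  is below \<open>x\<close> after time \<open>t\<close> with probability at most a multiple of \<open>exp (l x - \<phi>(l) t / 2)\<close>. This is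
  summable for \<open>x = \<epsilon> t\<^sup>\<gamma>\<close>.

  Upper bound: at a fixed truncation level, generation \<open>2j + 1\<close> contains more than \<open>j\<close> particles
  whose birth times and positions are linear in \<open>j\<close>. At truncation level \<open>a\<close>, a child moves by at most \<open>a\<close>
  during the time \<open>(a / K) powr (1 / \<gamma>)\<close> with probability at least \<open>2 powr (- m)\<close>, where \<open>m\<close> is of order
  \<open>a powr (1 + \<sigma>)\<close>; by assumption (3) and the second moment method the children are numerous enough for some
  child to do so with a probability bounded away from \<open>0\<close>. Hence the \<open>j\<close> particles fail to have such a child with
  probability exponentially small in \<open>j\<close>, and Borel-Cantelli applies along the times \<open>2\<^sup>j\<close>.\<close>

section \<open>Measurability on the space of configurations\<close>

text \<open>With l of order x powr \<sigma>, the exponential tilt costs l x, of order x powr (1 +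
  \<sigma>), and the motion pays t \<phi>(l), of order t x powr (\<alpha> \<sigma>); the two balance
  when x powr (1 + \<sigma> - \<alpha> \<sigma>) is of order t, which is where \<gamma> comes from.
  Taking \<phi>(l) / 2 in the weight leaves half of the decay of the Laplace transform to make the
  sum over birth times converge. Independence is given for whole sources of noise attached to
  labels, while births happen at random times. No filtration or strong Markov property is set up:
  every conditioning is a factorisation of an integral over disjoint sets of sources, after random
  times have been rounded to a grid. Labels depend on the truncation level, and each level has its
  own noise, so levels are compared only through particle identities and positions, and the estimate
  behind the lower bound must be uniform in the level. Time 2 powr j allows displacements of order 2
  powr (\<gamma> j), so the cost of reaching generation 2j + 1, linear in j, is negligible
  there.\<close>

lemma space_Qspace [simp]: "space Qspace = Qset"
  and sets_Qspace: "sets Qspace = sigma_sets Qset {U. openin vague_topology U}"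
proof -
  have "{U. openin vague_topology U} \<subseteq> Pow Qset"
  proof safe
    fix U x assume "openin vague_topology U" "x \<in> U"
    then have "x \<in> topspace vague_topology"
      using openin_subset by blast
    then show "x \<in> Qset"
      unfolding vague_topology_def topology_generated_by_topspace by auto
  qed
  then show "space Qspace = Qset" "sets Qspace = sigma_sets Qset {U. openin vague_topology U}"
    unfolding Qspace_def by (simp_all add: space_measure_of_conv sets_measure_of)
qed

lemma Qset_ge: "x \<in> Qset \<Longrightarrow> i \<le> j \<Longrightarrow> x i \<le> x j"
  by (auto simp: Qset_def mono_def)

lemma Qset_eventually_gt: "x \<in> Qset \<Longrightarrow> \<exists>N. \<forall>n\<ge>N. ennreal r < x n"
proof -
  assume "x \<in> Qset"
  then have "eventually (\<lambda>n. ennreal r < x n) sequentially"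
    by (intro order_tendstoD) (auto simp: Qset_def)
  then show ?thesis by (simp add: eventually_sequentially)
qed

lemma Qset_finite_less: "x \<in> Qset \<Longrightarrow> finite {n. x n < ennreal r}"
proof -
  assume "x \<in> Qset"
  then obtain N where N: "\<forall>n\<ge>N. ennreal r < x n" using Qset_eventually_gt by blast
  then have "{n. x n < ennreal r} \<subseteq> {..<N}" by (force simp: not_less[symmetric])
  then show ?thesis using finite_subset by blast
qed

lemma conf_integral_eq_sum:
  assumes x: "x \<in> Qset" and N: "\<And>n. n \<ge> N \<Longrightarrow> ennreal R < x n" and f: "\<And>r. r > R \<Longrightarrow> f r = 0"
    and R: "0 \<le> R"
  shows "conf_integral f x = (\<Sum>n<N. if x n < \<infinity> then f (enn2real (x n)) else 0)"
  unfolding conf_integral_def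
proof (rule suminf_finite)
  fix n assume "n \<notin> {..<N}"
  then have "ennreal R < x n" using N by auto
  then show "(if x n < \<infinity> then f (enn2real (x n)) else 0) = 0"
    using R by (cases "x n") (auto simp: f ennreal_less_iff)
qed simp

text \<open>The coordinate of index n (from 0) lies below r exactly when the configuration has more
  than n atoms in [0, r). The indicator of [0, r) is the increasing limit of the continuous
  functions \<open>f m\<close>, so this happens as soon as one of the continuous integrals exceeds
  n; each of these is a subbasic vaguely open condition.\<close>

lemma coordinate_less_sets:
  assumes r: "0 < r"
  shows "{x \<in> Qset. x n < ennreal r} \<in> sets Qspace"
proof -
  define f :: "nat \<Rightarrow> real \<Rightarrow> real" where "f = (\<lambda>m y. max 0 (min 1 (real m * (r - y))))"
  have f_cont: "continuous_on {0..} (f m)" for m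
    unfolding f_def by (intro continuous_intros)
  have f_zero: "f m y = 0" if "y \<ge> r" for m y
  proof -
    have "real m * (r - y) \<le> 0" using that by (intro mult_nonneg_nonpos) auto
    then show ?thesis unfolding f_def by auto
  qed
  have f_le: "f m y \<le> 1" "0 \<le> f m y" for m y
    unfolding f_def by auto
  have "{x \<in> Qset. x n < ennreal r} = (\<Union>m. {x \<in> Qset. conf_integral (f m) x \<in> {real n<..}})"
  proof (intro equalityI subsetI)
    fix x assume "x \<in> {x \<in> Qset. x n < ennreal r}"
    then have x: "x \<in> Qset" and xn: "x n < ennreal r" by auto
    obtain N where N: "\<forall>n\<ge>N. ennreal r < x n" using Qset_eventually_gt[OF x] by blast
    define e where "e = r - enn2real (x n)"
    have xfin: "x n < \<infinity>" using xn by (metis ennreal_less_top infinity_ennreal_def order_less_trans)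
    have e: "0 < e" using xn r xfin unfolding e_def by (cases "x n") (auto simp: ennreal_less_iff)
    obtain m :: nat where m: "real m * e > 1" using e by (metis ex_less_of_nat_mult)
    have one: "f m (enn2real (x k)) = 1 \<and> x k < \<infinity>" if "k \<le> n" for k
    proof -
      have le: "x k \<le> x n" using Qset_ge[OF x that] .
      then have "enn2real (x k) \<le> enn2real (x n)" using xfin by (intro enn2real_mono) (auto simp: less_top)
      then have "real m * (r - enn2real (x k)) \<ge> real m * e" by (intro mult_left_mono) (auto simp: e_def)
      then show ?thesis using m le xfin by (auto simp: f_def min_def)
    qed
    have nN: "n < N" using N xn by (meson leI order_less_asym)
    have "conf_integral (f m) x = (\<Sum>k<N. if x k < \<infinity> then f m (enn2real (x k)) else 0)"
      using conf_integral_eq_sum[OF x, of N r "f m"] N f_zero r by auto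
    also have "\<dots> \<ge> (\<Sum>k<Suc n. if x k < \<infinity> then f m (enn2real (x k)) else 0)"
      using nN by (intro sum_mono2) (auto simp: f_le)
    also have "(\<Sum>k<Suc n. if x k < \<infinity> then f m (enn2real (x k)) else 0) = (\<Sum>k<Suc n. 1)"
      using one by (intro sum.cong) auto
    finally have "conf_integral (f m) x > real n" by simp
    then show "x \<in> (\<Union>m. {x \<in> Qset. conf_integral (f m) x \<in> {real n<..}})" using x by auto
  next
    fix x assume "x \<in> (\<Union>m. {x \<in> Qset. conf_integral (f m) x \<in> {real n<..}})"
    then obtain m where x: "x \<in> Qset" and gt: "conf_integral (f m) x > real n" by auto
    have "x n < ennreal r"
    proof (rule ccontr)
      assume "\<not> x n < ennreal r"
      then have ge: "\<And>k. k \<ge> n \<Longrightarrow> ennreal r \<le> x k" using Qset_ge[OF x] by (meson leI order_trans)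
      have "conf_integral (f m) x = (\<Sum>k<n. if x k < \<infinity> then f m (enn2real (x k)) else 0)"
        unfolding conf_integral_def
      proof (rule suminf_finite)
        fix k assume "k \<notin> {..<n}"
        then have "ennreal r \<le> x k" using ge by auto
        then show "(if x k < \<infinity> then f m (enn2real (x k)) else 0) = 0"
          using r by (cases "x k") (auto simp: f_zero ennreal_le_iff)
      qed simp
      also have "\<dots> \<le> (\<Sum>k<n. 1)" by (intro sum_mono) (auto simp: f_le)
      finally show False using gt by simp
    qed
    then show "x \<in> {x \<in> Qset. x n < ennreal r}" using x by auto
  qed
  also have "\<dots> \<in> sets Qspace"
  proof (intro sets.countable_UN subsetI)
    fix A assume "A \<in> range (\<lambda>m. {x \<in> Qset. conf_integral (f m) x \<in> {real n<..}})"
    then obtain m where A: "A = {x \<in> Qset. conf_integral (f m) x \<in> {real n<..}}" by auto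
    have "openin vague_topology A"
      unfolding vague_topology_def openin_topology_generated_by_iff
      using f_cont f_zero
      by (intro generate_topology_on.Basis) (auto simp: A intro!: exI[of _ "f m"] exI[of _ "{real n<..}"] exI[of _ r])
    then show "A \<in> sets Qspace" unfolding sets_Qspace by auto
  qed
  finally show ?thesis .
qed

lemma measurable_coordinate: "(\<lambda>x. x n) \<in> borel_measurable Qspace"
proof (rule borel_measurableI_less)
  fix y :: ennreal
  show "{x \<in> space Qspace. x n < y} \<in> sets Qspace"
  proof (cases y)
    case (real r)
    then show ?thesis
      using coordinate_less_sets[of r n] by (cases "r = 0") auto
  next
    case top
    have "{x \<in> Qset. x n < top} = (\<Union>m. {x \<in> Qset. x n < ennreal (real (Suc m))})"
    proof (intro equalityI subsetI)
      fix x assume "x \<in> {x \<in> Qset. x n < top}"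
      then show "x \<in> (\<Union>m. {x \<in> Qset. x n < ennreal (real (Suc m))})"
        by (cases "x n") (auto simp: ennreal_less_iff intro: reals_Archimedean2 dest: less_SucI
            intro!: exI[of _ "nat \<lceil>enn2real (x n)\<rceil>"] simp del: of_nat_Suc, linarith)
    qed (auto intro: order_less_trans ennreal_less_top)
    also have "\<dots> \<in> sets Qspace" by (intro sets.countable_UN) (auto intro!: coordinate_less_sets simp del: of_nat_Suc)
    finally show ?thesis using top by simp
  qed
qed

text \<open>A neighbourhood of x keeps all coordinates from index N on beyond the support of f, so
  the integral is locally a finite sum of continuous functions of single coordinates. Continuity
  refers to the product topology, which is how a vaguely open set becomes the trace of a
  product-open one.\<close>

lemma continuous_conf_integral:
  assumes f: "continuous_on {0..} f" and R: "\<And>r. r > R \<Longrightarrow> f r = 0"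
  shows "continuous_on Qset (conf_integral f)"
  unfolding continuous_on_def
proof
  fix x assume x: "x \<in> Qset"
  define R' where "R' = max R 0 + 1"
  have R': "R' > 0" "R' > R" unfolding R'_def by auto
  obtain N where N: "\<forall>n\<ge>N. ennreal R' < x n" using Qset_eventually_gt[OF x] by blast
  \<comment> \<open>Capping at \<open>R'\<close> makes \<open>enn2real\<close> continuous on the
    whole range; as f vanishes beyond R < \<open>R'\<close>, the capped value also returns 0 for
    atoms at \<infinity>.\<close>
  define g where "g = (\<lambda>y. f (enn2real (min y (ennreal R'))))"
  have "isCont (\<lambda>y. enn2real (min y (ennreal R'))) y" for y
    unfolding isCont_def
  proof (rule tendsto_enn2real)
    have "min y (ennreal R') \<noteq> top" by (metis ennreal_less_top min_less_iff_disj order_less_irrefl)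
    then have "ennreal (enn2real (min y (ennreal R'))) = min y (ennreal R')" by (simp add: less_top)
    then show "(\<lambda>y. min y (ennreal R')) \<midarrow>y\<rightarrow> ennreal (enn2real (min y (ennreal R')))"
      by (auto intro!: tendsto_min)
  qed simp
  then have "continuous_on UNIV (\<lambda>y. enn2real (min y (ennreal R')))"
    by (simp add: continuous_at_imp_continuous_on)
  then have g: "continuous_on UNIV g"
    unfolding g_def by (intro continuous_on_compose2[OF f]) auto
  have geq: "(if y < \<infinity> then f (enn2real y) else 0) = g y" for y
    using R' by (cases y) (auto simp: g_def R min_def top_unique)
  define V where "V = {y. ennreal R' < y N}"
  have V: "open V" "x \<in> V"
    unfolding V_def using N by (auto intro!: open_Collect_less continuous_intros continuous_on_product_coordinates)
  have eq: "conf_integral f y = (\<Sum>n<N. g (y n))" if "y \<in> Qset" "y \<in> V" for y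
  proof -
    have "conf_integral f y = (\<Sum>n<N. if y n < \<infinity> then f (enn2real (y n)) else 0)"
      using that R R' Qset_ge[OF that(1), of N]
      by (intro conf_integral_eq_sum[where R=R']) (auto simp: V_def intro: order_less_le_trans)
    then show ?thesis by (simp only: geq)
  qed
  have "continuous_on UNIV (\<lambda>y::conf. \<Sum>n<N. g (y n))"
    by (intro continuous_on_sum continuous_on_compose2[OF g] continuous_on_product_coordinates) auto
  then have "((\<lambda>y::conf. \<Sum>n<N. g (y n)) \<longlongrightarrow> (\<Sum>n<N. g (x n))) (at x within UNIV)"
    unfolding continuous_on_def by blast
  then have "((\<lambda>y::conf. \<Sum>n<N. g (y n)) \<longlongrightarrow> conf_integral f x) (at x within Qset)"
    unfolding eq[OF x V(2)] by (rule tendsto_within_subset) simp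
  moreover have "eventually (\<lambda>y. (\<Sum>n<N. g (y n)) = conf_integral f y) (at x within Qset)"
    unfolding eventually_at_topological using V eq by (intro exI[of _ V]) auto
  ultimately show "(conf_integral f \<longlongrightarrow> conf_integral f x) (at x within Qset)"
    by (rule Lim_transform_eventually)
qed

text \<open>Allows measurability of maps into \<open>Qspace\<close>, such as truncation, to be
  checked one coordinate at a time. Since coordinates are measurable as well, sequences and point
  measures have the same measurable maps.\<close>

lemma vague_open_imp_product_open:
  assumes "openin vague_topology U"
  shows "\<exists>V. open V \<and> U = Qset \<inter> V"
proof -
  have "generate_topology_on {{x \<in> Qset. conf_integral f x \<in> U} | f U.
        continuous_on {0..} f \<and> (\<exists>R. \<forall>r>R. f r = 0) \<and> open U} U"
    using assms unfolding vague_topology_def openin_topology_generated_by_iff by (simp add: conj_assoc)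
  then have "openin (top_of_set Qset) U"
  proof (induction rule: generate_topology_on.induct)
    case (Basis s)
    then obtain f W R where *: "s = Qset \<inter> conf_integral f -` W" "continuous_on {0..} f" "\<forall>r>R. f r = 0" "open W"
      by blast
    then show ?case
      using continuous_conf_integral[of f R] continuous_on_open_invariant[of Qset "conf_integral f"]
      by (simp add: continuous_openin_preimage_gen)
  qed auto
  then show ?thesis by (simp add: openin_open)
qed

lemma measurable_QspaceI:
  assumes "f \<in> space N \<rightarrow> Qset" and "\<And>i. (\<lambda>w. f w i) \<in> borel_measurable N"
  shows "f \<in> measurable N Qspace"
proof -
  have f: "f \<in> borel_measurable N"
    using assms(2) by (rule measurable_coordinatewise_then_product)
  show ?thesis
    unfolding Qspace_def
  proof (rule measurable_measure_of)
    show "{U. openin vague_topology U} \<subseteq> Pow Qset"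
      using vague_open_imp_product_open by blast
    fix U assume "U \<in> {U. openin vague_topology U}"
    then obtain V where V: "open V" "U = Qset \<inter> V" using vague_open_imp_product_open by blast
    then have "f -` U \<inter> space N = f -` V \<inter> space N" using assms(1) by auto
    then show "f -` U \<inter> space N \<in> sets N" using f V(1) by (simp add: measurable_sets borel_open)
  qed (use assms(1) in auto)
qed

lemma trunc_Qset: "x \<in> Qset \<Longrightarrow> trunc a x \<in> Qset"
proof -
  assume x: "x \<in> Qset"
  have "mono (trunc a x)"
  proof (rule monoI)
    fix i j :: nat assume "i \<le> j"
    then show "trunc a x i \<le> trunc a x j"
      using Qset_ge[OF x \<open>i \<le> j\<close>] by (auto simp: trunc_def intro: order_le_less_trans)
  qed
  moreover have "trunc a x \<longlonglongrightarrow> \<infinity>"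
  proof (rule tendsto_sandwich)
    show "eventually (\<lambda>n. x n \<le> trunc a x n) sequentially" by (simp add: trunc_def)
    show "eventually (\<lambda>n. trunc a x n \<le> \<infinity>) sequentially" by simp
    show "x \<longlonglongrightarrow> \<infinity>" using x by (simp add: Qset_def)
  qed simp
  ultimately show ?thesis by (simp add: Qset_def)
qed

lemma trunc_measurable [measurable]: "trunc a \<in> measurable Qspace Qspace"
proof (rule measurable_QspaceI)
  show "trunc a \<in> space Qspace \<rightarrow> Qset" using trunc_Qset by auto
  fix i
  note [measurable] = measurable_coordinate
  have "(\<lambda>w. if i = 0 \<or> w i < ennreal a then w i else \<infinity>) \<in> borel_measurable Qspace" by measurable
  then show "(\<lambda>w. trunc a w i) \<in> borel_measurable Qspace" by (simp add: trunc_def)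
qed

lemma Qstar_sets [measurable]: "Qstar \<in> sets Qspace"
proof -
  note [measurable] = measurable_coordinate
  have "{x \<in> space Qspace. x 1 < \<infinity>} \<in> sets Qspace" by measurable
  then show ?thesis by (simp add: Qstar_def)
qed

lemma conf_zero_Qset: "conf_zero \<in> Qset" and conf_empty_Qset: "conf_empty \<in> Qset"
proof -
  have "eventually (\<lambda>n. conf_zero n = \<infinity>) sequentially"
    unfolding conf_zero_def eventually_sequentially by (intro exI[of _ 1]) auto
  then show "conf_zero \<in> Qset"
    unfolding Qset_def by (auto simp: conf_zero_def mono_def intro: tendsto_eventually)
  show "conf_empty \<in> Qset"
    unfolding Qset_def by (auto simp: conf_empty_def mono_def)
qed

lemma singleton_sets_Qspace: "c \<in> Qset \<Longrightarrow> {c} \<in> sets Qspace"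
proof -
  note [measurable] = measurable_coordinate
  assume "c \<in> Qset"
  then have "{c} = (\<Inter>i. {x \<in> space Qspace. x i = c i})" by auto
  also have "\<dots> \<in> sets Qspace" by (intro sets.countable_INT) (auto simp del: space_Qspace)
  finally show ?thesis .
qed

section \<open>Poisson point processes\<close>

definition point_sum :: "'a set \<Rightarrow> ('a \<Rightarrow> ennreal) \<Rightarrow> ennreal" where
  "point_sum S f = (\<integral>\<^sup>+p. f p \<partial>count_space S)"

lemma point_sum_indicator: "point_sum S (indicator B) = point_count S B"
  unfolding point_sum_def point_count_def
  by (subst nn_integral_count_space_indicator) (simp_all add: indicator_inter_arith[symmetric] Int_commute)

text \<open>Campbell's formula, proved together with measurability in one induction over nonnegative
  functions because the limit step of the formula needs the measurability of its terms. Only counts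
  of sets enter, so the result applies to the original Poisson points and to their modification on a
  null set.\<close>

lemma
  assumes cnt: "\<And>B. B \<in> sets \<nu> \<Longrightarrow> (\<lambda>\<omega>. point_count (S \<omega>) B) \<in> borel_measurable N"
    and S: "\<And>\<omega>. \<omega> \<in> space N \<Longrightarrow> S \<omega> \<subseteq> space \<nu>"
    and f: "f \<in> borel_measurable \<nu>"
  shows borel_measurable_point_sum: "(\<lambda>\<omega>. point_sum (S \<omega>) f) \<in> borel_measurable N"
    and campbell: "(\<And>B. B \<in> sets \<nu> \<Longrightarrow> (\<integral>\<^sup>+\<omega>. point_count (S \<omega>) B \<partial>N) = emeasure \<nu> B) \<Longrightarrow>
      (\<integral>\<^sup>+\<omega>. point_sum (S \<omega>) f \<partial>N) = (\<integral>\<^sup>+p. f p \<partial>\<nu>)"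
proof -
  let ?M = "\<lambda>f. (\<lambda>\<omega>. point_sum (S \<omega>) f) \<in> borel_measurable N"
  let ?E = "\<lambda>f. (\<integral>\<^sup>+\<omega>. point_sum (S \<omega>) f \<partial>N) = (\<integral>\<^sup>+p. f p \<partial>\<nu>)"
  let ?c = "\<forall>B\<in>sets \<nu>. (\<integral>\<^sup>+\<omega>. point_count (S \<omega>) B \<partial>N) = emeasure \<nu> B"
  have "?M f \<and> (?c \<longrightarrow> ?E f)"
    using f
  proof (induction rule: borel_measurable_induct)
    case (cong f g)
    have "point_sum (S \<omega>) f = point_sum (S \<omega>) g" if "\<omega> \<in> space N" for \<omega>
      unfolding point_sum_def using S[OF that] cong by (intro nn_integral_cong) auto
    then show ?case
      using cong measurable_cong[of N "\<lambda>\<omega>. point_sum (S \<omega>) f" "\<lambda>\<omega>. point_sum (S \<omega>) g" borel]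
        nn_integral_cong[of N "\<lambda>\<omega>. point_sum (S \<omega>) f" "\<lambda>\<omega>. point_sum (S \<omega>) g"]
        nn_integral_cong[of \<nu> f g] by simp
  next
    case (set A)
    then show ?case using cnt by (simp add: point_sum_indicator)
  next
    case (mult u c)
    have *: "point_sum (S \<omega>) (\<lambda>p. c * u p) = c * point_sum (S \<omega>) u" for \<omega>
      unfolding point_sum_def by (intro nn_integral_cmult) simp
    then show ?case using mult by (auto simp: nn_integral_cmult)
  next
    case (add u v)
    have *: "point_sum (S \<omega>) (\<lambda>p. v p + u p) = point_sum (S \<omega>) v + point_sum (S \<omega>) u" for \<omega>
      unfolding point_sum_def by (intro nn_integral_add) simp_all
    then show ?case using add by (auto simp: nn_integral_add)
  next
    case (seq U)
    have *: "point_sum (S \<omega>) (SUP i. U i) = (SUP i. point_sum (S \<omega>) (U i))" for \<omega>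
    proof -
      have "(SUP i. U i) = (\<lambda>p. SUP i. U i p)" by (rule ext) (simp add: SUP_apply image_comp)
      then show ?thesis
        unfolding point_sum_def using seq(3)
        by (subst nn_integral_monotone_convergence_SUP[symmetric]) (simp_all)
    qed
    have inc: "incseq (\<lambda>i \<omega>. point_sum (S \<omega>) (U i))"
      using seq(3) unfolding point_sum_def
      by (auto simp: incseq_def le_fun_def intro!: nn_integral_mono)
    show ?case
    proof (intro conjI impI)
      show "?M (SUP i. U i)" unfolding * using seq by (intro borel_measurable_SUP) auto
      assume ?c
      have "(\<integral>\<^sup>+\<omega>. point_sum (S \<omega>) (SUP i. U i) \<partial>N) = (SUP i. \<integral>\<^sup>+\<omega>. point_sum (S \<omega>) (U i) \<partial>N)"
        unfolding * using inc seq by (intro nn_integral_monotone_convergence_SUP) auto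
      also have "\<dots> = (SUP i. \<integral>\<^sup>+p. U i p \<partial>\<nu>)" using seq \<open>?c\<close> by simp
      also have "\<dots> = (\<integral>\<^sup>+p. (SUP i. U i p) \<partial>\<nu>)"
        using seq by (intro nn_integral_monotone_convergence_SUP[symmetric]) auto
      finally show "?E (SUP i. U i)" by (simp add: SUP_apply image_comp)
    qed
  qed
  then show "?M f" "(\<And>B. B \<in> sets \<nu> \<Longrightarrow> (\<integral>\<^sup>+\<omega>. point_count (S \<omega>) B \<partial>N) = emeasure \<nu> B) \<Longrightarrow> ?E f"
    by auto
qed

text \<open>The hypothesis gives the masses of the natural numbers; they add up to 1, so X is almost
  surely a natural number and the integral is the Poisson sum.\<close>

lemma (in prob_space) poisson_nn_integral:
  fixes X :: "'a \<Rightarrow> ennreal"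
  assumes X: "X \<in> borel_measurable M" and x: "0 \<le> x"
    and law: "\<And>k::nat. measure M {\<omega> \<in> space M. X \<omega> = of_nat k} = exp (- x) * x ^ k / fact k"
  shows "(\<integral>\<^sup>+\<omega>. g (X \<omega>) \<partial>M) = (\<Sum>k. g (of_nat k) * ennreal (exp (- x) * x ^ k / fact k))"
proof -
  define E where "E = (\<lambda>k::nat. {\<omega> \<in> space M. X \<omega> = (of_nat k :: ennreal)})"
  have E [measurable]: "E k \<in> sets M" for k using X unfolding E_def by measurable
  have disj: "disjoint_family E" unfolding E_def disjoint_family_on_def by auto
  have "(\<lambda>k. measure M (E k)) sums measure M (\<Union>k. E k)"
    using E disj by (intro finite_measure_UNION) auto
  moreover have "(\<lambda>k. measure M (E k)) sums 1"
  proof -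
    have "(\<lambda>k. exp (- x) * (x ^ k /\<^sub>R fact k)) sums (exp (- x) * exp x)"
      by (intro sums_mult exp_converges)
    then show ?thesis by (simp add: E_def law exp_minus field_simps)
  qed
  ultimately have "prob (\<Union>k. E k) = 1" using sums_unique2 by blast
  then have "AE \<omega> in M. \<omega> \<in> (\<Union>k. E k)" by (subst AE_in_set_eq_1) auto
  then have "(\<integral>\<^sup>+\<omega>. g (X \<omega>) \<partial>M) = (\<integral>\<^sup>+\<omega>. (\<Sum>k. g (of_nat k) * indicator (E k) \<omega>) \<partial>M)"
  proof (intro nn_integral_cong_AE, eventually_elim)
    fix \<omega> assume "\<omega> \<in> (\<Union>k. E k)"
    then obtain k where k: "\<omega> \<in> E k" by auto
    have X\<omega>: "X \<omega> = of_nat k" and notin: "\<And>j. j \<noteq> k \<Longrightarrow> indicator (E j) \<omega> = (0::ennreal)"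
      using k unfolding E_def by simp_all
    have "(\<Sum>j. g (of_nat j) * indicator (E j) \<omega>) = (\<Sum>j\<in>{k}. g (of_nat j) * indicator (E j) \<omega>)"
      using notin by (intro suminf_finite) simp_all
    then show "g (X \<omega>) = (\<Sum>k. g (of_nat k) * indicator (E k) \<omega>)" using k X\<omega> by simp
  qed
  also have "\<dots> = (\<Sum>k. \<integral>\<^sup>+\<omega>. g (of_nat k) * indicator (E k) \<omega> \<partial>M)"
    by (intro nn_integral_suminf) measurable
  also have "\<dots> = (\<Sum>k. g (of_nat k) * ennreal (exp (- x) * x ^ k / fact k))"
    using E law by (simp add: nn_integral_cmult_indicator emeasure_eq_measure E_def)
  finally show ?thesis .
qed

lemma exp_neg_of_nat: "exp_neg l (of_nat k) = exp (- l) ^ k"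
  by (simp add: exp_neg_def exp_of_nat_mult[symmetric] ennreal_of_nat_eq_real_of_nat mult.commute)

text \<open>All four are power series with Poisson weights. The last one majorises the indicator of
  k >= 2 by k (k - 1), that is by the second factorial moment; its quadratic order in x is what
  later separates the points in time.\<close>

lemma (in prob_space)
  fixes X :: "'a \<Rightarrow> ennreal"
  assumes X: "X \<in> borel_measurable M" and x: "0 \<le> x"
    and law: "\<And>k::nat. measure M {\<omega> \<in> space M. X \<omega> = of_nat k} = exp (- x) * x ^ k / fact k"
  shows poisson_mean: "(\<integral>\<^sup>+\<omega>. X \<omega> \<partial>M) = ennreal x"
    and poisson_laplace: "(\<integral>\<^sup>+\<omega>. ennreal (exp_neg l (X \<omega>)) \<partial>M) = ennreal (exp (- x * (1 - exp (- l))))"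
    and poisson_zero: "emeasure M {\<omega> \<in> space M. X \<omega> = 0} = ennreal (exp (- x))"
    and poisson_ge_two: "emeasure M {\<omega> \<in> space M. 2 \<le> X \<omega>} \<le> ennreal (x\<^sup>2)"
proof -
  note * = poisson_nn_integral[OF X x law]
  have s: "(\<lambda>k. x ^ k / fact k) sums exp x"
    using exp_converges[of x] by (simp add: field_simps)
  have s1: "(\<lambda>k. real k * (x ^ k / fact k)) sums (x * exp x)"
  proof -
    have "(\<lambda>k. real (Suc k) * (x ^ Suc k / fact (Suc k))) = (\<lambda>k. x * (x ^ k / fact k))"
      by (rule ext) (simp del: of_nat_Suc)
    then have "(\<lambda>k. real (Suc k) * (x ^ Suc k / fact (Suc k))) sums (x * exp x)"
      using sums_mult[OF s] by simp
    then show ?thesis by (subst (asm) sums_Suc_iff) simp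
  qed
  have s2: "(\<lambda>k. real k * (real k - 1) * (x ^ k / fact k)) sums (x\<^sup>2 * exp x)"
  proof -
    have "(\<lambda>k. real (Suc k) * (real (Suc k) - 1) * (x ^ Suc k / fact (Suc k))) = (\<lambda>k. x * (real k * (x ^ k / fact k)))"
    proof
      fix k
      have "real (Suc k) * (x ^ Suc k / fact (Suc k)) = x * (x ^ k / fact k)"
        by (simp del: of_nat_Suc)
      then have "(real (Suc k) - 1) * (real (Suc k) * (x ^ Suc k / fact (Suc k))) = real k * (x * (x ^ k / fact k))"
        by simp
      then show "real (Suc k) * (real (Suc k) - 1) * (x ^ Suc k / fact (Suc k)) = x * (real k * (x ^ k / fact k))"
        by (simp only: mult_ac)
    qed
    then have "(\<lambda>k. real (Suc k) * (real (Suc k) - 1) * (x ^ Suc k / fact (Suc k))) sums (x * (x * exp x))"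
      using sums_mult[OF s1] by simp
    then show ?thesis by (subst (asm) sums_Suc_iff) (simp add: power2_eq_square mult.assoc)
  qed
  have sums: "(\<Sum>k. ennreal (c k) * ennreal (exp (- x) * x ^ k / fact k)) = ennreal (exp (-x) * C)"
    if "\<And>k. 0 \<le> c k" "(\<lambda>k. c k * (x ^ k / fact k)) sums C" for c C
  proof -
    have "(\<lambda>k. exp (-x) * (c k * (x ^ k / fact k))) sums (exp (-x) * C)"
      by (intro sums_mult that)
    then have "(\<Sum>k. ennreal (exp (-x) * (c k * (x ^ k / fact k)))) = ennreal (exp (-x) * C)"
      using that x by (intro suminf_ennreal_eq) auto
    moreover have "ennreal (c k) * ennreal (exp (- x) * x ^ k / fact k) = ennreal (exp (-x) * (c k * (x ^ k / fact k)))" for k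
      using that x by (subst ennreal_mult[symmetric]) (auto simp: mult_ac)
    ultimately show ?thesis by simp
  qed
  show "(\<integral>\<^sup>+\<omega>. X \<omega> \<partial>M) = ennreal x"
  proof -
    have "(\<integral>\<^sup>+\<omega>. X \<omega> \<partial>M) = ennreal (exp (-x) * (x * exp x))"
      unfolding *[of "\<lambda>y. y"] ennreal_of_nat_eq_real_of_nat by (rule sums[OF _ s1]) simp
    also have "exp (-x) * (x * exp x) = x" by (simp add: exp_minus)
    finally show ?thesis .
  qed
  have "(\<lambda>k. exp (- l) ^ k * (x ^ k / fact k)) sums exp (exp (-l) * x)"
    using exp_converges[of "exp (-l) * x"] by (simp add: field_simps)
  then show "(\<integral>\<^sup>+\<omega>. ennreal (exp_neg l (X \<omega>)) \<partial>M) = ennreal (exp (- x * (1 - exp (- l))))"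
  proof -
    assume s3: "(\<lambda>k. exp (- l) ^ k * (x ^ k / fact k)) sums exp (exp (-l) * x)"
    have "(\<integral>\<^sup>+\<omega>. ennreal (exp_neg l (X \<omega>)) \<partial>M) = ennreal (exp (-x) * exp (exp (-l) * x))"
      unfolding *[of "\<lambda>y. ennreal (exp_neg l y)"] exp_neg_of_nat by (rule sums[OF _ s3]) simp
    also have "exp (-x) * exp (exp (-l) * x) = exp (- x * (1 - exp (- l)))"
      by (simp only: exp_add[symmetric]) (simp add: algebra_simps)
    finally show ?thesis .
  qed
  show "emeasure M {\<omega> \<in> space M. X \<omega> = 0} = ennreal (exp (- x))"
    using law[of 0] by (simp add: emeasure_eq_measure)
  have "emeasure M {\<omega> \<in> space M. 2 \<le> X \<omega>} = (\<integral>\<^sup>+\<omega>. indicator {2..} (X \<omega>) \<partial>M)"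
  proof -
    have "{\<omega> \<in> space M. 2 \<le> X \<omega>} \<in> sets M" using X by measurable
    then have "emeasure M {\<omega> \<in> space M. 2 \<le> X \<omega>} = (\<integral>\<^sup>+\<omega>. indicator {\<omega> \<in> space M. 2 \<le> X \<omega>} \<omega> \<partial>M)"
      by simp
    also have "\<dots> = (\<integral>\<^sup>+\<omega>. indicator {2..} (X \<omega>) \<partial>M)"
      by (intro nn_integral_cong) (auto simp: indicator_def)
    finally show ?thesis .
  qed
  also have "\<dots> = (\<Sum>k. indicator {2..} (of_nat k :: ennreal) * ennreal (exp (- x) * x ^ k / fact k))"
    by (rule *)
  also have "\<dots> \<le> (\<Sum>k. ennreal (real k * (real k - 1)) * ennreal (exp (- x) * x ^ k / fact k))"
  proof (intro suminf_le mult_right_mono)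
    fix k :: nat
    show "indicator {2..} (of_nat k :: ennreal) \<le> ennreal (real k * (real k - 1))"
    proof (cases "2 \<le> k")
      case True
      then have "1 * 1 \<le> real k * (real k - 1)" by (intro mult_mono) auto
      then show ?thesis by (simp add: indicator_def)
    next
      case False
      have "\<not> (2::ennreal) \<le> of_nat k"
        using False by (metis of_nat_le_iff of_nat_numeral)
      then show ?thesis by (simp add: indicator_def)
    qed
  qed simp_all
  also have "\<dots> = ennreal (exp (-x) * (x\<^sup>2 * exp x))"
  proof (rule sums[OF _ s2])
    fix k :: nat show "0 \<le> real k * (real k - 1)" by (cases k) auto
  qed
  also have "exp (-x) * (x\<^sup>2 * exp x) = x\<^sup>2" by (simp add: exp_minus)
  finally show "emeasure M {\<omega> \<in> space M. 2 \<le> X \<omega>} \<le> ennreal (x\<^sup>2)" .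
qed

lemma exp_neg_nonneg [simp]: "0 \<le> exp_neg l y" and exp_neg_le_1: "0 \<le> l \<Longrightarrow> exp_neg l y \<le> 1"
  by (auto simp: exp_neg_def)

lemma exp_neg_add: "0 \<le> l \<Longrightarrow> exp_neg l (x + y) = exp_neg l x * exp_neg l y"
  by (cases x; cases y) (auto simp: exp_neg_def exp_add[symmetric] algebra_simps enn2real_plus)

lemma exp_neg_antimono: "0 \<le> l \<Longrightarrow> x \<le> y \<Longrightarrow> exp_neg l y \<le> exp_neg l x"
  by (cases x; cases y) (auto simp: exp_neg_def top_unique intro!: mult_left_mono)

lemma exp_neg_zero [simp]: "exp_neg l 0 = 1"
  by (simp add: exp_neg_def)

lemma exp_neg_ennreal: "0 \<le> r \<Longrightarrow> exp_neg l (ennreal r) = exp (- l * r)"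
  by (simp add: exp_neg_def)

lemma measurable_exp_neg [measurable]: "exp_neg l \<in> borel_measurable borel"
  unfolding exp_neg_def by measurable

text \<open>At k = 0 the two sides differ when y = \<infinity>: by convention
  \<open>exp_neg 0 \<infinity> = 0\<close>, while 0 times \<infinity> is 0 and has
  \<open>exp_neg\<close> equal to 1.\<close>

lemma exp_neg_mult_of_nat: "exp_neg (l * real k) y = exp_neg l (of_nat k * y)" if "k > 0"
  using that by (cases y) (auto simp: exp_neg_def ennreal_mult_eq_top_iff ennreal_of_nat_eq_real_of_nat enn2real_mult)

lemma exp_neg_sum: "0 \<le> l \<Longrightarrow> exp_neg l (\<Sum>k\<in>A. f k) = (\<Prod>k\<in>A. exp_neg l (f k))"
  by (induction A rule: infinite_finite_induct) (auto simp: exp_neg_add)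

text \<open>The Laplace functional of a Poisson process for an integer-valued function: the level
  sets of F are disjoint, so their counts are independent Poisson variables and the expectation
  becomes a product. Taking c strictly below the exponent lets finitely many levels suffice, which
  avoids infinite products and also covers an infinite exponent; dropping the other levels can only
  increase \<open>exp_neg\<close>.\<close>

lemma (in prob_space) poisson_process_laplace_le:
  fixes F :: "'b \<Rightarrow> nat"
  assumes P: "poisson_process M \<nu> P" and F: "F \<in> measurable \<nu> (count_space UNIV)" and l: "0 < l"
    and fin: "\<And>k. 0 < k \<Longrightarrow> emeasure \<nu> {p \<in> space \<nu>. F p = k} < \<infinity>"
    and c: "ennreal c < (\<integral>\<^sup>+p. ennreal (1 - exp (- l * real (F p))) \<partial>\<nu>)" "0 \<le> c"
  shows "(\<integral>\<^sup>+\<omega>. ennreal (exp_neg l (point_sum (P \<omega>) (\<lambda>p. of_nat (F p)))) \<partial>M) \<le> ennreal (exp (- c))"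
proof -
  define B where "B = (\<lambda>k. {p \<in> space \<nu>. F p = k})"
  have B [measurable]: "B k \<in> sets \<nu>" for k
    unfolding B_def using F by measurable
  have disj: "disjoint_family B" unfolding B_def disjoint_family_on_def by auto
  have Bfin: "emeasure \<nu> (B k) = ennreal (measure \<nu> (B k))" if "0 < k" for k
    using fin[OF that] by (auto simp: B_def emeasure_eq_ennreal_measure)
  have "(\<integral>\<^sup>+p. ennreal (1 - exp (- l * real (F p))) \<partial>\<nu>) =
      (\<integral>\<^sup>+p. (\<Sum>k. ennreal (1 - exp (- l * real k)) * indicator (B k) p) \<partial>\<nu>)"
  proof (intro nn_integral_cong)
    fix p assume "p \<in> space \<nu>"
    then have "indicator (B k) p = (if k = F p then 1 else 0 :: ennreal)" for k by (simp add: B_def indicator_def)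
    then have "(\<Sum>k. ennreal (1 - exp (- l * real k)) * indicator (B k) p) =
        (\<Sum>k\<in>{F p}. ennreal (1 - exp (- l * real k)) * indicator (B k) p)"
      by (intro suminf_finite) simp_all
    then show "ennreal (1 - exp (- l * real (F p))) = (\<Sum>k. ennreal (1 - exp (- l * real k)) * indicator (B k) p)"
      using \<open>p \<in> space \<nu>\<close> by (simp add: B_def)
  qed
  also have "\<dots> = (\<Sum>k. ennreal (1 - exp (- l * real k)) * emeasure \<nu> (B k))"
    by (subst nn_integral_suminf) (auto simp: nn_integral_cmult_indicator)
  also have "\<dots> = (SUP n. \<Sum>k<n. ennreal (1 - exp (- l * real k)) * emeasure \<nu> (B k))"
    by (rule suminf_eq_SUP)
  finally obtain n where n: "ennreal c < (\<Sum>k<n. ennreal (1 - exp (- l * real k)) * emeasure \<nu> (B k))"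
    using c(1) by (auto simp: less_SUP_iff)
  define I where "I = {1..<n}"
  have "(\<Sum>k<n. ennreal (1 - exp (- l * real k)) * emeasure \<nu> (B k)) =
      (\<Sum>k\<in>I. ennreal (1 - exp (- l * real k)) * emeasure \<nu> (B k))"
    unfolding I_def by (intro sum.mono_neutral_right) (auto simp: not_le)
  also have "\<dots> = (\<Sum>k\<in>I. ennreal (measure \<nu> (B k) * (1 - exp (- (l * real k)))))"
    using l by (intro sum.cong) (auto simp: I_def Bfin ennreal_mult mult.commute)
  also have "\<dots> = ennreal (\<Sum>k\<in>I. measure \<nu> (B k) * (1 - exp (- (l * real k))))"
    using l by (intro sum_ennreal) auto
  finally have c_le: "c < (\<Sum>k\<in>I. measure \<nu> (B k) * (1 - exp (- (l * real k))))"
    using n c(2) by (simp add: ennreal_less_iff)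
  define X where "X = (\<lambda>k \<omega>. point_count (P \<omega>) (B k))"
  have X [measurable]: "X k \<in> borel_measurable M" for k
    using P B unfolding X_def poisson_process_def by auto
  have law: "(\<integral>\<^sup>+\<omega>. ennreal (exp_neg m (X k \<omega>)) \<partial>M) = ennreal (exp (- measure \<nu> (B k) * (1 - exp (- m))))"
    if "0 < k" for k m
    using P B fin[OF that] unfolding poisson_process_def
    by (intro poisson_laplace) (auto simp: X_def B_def)
  have indep: "indep_vars (\<lambda>_. borel) X UNIV"
    using P disj B unfolding poisson_process_def X_def by (auto simp: image_subset_iff)
  have indep': "indep_vars (\<lambda>_. borel) (\<lambda>k \<omega>. ennreal (exp_neg (l * real k) (X k \<omega>))) I"
    by (rule indep_vars_compose2[OF indep_vars_subset[OF indep]]) auto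
  have AEP: "AE \<omega> in M. P \<omega> \<subseteq> space \<nu>" using P by (auto simp: poisson_process_def)
  have le: "exp_neg l (point_sum (P \<omega>) (\<lambda>p. of_nat (F p))) \<le> (\<Prod>k\<in>I. exp_neg (l * real k) (X k \<omega>))"
    if "P \<omega> \<subseteq> space \<nu>" for \<omega>
  proof -
    have "(\<Sum>k\<in>I. of_nat k * X k \<omega>) = point_sum (P \<omega>) (\<lambda>p. \<Sum>k\<in>I. of_nat k * indicator (B k) p)"
      unfolding X_def point_sum_indicator[symmetric] point_sum_def
      by (simp add: nn_integral_sum nn_integral_cmult)
    also have "\<dots> \<le> point_sum (P \<omega>) (\<lambda>p. of_nat (F p))"
      unfolding point_sum_def
    proof (intro nn_integral_mono)
      fix p
      have "(\<Sum>k\<in>I. of_nat k * indicator (B k) p) = (\<Sum>k\<in>I. if k = F p then of_nat k * indicator (B k) p else 0 :: ennreal)"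
        by (intro sum.cong) (auto simp: B_def)
      also have "\<dots> \<le> of_nat (F p)"
        by (subst sum.delta) (auto simp: I_def indicator_def)
      finally show "(\<Sum>k\<in>I. of_nat k * indicator (B k) p) \<le> (of_nat (F p) :: ennreal)" .
    qed
    finally have "exp_neg l (point_sum (P \<omega>) (\<lambda>p. of_nat (F p))) \<le> exp_neg l (\<Sum>k\<in>I. of_nat k * X k \<omega>)"
      using l by (intro exp_neg_antimono) auto
    also have "\<dots> = (\<Prod>k\<in>I. exp_neg (l * real k) (X k \<omega>))"
      using l by (subst exp_neg_sum) (auto simp: I_def exp_neg_mult_of_nat intro!: prod.cong)
    finally show ?thesis .
  qed
  have "(\<integral>\<^sup>+\<omega>. ennreal (exp_neg l (point_sum (P \<omega>) (\<lambda>p. of_nat (F p)))) \<partial>M) \<le>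
      (\<integral>\<^sup>+\<omega>. (\<Prod>k\<in>I. ennreal (exp_neg (l * real k) (X k \<omega>))) \<partial>M)"
    using AEP by (intro nn_integral_mono_AE, eventually_elim) (auto simp: prod_ennreal intro!: ennreal_leI le)
  also have "\<dots> = (\<Prod>k\<in>I. \<integral>\<^sup>+\<omega>. ennreal (exp_neg (l * real k) (X k \<omega>)) \<partial>M)"
    using indep' by (intro indep_vars_nn_integral) (auto simp: I_def)
  also have "\<dots> = (\<Prod>k\<in>I. ennreal (exp (- (measure \<nu> (B k) * (1 - exp (- (l * real k)))))))"
    by (intro prod.cong) (auto simp: law I_def)
  also have "\<dots> = ennreal (exp (- (\<Sum>k\<in>I. measure \<nu> (B k) * (1 - exp (- (l * real k))))))"
    by (subst prod_ennreal) (auto simp: exp_sum[symmetric] sum_negf I_def)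
  also have "\<dots> \<le> ennreal (exp (- c))" using c_le by (intro ennreal_leI) simp
  finally show ?thesis .
qed

lemma (in prob_space) poisson_process_mean:
  assumes P: "poisson_process M \<nu> P" and B: "B \<in> sets \<nu>"
  shows "(\<integral>\<^sup>+\<omega>. point_count (P \<omega>) B \<partial>M) = emeasure \<nu> B"
proof (cases "emeasure \<nu> B < \<infinity>")
  case True
  then have "(\<integral>\<^sup>+\<omega>. point_count (P \<omega>) B \<partial>M) = ennreal (measure \<nu> B)"
    using P B unfolding poisson_process_def by (intro poisson_mean) auto
  then show ?thesis using True by (simp add: emeasure_eq_ennreal_measure)
next
  case False
  then have inf: "emeasure \<nu> B = \<infinity>" by (simp add: less_top[symmetric])
  then have "AE \<omega> in M. point_count (P \<omega>) B = \<infinity>"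
    using P B by (auto simp: poisson_process_def)
  then have "(\<integral>\<^sup>+\<omega>. point_count (P \<omega>) B \<partial>M) = (\<integral>\<^sup>+\<omega>. \<infinity> \<partial>M)"
    by (intro nn_integral_cong_AE)
  then show ?thesis using inf by (simp add: emeasure_space_1)
qed

section \<open>Subordinators\<close>

definition laplace_exponent :: "real measure \<Rightarrow> real \<Rightarrow> real" where
  "laplace_exponent \<nu> l = (\<integral>r. 1 - exp (- l * r) \<partial>\<nu>)"

context prob_space
begin

lemma subordinator_measurable: "subordinator M d \<nu> \<xi> \<Longrightarrow> 0 \<le> t \<Longrightarrow> \<xi> t \<in> borel_measurable M"
  by (simp add: subordinator_def)

lemma subordinator_mono:
  "subordinator M d \<nu> \<xi> \<Longrightarrow> AE \<omega> in M. \<xi> 0 \<omega> = 0 \<and> mono_on {0..} (\<lambda>t. \<xi> t \<omega>)"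
  unfolding subordinator_def by auto

lemma subordinator_nonneg:
  assumes "subordinator M d \<nu> \<xi>" "0 \<le> t"
  shows "AE \<omega> in M. 0 \<le> \<xi> t \<omega>"
  using subordinator_mono[OF assms(1)]
  by eventually_elim (use assms(2) in \<open>metis atLeast_iff mono_on_def order_refl\<close>)

lemma subordinator_laplace:
  assumes "subordinator M 0 \<nu> \<xi>" "0 \<le> t" "0 \<le> l"
  shows "(\<integral>\<omega>. exp (- l * \<xi> t \<omega>) \<partial>M) = exp (- t * laplace_exponent \<nu> l)"
    and "(\<integral>\<^sup>+\<omega>. ennreal (exp (- l * \<xi> t \<omega>)) \<partial>M) = ennreal (exp (- t * laplace_exponent \<nu> l))"
    and "integrable M (\<lambda>\<omega>. exp (- l * \<xi> t \<omega>))"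
proof -
  show 1: "(\<integral>\<omega>. exp (- l * \<xi> t \<omega>) \<partial>M) = exp (- t * laplace_exponent \<nu> l)"
    using assms by (simp add: subordinator_def laplace_exponent_def)
  have [measurable]: "\<xi> t \<in> borel_measurable M" using assms subordinator_measurable by blast
  show 2: "integrable M (\<lambda>\<omega>. exp (- l * \<xi> t \<omega>))"
  proof (rule integrable_const_bound[where B=1])
    show "AE \<omega> in M. norm (exp (- l * \<xi> t \<omega>)) \<le> 1"
      using subordinator_nonneg[OF assms(1,2)] by eventually_elim (use assms in auto)
  qed measurable
  show "(\<integral>\<^sup>+\<omega>. ennreal (exp (- l * \<xi> t \<omega>)) \<partial>M) = ennreal (exp (- t * laplace_exponent \<nu> l))"
    using nn_integral_eq_integral[OF 2] 1 by simp
qed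

text \<open>Markov's inequality for 1 - exp (- \<xi> / y): it is at least 1 - 1/e >= 1/2 where \<xi>
  exceeds y, hence the factor 2, and its mean 1 - exp (- t \<phi>(1/y)) is at most t
  \<phi>(1/y).\<close>

lemma subordinator_tail:
  assumes sub: "subordinator M 0 \<nu> \<xi>" "0 \<le> t" and y: "0 < y"
  shows "prob {\<omega> \<in> space M. y < \<xi> t \<omega>} \<le> 2 * t * laplace_exponent \<nu> (1 / y)"
proof -
  have [measurable]: "\<xi> t \<in> borel_measurable M" using sub subordinator_measurable by blast
  have e: "exp (-1) \<le> (1/2 :: real)"
    using exp_ge_add_one_self[of 1] by (simp add: exp_minus field_simps)
  have int: "integrable M (\<lambda>\<omega>. exp (- (1 / y) * \<xi> t \<omega>))"
    using sub y by (intro subordinator_laplace) auto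
  have "(1/2) * prob {\<omega> \<in> space M. y < \<xi> t \<omega>} = (\<integral>\<omega>. (1/2) * indicator {\<omega> \<in> space M. y < \<xi> t \<omega>} \<omega> \<partial>M)"
    by simp
  also have "\<dots> \<le> (\<integral>\<omega>. 1 - exp (- (1 / y) * \<xi> t \<omega>) \<partial>M)"
  proof (rule integral_mono_AE)
    show "AE \<omega> in M. (1/2) * indicator {\<omega> \<in> space M. y < \<xi> t \<omega>} \<omega> \<le> 1 - exp (- (1 / y) * \<xi> t \<omega>)"
      using subordinator_nonneg[OF sub]
    proof eventually_elim
      fix \<omega> assume n: "0 \<le> \<xi> t \<omega>"
      show "(1/2) * indicator {\<omega> \<in> space M. y < \<xi> t \<omega>} \<omega> \<le> 1 - exp (- (1 / y) * \<xi> t \<omega>)"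
      proof (cases "y < \<xi> t \<omega>")
        case True
        then have "exp (- (1 / y) * \<xi> t \<omega>) \<le> exp (-1)" using y by (simp add: field_simps)
        then have "exp (- (1 / y) * \<xi> t \<omega>) \<le> 1/2" using e by linarith
        then show ?thesis using n y by (auto simp: indicator_def)
      next
        case False
        then show ?thesis using n y by (simp add: indicator_def)
      qed
    qed
    show "integrable M (\<lambda>\<omega>. (1/2) * indicator {\<omega> \<in> space M. y < \<xi> t \<omega>} \<omega> :: real)"
      by (intro integrable_mult_right integrable_real_indicator) (auto simp: emeasure_eq_measure)
  qed (use int in auto)
  also have "\<dots> = 1 - exp (- t * laplace_exponent \<nu> (1 / y))"
    using int subordinator_laplace(1)[OF sub, of "1 / y"] y by (simp add: prob_space)
  also have "\<dots> \<le> t * laplace_exponent \<nu> (1 / y)"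
    using exp_ge_add_one_self[of "- t * laplace_exponent \<nu> (1 / y)"] by simp
  finally show ?thesis by simp
qed

text \<open>The time is cut into m equal pieces and every increment is asked to be at most a / m.
  The hypothesis bounds the failure probability of a single piece by 1/2 through
  \<open>subordinator_tail\<close>, and independence of the increments gives the power. The free
  parameter m is later of order a powr (1 + \<sigma>), where the loss 2 powr (- m) is compensated by
  the number of children.\<close>

lemma subordinator_small:
  assumes sub: "subordinator M 0 \<nu> \<xi>" and t: "0 \<le> t" and a: "0 < a" and m: "0 < m"
    and small: "4 * t * laplace_exponent \<nu> (real m / a) \<le> real m"
  shows "(1/2) ^ m \<le> prob {\<omega> \<in> space M. \<xi> t \<omega> \<le> a}"
proof -
  define T where "T = (\<lambda>i::nat. real i * (t / real m))"
  define D where "D = (\<lambda>i \<omega>. \<xi> (T (Suc i)) \<omega> - \<xi> (T i) \<omega>)"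
  have T: "T 0 = 0" "mono T" "0 \<le> T i" for i
    using t by (auto simp: T_def mono_def intro!: mult_right_mono divide_right_mono)
  have Tm: "T m = t" using m by (simp add: T_def)
  have \<xi> [measurable]: "\<xi> (T i) \<in> borel_measurable M" for i
    using subordinator_measurable[OF sub T(3)] .
  have D [measurable]: "D i \<in> borel_measurable M" for i unfolding D_def by measurable
  have ind: "indep_vars (\<lambda>_. borel) D UNIV"
    using sub T unfolding subordinator_def D_def by simp
  have half: "1/2 \<le> prob (D i -` {..a / real m} \<inter> space M)" for i
  proof -
    have h: "0 \<le> t / real m" using t by simp
    have [measurable]: "\<xi> (t / real m) \<in> borel_measurable M" using subordinator_measurable[OF sub h] .
    have TS: "T (Suc i) = T i + t / real m" by (simp add: T_def algebra_simps add_divide_distrib)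
    have "distr M borel (D i) = distr M borel (\<xi> (t / real m))"
      using sub T(3) h unfolding subordinator_def D_def TS by blast
    then have "measure (distr M borel (D i)) {..a / real m} = measure (distr M borel (\<xi> (t / real m))) {..a / real m}"
      by simp
    then have "prob (D i -` {..a / real m} \<inter> space M) = prob (\<xi> (t / real m) -` {..a / real m} \<inter> space M)"
      by (simp add: measure_distr)
    also have "\<xi> (t / real m) -` {..a / real m} \<inter> space M = space M - {\<omega> \<in> space M. a / real m < \<xi> (t / real m) \<omega>}"
      by auto
    also have "prob \<dots> = 1 - prob {\<omega> \<in> space M. a / real m < \<xi> (t / real m) \<omega>}"
      by (intro prob_compl) measurable
    finally have "prob (D i -` {..a / real m} \<inter> space M) \<ge> 1 - 2 * (t / real m) * laplace_exponent \<nu> (real m / a)"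
      using subordinator_tail[OF sub h, of "a / real m"] a m by simp
    moreover have "2 * (t / real m) * laplace_exponent \<nu> (real m / a) \<le> 1/2"
      using small m by (simp add: field_simps)
    ultimately show ?thesis by linarith
  qed
  have "(1/2) ^ m = (\<Prod>i<m. 1/2 :: real)" by simp
  also have "\<dots> \<le> (\<Prod>i<m. prob (D i -` {..a / real m} \<inter> space M))"
    using half by (intro prod_mono) auto
  also have "\<dots> = prob (\<Inter>i<m. D i -` {..a / real m} \<inter> space M)"
    using m by (intro indep_varsD[OF ind, symmetric]) auto
  also have "\<dots> \<le> prob {\<omega> \<in> space M. \<xi> t \<omega> \<le> a}"
  proof (rule finite_measure_mono_AE)
    show "AE \<omega> in M. \<omega> \<in> (\<Inter>i<m. D i -` {..a / real m} \<inter> space M) \<longrightarrow> \<omega> \<in> {\<omega> \<in> space M. \<xi> t \<omega> \<le> a}"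
      using subordinator_mono[OF sub]
    proof eventually_elim
      fix \<omega> assume \<omega>: "\<xi> 0 \<omega> = 0 \<and> mono_on {0..} (\<lambda>t. \<xi> t \<omega>)"
      show "\<omega> \<in> (\<Inter>i<m. D i -` {..a / real m} \<inter> space M) \<longrightarrow> \<omega> \<in> {\<omega> \<in> space M. \<xi> t \<omega> \<le> a}"
      proof
        assume *: "\<omega> \<in> (\<Inter>i<m. D i -` {..a / real m} \<inter> space M)"
        have "\<xi> t \<omega> = (\<Sum>i<m. D i \<omega>)"
          unfolding D_def using \<omega> Tm T(1) by (subst sum_lessThan_telescope) auto
        also have "\<dots> \<le> (\<Sum>i<m. a / real m)" using * m by (intro sum_mono) (auto split: if_splits)
        also have "\<dots> = a" using m by simp
        finally show "\<omega> \<in> {\<omega> \<in> space M. \<xi> t \<omega> \<le> a}" using * m by (auto split: if_splits)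
      qed
    qed
    have "\<xi> t \<in> borel_measurable M" using subordinator_measurable[OF sub t] .
    then show "{\<omega> \<in> space M. \<xi> t \<omega> \<le> a} \<in> sets M" by measurable
  qed
  finally show ?thesis .
qed

end

section \<open>The particle system at a fixed truncation level\<close>

text \<open>The noise of one truncation level, freed from \<Lambda>: \<Theta> is the finite measure
  of the marks at branchings and \<nu> the Levy measure. \<open>mark_AE\<close> records that the
  parent does not jump and that each child is born within distance a or not at all.\<close>

locale branching_noise = prob_space M for M :: "'w measure" +
  fixes \<Theta> :: "conf measure" and a :: real and \<nu> :: "real measure"
    and \<xi> :: "label \<Rightarrow> real \<Rightarrow> 'w \<Rightarrow> real" and P :: "label \<Rightarrow> 'w \<Rightarrow> (real \<times> conf) set"
  assumes finite_mark: "finite_measure \<Theta>"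
    and mark_pos: "0 < emeasure \<Theta> (space \<Theta>)"
    and mark_Qset: "space \<Theta> \<subseteq> Qset"
    and mark_coordinate: "\<And>i. (\<lambda>x. x i) \<in> borel_measurable \<Theta>"
    and mark_AE: "AE x in \<Theta>. x 0 = 0 \<and> x 1 < \<infinity> \<and> (\<forall>i\<ge>1. x i < ennreal a \<or> x i = \<infinity>)"
    and sub: "\<And>u. subordinator M 0 \<nu> (\<xi> u)"
    and poisson: "\<And>u. poisson_process M (restrict_space lborel {0..} \<Otimes>\<^sub>M \<Theta>) (P u)"
    and indep: "indep_sets (case_sum (\<lambda>u. process_events M (\<xi> u))
      (\<lambda>u. point_events M (restrict_space lborel {0..} \<Otimes>\<^sub>M \<Theta>) (P u))) UNIV"
begin

sublocale mark: finite_measure \<Theta> by (rule finite_mark)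

abbreviation "intens \<equiv> restrict_space lborel {0::real..} \<Otimes>\<^sub>M \<Theta>"

definition source_events :: "label + label \<Rightarrow> 'w set set" where
  "source_events = case_sum (\<lambda>u. process_events M (\<xi> u)) (\<lambda>u. point_events M intens (P u))"

text \<open>Used as a \<sigma>-algebra only: measurability with respect to \<open>noise I\<close>
  means being determined by the sources in I, and all integrals are taken against M.
  \<open>Inl u\<close> stands for the motion of u and \<open>Inr u\<close> for its branching
  points.\<close>

definition noise :: "(label + label) set \<Rightarrow> 'w measure" where
  "noise I = sigma (space M) (\<Union>i\<in>I. source_events i)"

lemma events_subset: "source_events i \<subseteq> Pow (space M)"
proof -
  have "{\<xi> u t -` B \<inter> space M | t B. 0 \<le> t \<and> B \<in> sets borel} \<subseteq> Pow (space M)" for u by auto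
  moreover have "{(\<lambda>\<omega>. point_count (P u \<omega>) B) -` C \<inter> space M | B C. B \<in> sets intens \<and> C \<in> sets borel} \<subseteq> Pow (space M)" for u
    by auto
  ultimately show ?thesis
    unfolding source_events_def process_events_def point_events_def
    by (cases i) (auto dest: sigma_sets_into_sp[rotated])
qed

lemma space_noise [simp]: "space (noise I) = space M"
  and sets_noise: "sets (noise I) = sigma_sets (space M) (\<Union>i\<in>I. source_events i)"
proof -
  have "(\<Union>i\<in>I. source_events i) \<subseteq> Pow (space M)" using events_subset by blast
  then show "space (noise I) = space M" "sets (noise I) = sigma_sets (space M) (\<Union>i\<in>I. source_events i)"
    unfolding noise_def by (auto simp: space_measure_of_conv sets_measure_of)
qed

lemma Int_stable_events: "Int_stable (source_events i)"
proof (cases i)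
  case (Inl u)
  interpret sigma_algebra "space M" "source_events i"
    unfolding Inl source_events_def process_events_def sum.case by (rule sigma_algebra_sigma_sets) auto
  show ?thesis by (auto simp: Int_stable_def)
next
  case (Inr u)
  interpret sigma_algebra "space M" "source_events i"
    unfolding Inr source_events_def point_events_def sum.case by (rule sigma_algebra_sigma_sets) auto
  show ?thesis by (auto simp: Int_stable_def)
qed

lemma noise_mono: "I \<subseteq> J \<Longrightarrow> sets (noise I) \<subseteq> sets (noise J)"
  unfolding sets_noise by (rule sigma_sets_mono') auto

lemma measurable_noise_mono: "f \<in> measurable (noise I) N \<Longrightarrow> I \<subseteq> J \<Longrightarrow> f \<in> measurable (noise J) N"
  using noise_mono[of I J] by (auto simp: measurable_def)

lemma indep_events: "indep_sets source_events UNIV"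
  using indep unfolding source_events_def .

lemma noise_sets_M: "sets (noise I) \<subseteq> sets M"
proof -
  have "source_events i \<subseteq> sets M" for i
    using indep_events by (auto simp: indep_sets_def)
  then show ?thesis unfolding sets_noise by (intro sets.sigma_sets_subset) auto
qed

lemma measurable_noise_M: "f \<in> measurable (noise I) N \<Longrightarrow> f \<in> measurable M N"
  using noise_sets_M[of I] by (auto simp: measurable_def)

text \<open>All conditioning on other particles goes through this factorisation: a function of one
  set of sources is integrated separately from a function of a disjoint set. The two sets are packed
  into a family indexed by booleans so that independence of grouped sources applies.\<close>

lemma nn_integral_noise_mult:
  assumes IJ: "I \<inter> J = {}" and f: "f \<in> borel_measurable (noise I)" and g: "g \<in> borel_measurable (noise J)"
  shows "(\<integral>\<^sup>+\<omega>. f \<omega> * g \<omega> \<partial>M) = (\<integral>\<^sup>+\<omega>. f \<omega> \<partial>M) * (\<integral>\<^sup>+\<omega>. g \<omega> \<partial>M)"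
proof -
  define K where "K = case_bool I J"
  define X where "X = case_bool f g"
  have "indep_sets (\<lambda>j. sigma_sets (space M) (\<Union>i\<in>K j. source_events i)) UNIV"
  proof (rule indep_sets_collect_sigma)
    show "indep_sets source_events (\<Union>j\<in>UNIV. K j)"
      using indep_events by (rule indep_sets_mono_index[rotated]) simp
    show "disjoint_family_on K UNIV"
      using IJ by (auto simp: disjoint_family_on_def K_def split: bool.splits)
  qed (rule Int_stable_events)
  then have ind: "indep_sets (\<lambda>j. sets (noise (K j))) UNIV" unfolding sets_noise .
  have X: "X j \<in> borel_measurable (noise (K j))" for j
    using f g by (cases j) (auto simp: X_def K_def)
  have "indep_vars (\<lambda>_. borel) X UNIV"
    unfolding indep_vars_def
  proof
    show "\<forall>i\<in>UNIV. random_variable borel (X i)" using X measurable_noise_M by blast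
    show "indep_sets (\<lambda>i. sigma_sets (space M) {X i -` A \<inter> space M |A. A \<in> sets borel}) UNIV"
    proof (rule indep_sets_mono_sets[OF ind])
      fix j
      have "{X j -` A \<inter> space M |A. A \<in> sets borel} \<subseteq> sets (noise (K j))"
        using measurable_sets[OF X] by auto
      then show "sigma_sets (space M) {X j -` A \<inter> space M |A. A \<in> sets borel} \<subseteq> sets (noise (K j))"
        using sets.sigma_sets_subset[of _ "noise (K j)"] by simp
    qed
  qed
  then have "(\<integral>\<^sup>+\<omega>. (\<Prod>i\<in>UNIV. X i \<omega>) \<partial>M) = (\<Prod>i\<in>UNIV. \<integral>\<^sup>+\<omega>. X i \<omega> \<partial>M)"
    by (intro indep_vars_nn_integral) auto
  then show ?thesis by (simp add: UNIV_bool X_def mult.commute)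
qed

lemma measurable_xi: "0 \<le> t \<Longrightarrow> Inl u \<in> I \<Longrightarrow> \<xi> u t \<in> borel_measurable (noise I)"
proof (rule measurableI)
  fix B :: "real set" assume B: "0 \<le> t" "Inl u \<in> I" "B \<in> sets borel"
  then have "\<xi> u t -` B \<inter> space M \<in> source_events (Inl u)"
    unfolding source_events_def process_events_def by auto
  then show "\<xi> u t -` B \<inter> space (noise I) \<in> sets (noise I)"
    using B unfolding sets_noise space_noise by blast
qed simp

lemma measurable_P: "B \<in> sets intens \<Longrightarrow> Inr u \<in> I \<Longrightarrow> (\<lambda>\<omega>. point_count (P u \<omega>) B) \<in> borel_measurable (noise I)"
proof (rule measurableI)
  fix C :: "ennreal set" assume B: "B \<in> sets intens" "Inr u \<in> I" "C \<in> sets borel"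
  then have "(\<lambda>\<omega>. point_count (P u \<omega>) B) -` C \<inter> space M \<in> source_events (Inr u)"
    unfolding source_events_def point_events_def by auto
  then show "(\<lambda>\<omega>. point_count (P u \<omega>) B) -` C \<inter> space (noise I) \<in> sets (noise I)"
    using B unfolding sets_noise space_noise by blast
qed simp

lemma space_intens: "space intens = {0..} \<times> space \<Theta>"
  by (simp add: space_pair_measure space_restrict_space)

lemma strip_sets: "0 \<le> s \<Longrightarrow> B \<in> sets \<Theta> \<Longrightarrow> {s..<t} \<times> B \<in> sets intens"
  by (intro pair_measureI) (auto simp: sets_restrict_space image_iff intro!: exI[of _ "{s..<t}"])

lemma emeasure_strip:
  assumes "0 \<le> s" "s \<le> t" "B \<in> sets \<Theta>"
  shows "emeasure intens ({s..<t} \<times> B) = ennreal (t - s) * emeasure \<Theta> B"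
proof -
  have s: "{s..<t} \<in> sets (restrict_space lborel {0..})"
    using assms by (auto simp: sets_restrict_space image_iff intro!: exI[of _ "{s..<t}"])
  have "emeasure (restrict_space lborel {0..}) {s..<t} = ennreal (t - s)"
    using assms by (subst emeasure_restrict_space) auto
  then show ?thesis
    using mark.emeasure_pair_measure_Times[OF s assms(3)] by simp
qed

lemma emeasure_strip_finite:
  assumes "0 \<le> s" "B \<in> sets \<Theta>"
  shows "emeasure intens ({s..<t} \<times> B) < \<infinity>"
proof (cases "s \<le> t")
  case True
  have "ennreal (t - s) * emeasure \<Theta> B < \<infinity>"
    using mark.emeasure_finite[of B] by (auto simp: less_top[symmetric] ennreal_mult_eq_top_iff)
  then show ?thesis using emeasure_strip[OF assms(1) True assms(2)] by simp
qed simp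

end

section \<open>Enumeration of a set of points in the order of time\<close>

definition regular :: "(real \<times> conf) set \<Rightarrow> bool" where
  "regular S \<longleftrightarrow> inj_on fst S \<and> (\<forall>t. finite {p \<in> S. fst p < t}) \<and> infinite S"

definition points_from :: "real \<Rightarrow> (real \<times> conf) set \<Rightarrow> (real \<times> conf) set" where
  "points_from b S = {p \<in> S. b \<le> fst p}"

lemma regular_points_from: "regular S \<Longrightarrow> regular (points_from b S)"
  unfolding regular_def points_from_def
proof safe
  assume S: "inj_on fst S" "\<forall>t. finite {p \<in> S. fst p < t}" "infinite S" "finite {p \<in> S. b \<le> fst p}"
  then have "finite ({p \<in> S. fst p < b} \<union> {p \<in> S. b \<le> fst p})" by blast
  moreover have "S = {p \<in> S. fst p < b} \<union> {p \<in> S. b \<le> fst p}" by auto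
  ultimately show False using S(3) by simp
next
  fix t assume "\<forall>t. finite {p \<in> S. fst p < t}"
  then show "finite {p \<in> {p \<in> S. b \<le> fst p}. fst p < t}"
    by (rule finite_subset[rotated, OF spec[of _ t]]) auto
qed (auto intro: inj_on_subset)

lemma regular_least:
  assumes "regular S" "A \<subseteq> S" "A \<noteq> {}"
  shows "\<exists>p\<in>A. \<forall>q\<in>A. fst p \<le> fst q"
proof -
  obtain p0 where p0: "p0 \<in> A" using assms by auto
  let ?B = "{q \<in> A. fst q \<le> fst p0}"
  have "finite {p \<in> S. fst p < fst p0 + 1}" using assms by (auto simp: regular_def)
  then have fin: "finite ?B" by (rule finite_subset[rotated]) (use assms in auto)
  have "?B \<noteq> {}" using p0 by blast
  then have "Min (fst ` ?B) \<in> fst ` ?B" using fin by (intro Min_in) blast+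
  then obtain p where p: "p \<in> ?B" "fst p = Min (fst ` ?B)" by force
  have "fst p \<le> fst q" if "q \<in> A" for q
  proof (cases "fst q \<le> fst p0")
    case True
    then have "q \<in> ?B" using that by simp
    then show ?thesis unfolding p(2) using fin by (intro Min_le) blast+
  next
    case False
    then show ?thesis using p(1) by simp
  qed
  then show ?thesis using p by blast
qed

definition rank :: "(real \<times> conf) set \<Rightarrow> real \<times> conf \<Rightarrow> nat" where
  "rank S p = card {q \<in> S. fst q < fst p}"

lemma rank_strict_mono:
  assumes "regular S" "p \<in> S" "fst p < fst q"
  shows "rank S p < rank S q"
  unfolding rank_def
proof (rule psubset_card_mono)
  show "finite {r \<in> S. fst r < fst q}" using assms by (auto simp: regular_def)
  show "{r \<in> S. fst r < fst p} \<subset> {r \<in> S. fst r < fst q}" using assms by force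
qed

text \<open>Distinct times make ranks distinct; local finiteness gives the points after p an
  earliest one, whose rank is one more; infiniteness guarantees that there are points after p. These
  are the three clauses of \<open>regular\<close>, and they make \<open>nth_point\<close> a genuine
  enumeration whose inverse is the rank.\<close>

lemma rank_bij:
  assumes S: "regular S"
  shows "bij_betw (rank S) S UNIV"
proof -
  have inj: "inj_on (rank S) S"
  proof (rule inj_onI)
    fix p q assume pq: "p \<in> S" "q \<in> S" "rank S p = rank S q"
    then have "fst p = fst q"
      using rank_strict_mono[OF S] by (metis linorder_neqE_linordered_idom nat_less_le)
    then show "p = q" using pq S by (auto simp: regular_def inj_on_def)
  qed
  have ex: "\<exists>p\<in>S. rank S p = k" for k
  proof (induction k)
    case 0
    have "S \<noteq> {}" using S by (auto simp: regular_def)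
    then obtain p where "p \<in> S" "\<forall>q\<in>S. fst p \<le> fst q" using regular_least[OF S order_refl] by auto
    then have "{q \<in> S. fst q < fst p} = {}" by force
    then have "rank S p = 0" unfolding rank_def by (simp only: card.empty)
    then show ?case using \<open>p \<in> S\<close> by blast
  next
    case (Suc k)
    then obtain p where p: "p \<in> S" "rank S p = k" by auto
    let ?A = "{q \<in> S. fst p < fst q}"
    have "?A \<noteq> {}"
    proof
      assume *: "?A = {}"
      have "finite {q \<in> S. fst q < fst p + 1}" using S by (auto simp: regular_def)
      moreover have "S \<subseteq> {q \<in> S. fst q < fst p + 1}" using * by force
      ultimately show False using S finite_subset by (auto simp: regular_def)
    qed
    then obtain q where q: "q \<in> ?A" "\<forall>r\<in>?A. fst q \<le> fst r"
      using regular_least[OF S, of ?A] by auto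
    have "{r \<in> S. fst r < fst q} = insert p {r \<in> S. fst r < fst p}"
    proof (intro equalityI subsetI)
      fix r assume r: "r \<in> {r \<in> S. fst r < fst q}"
      have "\<not> fst p < fst r"
      proof
        assume "fst p < fst r"
        then have "fst q \<le> fst r" using r q(2) by blast
        then show False using r by simp
      qed
      then have "fst r < fst p \<or> fst r = fst p" by linarith
      then show "r \<in> insert p {r \<in> S. fst r < fst p}"
        using r p S by (auto simp: regular_def dest: inj_onD)
    next
      fix r assume "r \<in> insert p {r \<in> S. fst r < fst p}"
      then show "r \<in> {r \<in> S. fst r < fst q}" using q(1) p(1) by auto
    qed
    moreover have "finite {r \<in> S. fst r < fst p}" using S by (auto simp: regular_def)
    ultimately have "rank S q = Suc k" using p by (simp add: rank_def)
    then show ?case using q by auto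
  qed
  have "k \<in> rank S ` S" for k using ex[of k] by auto
  then have "rank S ` S = UNIV" by auto
  then show ?thesis using inj by (simp add: bij_betw_def)
qed

lemma nth_point_eqI:
  assumes "regular S" "p \<in> S" "rank S p = k"
  shows "nth_point S k = p"
  unfolding nth_point_def
proof (rule the_equality)
  have fin: "finite {q \<in> S. fst q < t}" for t using assms by (auto simp: regular_def)
  show "p \<in> S \<and> finite {q \<in> S. fst q < fst p} \<and> card {q \<in> S. fst q < fst p} = k"
    using assms fin by (auto simp: rank_def)
  fix q assume "q \<in> S \<and> finite {r \<in> S. fst r < fst q} \<and> card {r \<in> S. fst r < fst q} = k"
  then show "q = p" using assms rank_bij[OF assms(1)] by (auto simp: rank_def bij_betw_def inj_on_def)
qed

lemma nth_point_rank: "regular S \<Longrightarrow> p \<in> S \<Longrightarrow> nth_point S (rank S p) = p"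
  by (rule nth_point_eqI) auto

lemma
  assumes S: "regular S"
  shows nth_point_in: "nth_point S k \<in> S" and rank_nth_point: "rank S (nth_point S k) = k"
proof -
  have "k \<in> rank S ` S" using rank_bij[OF S] by (simp add: bij_betw_def)
  then obtain p where "p \<in> S" "rank S p = k" by blast
  then show "nth_point S k \<in> S" "rank S (nth_point S k) = k" using nth_point_eqI[OF S, of p k] by auto
qed

lemma nth_point_bij: "regular S \<Longrightarrow> bij_betw (nth_point S) UNIV S"
  by (rule bij_betw_byWitness[where f' = "rank S"]) (auto simp: nth_point_rank nth_point_in rank_nth_point)

lemma nth_point_strict_mono:
  assumes "regular S" "i < j" shows "fst (nth_point S i) < fst (nth_point S j)"
proof (rule ccontr)
  assume *: "\<not> fst (nth_point S i) < fst (nth_point S j)"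
  have "rank S (nth_point S j) \<le> rank S (nth_point S i)"
    unfolding rank_def using * assms(1) by (intro card_mono) (auto simp: regular_def)
  then show False using assms by (simp add: rank_nth_point)
qed

section \<open>Poisson points made regular for every outcome\<close>

context branching_noise
begin

definition good_mark :: "conf \<Rightarrow> bool" where
  "good_mark x \<longleftrightarrow> x 0 = 0 \<and> x 1 < \<infinity> \<and> (\<forall>i\<ge>1. x i < ennreal a \<or> x i = \<infinity>)"

definition bad_points :: "(real \<times> conf) set" where
  "bad_points = {0..} \<times> {x \<in> space \<Theta>. \<not> good_mark x}"

definition strip :: "real \<Rightarrow> real \<Rightarrow> (real \<times> conf) set" where
  "strip s t = {s..<t} \<times> space \<Theta>"

text \<open>All clauses concern counts in countably many sets, so the event belongs to the
  \<sigma>-algebra of the points of u alone. Distinctness of times is not directly a statement about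
  counts; it is replaced by the existence, for each horizon n, of a grid of mesh 1 / (m + 1) with at
  most one point per cell.\<close>

definition good_noise :: "label \<Rightarrow> 'w set" where
  "good_noise u = {\<omega> \<in> space M. (\<forall>n::nat. point_count (P u \<omega>) (strip 0 (real n)) < \<infinity>) \<and>
     (\<forall>n. \<exists>m. \<forall>i<n * Suc m. point_count (P u \<omega>) (strip (real i / real (Suc m)) (real (Suc i) / real (Suc m))) < 2) \<and>
     point_count (P u \<omega>) (space intens) = \<infinity> \<and> point_count (P u \<omega>) bad_points = 0}"

lemma good_mark_sets [measurable]: "{x \<in> space \<Theta>. good_mark x} \<in> sets \<Theta>"
  using mark_coordinate[measurable] unfolding good_mark_def by measurable

lemma bad_points_sets: "bad_points \<in> sets intens"
proof -
  have "{x \<in> space \<Theta>. \<not> good_mark x} = space \<Theta> - {x \<in> space \<Theta>. good_mark x}" by auto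
  then have "{x \<in> space \<Theta>. \<not> good_mark x} \<in> sets \<Theta>" by simp
  then show ?thesis unfolding bad_points_def by (intro pair_measureI) (auto simp: sets_restrict_space)
qed

lemma strip_in_sets: "0 \<le> s \<Longrightarrow> strip s t \<in> sets intens"
  unfolding strip_def by (intro strip_sets) auto

lemma good_noise_sets: "good_noise u \<in> sets (noise {Inr u})"
proof -
  let ?N = "noise {Inr u}"
  have [measurable]: "(\<lambda>\<omega>. point_count (P u \<omega>) B) \<in> borel_measurable (noise {Inr u})" if "B \<in> sets intens" for B
    using that by (rule measurable_P) simp
  have [measurable]: "strip 0 (real n) \<in> sets intens" "strip (real i / real (Suc m)) (real (Suc i) / real (Suc m)) \<in> sets intens"
    for n i m by (auto intro!: strip_in_sets)
  note bad_points_sets [measurable]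
  have [measurable]: "Measurable.pred ?N (\<lambda>\<omega>. point_count (P u \<omega>) (strip 0 (real n)) < \<infinity>)" for n
    by measurable
  have p2: "Measurable.pred ?N (\<lambda>\<omega>. point_count (P u \<omega>) (strip (real i / real (Suc m)) (real (Suc i) / real (Suc m))) < 2)" for i m
    by measurable
  have [measurable]: "Measurable.pred ?N (\<lambda>\<omega>. point_count (P u \<omega>) (space intens) = \<infinity>)"
    by measurable
  have [measurable]: "Measurable.pred ?N (\<lambda>\<omega>. point_count (P u \<omega>) bad_points = 0)"
    by measurable
  have "Measurable.pred ?N (\<lambda>\<omega>. \<forall>n::nat. point_count (P u \<omega>) (strip 0 (real n)) < \<infinity>)"
    by (intro pred_intros_countable) measurable
  moreover have "Measurable.pred ?N (\<lambda>\<omega>. \<forall>n. \<exists>m. \<forall>i\<in>{..<n * Suc m}.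
      point_count (P u \<omega>) (strip (real i / real (Suc m)) (real (Suc i) / real (Suc m))) < 2)"
    by (intro pred_intros_countable pred_intros_finite p2) simp
  ultimately have "Measurable.pred ?N (\<lambda>\<omega>. (\<forall>n::nat. point_count (P u \<omega>) (strip 0 (real n)) < \<infinity>) \<and>
     (\<forall>n. \<exists>m. \<forall>i\<in>{..<n * Suc m}. point_count (P u \<omega>) (strip (real i / real (Suc m)) (real (Suc i) / real (Suc m))) < 2) \<and>
     point_count (P u \<omega>) (space intens) = \<infinity> \<and> point_count (P u \<omega>) bad_points = 0)"
    by (intro pred_intros_logic) auto
  then show ?thesis
    unfolding good_noise_def pred_def space_noise Ball_def lessThan_iff .
qed

lemma AE_good_mark: "AE x in \<Theta>. good_mark x"
  using mark_AE by eventually_elim (simp add: good_mark_def)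

lemma ex_good_mark: "\<exists>x\<in>space \<Theta>. good_mark x"
proof (rule ccontr)
  assume *: "\<not> ?thesis"
  have "AE x in \<Theta>. x \<in> space \<Theta> \<and> good_mark x" using mark_AE AE_space unfolding good_mark_def by auto
  then have "AE x in \<Theta>. False" by eventually_elim (use * in auto)
  then have "emeasure \<Theta> (space \<Theta>) = 0" by (simp add: AE_iff_measurable[of "space \<Theta>"])
  then show False using mark_pos by simp
qed

definition default_points :: "(real \<times> conf) set" where
  "default_points = range (\<lambda>n::nat. (real n + 1, SOME x. x \<in> space \<Theta> \<and> good_mark x))"

text \<open>Outside the good event a fixed regular set of points is substituted. Enumeration, birth
  times and branchings thereby become total functions, measurable with respect to the relevant
  sources without exceptional sets; almost surely nothing has changed.\<close>

definition pts :: "label \<Rightarrow> 'w \<Rightarrow> (real \<times> conf) set" where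
  "pts u \<omega> = (if \<omega> \<in> good_noise u then P u \<omega> \<inter> space intens else default_points)"

lemma default_mark: "(SOME x. x \<in> space \<Theta> \<and> good_mark x) \<in> space \<Theta>" "good_mark (SOME x. x \<in> space \<Theta> \<and> good_mark x)"
  using someI_ex[of "\<lambda>x. x \<in> space \<Theta> \<and> good_mark x"] ex_good_mark by auto

lemma pts_subset: "pts u \<omega> \<subseteq> space intens"
  using default_mark by (auto simp: pts_def default_points_def space_intens)

lemma pts_space: "p \<in> pts u \<omega> \<Longrightarrow> 0 \<le> fst p \<and> snd p \<in> space \<Theta>"
  using pts_subset[of u \<omega>] by (auto simp: space_intens)

lemma point_count_0_iff: "point_count S B = 0 \<longleftrightarrow> S \<inter> B = {}"
  unfolding point_count_def by (simp add: emeasure_count_space_eq_0)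

lemma point_count_finite_iff: "point_count S B < \<infinity> \<longleftrightarrow> finite (S \<inter> B)"
  unfolding point_count_def by (cases "finite (S \<inter> B)") (auto simp: of_nat_less_top)

lemma point_count_finite: "finite (S \<inter> B) \<Longrightarrow> point_count S B = of_nat (card (S \<inter> B))"
  unfolding point_count_def by simp

lemma pts_good_mark: "p \<in> pts u \<omega> \<Longrightarrow> good_mark (snd p)"
proof -
  assume p: "p \<in> pts u \<omega>"
  show ?thesis
  proof (cases "\<omega> \<in> good_noise u")
    case True
    then have "P u \<omega> \<inter> bad_points = {}" by (simp add: good_noise_def point_count_0_iff)
    then show ?thesis using p True by (auto simp: pts_def bad_points_def space_intens)
  next
    case False
    then show ?thesis using p default_mark by (auto simp: pts_def default_points_def)
  qed
qed

lemma regular_pts: "regular (pts u \<omega>)"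
proof (cases "\<omega> \<in> good_noise u")
  case True
  let ?S = "P u \<omega> \<inter> space intens"
  have fin: "finite {p \<in> ?S. fst p < t}" for t
  proof -
    obtain n :: nat where n: "t < real n" using reals_Archimedean2 by blast
    have "finite (P u \<omega> \<inter> strip 0 (real n))" using True by (simp add: good_noise_def point_count_finite_iff[symmetric])
    then show ?thesis by (rule finite_subset[rotated]) (use n in \<open>auto simp: strip_def space_intens\<close>)
  qed
  have inf: "infinite ?S" using True point_count_finite_iff[of "P u \<omega>" "space intens"] by (auto simp: good_noise_def)
  have "inj_on fst ?S"
  proof (rule inj_onI)
    fix p q assume p: "p \<in> ?S" and q: "q \<in> ?S" and eq: "fst p = fst q"
    obtain n :: nat where n: "fst p < real n" using reals_Archimedean2 by blast
    obtain m where m: "\<forall>i<n * Suc m. point_count (P u \<omega>) (strip (real i / real (Suc m)) (real (Suc i) / real (Suc m))) < 2"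
      using True unfolding good_noise_def by blast
    \<comment> \<open>Two points with the same time lie in the same cell of the grid, which holds at
      most one point.\<close>
    define i where "i = nat \<lfloor>fst p * real (Suc m)\<rfloor>"
    have p0: "0 \<le> fst p" using p by (auto simp: space_intens)
    have "0 \<le> fst p * real (Suc m)" using p0 by simp
    then have i: "real i \<le> fst p * real (Suc m)" "fst p * real (Suc m) < real i + 1"
      unfolding i_def by linarith+
    have "real i < real n * real (Suc m)"
      using i(1) n mult_strict_right_mono[of "fst p" "real n" "real (Suc m)"] by linarith
    then have "i < n * Suc m" by (metis of_nat_less_iff of_nat_mult)
    then have lt: "point_count (P u \<omega>) (strip (real i / real (Suc m)) (real (Suc i) / real (Suc m))) < 2" using m by blast
    let ?B = "P u \<omega> \<inter> strip (real i / real (Suc m)) (real (Suc i) / real (Suc m))"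
    have in_strip: "p \<in> ?B" "q \<in> ?B"
      using p q eq i by (auto simp: strip_def space_intens mem_Times_iff field_simps simp del: of_nat_Suc)
    have "finite ?B" using lt point_count_finite_iff by (metis infinity_ennreal_def order_less_trans ennreal_numeral_less_top)
    then have "card ?B < 2" using lt point_count_finite by (metis of_nat_less_iff of_nat_numeral)
    then show "p = q" using in_strip \<open>finite ?B\<close>
      by (metis One_nat_def card_le_Suc0_iff_eq less_2_cases_iff less_or_eq_imp_le zero_le)
  qed
  then show ?thesis using True fin inf by (simp add: regular_def pts_def)
next
  case False
  have "finite {p \<in> default_points. fst p < t}" for t
  proof -
    obtain n :: nat where n: "t < real n" using reals_Archimedean2 by blast
    have "{p \<in> default_points. fst p < t} \<subseteq> (\<lambda>n::nat. (real n + 1, SOME x. x \<in> space \<Theta> \<and> good_mark x)) ` {..<n}"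
      using n by (auto simp: default_points_def)
    then show ?thesis using finite_subset by blast
  qed
  moreover have "inj_on fst default_points" by (auto simp: default_points_def inj_on_def)
  moreover have "infinite default_points"
    unfolding default_points_def by (intro range_inj_infinite) (auto simp: inj_def)
  ultimately show ?thesis using False by (simp add: regular_def pts_def)
qed

lemma measurable_pts [measurable (raw)]:
  assumes "B \<in> sets intens" "Inr u \<in> I"
  shows "(\<lambda>\<omega>. point_count (pts u \<omega>) B) \<in> borel_measurable (noise I)"
proof -
  have B: "space intens \<inter> B = B" using sets.sets_into_space[OF assms(1)] by auto
  have g: "good_noise u \<in> sets (noise I)" using good_noise_sets noise_mono[of "{Inr u}" I] assms by auto
  have eq: "point_count (pts u \<omega>) B = (if \<omega> \<in> good_noise u then point_count (P u \<omega>) B else point_count default_points B)" for \<omega>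
    using B by (auto simp: pts_def point_count_def Int_assoc)
  show ?thesis unfolding eq
    using measurable_P[OF assms] g sets.sets_into_space[OF g]
    by (intro measurable_If_set) (auto simp: Int_absorb2)
qed

lemma AE_good_noise: "AE \<omega> in M. \<omega> \<in> good_noise u"
proof -
  have pm [measurable]: "(\<lambda>\<omega>. point_count (P u \<omega>) B) \<in> borel_measurable M" if "B \<in> sets intens" for B
    using that poisson[of u] by (auto simp: poisson_process_def)
  have law: "emeasure intens B < \<infinity> \<Longrightarrow> measure M {\<omega> \<in> space M. point_count (P u \<omega>) B = of_nat k} =
           exp (- measure intens B) * measure intens B ^ k / fact k" if "B \<in> sets intens" for B k
    using that poisson[of u] by (auto simp: poisson_process_def)
  have s: "0 \<le> s \<Longrightarrow> s \<le> t \<Longrightarrow> emeasure intens (strip s t) = ennreal ((t - s) * measure \<Theta> (space \<Theta>))" for s t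
    unfolding strip_def by (simp add: emeasure_strip mark.emeasure_eq_measure ennreal_mult)
  have sf: "0 \<le> s \<Longrightarrow> emeasure intens (strip s t) < \<infinity>" for s t
    unfolding strip_def by (intro emeasure_strip_finite) auto
  have 1: "AE \<omega> in M. \<forall>n::nat. point_count (P u \<omega>) (strip 0 (real n)) < \<infinity>"
    unfolding AE_all_countable
  proof
    fix n :: nat
    have "(\<integral>\<^sup>+\<omega>. point_count (P u \<omega>) (strip 0 (real n)) \<partial>M) \<noteq> \<infinity>"
      using poisson_process_mean[OF poisson strip_in_sets[OF order_refl], of u "real n"] sf[of 0 "real n"] by simp
    then have "AE \<omega> in M. point_count (P u \<omega>) (strip 0 (real n)) \<noteq> \<infinity>"
      by (intro nn_integral_noteq_infinite pm strip_in_sets) auto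
    then show "AE \<omega> in M. point_count (P u \<omega>) (strip 0 (real n)) < \<infinity>" by (simp add: less_top)
  qed
  have 2: "AE \<omega> in M. \<forall>n. \<exists>m. \<forall>i<n * Suc m. point_count (P u \<omega>) (strip (real i / real (Suc m)) (real (Suc i) / real (Suc m))) < 2"
    unfolding AE_all_countable
  proof
    fix n
    let ?st = "\<lambda>m i. strip (real i / real (Suc m)) (real (Suc i) / real (Suc m))"
    let ?B = "\<lambda>m. {\<omega> \<in> space M. \<exists>i<n * Suc m. \<not> point_count (P u \<omega>) (?st m i) < 2}"
    define r where "r = measure \<Theta> (space \<Theta>)"
    have st [measurable]: "?st m i \<in> sets intens" for m i by (auto intro!: strip_in_sets)
    have B: "?B m \<in> sets M" for m by measurable
    have Bi: "{\<omega> \<in> space M. 2 \<le> point_count (P u \<omega>) (?st m i)} \<in> sets M" for m i by measurable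
    \<comment> \<open>Union bound over n (m + 1) cells, each holding two points with probability at
      most the square of r / (m + 1); the total is of order 1 / (m + 1).\<close>
    have em: "emeasure M (?B m) \<le> ennreal (real n * r\<^sup>2 / real (Suc m))" for m
    proof -
      have "?B m = (\<Union>i<n * Suc m. {\<omega> \<in> space M. 2 \<le> point_count (P u \<omega>) (?st m i)})" by (auto simp: not_less)
      also have "emeasure M \<dots> \<le> (\<Sum>i<n * Suc m. emeasure M {\<omega> \<in> space M. 2 \<le> point_count (P u \<omega>) (?st m i)})"
        by (intro emeasure_subadditive_finite) (use Bi in blast)+
      also have "\<dots> \<le> (\<Sum>i<n * Suc m. ennreal ((r / real (Suc m))\<^sup>2))"
      proof (rule sum_mono)
        fix i
        have "emeasure intens (?st m i) = ennreal (r / real (Suc m))"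
          by (subst s) (auto simp: r_def field_simps divide_right_mono simp del: of_nat_Suc, simp add: field_simps)
        then have "measure intens (?st m i) = r / real (Suc m)" by (simp add: measure_def r_def)
        then show "emeasure M {\<omega> \<in> space M. 2 \<le> point_count (P u \<omega>) (?st m i)} \<le> ennreal ((r / real (Suc m))\<^sup>2)"
          using poisson_ge_two[OF pm[OF st] measure_nonneg law[OF st], of i m] sf by simp
      qed
      also have "\<dots> = ennreal (\<Sum>i<n * Suc m. (r / real (Suc m))\<^sup>2)" by (intro sum_ennreal) auto
      also have "(\<Sum>i<n * Suc m. (r / real (Suc m))\<^sup>2) = real n * r\<^sup>2 / real (Suc m)"
        by (simp only: sum_constant card_lessThan of_nat_mult) (simp add: power2_eq_square field_simps del: of_nat_Suc)
      finally show ?thesis .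
    qed
    have "emeasure M (\<Inter>m. ?B m) \<le> 0"
    proof (rule LIMSEQ_le_const)
      have "(\<lambda>m. real n * r\<^sup>2 / real (Suc m)) \<longlonglongrightarrow> 0"
        by (rule LIMSEQ_Suc[OF lim_const_over_n])
      then have "(\<lambda>m. ennreal (real n * r\<^sup>2 / real (Suc m))) \<longlonglongrightarrow> ennreal 0" by (rule tendsto_ennrealI)
      then show "(\<lambda>m. ennreal (real n * r\<^sup>2 / real (Suc m))) \<longlonglongrightarrow> 0" by (simp only: ennreal_0)
      show "\<exists>N. \<forall>m\<ge>N. emeasure M (\<Inter>m. ?B m) \<le> ennreal (real n * r\<^sup>2 / real (Suc m))"
      proof (intro exI allI impI)
        fix m
        have "emeasure M (\<Inter>m. ?B m) \<le> emeasure M (?B m)" 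
          by (rule emeasure_mono[OF _ B]) (rule INF_lower, simp)
        then show "emeasure M (\<Inter>m. ?B m) \<le> ennreal (real n * r\<^sup>2 / real (Suc m))" by (rule order_trans[OF _ em])
      qed
    qed
    then have "(\<Inter>m. ?B m) \<in> null_sets M" using B by (intro null_setsI sets.countable_INT) (auto simp only: le_zero_eq)
    then show "AE \<omega> in M. \<exists>m. \<forall>i<n * Suc m. point_count (P u \<omega>) (?st m i) < 2"
      by (rule AE_I') auto
  qed
  have 3: "AE \<omega> in M. point_count (P u \<omega>) (space intens) = \<infinity>"
  proof -
    have "emeasure (restrict_space lborel {0..}) {0::real..} = \<infinity>"
    proof (rule ccontr)
      assume "emeasure (restrict_space lborel {0..}) {0::real..} \<noteq> \<infinity>"
      then have fin: "emeasure lborel {0::real..} < \<infinity>" by (simp add: emeasure_restrict_space less_top)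
      obtain n :: nat where "enn2real (emeasure lborel {0::real..}) < real n" using reals_Archimedean2 by blast
      then have "emeasure lborel {0::real..} < ennreal (real n)"
        using fin by (cases "emeasure lborel {0::real..}") (auto simp: ennreal_less_iff)
      moreover have "emeasure lborel {0::real..real n} \<le> emeasure lborel {0::real..}" by (intro emeasure_mono) auto
      ultimately show False by simp
    qed
    moreover have "{0..} \<in> sets (restrict_space lborel {0::real..})"
      using sets.top[of "restrict_space lborel {0::real..}"] by (simp add: space_restrict_space)
    ultimately have "emeasure intens (space intens) = \<infinity>"
      using mark_pos mark.emeasure_pair_measure_Times[of "{0..}" "restrict_space lborel {0::real..}" "space \<Theta>"]
      by (auto simp: space_intens ennreal_top_mult)
    then show ?thesis using poisson[of u] by (auto simp: poisson_process_def)
  qed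
  have 4: "AE \<omega> in M. point_count (P u \<omega>) bad_points = 0"
  proof -
    have "{x \<in> space \<Theta>. \<not> good_mark x} \<in> null_sets \<Theta>"
      using AE_good_mark good_mark_sets by (subst AE_iff_null[symmetric]) auto
    then have "emeasure \<Theta> {x \<in> space \<Theta>. \<not> good_mark x} = 0" "{x \<in> space \<Theta>. \<not> good_mark x} \<in> sets \<Theta>" by auto
    then have "emeasure intens bad_points = 0"
      unfolding bad_points_def
      by (subst mark.emeasure_pair_measure_Times) (auto simp: sets_restrict_space)
    then have "(\<integral>\<^sup>+\<omega>. point_count (P u \<omega>) bad_points \<partial>M) = 0"
      using poisson_process_mean[OF poisson bad_points_sets] by simp
    then show ?thesis
      using pm[OF bad_points_sets] by (subst (asm) nn_integral_0_iff_AE) auto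
  qed
  show ?thesis
    using 1 2 3 4 AE_space by eventually_elim (simp add: good_noise_def)
qed

lemma AE_pts: "AE \<omega> in M. \<forall>u. pts u \<omega> = P u \<omega>"
  unfolding AE_all_countable
proof
  fix u
  have "AE \<omega> in M. P u \<omega> \<subseteq> space intens" using poisson[of u] by (auto simp: poisson_process_def)
  then show "AE \<omega> in M. pts u \<omega> = P u \<omega>"
    using AE_good_noise[of u] by eventually_elim (auto simp: pts_def)
qed

end

section \<open>Points after a random time\<close>

lemma finite_less_rat:
  assumes "finite A" "\<And>x. x \<in> A \<Longrightarrow> x < (b::real)"
  shows "\<exists>q::rat. of_rat q < b \<and> (\<forall>x\<in>A. x < of_rat q)"
proof (cases "A = {}")
  case True
  then show ?thesis using of_rat_dense[of "b - 1" b] by auto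
next
  case False
  then have "Max A < b" using assms by simp
  then obtain q where "Max A < of_rat q" "of_rat q < b" using of_rat_dense by blast
  then show ?thesis using assms(1) by (intro exI[of _ q]) (auto intro: le_less_trans[OF Max_ge])
qed

context branching_noise
begin

lemma upper_strip_sets: "(({s..} \<inter> {0..}) \<times> space \<Theta>) \<in> sets intens"
proof (intro pair_measureI)
  have "{0..} \<inter> {s..} \<in> sets (restrict_space lborel {0..})"
    unfolding sets_restrict_space by (rule imageI) simp
  then show "{s..} \<inter> {0..} \<in> sets (restrict_space lborel {0..})" by (simp only: Int_commute)
qed simp

text \<open>A random starting time b is approached by rationals q <= b: counting from q counts at
  least as many points, and since the strip holds finitely many points, some rational below b is
  later than all points before b and gives equality. The count is thus an infimum of countably many
  measurable functions.\<close>

lemma measurable_count_from: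
  assumes b: "b \<in> borel_measurable (noise I)" and u: "Inr u \<in> I" and D: "D \<in> sets intens" and s: "0 \<le> s"
  shows "(\<lambda>\<omega>. point_count (points_from (b \<omega>) (pts u \<omega>)) (strip s t \<inter> D)) \<in> borel_measurable (noise I)"
proof -
  let ?D = "strip s t \<inter> D"
  let ?E = "\<lambda>q::rat. ?D \<inter> (({of_rat q..} \<inter> {0..}) \<times> space \<Theta>)"
  have E: "?E q \<in> sets intens" for q using D s upper_strip_sets strip_in_sets by blast
  have "point_count (points_from (b \<omega>) (pts u \<omega>)) ?D =
      (INF q::rat. if of_rat q \<le> b \<omega> then point_count (pts u \<omega>) (?E q) else \<infinity>)" (is "?l = ?r") for \<omega>
  proof (rule antisym)
    show "?l \<le> ?r"
    proof (rule INF_greatest)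
      fix q :: rat
      show "?l \<le> (if of_rat q \<le> b \<omega> then point_count (pts u \<omega>) (?E q) else \<infinity>)"
        using pts_subset[of u \<omega>] unfolding point_count_def
        by (auto intro!: emeasure_mono simp: points_from_def strip_def space_intens)
    qed
    have "finite (pts u \<omega> \<inter> ?D)"
      by (rule finite_subset[of _ "{p \<in> pts u \<omega>. fst p < t}"])
         (use regular_pts[of u \<omega>] in \<open>auto simp: regular_def strip_def\<close>)
    then have fin: "finite (fst ` {p \<in> pts u \<omega> \<inter> ?D. fst p < b \<omega>})" by (intro finite_imageI finite_subset[OF _ \<open>finite (pts u \<omega> \<inter> ?D)\<close>]) blast
    have lt: "x < b \<omega>" if "x \<in> fst ` {p \<in> pts u \<omega> \<inter> ?D. fst p < b \<omega>}" for x using that by blast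
    obtain q :: rat where q: "of_rat q < b \<omega>" "\<forall>x\<in>fst ` {p \<in> pts u \<omega> \<inter> ?D. fst p < b \<omega>}. x < of_rat q"
      using finite_less_rat[OF fin lt] by blast
    have "?r \<le> (if of_rat q \<le> b \<omega> then point_count (pts u \<omega>) (?E q) else \<infinity>)" by (rule INF_lower) simp
    also have "\<dots> = point_count (pts u \<omega>) (?E q)" using q by simp
    also have "\<dots> \<le> ?l"
      unfolding point_count_def
    proof (rule emeasure_mono)
      show "pts u \<omega> \<inter> ?E q \<subseteq> points_from (b \<omega>) (pts u \<omega>) \<inter> ?D"
      proof
        fix p assume p: "p \<in> pts u \<omega> \<inter> ?E q"
        then have "of_rat q \<le> fst p" by auto
        have "\<not> fst p < b \<omega>"
        proof
          assume "fst p < b \<omega>"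
          then have "fst p < of_rat q" using p by (intro q(2)[rule_format] imageI) blast
          then show False using \<open>of_rat q \<le> fst p\<close> by simp
        qed
        then show "p \<in> points_from (b \<omega>) (pts u \<omega>) \<inter> ?D" using p by (auto simp: points_from_def)
      qed
    qed simp
    finally show "?r \<le> ?l" .
  qed
  moreover have "(\<lambda>\<omega>. if of_rat q \<le> b \<omega> then point_count (pts u \<omega>) (?E q) else \<infinity>) \<in> borel_measurable (noise I)" for q
  proof (rule measurable_If)
    show "{\<omega> \<in> space (noise I). of_rat q \<le> b \<omega>} \<in> sets (noise I)" using b by measurable
  qed (use measurable_pts[OF E u, of q] in simp_all)
  ultimately show ?thesis by (simp only:) (intro borel_measurable_INF, simp_all)
qed

text \<open>Membership of the point number k (from 0) is expressed through counts with rational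
  bounds: k points before q, a single point from q up to q', and that point in C. Such bounds exist
  because the points are isolated in time. \<open>max 0\<close> keeps the strips inside the
  half-line where the intensity lives.\<close>

lemma nth_point_mem_iff:
  assumes S: "regular S" "S \<subseteq> space intens" and C: "C \<subseteq> space intens"
  shows "nth_point S k \<in> C \<longleftrightarrow> (\<exists>q q'::rat. point_count S (strip 0 (of_rat q)) = of_nat k \<and>
    point_count S (strip (max 0 (of_rat q)) (of_rat q')) = 1 \<and> point_count S (strip (max 0 (of_rat q)) (of_rat q') \<inter> C) = 1)"
    (is "_ \<longleftrightarrow> (\<exists>q q'. ?Q q q')")
proof
  have fin: "finite {p \<in> S. fst p < t}" for t using S by (auto simp: regular_def)
  have fin': "finite (S \<inter> strip s t)" for s t by (rule finite_subset[OF _ fin[of t]]) (auto simp: strip_def)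
  have S0: "0 \<le> fst p" "snd p \<in> space \<Theta>" if "p \<in> S" for p using S that by (auto simp: space_intens)
  define p where "p = nth_point S k"
  have pS: "p \<in> S" using nth_point_in[OF S(1)] by (simp add: p_def)
  have card1: "\<exists>q. A = {q}" if "point_count S A' = 1" "A = S \<inter> A'" "finite A" for A A'
    using that by (auto simp: point_count_finite card_1_singleton_iff)
  {
    assume pC: "nth_point S k \<in> C"
    obtain q :: rat where q: "of_rat q < fst p" "\<forall>x\<in>fst ` {r \<in> S. fst r < fst p}. x < of_rat q"
    proof -
      have "finite (fst ` {r \<in> S. fst r < fst p})" using fin by blast
      moreover have "x < fst p" if "x \<in> fst ` {r \<in> S. fst r < fst p}" for x using that by blast
      ultimately show ?thesis using finite_less_rat[of "fst ` {r \<in> S. fst r < fst p}" "fst p"] that by blast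
    qed
    define T' where "T' = fst (nth_point S (Suc k))"
    have T': "fst p < T'" unfolding p_def T'_def using nth_point_strict_mono[OF S(1)] by simp
    then obtain q' :: rat where q': "fst p < of_rat q'" "of_rat q' < T'" using of_rat_dense by blast
    have q_le: "max 0 (of_rat q) \<le> fst p" using q(1) S0(1)[OF pS] by auto
    have ge: "T' \<le> fst r" if "r \<in> S" "fst p < fst r" for r
    proof (rule ccontr)
      assume "\<not> T' \<le> fst r"
      then have "rank S r < rank S (nth_point S (Suc k))"
        using rank_strict_mono[OF S(1) that(1)] by (simp add: T'_def)
      moreover have "rank S p < rank S r" using rank_strict_mono[OF S(1) pS that(2)] .
      ultimately show False by (simp add: rank_nth_point[OF S(1)] p_def)
    qed
    have eq1: "S \<inter> strip 0 (of_rat q) = {r \<in> S. fst r < fst p}"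
      using q q_le S0 by (auto simp: strip_def mem_Times_iff)
    have eq2: "S \<inter> strip (max 0 (of_rat q)) (of_rat q') = {p}"
    proof (intro equalityI subsetI)
      fix r assume r: "r \<in> S \<inter> strip (max 0 (of_rat q)) (of_rat q')"
      then have rq: "r \<in> S" "of_rat q \<le> fst r" "fst r < of_rat q'" by (auto simp: strip_def mem_Times_iff)
      have "\<not> fst r < fst p"
      proof
        assume "fst r < fst p"
        then have "fst r < of_rat q" using rq(1) by (intro q(2)[rule_format] imageI) blast
        then show False using rq by simp
      qed
      moreover have "\<not> fst p < fst r"
      proof
        assume "fst p < fst r"
        then have "T' \<le> fst r" by (rule ge[OF rq(1)])
        then show False using rq q' by simp
      qed
      ultimately have "fst r = fst p" by simp
      then show "r \<in> {p}" using rq pS S(1) by (auto simp: regular_def dest: inj_onD)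
    qed (use pS q_le q' S0[OF pS] in \<open>auto simp: strip_def mem_Times_iff\<close>)
    have eq3: "S \<inter> (strip (max 0 (of_rat q)) (of_rat q') \<inter> C) = {p}" using eq2 pC unfolding p_def by blast
    have "?Q q q'"
      using fin[of "fst p"] rank_nth_point[OF S(1), of k]
      by (simp add: point_count_finite eq1 eq2 eq3 p_def rank_def)
    then show "\<exists>q q'. ?Q q q'" by blast
  }
  {
    assume "\<exists>q q'. ?Q q q'"
    then obtain q q' where Q: "point_count S (strip 0 (of_rat q)) = of_nat k"
      and Q2: "point_count S (strip (max 0 (of_rat q)) (of_rat q')) = 1"
      and Q3: "point_count S (strip (max 0 (of_rat q)) (of_rat q') \<inter> C) = 1" by (elim exE conjE)
    obtain r where r: "S \<inter> strip (max 0 (of_rat q)) (of_rat q') = {r}"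
      using card1[OF Q2 refl fin'] by (rule exE)
    have "finite (S \<inter> (strip (max 0 (of_rat q)) (of_rat q') \<inter> C))" using fin' by (rule finite_subset[rotated]) blast
    then obtain r' where r': "S \<inter> (strip (max 0 (of_rat q)) (of_rat q') \<inter> C) = {r'}"
      using card1[OF Q3 refl] by blast
    have rC: "r \<in> C" "r \<in> S" using r r' by auto
    have rr: "max 0 (of_rat q) \<le> fst r" "fst r < of_rat q'" 
    proof -
      have "r \<in> strip (max 0 (of_rat q)) (of_rat q')" using r by blast
      then show "max 0 (of_rat q) \<le> fst r" "fst r < of_rat q'" by (auto simp: strip_def mem_Times_iff)
    qed
    have "{s \<in> S. fst s < fst r} = S \<inter> strip 0 (of_rat q)"
    proof (intro equalityI subsetI)
      fix s assume s: "s \<in> {s \<in> S. fst s < fst r}"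
      have "fst s < of_rat q"
      proof (rule ccontr)
        assume "\<not> fst s < of_rat q"
        then have "s \<in> S \<inter> strip (max 0 (of_rat q)) (of_rat q')"
          using s rr S0[of s] by (auto simp: strip_def mem_Times_iff)
        then have "s = r" using r by blast
        then show False using s by simp
      qed
      then show "s \<in> S \<inter> strip 0 (of_rat q)" using s S0[of s] by (auto simp: strip_def mem_Times_iff)
    qed (use rr in \<open>auto simp: strip_def mem_Times_iff\<close>)
    then have "rank S r = k" using Q fin'[of 0 "of_rat q"] by (simp add: rank_def point_count_finite)
    then show "nth_point S k \<in> C" using nth_point_eqI[OF S(1) rC(2)] rC(1) by simp
  }
qed

lemma measurable_nth_point:
  assumes b: "b \<in> borel_measurable (noise I)" and u: "Inr u \<in> I"
  shows "(\<lambda>\<omega>. nth_point (points_from (b \<omega>) (pts u \<omega>)) k) \<in> measurable (noise I) intens"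
proof (rule measurableI)
  have reg: "regular (points_from (b \<omega>) (pts u \<omega>))" "points_from (b \<omega>) (pts u \<omega>) \<subseteq> space intens" for \<omega>
    using regular_pts regular_points_from pts_subset[of u \<omega>] by (auto simp: points_from_def)
  show "nth_point (points_from (b \<omega>) (pts u \<omega>)) k \<in> space intens" for \<omega>
    using nth_point_in[OF reg(1)] reg(2) by blast
  fix C assume C: "C \<in> sets intens"
  let ?c = "\<lambda>D \<omega>. point_count (points_from (b \<omega>) (pts u \<omega>)) D"
  have [measurable]: "?c (strip s t \<inter> D) \<in> borel_measurable (noise I)" if "D \<in> sets intens" "0 \<le> s" for s t D
    by (rule measurable_count_from[OF b u that])
  have strip_eq: "strip s t = strip s t \<inter> space intens" if "0 \<le> s" for s t using that by (auto simp: strip_def space_intens)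
  have [measurable]: "?c (strip s t) \<in> borel_measurable (noise I)" if "0 \<le> s" for s t
    using measurable_count_from[OF b u sets.top that, of t] strip_eq[OF that, of t] by simp
  have "(\<lambda>\<omega>. nth_point (points_from (b \<omega>) (pts u \<omega>)) k) -` C \<inter> space (noise I) = {\<omega> \<in> space (noise I).
      (\<exists>q q'::rat. ?c (strip 0 (of_rat q)) \<omega> = of_nat k \<and>
    ?c (strip (max 0 (of_rat q)) (of_rat q')) \<omega> = 1 \<and> ?c (strip (max 0 (of_rat q)) (of_rat q') \<inter> C) \<omega> = 1)}"
    unfolding vimage_def Int_def mem_Collect_eq nth_point_mem_iff[OF reg sets.sets_into_space[OF C]]
    by (rule Collect_cong) (rule conj_commute)
  also have "\<dots> \<in> sets (noise I)"
  proof -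
    have m1: "?c (strip 0 (of_rat q)) \<in> borel_measurable (noise I)"
        "?c (strip (max 0 (of_rat q)) (of_rat q')) \<in> borel_measurable (noise I)"
        "?c (strip (max 0 (of_rat q)) (of_rat q') \<inter> C) \<in> borel_measurable (noise I)" for q q' :: rat
      using C by measurable
    show ?thesis using m1 by measurable
  qed
  finally show "(\<lambda>\<omega>. nth_point (points_from (b \<omega>) (pts u \<omega>)) k) -` C \<inter> space (noise I) \<in> sets (noise I)" .
qed

section \<open>Birth times, branchings and birth positions of labels\<close>

definition bt :: "label \<Rightarrow> 'w \<Rightarrow> real" where
  "bt u \<omega> = birth (\<lambda>v. pts v \<omega>) u"

definition br :: "label \<Rightarrow> nat \<Rightarrow> 'w \<Rightarrow> real \<times> conf" where
  "br u k \<omega> = nth_point (points_from (bt u \<omega>) (pts u \<omega>)) k"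

text \<open>Sources of all labels of generation below n. This contains more than the ancestors of a
  given label of length n, but it is disjoint from the sources of every label of length n, which is
  what independence requires.\<close>

definition past :: "nat \<Rightarrow> (label + label) set" where
  "past n = {i. length (case_sum id id i) < n}"

text \<open>A supremum over rational times, so that it is measurable even at a random time r and
  requires no regularity of the path; on nondecreasing paths it is the left limit.\<close>

definition left_limit :: "label \<Rightarrow> real \<Rightarrow> 'w \<Rightarrow> ennreal" where
  "left_limit u r \<omega> = (SUP q::rat. if 0 \<le> q \<and> of_rat q < r then ennreal (\<xi> u (of_rat q) \<omega>) else 0)"

text \<open>Birth position, with the value \<infinity> for a label that is not a particle, so that
  sums over particles become sums over all labels. A birth displacement of at least c along the
  ancestral line also gives \<infinity>: c = \<infinity> describes the level itself, and c = x is
  used when only particles below x matter.\<close>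

fun bp :: "ennreal \<Rightarrow> label \<Rightarrow> 'w \<Rightarrow> ennreal" where
  "bp c [] \<omega> = 0"
| "bp c ((k, i) # u) \<omega> = bp c u \<omega> + left_limit u (fst (br u k \<omega>) - bt u \<omega>) \<omega> +
     (if 1 \<le> i \<and> snd (br u k \<omega>) i < c then snd (br u k \<omega>) i else \<infinity>)"

lemma branching_eq: "branching (\<lambda>v. pts v \<omega>) u k = br u k \<omega>"
  by (simp add: branching_def br_def points_from_def bt_def)

lemma bt_Nil [simp]: "bt [] \<omega> = 0"
  by (simp add: bt_def)

lemma bt_Cons [simp]: "bt ((k, i) # u) \<omega> = fst (br u k \<omega>)"
  by (simp add: bt_def branching_eq[symmetric] branching_def)

lemma regular_from: "regular (points_from (bt u \<omega>) (pts u \<omega>))"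
  by (intro regular_points_from regular_pts)

lemma br_in: "br u k \<omega> \<in> pts u \<omega>" and br_ge: "bt u \<omega> \<le> fst (br u k \<omega>)"
  using nth_point_in[OF regular_from, of u \<omega> k] by (auto simp: br_def points_from_def)

lemma bt_nonneg: "0 \<le> bt u \<omega>"
proof (cases u)
  case (Cons e v)
  then show ?thesis using pts_space[OF br_in] by (cases e) auto
qed simp

lemma past_mono: "m \<le> n \<Longrightarrow> past m \<subseteq> past n"
  by (auto simp: past_def)

lemma in_past [simp]: "Inl u \<in> past n \<longleftrightarrow> length u < n" "Inr u \<in> past n \<longleftrightarrow> length u < n"
  by (auto simp: past_def)

lemma measurable_bt: "bt u \<in> borel_measurable (noise (past (length u)))"
  and measurable_br: "past (length u) \<subseteq> I \<Longrightarrow> Inr u \<in> I \<Longrightarrow> br u k \<in> measurable (noise I) intens"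
proof -
  have br: "br u k \<in> measurable (noise I) intens"
    if "bt u \<in> borel_measurable (noise (past (length u)))" "past (length u) \<subseteq> I" "Inr u \<in> I" for u I k
    using measurable_nth_point[OF measurable_noise_mono[OF that(1,2)] that(3), of k] unfolding br_def[abs_def] .
  have "bt u \<in> borel_measurable (noise (past (length u)))" for u
  proof (induction u)
    case Nil
    have "bt [] = (\<lambda>_. 0)" by auto
    then show ?case by simp
  next
    case (Cons e u)
    obtain k i where e: "e = (k, i)" by (cases e)
    have "br u k \<in> measurable (noise (past (length (e # u)))) intens"
      by (rule br[OF Cons past_mono]) simp_all
    then have "(\<lambda>\<omega>. fst (br u k \<omega>)) \<in> measurable (noise (past (length (e # u)))) (restrict_space lborel {0..})"
      by simp
    then have "(\<lambda>\<omega>. fst (br u k \<omega>)) \<in> borel_measurable (noise (past (length (e # u))))"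
      by (simp add: measurable_restrict_space2_iff)
    moreover have "bt (e # u) = (\<lambda>\<omega>. fst (br u k \<omega>))" using e by auto
    ultimately show ?case by simp
  qed
  then show "bt u \<in> borel_measurable (noise (past (length u)))"
    "past (length u) \<subseteq> I \<Longrightarrow> Inr u \<in> I \<Longrightarrow> br u k \<in> measurable (noise I) intens" using br by blast+
qed

lemma measurable_bt': "past (length u) \<subseteq> I \<Longrightarrow> bt u \<in> borel_measurable (noise I)"
  using measurable_noise_mono[OF measurable_bt] .

lemma measurable_time:
  assumes "past (length u) \<subseteq> I" "Inr u \<in> I"
  shows "(\<lambda>\<omega>. fst (br u k \<omega>)) \<in> borel_measurable (noise I)"
proof -
  have "(\<lambda>\<omega>. fst (br u k \<omega>)) \<in> measurable (noise I) (restrict_space lborel {0..})"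
    using measurable_br[OF assms, of k] by simp
  then show ?thesis by (simp add: measurable_restrict_space2_iff)
qed

lemma measurable_mark:
  assumes "past (length u) \<subseteq> I" "Inr u \<in> I"
  shows "(\<lambda>\<omega>. snd (br u k \<omega>)) \<in> measurable (noise I) \<Theta>" "(\<lambda>\<omega>. snd (br u k \<omega>) i) \<in> borel_measurable (noise I)"
proof -
  show "(\<lambda>\<omega>. snd (br u k \<omega>)) \<in> measurable (noise I) \<Theta>" using measurable_br[OF assms, of k] by simp
  then show "(\<lambda>\<omega>. snd (br u k \<omega>) i) \<in> borel_measurable (noise I)"
    using measurable_compose[OF _ mark_coordinate] by blast
qed

lemma measurable_left_limit:
  assumes "r \<in> borel_measurable (noise I)" "Inl u \<in> I"
  shows "(\<lambda>\<omega>. left_limit u (r \<omega>) \<omega>) \<in> borel_measurable (noise I)"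
proof -
  have "(\<lambda>\<omega>. if 0 \<le> q \<and> of_rat q < r \<omega> then ennreal (\<xi> u (of_rat q) \<omega>) else 0) \<in> borel_measurable (noise I)" for q :: rat
  proof (cases "0 \<le> q")
    case True
    then have [measurable]: "\<xi> u (of_rat q) \<in> borel_measurable (noise I)" using assms by (intro measurable_xi) auto
    show ?thesis using assms(1) by measurable
  qed simp
  then show ?thesis unfolding left_limit_def by (intro borel_measurable_SUP) simp_all
qed

lemma measurable_bp: "bp c u \<in> borel_measurable (noise (past (length u)))"
proof (induction u)
  case Nil
  have "bp c [] = (\<lambda>_. 0)" by auto
  then show ?case by simp
next
  case (Cons e u)
  obtain k i where e: "e = (k, i)" by (cases e)
  let ?N = "noise (past (length (e # u)))"
  have sub: "past (length u) \<subseteq> past (length (e # u))" "Inr u \<in> past (length (e # u))" "Inl u \<in> past (length (e # u))"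
    by (simp_all add: past_mono)
  have [measurable]: "bp c u \<in> borel_measurable ?N" using measurable_noise_mono[OF Cons sub(1)] .
  have "(\<lambda>\<omega>. fst (br u k \<omega>) - bt u \<omega>) \<in> borel_measurable ?N"
    using measurable_time[OF sub(1,2)] measurable_bt'[OF sub(1)] by (rule borel_measurable_diff)
  then have [measurable]: "(\<lambda>\<omega>. left_limit u (fst (br u k \<omega>) - bt u \<omega>) \<omega>) \<in> borel_measurable ?N"
    using sub(3) by (rule measurable_left_limit)
  have [measurable]: "(\<lambda>\<omega>. snd (br u k \<omega>) i) \<in> borel_measurable ?N" by (rule measurable_mark[OF sub(1,2)])
  have "bp c (e # u) = (\<lambda>\<omega>. bp c u \<omega> + left_limit u (fst (br u k \<omega>) - bt u \<omega>) \<omega> +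
     (if 1 \<le> i \<and> snd (br u k \<omega>) i < c then snd (br u k \<omega>) i else \<infinity>))"
    unfolding e by (rule ext) simp
  then show ?case by (simp only:) measurable
qed

section \<open>Integrals over the points and at random times\<close>

lemma nn_integral_pts:
  "(\<integral>\<^sup>+\<omega>. g (pts u \<omega>) \<partial>M) = (\<integral>\<^sup>+\<omega>. g (P u \<omega>) \<partial>M)"
proof (rule nn_integral_cong_AE)
  show "AE \<omega> in M. g (pts u \<omega>) = g (P u \<omega>)" using AE_pts by eventually_elim simp
qed

lemma measurable_point_sum_pts:
  "f \<in> borel_measurable intens \<Longrightarrow> Inr u \<in> I \<Longrightarrow> (\<lambda>\<omega>. point_sum (pts u \<omega>) f) \<in> borel_measurable (noise I)"
  by (rule borel_measurable_point_sum[where \<nu> = intens]) (use measurable_pts pts_subset in blast)+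

lemma campbell_pts:
  assumes f: "f \<in> borel_measurable intens"
  shows "(\<integral>\<^sup>+\<omega>. point_sum (pts u \<omega>) f \<partial>M) = (\<integral>\<^sup>+p. f p \<partial>intens)"
proof (rule campbell[OF _ _ f])
  show "(\<lambda>\<omega>. point_count (pts u \<omega>) B) \<in> borel_measurable M" if "B \<in> sets intens" for B
    using measurable_pts[OF that, of u UNIV] measurable_noise_M by blast
  show "(\<integral>\<^sup>+\<omega>. point_count (pts u \<omega>) B \<partial>M) = emeasure intens B" if "B \<in> sets intens" for B
    using poisson_process_mean[OF poisson that, of u] by (simp add: nn_integral_pts[where g = "\<lambda>S. point_count S B"])
qed (rule pts_subset)

text \<open>Random times are replaced by the countably many cells of a grid, so that independence is only
  needed for finitely many deterministic times.\<close>

lemma nn_integral_cells: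
  assumes IJ: "I \<inter> J = {}" and g: "g \<in> borel_measurable (noise I)"
    and N: "N \<in> measurable (noise I) (count_space UNIV)" and f: "\<And>n::nat. f n \<in> borel_measurable (noise J)"
  shows "(\<integral>\<^sup>+\<omega>. g \<omega> * f (N \<omega>) \<omega> \<partial>M) = (\<Sum>n. (\<integral>\<^sup>+\<omega>. g \<omega> * indicator {n} (N \<omega>) \<partial>M) * (\<integral>\<^sup>+\<omega>. f n \<omega> \<partial>M))"
proof -
  have gi [measurable]: "(\<lambda>\<omega>. g \<omega> * indicator {n} (N \<omega>)) \<in> borel_measurable (noise I)" for n
    by (intro borel_measurable_times_ennreal g measurable_compose[OF N]) simp
  have [measurable]: "(\<lambda>\<omega>. g \<omega> * indicator {n} (N \<omega>)) \<in> borel_measurable M" for n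
    by (rule measurable_noise_M[OF gi])
  have [measurable]: "f n \<in> borel_measurable M" for n by (rule measurable_noise_M[OF f])
  have "(\<integral>\<^sup>+\<omega>. g \<omega> * f (N \<omega>) \<omega> \<partial>M) = (\<integral>\<^sup>+\<omega>. (\<Sum>n. (g \<omega> * indicator {n} (N \<omega>)) * f n \<omega>) \<partial>M)"
  proof (rule nn_integral_cong)
    fix \<omega>
    have "(\<Sum>n. (g \<omega> * indicator {n} (N \<omega>)) * f n \<omega>) = (\<Sum>n\<in>{N \<omega>}. (g \<omega> * indicator {n} (N \<omega>)) * f n \<omega>)"
      by (rule suminf_finite) auto
    then show "g \<omega> * f (N \<omega>) \<omega> = (\<Sum>n. (g \<omega> * indicator {n} (N \<omega>)) * f n \<omega>)" by simp
  qed
  also have "\<dots> = (\<Sum>n. \<integral>\<^sup>+\<omega>. (g \<omega> * indicator {n} (N \<omega>)) * f n \<omega> \<partial>M)"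
    by (rule nn_integral_suminf) measurable
  also have "\<dots> = (\<Sum>n. (\<integral>\<^sup>+\<omega>. g \<omega> * indicator {n} (N \<omega>) \<partial>M) * (\<integral>\<^sup>+\<omega>. f n \<omega> \<partial>M))"
    by (simp add: nn_integral_noise_mult[OF IJ gi f])
  finally show ?thesis .
qed

lemma nn_integral_split_cells:
  assumes g: "g \<in> borel_measurable M" and N: "N \<in> measurable M (count_space (UNIV :: nat set))"
  shows "(\<Sum>n. \<integral>\<^sup>+\<omega>. g \<omega> * indicator {n} (N \<omega>) \<partial>M) = (\<integral>\<^sup>+\<omega>. g \<omega> \<partial>M)"
proof -
  have [measurable]: "(\<lambda>\<omega>. g \<omega> * indicator {n} (N \<omega>)) \<in> borel_measurable M" for n
    by (intro borel_measurable_times_ennreal g measurable_compose[OF N]) simp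
  have "(\<Sum>n. \<integral>\<^sup>+\<omega>. g \<omega> * indicator {n} (N \<omega>) \<partial>M) = (\<integral>\<^sup>+\<omega>. (\<Sum>n. g \<omega> * indicator {n} (N \<omega>)) \<partial>M)"
    by (rule nn_integral_suminf[symmetric]) measurable
  also have "\<dots> = (\<integral>\<^sup>+\<omega>. g \<omega> \<partial>M)"
  proof (rule nn_integral_cong)
    fix \<omega>
    have "(\<Sum>n. g \<omega> * indicator {n} (N \<omega>)) = (\<Sum>n\<in>{N \<omega>}. g \<omega> * indicator {n} (N \<omega>))"
      by (rule suminf_finite) auto
    then show "(\<Sum>n. g \<omega> * indicator {n} (N \<omega>)) = g \<omega>" by simp
  qed
  finally show ?thesis .
qed

end

definition cell :: "real \<Rightarrow> real \<Rightarrow> nat" where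
  "cell h t = nat \<lfloor>t / h\<rfloor>"

lemma cell_le: "0 < h \<Longrightarrow> 0 \<le> t \<Longrightarrow> real (cell h t) * h \<le> t"
  and cell_gt: "0 < h \<Longrightarrow> 0 \<le> t \<Longrightarrow> t < (real (cell h t) + 1) * h"
proof -
  assume h: "0 < h" and t: "0 \<le> t"
  have "0 \<le> t / h" using h t by simp
  then have "real (cell h t) \<le> t / h" "t / h < real (cell h t) + 1"
    unfolding cell_def by linarith+
  then show "real (cell h t) * h \<le> t" "t < (real (cell h t) + 1) * h"
    using h by (simp_all add: field_simps)
qed

lemma cell_mono: "0 < h \<Longrightarrow> s \<le> t \<Longrightarrow> cell h s \<le> cell h t"
  unfolding cell_def by (intro nat_mono floor_mono divide_right_mono) auto

lemma measurable_cell [measurable]: "cell h \<in> measurable borel (count_space UNIV)"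
  unfolding cell_def by measurable

context branching_noise
begin

lemma measurable_cell_bt: "past (length u) \<subseteq> I \<Longrightarrow> (\<lambda>\<omega>. cell h (bt u \<omega>)) \<in> measurable (noise I) (count_space UNIV)"
  by (rule measurable_compose[OF measurable_bt' measurable_cell])

text \<open>Excludes a branching at the very time of birth, where the position before the branching
  could not be read off the particle's own path. The cell of mesh h around the birth time is
  determined by earlier generations, hence independent of the points of u, and contains r h of them
  on average; this tends to 0, while a point at the birth time would lie in every such cell.\<close>

lemma AE_bt_less: "AE \<omega> in M. \<forall>u k. bt u \<omega> < fst (br u k \<omega>)"
  unfolding AE_all_countable
proof (intro allI)
  fix u k
  define r where "r = measure \<Theta> (space \<Theta>)"
  define h where "h = (\<lambda>m. 1 / real (Suc m))"
  have h: "0 < h m" for m by (simp add: h_def)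
  let ?st = "\<lambda>m n. strip (real n * h m) ((real n + 1) * h m)"
  define X where "X = (\<lambda>m \<omega>. point_count (pts u \<omega>) (?st m (cell (h m) (bt u \<omega>))))"
  have st: "?st m n \<in> sets intens" for m n using h[of m] by (intro strip_in_sets) simp
  have em: "emeasure intens (?st m n) = ennreal (r * h m)" for m n
  proof -
    have "emeasure intens (?st m n) = ennreal ((real n + 1) * h m - real n * h m) * emeasure \<Theta> (space \<Theta>)"
      unfolding strip_def using h[of m] by (intro emeasure_strip) (auto intro!: mult_right_mono)
    also have "(real n + 1) * h m - real n * h m = h m" by (simp add: algebra_simps)
    finally show ?thesis using h[of m] by (simp add: mark.emeasure_eq_measure r_def ennreal_mult mult.commute)
  qed
  have Npast: "(\<lambda>\<omega>. cell (h m) (bt u \<omega>)) \<in> measurable (noise (past (length u))) (count_space UNIV)" for m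
    by (rule measurable_cell_bt) simp
  have cnt: "(\<lambda>\<omega>. point_count (pts u \<omega>) (?st m n)) \<in> borel_measurable (noise {Inr u})" for m n
    by (rule measurable_pts[OF st]) simp
  have X_eq: "X m \<omega> = (\<Sum>n. indicator {n} (cell (h m) (bt u \<omega>)) * point_count (pts u \<omega>) (?st m n))" for m \<omega>
  proof -
    have "(\<Sum>n. indicator {n} (cell (h m) (bt u \<omega>)) * point_count (pts u \<omega>) (?st m n)) =
      (\<Sum>n\<in>{cell (h m) (bt u \<omega>)}. indicator {n} (cell (h m) (bt u \<omega>)) * point_count (pts u \<omega>) (?st m n))"
      by (rule suminf_finite) auto
    then show ?thesis by (simp add: X_def)
  qed
  have Xm: "X m \<in> borel_measurable M" for m
  proof -
    have 1: "(\<lambda>\<omega>. indicator {n} (cell (h m) (bt u \<omega>)) :: ennreal) \<in> borel_measurable M" for n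
      by (rule measurable_noise_M[OF measurable_compose[OF Npast]]) simp
    have 2: "(\<lambda>\<omega>. point_count (pts u \<omega>) (?st m n)) \<in> borel_measurable M" for n
      by (rule measurable_noise_M[OF cnt])
    show ?thesis unfolding X_eq[abs_def] using 1 2 by (intro borel_measurable_suminf_order borel_measurable_times_ennreal) auto
  qed
  have EX: "(\<integral>\<^sup>+\<omega>. X m \<omega> \<partial>M) = ennreal (r * h m)" for m
  proof -
    have "(\<integral>\<^sup>+\<omega>. 1 * X m \<omega> \<partial>M) = (\<Sum>n. (\<integral>\<^sup>+\<omega>. 1 * indicator {n} (cell (h m) (bt u \<omega>)) \<partial>M) *
        (\<integral>\<^sup>+\<omega>. point_count (pts u \<omega>) (?st m n) \<partial>M))"
      unfolding X_def by (rule nn_integral_cells[OF _ _ Npast cnt]) simp_all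
    also have "\<dots> = (\<Sum>n. (\<integral>\<^sup>+\<omega>. 1 * indicator {n} (cell (h m) (bt u \<omega>)) \<partial>M) * ennreal (r * h m))"
    proof -
      have "(\<integral>\<^sup>+\<omega>. point_count (pts u \<omega>) (?st m n) \<partial>M) = ennreal (r * h m)" for n
        using campbell_pts[of "indicator (?st m n)" u] st by (simp add: point_sum_indicator em)
      then show ?thesis by simp
    qed
    also have "\<dots> = (\<Sum>n. (\<integral>\<^sup>+\<omega>. 1 * indicator {n} (cell (h m) (bt u \<omega>)) \<partial>M)) * ennreal (r * h m)"
      by (rule ennreal_suminf_multc)
    also have "(\<Sum>n. (\<integral>\<^sup>+\<omega>. 1 * indicator {n} (cell (h m) (bt u \<omega>)) \<partial>M)) = (\<integral>\<^sup>+\<omega>. 1 \<partial>M)"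
      by (rule nn_integral_split_cells[OF _ measurable_noise_M[OF Npast]]) simp
    finally show ?thesis by (simp add: emeasure_space_1)
  qed
  have "(\<integral>\<^sup>+\<omega>. (INF m. X m \<omega>) \<partial>M) \<le> 0"
  proof (rule LIMSEQ_le_const)
    have "(\<lambda>m. r * h m) \<longlonglongrightarrow> r * 0"
      unfolding h_def by (intro tendsto_mult tendsto_const LIMSEQ_Suc[OF lim_const_over_n])
    then have "(\<lambda>m. ennreal (r * h m)) \<longlonglongrightarrow> ennreal (r * 0)" by (rule tendsto_ennrealI)
    then show "(\<lambda>m. ennreal (r * h m)) \<longlonglongrightarrow> 0" by simp
    have "(\<integral>\<^sup>+\<omega>. (INF m. X m \<omega>) \<partial>M) \<le> ennreal (r * h m)" for m
      unfolding EX[symmetric] by (intro nn_integral_mono INF_lower) simp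
    then show "\<exists>N. \<forall>m\<ge>N. (\<integral>\<^sup>+\<omega>. (INF m. X m \<omega>) \<partial>M) \<le> ennreal (r * h m)" by blast
  qed
  then have "(\<integral>\<^sup>+\<omega>. (INF m. X m \<omega>) \<partial>M) = 0" by simp
  moreover have "(\<lambda>\<omega>. INF m. X m \<omega>) \<in> borel_measurable M" using Xm by (intro borel_measurable_INF) simp_all
  ultimately have "AE \<omega> in M. (INF m. X m \<omega>) = 0" by (simp add: nn_integral_0_iff_AE)
  then show "AE \<omega> in M. bt u \<omega> < fst (br u k \<omega>)"
  proof eventually_elim
    fix \<omega> assume "(INF m. X m \<omega>) = 0"
    then have "(INF m. X m \<omega>) < 1" by simp
    then obtain m where m: "X m \<omega> < 1" by (auto simp: INF_less_iff)
    show "bt u \<omega> < fst (br u k \<omega>)"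
    proof (rule ccontr)
      assume "\<not> bt u \<omega> < fst (br u k \<omega>)"
      then have eq: "fst (br u k \<omega>) = bt u \<omega>" using br_ge[of u \<omega> k] by simp
      have "br u k \<omega> \<in> pts u \<omega> \<inter> ?st m (cell (h m) (bt u \<omega>))"
        using br_in[of u k \<omega>] pts_space[OF br_in, of u k \<omega>] eq cell_le[OF h bt_nonneg, of m u \<omega>] cell_gt[OF h bt_nonneg, of u \<omega> m]
        by (simp add: strip_def mem_Times_iff)
      then have ne: "X m \<omega> \<noteq> 0" unfolding X_def point_count_0_iff by blast
      have "X m \<omega> < \<infinity>" using m by (rule order_less_trans) simp
      then have "finite (pts u \<omega> \<inter> ?st m (cell (h m) (bt u \<omega>)))"
        unfolding X_def by (simp add: point_count_finite_iff[symmetric])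
      then have "X m \<omega> = of_nat (card (pts u \<omega> \<inter> ?st m (cell (h m) (bt u \<omega>))))"
        unfolding X_def by (rule point_count_finite)
      then show False using m ne by (simp del: of_nat_eq_0_iff)
    qed
  qed
qed

section \<open>The almost sure event and the positions on it\<close>

definition nice :: "'w \<Rightarrow> bool" where
  "nice \<omega> \<longleftrightarrow> \<omega> \<in> space M \<and> (\<forall>u. pts u \<omega> = P u \<omega>) \<and> (\<forall>u. \<xi> u 0 \<omega> = 0 \<and> mono_on {0..} (\<lambda>t. \<xi> u t \<omega>)) \<and>
    (\<forall>u k. bt u \<omega> < fst (br u k \<omega>))"

lemma AE_nice: "AE \<omega> in M. nice \<omega>"
proof -
  have "AE \<omega> in M. \<forall>u. \<xi> u 0 \<omega> = 0 \<and> mono_on {0..} (\<lambda>t. \<xi> u t \<omega>)"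
    unfolding AE_all_countable using subordinator_mono[OF sub] by blast
  then show ?thesis using AE_pts AE_bt_less AE_space
    by eventually_elim (simp add: nice_def)
qed

lemma nice_mono: "nice \<omega> \<Longrightarrow> 0 \<le> s \<Longrightarrow> s \<le> t \<Longrightarrow> \<xi> u s \<omega> \<le> \<xi> u t \<omega>"
  by (auto simp: nice_def mono_on_def)

lemma nice_nonneg: "nice \<omega> \<Longrightarrow> 0 \<le> t \<Longrightarrow> 0 \<le> \<xi> u t \<omega>"
  using nice_mono[of \<omega> 0 t u] by (simp add: nice_def)

lemma left_limit_ge:
  assumes "nice \<omega>" "0 \<le> q" "q < r"
  shows "ennreal (\<xi> u q \<omega>) \<le> left_limit u r \<omega>"
proof -
  obtain q' :: rat where q': "q < of_rat q'" "of_rat q' < r" using of_rat_dense assms(3) by blast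
  have "0 \<le> q'" using q'(1) assms(2) by (metis le_less_trans of_rat_0 of_rat_less_eq less_imp_le)
  then have "ennreal (\<xi> u (of_rat q') \<omega>) \<le> left_limit u r \<omega>"
    unfolding left_limit_def using q'(2) by (intro SUP_upper2[of q']) auto
  moreover have "ennreal (\<xi> u q \<omega>) \<le> ennreal (\<xi> u (of_rat q') \<omega>)"
    using assms q' by (intro ennreal_leI nice_mono) auto
  ultimately show ?thesis by (rule order_trans[rotated])
qed

lemma left_limit_le:
  assumes "nice \<omega>" "0 \<le> r"
  shows "left_limit u r \<omega> \<le> ennreal (\<xi> u r \<omega>)"
  unfolding left_limit_def
proof (rule SUP_least)
  fix q :: rat
  show "(if 0 \<le> q \<and> of_rat q < r then ennreal (\<xi> u (of_rat q) \<omega>) else 0) \<le> ennreal (\<xi> u r \<omega>)"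
    using assms nice_mono[of \<omega> "of_rat q" r u] by (auto intro: ennreal_leI)
qed

lemma left_limit_finite: "nice \<omega> \<Longrightarrow> 0 \<le> r \<Longrightarrow> left_limit u r \<omega> < \<infinity>"
  using left_limit_le[of \<omega> r u] by (rule order_le_less_trans) simp_all

lemma left_limit_tendsto:
  assumes "nice \<omega>" "b < s"
  shows "((\<lambda>t. \<xi> u (t - b) \<omega>) \<longlongrightarrow> enn2real (left_limit u (s - b) \<omega>)) (at_left s)"
proof (rule order_tendstoI)
  let ?L = "left_limit u (s - b) \<omega>"
  have fin: "?L < \<infinity>" using assms by (intro left_limit_finite) auto
  have ev: "eventually (\<lambda>t. t \<in> {b<..<s}) (at_left s)"
    using eventually_at_left_real[OF assms(2)] .
  fix y
  {
    assume y: "enn2real ?L < y"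
    show "eventually (\<lambda>t. \<xi> u (t - b) \<omega> < y) (at_left s)"
      using ev
    proof eventually_elim
      fix t assume t: "t \<in> {b<..<s}"
      have "ennreal (\<xi> u (t - b) \<omega>) \<le> ?L" using t assms by (intro left_limit_ge) auto
      then have "\<xi> u (t - b) \<omega> \<le> enn2real ?L"
        using fin nice_nonneg[OF assms(1), of "t - b" u] t by (cases ?L) (auto simp: ennreal_le_iff)
      then show "\<xi> u (t - b) \<omega> < y" using y by simp
    qed
  }
  {
    assume y: "y < enn2real ?L"
    show "eventually (\<lambda>t. y < \<xi> u (t - b) \<omega>) (at_left s)"
    proof (cases "y < 0")
      case True
      show ?thesis using ev
        by eventually_elim (use True nice_nonneg[OF assms(1)] in \<open>auto intro: order_less_le_trans\<close>)
    next
      case False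
      then have "ennreal y < ?L" using y fin by (cases ?L) (auto simp: ennreal_less_iff)
      then obtain q :: rat where q: "ennreal y < (if 0 \<le> q \<and> of_rat q < s - b then ennreal (\<xi> u (of_rat q) \<omega>) else 0)"
        unfolding left_limit_def less_SUP_iff by blast
      then have q': "0 \<le> q" "of_rat q < s - b" "y < \<xi> u (of_rat q) \<omega>"
        using False by (auto split: if_splits simp: ennreal_less_iff)
      have "b + of_rat q < s" using q'(2) by simp
      then have "eventually (\<lambda>t. t \<in> {b + of_rat q<..<s}) (at_left s)" by (rule eventually_at_left_real)
      then show ?thesis
      proof eventually_elim
        fix t assume t: "t \<in> {b + of_rat q<..<s}"
        have "\<xi> u (of_rat q) \<omega> \<le> \<xi> u (t - b) \<omega>" using t q'(1) assms by (intro nice_mono) auto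
        then show "y < \<xi> u (t - b) \<omega>" using q'(3) by simp
      qed
    qed
  }
qed

lemma displacement_eq:
  assumes "nice \<omega>"
  shows "displacement (\<lambda>u s. \<xi> u s \<omega>) (\<lambda>u. pts u \<omega>) u t = \<xi> u (t - bt u \<omega>) \<omega>"
proof -
  have "(\<Sum>p | p \<in> pts u \<omega> \<and> birth (\<lambda>u. pts u \<omega>) u \<le> fst p \<and> fst p \<le> t. enn2real (snd p 0)) = 0"
    using pts_good_mark[of _ u \<omega>] by (intro sum.neutral) (auto simp: good_mark_def)
  then show ?thesis by (simp add: displacement_def bt_def)
qed

lemma is_particle_iff:
  assumes "nice \<omega>"
  shows "is_particle (\<lambda>v. pts v \<omega>) u \<longleftrightarrow> bp \<infinity> u \<omega> < \<infinity>"
proof (induction u)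
  case (Cons e u)
  obtain k i where e: "e = (k, i)" by (cases e)
  have "left_limit u (fst (br u k \<omega>) - bt u \<omega>) \<omega> < \<infinity>"
    using left_limit_finite[OF assms] br_ge[of u \<omega> k] by simp
  then show ?case using Cons unfolding e by (auto simp: branching_eq less_top)
qed simp

text \<open>Marks do not move the parent, so a particle sits at its birth position plus its own
  subordinator. The induction follows the ancestral line; the limit of the parent's position at the
  branching time s uses that s is strictly later than the parent's birth, so that times just before
  s fall under the induction hypothesis.\<close>

lemma position_eq:
  assumes \<omega>: "nice \<omega>"
  shows "bp \<infinity> u \<omega> < \<infinity> \<Longrightarrow> bt u \<omega> \<le> t \<Longrightarrow>
    position (\<lambda>u s. \<xi> u s \<omega>) (\<lambda>u. pts u \<omega>) u t = enn2real (bp \<infinity> u \<omega>) + \<xi> u (t - bt u \<omega>) \<omega>"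
proof (induction u arbitrary: t)
  case Nil
  then show ?case by (simp add: displacement_eq[OF \<omega>])
next
  case (Cons e u)
  obtain k i where e: "e = (k, i)" by (cases e)
  define s where "s = fst (br u k \<omega>)"
  have s: "bt u \<omega> < s" using \<omega> by (simp add: nice_def s_def)
  have fin: "bp \<infinity> u \<omega> < \<infinity>" and i: "1 \<le> i \<and> snd (br u k \<omega>) i < \<infinity>"
    using Cons.prems(1) unfolding e by (auto split: if_splits)
  have L: "left_limit u (s - bt u \<omega>) \<omega> < \<infinity>" using left_limit_finite[OF \<omega>] s by simp
  have "((\<lambda>t. enn2real (bp \<infinity> u \<omega>) + \<xi> u (t - bt u \<omega>) \<omega>) \<longlongrightarrow>
      enn2real (bp \<infinity> u \<omega>) + enn2real (left_limit u (s - bt u \<omega>) \<omega>)) (at_left s)"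
    by (intro tendsto_add tendsto_const left_limit_tendsto \<omega> s)
  moreover have "eventually (\<lambda>t. enn2real (bp \<infinity> u \<omega>) + \<xi> u (t - bt u \<omega>) \<omega> =
      position (\<lambda>u s. \<xi> u s \<omega>) (\<lambda>u. pts u \<omega>) u t) (at_left s)"
    using eventually_at_left_real[OF s]
    by eventually_elim (simp add: Cons.IH[OF fin])
  ultimately have "(position (\<lambda>u s. \<xi> u s \<omega>) (\<lambda>u. pts u \<omega>) u \<longlongrightarrow>
      enn2real (bp \<infinity> u \<omega>) + enn2real (left_limit u (s - bt u \<omega>) \<omega>)) (at_left s)"
    by (rule Lim_transform_eventually)
  then have Lim: "Lim (at_left s) (position (\<lambda>u s. \<xi> u s \<omega>) (\<lambda>u. pts u \<omega>) u) =
      enn2real (bp \<infinity> u \<omega>) + enn2real (left_limit u (s - bt u \<omega>) \<omega>)"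
    by (intro tendsto_Lim) simp_all
  have "position (\<lambda>u s. \<xi> u s \<omega>) (\<lambda>u. pts u \<omega>) (e # u) t =
      enn2real (bp \<infinity> u \<omega>) + enn2real (left_limit u (s - bt u \<omega>) \<omega>) + enn2real (snd (br u k \<omega>) i) + \<xi> (e # u) (t - bt (e # u) \<omega>) \<omega>"
    using Cons.prems(2) Lim unfolding e
    by (simp add: branching_eq split_beta displacement_eq[OF \<omega>] s_def[symmetric])
  also have "enn2real (bp \<infinity> u \<omega>) + enn2real (left_limit u (s - bt u \<omega>) \<omega>) + enn2real (snd (br u k \<omega>) i) = enn2real (bp \<infinity> (e # u) \<omega>)"
    using fin L i unfolding e by (simp add: enn2real_plus s_def[symmetric] less_top)
  finally show ?case .
qed

lemma length_identity: "length (identity (\<lambda>v. pts v \<omega>) u) = length u"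
  by (induction u) auto

lemma birth_time_identity: "birth_time (identity (\<lambda>v. pts v \<omega>) u) = bt u \<omega>"
  by (cases "(\<lambda>v. pts v \<omega>, u)" rule: identity.cases) (auto simp: bt_def)

text \<open>The branching times of one particle are strictly increasing, so the birth time recovers
  the number k of the branching. Counting particles is therefore the same as counting
  labels.\<close>

lemma inj_identity: "inj (identity (\<lambda>v. pts v \<omega>))"
proof (rule injI)
  fix u u'
  show "identity (\<lambda>v. pts v \<omega>) u = identity (\<lambda>v. pts v \<omega>) u' \<Longrightarrow> u = u'"
  proof (induction u arbitrary: u')
    case Nil
    then show ?case using length_identity[of \<omega> u'] by auto
  next
    case (Cons e u)
    obtain k i where e: "e = (k, i)" by (cases e)
    have "u' \<noteq> []" using Cons.prems length_identity[of \<omega> u'] length_identity[of \<omega> "e # u"] by auto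
    then obtain k' i' v where u': "u' = (k', i') # v" by (metis list.exhaust surj_pair)
    have *: "u = v" "i = i'" "birth (\<lambda>v. pts v \<omega>) ((k, i) # u) = birth (\<lambda>v. pts v \<omega>) ((k', i') # v)"
      using Cons.prems Cons.IH[of v] unfolding e u' by auto
    then have "fst (br u k \<omega>) = fst (br u k' \<omega>)" using bt_Cons[of k i u \<omega>] bt_Cons[of k' i' v \<omega>] by (simp add: bt_def)
    then have "k = k'"
      using nth_point_strict_mono[OF regular_from, of k k' u \<omega>] nth_point_strict_mono[OF regular_from, of k' k u \<omega>]
      unfolding br_def by (cases k k' rule: linorder_cases) auto
    then show ?case using * e u' by simp
  qed
qed

end

section \<open>Low particles are unlikely\<close>

lemma nn_integral_labels_Suc:
  fixes f :: "(nat \<times> nat) list \<Rightarrow> ennreal"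
  shows "(\<integral>\<^sup>+u. f u \<partial>count_space {u. length u = Suc g}) =
    (\<integral>\<^sup>+v. (\<Sum>k. \<Sum>i. f ((k, i) # v)) \<partial>count_space {v. length v = g})"
proof -
  let ?F = "\<lambda>p. f (fst p # snd p) * indicator {v. length v = g} (snd p)"
  have "bij_betw (\<lambda>p. fst p # snd p) (UNIV \<times> {v. length v = g}) {u :: (nat \<times> nat) list. length u = Suc g}"
  proof (rule bij_betw_byWitness[where f' = "\<lambda>u. (hd u, tl u)"])
    show "(\<lambda>u. (hd u, tl u)) ` {u :: (nat \<times> nat) list. length u = Suc g} \<subseteq> UNIV \<times> {v. length v = g}" by auto
  qed (auto simp: length_Suc_conv)
  then have "(\<integral>\<^sup>+u. f u \<partial>count_space {u. length u = Suc g}) =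
      (\<integral>\<^sup>+p. f (fst p # snd p) \<partial>count_space (UNIV \<times> {v. length v = g}))"
    by (rule nn_integral_bij_count_space[symmetric])
  also have "\<dots> = (\<integral>\<^sup>+p. ?F p \<partial>count_space UNIV)"
    by (subst nn_integral_count_space_indicator) (auto intro!: nn_integral_cong simp: indicator_def)
  also have "\<dots> = (\<integral>\<^sup>+v. \<integral>\<^sup>+e. ?F (e, v) \<partial>count_space UNIV \<partial>count_space UNIV)"
    by (rule nn_integral_snd_count_space[symmetric])
  also have "\<dots> = (\<integral>\<^sup>+v. (\<integral>\<^sup>+e. f (e # v) \<partial>count_space UNIV) * indicator {v. length v = g} v \<partial>count_space UNIV)"
    by (simp add: nn_integral_multc)
  also have "\<dots> = (\<integral>\<^sup>+v. (\<integral>\<^sup>+e. f (e # v) \<partial>count_space UNIV) \<partial>count_space {v. length v = g})"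
    by (rule nn_integral_count_space_indicator[symmetric]) simp
  also have "\<dots> = (\<integral>\<^sup>+v. (\<Sum>k. \<Sum>i. f ((k, i) # v)) \<partial>count_space {v. length v = g})"
  proof (rule nn_integral_cong)
    fix v
    have "(\<integral>\<^sup>+e. f (e # v) \<partial>count_space UNIV) = (\<integral>\<^sup>+k. \<integral>\<^sup>+i. f ((k, i) # v) \<partial>count_space UNIV \<partial>count_space UNIV)"
      by (rule nn_integral_fst_count_space[symmetric])
    then show "(\<integral>\<^sup>+e. f (e # v) \<partial>count_space UNIV) = (\<Sum>k. \<Sum>i. f ((k, i) # v))"
      by (simp add: nn_integral_count_space_nat)
  qed
  finally show ?thesis .
qed

text \<open>Sum over the number m of cells of length 1 / \<phi>(l) between the births of parent and
  child: the time factor of the weight grows by exp (m / 2), while at least m - 1 full cells of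
  motion contribute exp (- (m - 1)). It is a universal constant, the discrete form of \<phi>(l)
  times the integral of exp (- \<phi>(l) s / 2).\<close>

definition grid_const :: ennreal where
  "grid_const = (\<Sum>m. ennreal (exp (real m / 2 - max 0 (real m - 1))))"

lemma grid_const_finite: "grid_const < \<infinity>"
proof -
  have 1: "summable (\<lambda>m. exp 1 * exp (- 1 / 2 :: real) ^ m)"
    by (intro summable_mult summable_geometric) simp
  have "exp (real m / 2 - max 0 (real m - 1)) \<le> exp 1 * exp (- 1 / 2) ^ m" for m
    by (simp add: exp_of_nat_mult[symmetric] exp_add[symmetric])
  then have "summable (\<lambda>m. exp (real m / 2 - max 0 (real m - 1)))"
    by (intro summable_comparison_test'[OF 1]) simp
  then show ?thesis
    unfolding grid_const_def by (subst suminf_ennreal2) auto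
qed

lemma emeasure_UN_le_nn_integral:
  fixes X :: "'i::countable \<Rightarrow> 'a set"
  assumes X: "\<And>i. i \<in> I \<Longrightarrow> X i \<in> sets M"
  shows "emeasure M (\<Union>i\<in>I. X i) \<le> (\<integral>\<^sup>+i. emeasure M (X i) \<partial>count_space I)"
proof -
  define Y where "Y = (\<lambda>n. if n \<in> to_nat ` I then X (from_nat n) else {})"
  have Y: "Y n \<in> sets M" for n using X by (auto simp: Y_def)
  have "(\<Union>i\<in>I. X i) = (\<Union>n. Y n)"
    unfolding Y_def by (auto split: if_splits)
  then have "emeasure M (\<Union>i\<in>I. X i) \<le> (\<Sum>n. emeasure M (Y n))"
    using Y by (auto intro!: emeasure_subadditive_countably)
  also have "\<dots> = (\<integral>\<^sup>+n. emeasure M (Y n) \<partial>count_space UNIV)" by (simp add: nn_integral_count_space_nat)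
  also have "\<dots> = (\<integral>\<^sup>+n. emeasure M (X (from_nat n)) * indicator (to_nat ` I) n \<partial>count_space UNIV)"
    by (intro nn_integral_cong) (simp add: Y_def indicator_def)
  also have "\<dots> = (\<integral>\<^sup>+n. emeasure M (X (from_nat n)) \<partial>count_space (to_nat ` I))"
    by (rule nn_integral_count_space_indicator[symmetric]) simp
  also have "\<dots> = (\<integral>\<^sup>+i. emeasure M (X (from_nat (to_nat i))) \<partial>count_space I)"
    by (rule nn_integral_bij_count_space[symmetric]) (auto simp: bij_betw_def inj_on_def)
  finally show ?thesis by simp
qed

context branching_noise
begin

lemma measurable_trunc_laplace: "trunc_laplace x l \<in> borel_measurable \<Theta>"
proof -
  have [measurable]: "(\<lambda>x. x i) \<in> borel_measurable \<Theta>" for i by (rule mark_coordinate)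
  show ?thesis unfolding trunc_laplace_def by measurable
qed

text \<open>A particle below x has made no birth displacement of x or more, so discarding such
  displacements does not affect it. This is what makes the bound involve
  \<open>trunc_laplace x\<close> instead of the truncation level a, hence uniform over
  levels.\<close>

lemma bp_cut:
  assumes "bp \<infinity> u \<omega> < ennreal x"
  shows "bp (ennreal x) u \<omega> = bp \<infinity> u \<omega>"
  using assms
proof (induction u)
  case (Cons e u)
  obtain k i where e: "e = (k, i)" by (cases e)
  let ?m = "if 1 \<le> i \<and> snd (br u k \<omega>) i < \<infinity> then snd (br u k \<omega>) i else \<infinity>"
  have le: "bp \<infinity> u \<omega> \<le> bp \<infinity> (e # u) \<omega>" "?m \<le> bp \<infinity> (e # u) \<omega>" unfolding e by simp_all
  have "bp \<infinity> u \<omega> < ennreal x" using le(1) Cons.prems by (rule le_less_trans)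
  moreover have m: "?m < ennreal x" using le(2) Cons.prems by (rule le_less_trans)
  moreover have "1 \<le> i \<and> snd (br u k \<omega>) i < \<infinity>" using m by (auto split: if_splits)
  ultimately show ?case using Cons.IH unfolding e by simp
qed simp

context
  fixes l x :: real
  assumes l: "0 \<le> l" and \<phi>: "0 < laplace_exponent \<nu> l"
begin

abbreviation "mesh \<equiv> 1 / laplace_exponent \<nu> l"

text \<open>The exponential weight with the birth time rounded down to a multiple of 1 / \<phi>(l):
  in these units \<phi>(l) b / 2 becomes half the cell number. Rounding makes the time factor a
  function of a discrete variable, as required for splitting the integral over cells.\<close>

definition weight :: "label \<Rightarrow> 'w \<Rightarrow> ennreal" where
  "weight u \<omega> = ennreal (exp_neg l (bp (ennreal x) u \<omega>)) * ennreal (exp (real (cell mesh (bt u \<omega>)) / 2))"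

lemma mesh_pos: "0 < mesh" using \<phi> by simp

lemma measurable_weight: "weight u \<in> borel_measurable (noise (past (length u)))"
proof -
  have "(\<lambda>\<omega>. exp_neg l (bp (ennreal x) u \<omega>)) \<in> borel_measurable (noise (past (length u)))"
    by (rule measurable_compose[OF measurable_bp measurable_exp_neg])
  then have "(\<lambda>\<omega>. ennreal (exp_neg l (bp (ennreal x) u \<omega>))) \<in> borel_measurable (noise (past (length u)))"
    by (rule measurable_compose[OF _ measurable_ennreal])
  moreover have "(\<lambda>\<omega>. ennreal (exp (real (cell mesh (bt u \<omega>)) / 2))) \<in> borel_measurable (noise (past (length u)))"
    by (rule measurable_compose[OF measurable_cell_bt[OF order_refl]]) simp
  ultimately show ?thesis unfolding weight_def[abs_def] by (rule borel_measurable_times_ennreal)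
qed

lemma xi_laplace: "0 \<le> t \<Longrightarrow> (\<integral>\<^sup>+\<omega>. ennreal (exp (- l * \<xi> u t \<omega>)) \<partial>M) = ennreal (exp (- t * laplace_exponent \<nu> l))"
  using subordinator_laplace(2)[OF sub _ l] .

definition cell_sum :: "label \<Rightarrow> nat \<Rightarrow> 'w \<Rightarrow> ennreal" where
  "cell_sum u n \<omega> = point_sum (pts u \<omega>) (\<lambda>p. indicator {real n * mesh..<(real n + 1) * mesh} (fst p) * trunc_laplace x l (snd p))"

lemma cell_sum_facts:
  shows measurable_cell_sum: "cell_sum u n \<in> borel_measurable (noise {Inr u})"
    and nn_integral_cell_sum: "(\<integral>\<^sup>+\<omega>. cell_sum u n \<omega> \<partial>M) = ennreal mesh * (\<integral>\<^sup>+y. trunc_laplace x l y \<partial>\<Theta>)"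
proof -
  define I where "I = {real n * mesh..<(real n + 1) * mesh}"
  have I: "I \<subseteq> {0..}" unfolding I_def using mesh_pos by (auto intro: order_trans[of 0 "real n * mesh"])
  have "I \<in> sets borel" unfolding I_def by simp
  then have I_sets: "I \<in> sets (restrict_space lborel {0..})"
    using I by (simp add: sets_restrict_space_iff)
  note [measurable] = borel_measurable_indicator[OF I_sets] measurable_trunc_laplace
  have f: "(\<lambda>p. indicator I (fst p) * trunc_laplace x l (snd p)) \<in> borel_measurable intens"
    by (intro borel_measurable_times_ennreal measurable_compose[OF measurable_fst borel_measurable_indicator[OF I_sets]]
      measurable_compose[OF measurable_snd measurable_trunc_laplace])
  show "cell_sum u n \<in> borel_measurable (noise {Inr u})"
    unfolding cell_sum_def[abs_def] I_def[symmetric] by (rule measurable_point_sum_pts[OF f]) simp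
  have "(\<integral>\<^sup>+\<omega>. cell_sum u n \<omega> \<partial>M) = (\<integral>\<^sup>+p. indicator I (fst p) * trunc_laplace x l (snd p) \<partial>intens)"
    unfolding cell_sum_def I_def[symmetric] by (rule campbell_pts[OF f])
  also have "\<dots> = (\<integral>\<^sup>+s. \<integral>\<^sup>+y. indicator I s * trunc_laplace x l y \<partial>\<Theta> \<partial>restrict_space lborel {0..})"
    by (subst mark.nn_integral_fst[OF f, symmetric]) simp
  also have "\<dots> = (\<integral>\<^sup>+s. indicator I s * (\<integral>\<^sup>+y. trunc_laplace x l y \<partial>\<Theta>) \<partial>restrict_space lborel {0..})"
    by (simp add: nn_integral_cmult[OF measurable_trunc_laplace])
  also have "\<dots> = (\<integral>\<^sup>+s. indicator I s \<partial>restrict_space lborel {0..}) * (\<integral>\<^sup>+y. trunc_laplace x l y \<partial>\<Theta>)"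
    by (rule nn_integral_multc[OF borel_measurable_indicator[OF I_sets]])
  also have "(\<integral>\<^sup>+s. indicator I s \<partial>restrict_space lborel {0..}) = emeasure (restrict_space lborel {0..}) I"
    by (rule nn_integral_indicator[OF I_sets])
  also have "\<dots> = emeasure lborel I" using I by (intro emeasure_restrict_space) auto
  also have "\<dots> = ennreal mesh"
  proof -
    have "(real n + 1) * mesh - real n * mesh = mesh" by (simp add: diff_divide_distrib[symmetric])
    then show ?thesis unfolding I_def using mesh_pos by (subst emeasure_lborel_Ico) (auto intro!: mult_right_mono divide_right_mono)
  qed
  finally show "(\<integral>\<^sup>+\<omega>. cell_sum u n \<omega> \<partial>M) = ennreal mesh * (\<integral>\<^sup>+y. trunc_laplace x l y \<partial>\<Theta>)" .
qed

lemma measurable_xi_weight: "0 \<le> t \<Longrightarrow> (\<lambda>\<omega>. ennreal (exp (- l * \<xi> u t \<omega>))) \<in> borel_measurable (noise {Inl u})"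
proof -
  assume "0 \<le> t"
  then have [measurable]: "\<xi> u t \<in> borel_measurable (noise {Inl u})" by (rule measurable_xi) simp
  show ?thesis by measurable
qed

text \<open>Dominates, up to the weight of u, the contribution of the children of u born m cells
  after its own birth cell n. At least m - 1 full cells separate the two births, so the motion is
  evaluated at the deterministic time (m - 1) \<open>mesh\<close>, and the points enter through one
  deterministic cell. The two factors are then independent of each other and of the past.\<close>

definition step_term :: "label \<Rightarrow> nat \<Rightarrow> nat \<Rightarrow> 'w \<Rightarrow> ennreal" where
  "step_term u m n \<omega> = ennreal (exp (real m / 2)) *
     (ennreal (exp (- l * \<xi> u (max 0 (real m - 1) * mesh) \<omega>)) * cell_sum u (n + m) \<omega>)"

lemma measurable_step_term: "step_term u m n \<in> borel_measurable (noise {Inl u, Inr u})"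
proof -
  have 1: "(\<lambda>\<omega>. ennreal (exp (- l * \<xi> u (max 0 (real m - 1) * mesh) \<omega>))) \<in> borel_measurable (noise {Inl u, Inr u})"
    using mesh_pos by (intro measurable_noise_mono[OF measurable_xi_weight]) auto
  have 2: "cell_sum u (n + m) \<in> borel_measurable (noise {Inl u, Inr u})"
    by (rule measurable_noise_mono[OF measurable_cell_sum]) simp
  show ?thesis unfolding step_term_def[abs_def] using 1 2 by (intro borel_measurable_times_ennreal) simp_all
qed

lemma nn_integral_step_term:
  "(\<integral>\<^sup>+\<omega>. step_term u m n \<omega> \<partial>M) = ennreal (exp (real m / 2 - max 0 (real m - 1))) * (ennreal mesh * (\<integral>\<^sup>+y. trunc_laplace x l y \<partial>\<Theta>))"
proof -
  let ?t = "max 0 (real m - 1) * mesh"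
  have t: "0 \<le> ?t" using mesh_pos by simp
  have disj: "{Inl u} \<inter> {Inr u} = ({} :: (label + label) set)" by simp
  have m: "(\<lambda>\<omega>. ennreal (exp (- l * \<xi> u ?t \<omega>)) * cell_sum u (n + m) \<omega>) \<in> borel_measurable M"
    by (intro borel_measurable_times_ennreal measurable_noise_M[OF measurable_xi_weight[OF t]] measurable_noise_M[OF measurable_cell_sum])
  have "(\<integral>\<^sup>+\<omega>. step_term u m n \<omega> \<partial>M) = ennreal (exp (real m / 2)) *
      ((\<integral>\<^sup>+\<omega>. ennreal (exp (- l * \<xi> u ?t \<omega>)) \<partial>M) * (\<integral>\<^sup>+\<omega>. cell_sum u (n + m) \<omega> \<partial>M))"
    unfolding step_term_def nn_integral_cmult[OF m]
    by (simp only: nn_integral_noise_mult[OF disj measurable_xi_weight[OF t] measurable_cell_sum])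
  also have "(\<integral>\<^sup>+\<omega>. ennreal (exp (- l * \<xi> u ?t \<omega>)) \<partial>M) = ennreal (exp (- max 0 (real m - 1)))"
    using xi_laplace[OF t] \<phi> by simp
  finally show ?thesis
    by (simp add: nn_integral_cell_sum mult.assoc[symmetric] ennreal_mult[symmetric] exp_add[symmetric])
qed

text \<open>Monotonicity of the path replaces the left limit at a random branching time by the value
  at (m - 1) \<open>mesh\<close>, where m is the number of cells since birth; the cell lost in this
  way is accounted for in \<open>grid_const\<close>. The sum over branchings becomes a sum over
  points because \<open>nth_point\<close> is a bijection.\<close>

lemma children_weight_le:
  assumes \<omega>: "nice \<omega>"
  shows "(\<Sum>k. \<Sum>i. weight ((k, i) # v) \<omega>) \<le> (\<Sum>m. weight v \<omega> * step_term v m (cell mesh (bt v \<omega>)) \<omega>)"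
proof -
  define N where "N = cell mesh (bt v \<omega>)"
  define e0 where "e0 = ennreal (exp_neg l (bp (ennreal x) v \<omega>))"
  define S where "S = points_from (bt v \<omega>) (pts v \<omega>)"
  define G where "G = (\<lambda>p. ennreal (exp_neg l (left_limit v (fst p - bt v \<omega>) \<omega>)) * ennreal (exp (real (cell mesh (fst p)) / 2)) *
    trunc_laplace x l (snd p))"
  define K where "K = (\<lambda>m. ennreal (exp (real (N + m) / 2)) * ennreal (exp (- l * \<xi> v (max 0 (real m - 1) * mesh) \<omega>)))"
  have inner: "(\<Sum>i. weight ((k, i) # v) \<omega>) = e0 * G (br v k \<omega>)" for k
  proof -
    let ?c = "ennreal (exp_neg l (left_limit v (fst (br v k \<omega>) - bt v \<omega>) \<omega>)) * ennreal (exp (real (cell mesh (fst (br v k \<omega>))) / 2))"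
    let ?z = "\<lambda>i. ennreal (exp_neg l (if 1 \<le> i \<and> snd (br v k \<omega>) i < ennreal x then snd (br v k \<omega>) i else \<infinity>))"
    have "weight ((k, i) # v) \<omega> = (e0 * ?c) * ?z i" for i
      unfolding weight_def e0_def by (simp add: exp_neg_add l ennreal_mult mult_ac)
    then have "(\<Sum>i. weight ((k, i) # v) \<omega>) = (e0 * ?c) * (\<Sum>i. ?z i)"
      by (simp only: ennreal_suminf_cmult)
    \<comment> \<open>Index 0 belongs to the parent; its term is
      \<open>exp_neg l \<infinity> = 0\<close>, so the sum starts at index 1.\<close>
    also have "(\<Sum>i. ?z i) = (\<Sum>i. ?z (Suc i))"
    proof -
      have "(\<lambda>i. ?z (Suc i)) sums (\<Sum>i. ?z (Suc i))" by (rule summable_sums) simp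
      then have "?z sums ((\<Sum>i. ?z (Suc i)) + ?z 0)" by (rule sums_Suc)
      then show ?thesis by (simp add: sums_iff exp_neg_def)
    qed
    also have "\<dots> = trunc_laplace x l (snd (br v k \<omega>))"
      unfolding trunc_laplace_def by (auto simp: exp_neg_def intro!: suminf_cong)
    finally show ?thesis by (simp add: G_def mult_ac)
  qed
  have "(\<Sum>k. \<Sum>i. weight ((k, i) # v) \<omega>) = e0 * (\<Sum>k. G (br v k \<omega>))"
    by (simp only: inner ennreal_suminf_cmult)
  also have "(\<Sum>k. G (br v k \<omega>)) = (\<integral>\<^sup>+k. G (br v k \<omega>) \<partial>count_space UNIV)"
    by (simp add: nn_integral_count_space_nat)
  also have "\<dots> = (\<integral>\<^sup>+p. G p \<partial>count_space S)"
    unfolding br_def S_def by (rule nn_integral_bij_count_space[OF nth_point_bij[OF regular_from]])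
  also have "\<dots> \<le> (\<integral>\<^sup>+p. (\<Sum>m. K m * (indicator {real (N + m) * mesh..<(real (N + m) + 1) * mesh} (fst p) * trunc_laplace x l (snd p))) \<partial>count_space S)"
  proof (rule nn_integral_mono)
    fix p assume "p \<in> space (count_space S)"
    then have p: "p \<in> pts v \<omega>" "bt v \<omega> \<le> fst p" by (auto simp: S_def points_from_def)
    define n where "n = cell mesh (fst p)"
    have nN: "N \<le> n" unfolding N_def n_def using p(2) mesh_pos by (rule cell_mono[rotated])
    define m where "m = n - N"
    have nm: "n = N + m" using nN by (simp add: m_def)
    have fp: "0 \<le> fst p" using pts_space[OF p(1)] by simp
    have in_cell: "fst p \<in> {real n * mesh..<(real n + 1) * mesh}"
      using cell_le[OF mesh_pos fp] cell_gt[OF mesh_pos fp] by (simp add: n_def)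
    have exp_le: "exp_neg l (left_limit v (fst p - bt v \<omega>) \<omega>) \<le> exp (- l * \<xi> v (max 0 (real m - 1) * mesh) \<omega>)"
    proof (cases "m \<le> 1")
      case True
      then have z: "max 0 (real m - 1) = 0" by simp
      have "\<xi> v 0 \<omega> = 0" using \<omega> by (simp add: nice_def)
      then show ?thesis unfolding z using exp_neg_le_1[OF l] by simp
    next
      case False
      have "bt v \<omega> < (real N + 1) * mesh" unfolding N_def by (rule cell_gt[OF mesh_pos bt_nonneg])
      moreover have "real n * mesh = (real N + 1) * mesh + (real m - 1) * mesh"
      proof -
        have "real n = (real N + 1) + (real m - 1)" using nm by simp
        then show ?thesis by (simp only: distrib_right)
      qed
      ultimately have lt: "(real m - 1) * mesh < fst p - bt v \<omega>" using in_cell by simp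
      have pos: "0 \<le> (real m - 1) * mesh" using False mesh_pos by (intro mult_nonneg_nonneg) auto
      have "exp_neg l (left_limit v (fst p - bt v \<omega>) \<omega>) \<le> exp_neg l (ennreal (\<xi> v ((real m - 1) * mesh) \<omega>))"
        by (rule exp_neg_antimono[OF l left_limit_ge[OF \<omega> pos lt]])
      also have "\<dots> = exp (- l * \<xi> v (max 0 (real m - 1) * mesh) \<omega>)"
        using nice_nonneg[OF \<omega> pos] False by (simp add: exp_neg_ennreal)
      finally show ?thesis .
    qed
    have "G p \<le> K m * (indicator {real (N + m) * mesh..<(real (N + m) + 1) * mesh} (fst p) * trunc_laplace x l (snd p))"
    proof -
      have "G p = ennreal (exp_neg l (left_limit v (fst p - bt v \<omega>) \<omega>)) * ennreal (exp (real (N + m) / 2)) * trunc_laplace x l (snd p)"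
        unfolding G_def using nm n_def by simp
      also have "\<dots> \<le> ennreal (exp (- l * \<xi> v (max 0 (real m - 1) * mesh) \<omega>)) * ennreal (exp (real (N + m) / 2)) * trunc_laplace x l (snd p)"
        by (intro mult_right_mono ennreal_leI exp_le) simp_all
      finally show ?thesis using in_cell nm by (simp add: K_def mult_ac)
    qed
    also have "\<dots> \<le> (\<Sum>m. K m * (indicator {real (N + m) * mesh..<(real (N + m) + 1) * mesh} (fst p) * trunc_laplace x l (snd p)))"
      using sum_le_suminf[of "\<lambda>m. K m * (indicator {real (N + m) * mesh..<(real (N + m) + 1) * mesh} (fst p) * trunc_laplace x l (snd p))" "{m}"]
      by simp
    finally show "G p \<le> (\<Sum>m. K m * (indicator {real (N + m) * mesh..<(real (N + m) + 1) * mesh} (fst p) * trunc_laplace x l (snd p)))" .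
  qed
  \<comment> \<open>Points of the birth cell that precede the birth of v are added, so that the
    right-hand side depends on the birth time only through its cell.\<close>
  also have "\<dots> \<le> (\<integral>\<^sup>+p. (\<Sum>m. K m * (indicator {real (N + m) * mesh..<(real (N + m) + 1) * mesh} (fst p) * trunc_laplace x l (snd p))) \<partial>count_space (pts v \<omega>))"
    unfolding S_def points_from_def
    by (subst (1 2) nn_integral_count_space_indicator) (auto intro!: nn_integral_mono simp: indicator_def)
  also have "\<dots> = (\<Sum>m. K m * cell_sum v (N + m) \<omega>)"
    unfolding cell_sum_def point_sum_def by (simp add: nn_integral_suminf nn_integral_cmult)
  finally have "(\<Sum>k. \<Sum>i. weight ((k, i) # v) \<omega>) \<le> e0 * (\<Sum>m. K m * cell_sum v (N + m) \<omega>)"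
    by (simp add: mult_left_mono)
  also have "\<dots> = (\<Sum>m. e0 * (K m * cell_sum v (N + m) \<omega>))" by simp
  also have "\<dots> = (\<Sum>m. weight v \<omega> * step_term v m N \<omega>)"
    unfolding weight_def step_term_def K_def e0_def N_def[symmetric]
    by (simp add: add_divide_distrib exp_add ennreal_mult mult_ac)
  finally show ?thesis unfolding N_def .
qed

definition moment :: "nat \<Rightarrow> ennreal" where
  "moment g = (\<integral>\<^sup>+u. (\<integral>\<^sup>+\<omega>. weight u \<omega> \<partial>M) \<partial>count_space {u. length u = g})"

text \<open>The weight of v is determined by earlier generations and the bound for its children by
  its own sources. Once the birth cell is fixed the integrals factor, and the second one does not
  depend on the cell; summing over cells restores the mean weight, and summing over m gives
  \<open>grid_const\<close>.\<close>

lemma moment_Suc_le: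
  "moment (Suc g) \<le> (grid_const * (ennreal mesh * (\<integral>\<^sup>+y. trunc_laplace x l y \<partial>\<Theta>))) * moment g"
proof -
  let ?Z = "ennreal mesh * (\<integral>\<^sup>+y. trunc_laplace x l y \<partial>\<Theta>)"
  have wM: "weight u \<in> borel_measurable M" for u by (rule measurable_noise_M[OF measurable_weight])
  have sM: "step_term v m n \<in> borel_measurable M" for v m n by (rule measurable_noise_M[OF measurable_step_term])
  have one: "(\<Sum>k. \<Sum>i. \<integral>\<^sup>+\<omega>. weight ((k, i) # v) \<omega> \<partial>M) \<le> (grid_const * ?Z) * (\<integral>\<^sup>+\<omega>. weight v \<omega> \<partial>M)" for v
  proof -
    have disj: "past (length v) \<inter> {Inl v, Inr v} = {}" by (auto simp: past_def)
    note N = measurable_cell_bt[OF order_refl, where u = v and h = mesh]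
    have "(\<Sum>k. \<Sum>i. \<integral>\<^sup>+\<omega>. weight ((k, i) # v) \<omega> \<partial>M) = (\<integral>\<^sup>+\<omega>. (\<Sum>k. \<Sum>i. weight ((k, i) # v) \<omega>) \<partial>M)"
      using wM by (simp add: nn_integral_suminf)
    also have "\<dots> \<le> (\<integral>\<^sup>+\<omega>. (\<Sum>m. weight v \<omega> * step_term v m (cell mesh (bt v \<omega>)) \<omega>) \<partial>M)"
      using AE_nice by (intro nn_integral_mono_AE, eventually_elim) (rule children_weight_le)
    also have "\<dots> = (\<Sum>m. \<integral>\<^sup>+\<omega>. weight v \<omega> * step_term v m (cell mesh (bt v \<omega>)) \<omega> \<partial>M)"
    proof (rule nn_integral_suminf)
      fix m
      have "(\<lambda>\<omega>. step_term v m (cell mesh (bt v \<omega>)) \<omega>) \<in> borel_measurable M"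
        by (rule measurable_compose_countable[OF sM measurable_noise_M[OF N]])
      then show "(\<lambda>\<omega>. weight v \<omega> * step_term v m (cell mesh (bt v \<omega>)) \<omega>) \<in> borel_measurable M"
        using wM by (rule borel_measurable_times_ennreal[rotated])
    qed
    also have "\<dots> = (\<Sum>m. \<Sum>n. (\<integral>\<^sup>+\<omega>. weight v \<omega> * indicator {n} (cell mesh (bt v \<omega>)) \<partial>M) *
        (ennreal (exp (real m / 2 - max 0 (real m - 1))) * ?Z))"
    proof -
      have "(\<integral>\<^sup>+\<omega>. weight v \<omega> * step_term v m (cell mesh (bt v \<omega>)) \<omega> \<partial>M) =
          (\<Sum>n. (\<integral>\<^sup>+\<omega>. weight v \<omega> * indicator {n} (cell mesh (bt v \<omega>)) \<partial>M) * (\<integral>\<^sup>+\<omega>. step_term v m n \<omega> \<partial>M))" for m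
        by (rule nn_integral_cells[OF disj measurable_weight N measurable_step_term])
      then show ?thesis by (simp only: nn_integral_step_term)
    qed
    also have "\<dots> = (\<Sum>m. (\<integral>\<^sup>+\<omega>. weight v \<omega> \<partial>M) * (ennreal (exp (real m / 2 - max 0 (real m - 1))) * ?Z))"
      by (simp only: ennreal_suminf_multc nn_integral_split_cells[OF wM measurable_noise_M[OF N]])
    also have "\<dots> = (grid_const * ?Z) * (\<integral>\<^sup>+\<omega>. weight v \<omega> \<partial>M)"
      unfolding grid_const_def by (simp only: ennreal_suminf_cmult ennreal_suminf_multc mult_ac)
    finally show ?thesis .
  qed
  have "moment (Suc g) = (\<integral>\<^sup>+v. (\<Sum>k. \<Sum>i. \<integral>\<^sup>+\<omega>. weight ((k, i) # v) \<omega> \<partial>M) \<partial>count_space {v. length v = g})"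
    unfolding moment_def by (rule nn_integral_labels_Suc)
  also have "\<dots> \<le> (\<integral>\<^sup>+v. (grid_const * ?Z) * (\<integral>\<^sup>+\<omega>. weight v \<omega> \<partial>M) \<partial>count_space {v. length v = g})"
    by (rule nn_integral_mono) (rule one)
  also have "\<dots> = (grid_const * ?Z) * moment g"
    unfolding moment_def by (rule nn_integral_cmult) simp
  finally show ?thesis .
qed

lemma moment_0: "moment 0 = 1"
proof -
  have "weight [] = (\<lambda>_. 1)" by (rule ext) (simp add: weight_def cell_def)
  then show ?thesis
    unfolding moment_def by (simp add: nn_integral_count_space_finite emeasure_space_1)
qed

lemma moment_le:
  assumes "grid_const * (ennreal mesh * (\<integral>\<^sup>+y. trunc_laplace x l y \<partial>\<Theta>)) \<le> ennreal (1/2)"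
  shows "moment g \<le> ennreal ((1/2) ^ g)"
proof (induction g)
  case (Suc g)
  have "moment (Suc g) \<le> ennreal (1/2) * ennreal ((1/2) ^ g)"
    by (rule order_trans[OF moment_Suc_le mult_mono[OF assms Suc]]) simp_all
  also have "ennreal (1/2) * ennreal ((1/2) ^ g) = ennreal ((1/2) ^ Suc g)"
    by (subst ennreal_mult[symmetric]) simp_all
  finally show ?case .
qed (simp add: moment_0)

text \<open>Motion after the last birth, up to a time in cell n0. If the particle was born in cell
  n, the Laplace transform over the remaining full cells is exp (- max 0 (n0 - n - 1)), at most exp
  (1 - n0 / 2) exp (n / 2): half of the rate suffices to complete the weight of the particle, so
  early and late births are bounded alike.\<close>

lemma nn_integral_endpoint_le:
  fixes n0 :: nat
  shows "(\<integral>\<^sup>+\<omega>. ennreal (exp_neg l (bp (ennreal x) u \<omega>)) *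
      ennreal (exp (- l * \<xi> u (max 0 (real n0 - real (cell mesh (bt u \<omega>)) - 1) * mesh) \<omega>)) \<partial>M) \<le>
    ennreal (exp (1 - real n0 / 2)) * (\<integral>\<^sup>+\<omega>. weight u \<omega> \<partial>M)"
proof -
  let ?e = "\<lambda>\<omega>. ennreal (exp_neg l (bp (ennreal x) u \<omega>))"
  let ?N = "\<lambda>\<omega>. cell mesh (bt u \<omega>)"
  let ?t = "\<lambda>n::nat. max 0 (real n0 - real n - 1) * mesh"
  have disj: "past (length u) \<inter> {Inl u} = {}" by (auto simp: past_def)
  note N = measurable_cell_bt[OF order_refl, where u = u and h = mesh]
  have e: "?e \<in> borel_measurable (noise (past (length u)))"
    by (rule measurable_compose[OF measurable_compose[OF measurable_bp measurable_exp_neg] measurable_ennreal])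
  have t: "0 \<le> ?t n" for n using mesh_pos by simp
  have ind: "(\<lambda>\<omega>. indicator {n} (?N \<omega>) :: ennreal) \<in> borel_measurable M" for n
    by (rule measurable_noise_M[OF measurable_compose[OF N]]) simp
  have "(\<integral>\<^sup>+\<omega>. ?e \<omega> * ennreal (exp (- l * \<xi> u (?t (?N \<omega>)) \<omega>)) \<partial>M) =
      (\<Sum>n. (\<integral>\<^sup>+\<omega>. ?e \<omega> * indicator {n} (?N \<omega>) \<partial>M) * (\<integral>\<^sup>+\<omega>. ennreal (exp (- l * \<xi> u (?t n) \<omega>)) \<partial>M))"
    by (rule nn_integral_cells[OF disj e N measurable_xi_weight[OF t]])
  also have "\<dots> \<le> (\<Sum>n. ennreal (exp (1 - real n0 / 2)) * (\<integral>\<^sup>+\<omega>. weight u \<omega> * indicator {n} (?N \<omega>) \<partial>M))"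
  proof (intro suminf_le)
    fix n
    have "(\<integral>\<^sup>+\<omega>. ennreal (exp (- l * \<xi> u (?t n) \<omega>)) \<partial>M) = ennreal (exp (- max 0 (real n0 - real n - 1)))"
      unfolding xi_laplace[OF t] using \<phi> by simp
    also have "\<dots> \<le> ennreal (exp (1 - real n0 / 2) * exp (real n / 2))"
      by (intro ennreal_leI) (simp add: exp_add[symmetric])
    finally have le: "(\<integral>\<^sup>+\<omega>. ennreal (exp (- l * \<xi> u (?t n) \<omega>)) \<partial>M) \<le> ennreal (exp (1 - real n0 / 2) * exp (real n / 2))" .
    have "weight u \<omega> * indicator {n} (?N \<omega>) = ennreal (exp (real n / 2)) * (?e \<omega> * indicator {n} (?N \<omega>))" for \<omega>
      by (auto simp: weight_def indicator_def mult_ac)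
    then have "(\<integral>\<^sup>+\<omega>. weight u \<omega> * indicator {n} (?N \<omega>) \<partial>M) = ennreal (exp (real n / 2)) * (\<integral>\<^sup>+\<omega>. ?e \<omega> * indicator {n} (?N \<omega>) \<partial>M)"
      using measurable_noise_M[OF e] ind by (simp add: nn_integral_cmult borel_measurable_times_ennreal)
    then have "ennreal (exp (1 - real n0 / 2)) * (\<integral>\<^sup>+\<omega>. weight u \<omega> * indicator {n} (?N \<omega>) \<partial>M) =
        (\<integral>\<^sup>+\<omega>. ?e \<omega> * indicator {n} (?N \<omega>) \<partial>M) * ennreal (exp (1 - real n0 / 2) * exp (real n / 2))"
      by (simp add: ennreal_mult mult_ac)
    then show "(\<integral>\<^sup>+\<omega>. ?e \<omega> * indicator {n} (?N \<omega>) \<partial>M) * (\<integral>\<^sup>+\<omega>. ennreal (exp (- l * \<xi> u (?t n) \<omega>)) \<partial>M) \<le>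
        ennreal (exp (1 - real n0 / 2)) * (\<integral>\<^sup>+\<omega>. weight u \<omega> * indicator {n} (?N \<omega>) \<partial>M)"
      using mult_left_mono[OF le] by (simp only: zero_le)
  qed simp_all
  also have "\<dots> = ennreal (exp (1 - real n0 / 2)) * (\<integral>\<^sup>+\<omega>. weight u \<omega> \<partial>M)"
    by (simp only: ennreal_suminf_cmult nn_integral_split_cells[OF measurable_noise_M[OF measurable_weight] measurable_noise_M[OF N]])
  finally show ?thesis .
qed

text \<open>Chernoff bound: a particle below x makes exp (l x) times \<open>V u\<close> at least 1.
  The motion is evaluated at a rounded time that is at most s minus the birth time for every s >= t,
  which puts all later times into one event per label. The event is enclosed in a measurable set
  because it ranges over uncountably many s. In the constant, 2 is the sum of the generation bounds
  (1/2) ^ g.\<close>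

lemma lower_event:
  assumes ratio: "grid_const * (ennreal mesh * (\<integral>\<^sup>+y. trunc_laplace x l y \<partial>\<Theta>)) \<le> ennreal (1/2)" and t: "0 \<le> t"
  shows "\<exists>L\<in>sets M. emeasure M L \<le> ennreal (2 * exp (l * x - t * laplace_exponent \<nu> l / 2 + 3 / 2)) \<and>
    (\<forall>\<omega> u s. nice \<omega> \<and> t \<le> s \<and> bt u \<omega> \<le> s \<and> bp \<infinity> u \<omega> < \<infinity> \<and> enn2real (bp \<infinity> u \<omega>) + \<xi> u (s - bt u \<omega>) \<omega> < x \<longrightarrow> \<omega> \<in> L)"
proof -
  define n0 where "n0 = cell mesh t"
  define V where "V = (\<lambda>u \<omega>. ennreal (exp_neg l (bp (ennreal x) u \<omega>)) *
      ennreal (exp (- l * \<xi> u (max 0 (real n0 - real (cell mesh (bt u \<omega>)) - 1) * mesh) \<omega>)))"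
  define Lu where "Lu = (\<lambda>u. {\<omega> \<in> space M. 1 \<le> ennreal (exp (l * x)) * V u \<omega>})"
  have VM: "V u \<in> borel_measurable M" for u
  proof -
    have "(\<lambda>\<omega>. ennreal (exp (- l * \<xi> u (max 0 (real n0 - real n - 1) * mesh) \<omega>))) \<in> borel_measurable M" for n :: nat
      using mesh_pos by (intro measurable_noise_M[OF measurable_xi_weight]) simp
    then have "(\<lambda>\<omega>. ennreal (exp (- l * \<xi> u (max 0 (real n0 - real (cell mesh (bt u \<omega>)) - 1) * mesh) \<omega>))) \<in> borel_measurable M"
      by (rule measurable_compose_countable[OF _ measurable_noise_M[OF measurable_cell_bt[OF order_refl]]])
    moreover have "(\<lambda>\<omega>. ennreal (exp_neg l (bp (ennreal x) u \<omega>))) \<in> borel_measurable M"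
      by (rule measurable_noise_M[OF measurable_compose[OF measurable_compose[OF measurable_bp measurable_exp_neg] measurable_ennreal]])
    ultimately show ?thesis unfolding V_def by (rule borel_measurable_times_ennreal[rotated])
  qed
  have Lu: "Lu u \<in> sets M" for u using VM[of u] unfolding Lu_def by measurable
  define A where "A = ennreal (exp (l * x)) * ennreal (exp (1 - real n0 / 2))"
  have PLu: "emeasure M (Lu u) \<le> A * (\<integral>\<^sup>+\<omega>. weight u \<omega> \<partial>M)" for u
  proof -
    have "emeasure M (Lu u) = (\<integral>\<^sup>+\<omega>. indicator (Lu u) \<omega> \<partial>M)" using Lu by simp
    also have "\<dots> \<le> (\<integral>\<^sup>+\<omega>. ennreal (exp (l * x)) * V u \<omega> \<partial>M)"
      by (rule nn_integral_mono) (auto simp: indicator_def Lu_def)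
    also have "\<dots> = ennreal (exp (l * x)) * (\<integral>\<^sup>+\<omega>. V u \<omega> \<partial>M)" by (rule nn_integral_cmult[OF VM])
    also have "\<dots> \<le> ennreal (exp (l * x)) * (ennreal (exp (1 - real n0 / 2)) * (\<integral>\<^sup>+\<omega>. weight u \<omega> \<partial>M))"
      unfolding V_def by (intro mult_left_mono nn_integral_endpoint_le) simp
    finally show ?thesis by (simp add: A_def mult.assoc)
  qed
  define L where "L = (\<Union>g. \<Union>u\<in>{u. length u = g}. Lu u)"
  have L: "L \<in> sets M" unfolding L_def using Lu by (intro sets.countable_UN' sets.countable_UN) auto
  have "emeasure M L \<le> (\<Sum>g. emeasure M (\<Union>u\<in>{u. length u = g}. Lu u))"
    unfolding L_def using Lu by (intro emeasure_subadditive_countably) (auto intro!: sets.countable_UN')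
  also have "\<dots> \<le> (\<Sum>g. A * moment g)"
  proof (intro suminf_le)
    fix g
    have "emeasure M (\<Union>u\<in>{u. length u = g}. Lu u) \<le> (\<integral>\<^sup>+u. emeasure M (Lu u) \<partial>count_space {u. length u = g})"
      using Lu by (intro emeasure_UN_le_nn_integral) auto
    also have "\<dots> \<le> (\<integral>\<^sup>+u. A * (\<integral>\<^sup>+\<omega>. weight u \<omega> \<partial>M) \<partial>count_space {u. length u = g})"
      by (rule nn_integral_mono) (rule PLu)
    also have "\<dots> = A * moment g" unfolding moment_def by (rule nn_integral_cmult) simp
    finally show "emeasure M (\<Union>u\<in>{u. length u = g}. Lu u) \<le> A * moment g" .
  qed simp_all
  also have "\<dots> \<le> (\<Sum>g. A * ennreal ((1/2) ^ g))"
    by (intro suminf_le mult_left_mono moment_le ratio) simp_all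
  also have "\<dots> = A * (\<Sum>g. ennreal ((1/2) ^ g))" by (rule ennreal_suminf_cmult)
  also have "(\<Sum>g. ennreal ((1/2) ^ g)) = ennreal 2"
  proof (rule suminf_ennreal_eq)
    show "(\<lambda>g. (1/2) ^ g) sums (2::real)" using geometric_sums[of "1/2::real"] by simp
  qed simp
  also have "A * ennreal 2 \<le> ennreal (2 * exp (l * x - t * laplace_exponent \<nu> l / 2 + 3 / 2))"
  proof -
    \<comment> \<open>Rounding t down to cell n0 loses less than one cell, that is 1/2 in the
      exponent; with the 1 from \<open>nn_integral_endpoint_le\<close> this is the 3/2.\<close>
    have "t < (real n0 + 1) / laplace_exponent \<nu> l"
      using cell_gt[OF mesh_pos t] unfolding n0_def by simp
    then have "t * laplace_exponent \<nu> l < real n0 + 1"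
      using \<phi> by (simp add: pos_less_divide_eq)
    then have "exp (l * x) * exp (1 - real n0 / 2) \<le> exp (l * x - t * laplace_exponent \<nu> l / 2 + 3 / 2)"
      by (simp add: exp_add[symmetric])
    moreover have "A * ennreal 2 = ennreal (exp (l * x) * exp (1 - real n0 / 2) * 2)"
      unfolding A_def by (simp only: ennreal_mult[symmetric] exp_ge_zero zero_le_numeral mult_nonneg_nonneg)
    ultimately show ?thesis by (simp only:) (intro ennreal_leI, simp)
  qed
  finally have PL: "emeasure M L \<le> ennreal (2 * exp (l * x - t * laplace_exponent \<nu> l / 2 + 3 / 2))" .
  have "\<omega> \<in> L" if h: "nice \<omega>" "t \<le> s" "bt u \<omega> \<le> s" "bp \<infinity> u \<omega> < \<infinity>"
    "enn2real (bp \<infinity> u \<omega>) + \<xi> u (s - bt u \<omega>) \<omega> < x" for \<omega> u s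
  proof -
    define r where "r = max 0 (real n0 - real (cell mesh (bt u \<omega>)) - 1) * mesh"
    have "r \<le> s - bt u \<omega>"
    proof (cases "real n0 - real (cell mesh (bt u \<omega>)) - 1 \<le> 0")
      case False
      have "real n0 * mesh \<le> t" unfolding n0_def by (rule cell_le[OF mesh_pos t])
      moreover have "bt u \<omega> < (real (cell mesh (bt u \<omega>)) + 1) * mesh" by (rule cell_gt[OF mesh_pos bt_nonneg])
      moreover have "r = real n0 * mesh - (real (cell mesh (bt u \<omega>)) + 1) * mesh"
        using False unfolding r_def left_diff_distrib[symmetric] by simp
      ultimately show ?thesis using h(2) by simp
    qed (use h(3) in \<open>simp add: r_def max_def\<close>)
    moreover have r0: "0 \<le> r" using mesh_pos by (simp add: r_def)
    ultimately have \<xi>: "\<xi> u r \<omega> \<le> \<xi> u (s - bt u \<omega>) \<omega>" "0 \<le> \<xi> u (s - bt u \<omega>) \<omega>"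
      using nice_mono[OF h(1)] nice_nonneg[OF h(1)] h(3) by auto
    obtain b where b: "0 \<le> b" "bp \<infinity> u \<omega> = ennreal b" using h(4) by (cases "bp \<infinity> u \<omega>") auto
    have bx: "b + \<xi> u r \<omega> < x" "b < x" using h(5) \<xi> b by auto
    have "bp (ennreal x) u \<omega> = ennreal b" using bp_cut[of u \<omega> x] b bx(2) by (simp add: ennreal_less_iff)
    then have "ennreal (exp (l * x)) * V u \<omega> = ennreal (exp (l * (x - b - \<xi> u r \<omega>)))"
      unfolding V_def r_def[symmetric] using b(1)
      by (simp add: exp_neg_ennreal ennreal_mult[symmetric] exp_add[symmetric] algebra_simps)
    moreover have "0 \<le> l * (x - b - \<xi> u r \<omega>)" using l bx(1) by (intro mult_nonneg_nonneg) auto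
    ultimately have "1 \<le> ennreal (exp (l * x)) * V u \<omega>" by simp
    then have "\<omega> \<in> Lu u" using h(1) by (simp add: Lu_def nice_def)
    then show ?thesis unfolding L_def by blast
  qed
  then show ?thesis using L PL by blast
qed

end

section \<open>Many particles near the origin\<close>

text \<open>The factors are replaced one at a time, the others being absorbed into H, which never
  involves the private sources \<open>B v\<close> of the factor under replacement. R is equality for
  the generating functions and <= for the failure probabilities, so one induction serves
  both.\<close>

lemma nn_integral_prod_iterate:
  fixes f g :: "label \<Rightarrow> 'w \<Rightarrow> ennreal"
  assumes R: "reflp R" "transp R" and U: "finite U"
    and f: "\<And>v. v \<in> U \<Longrightarrow> f v \<in> borel_measurable (noise (I \<union> B v))"
    and g: "\<And>v. v \<in> U \<Longrightarrow> g v \<in> borel_measurable (noise I)"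
    and disj: "\<And>v. v \<in> U \<Longrightarrow> I \<inter> B v = {}" "disjoint_family_on B U"
    and step: "\<And>v H. v \<in> U \<Longrightarrow> H \<in> borel_measurable (noise (- B v)) \<Longrightarrow>
      R (\<integral>\<^sup>+\<omega>. H \<omega> * f v \<omega> \<partial>M) (\<integral>\<^sup>+\<omega>. H \<omega> * g v \<omega> \<partial>M)"
    and H: "H \<in> borel_measurable (noise I)"
  shows "R (\<integral>\<^sup>+\<omega>. H \<omega> * (\<Prod>v\<in>U. f v \<omega>) \<partial>M) (\<integral>\<^sup>+\<omega>. H \<omega> * (\<Prod>v\<in>U. g v \<omega>) \<partial>M)"
  using U f g disj step H
proof (induction U arbitrary: H rule: finite_induct)
  case empty
  then show ?case using R(1) by (simp add: reflp_def)
next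
  case (insert v U)
  have H': "(\<lambda>\<omega>. H \<omega> * (\<Prod>v\<in>U. f v \<omega>)) \<in> borel_measurable (noise (- B v))"
  proof (intro borel_measurable_times_ennreal borel_measurable_prod_ennreal)
    show "H \<in> borel_measurable (noise (- B v))"
      using insert.prems(3)[of v] by (intro measurable_noise_mono[OF insert.prems(6)]) auto
    fix w assume w: "w \<in> U"
    then have "B v \<inter> B w = {}" using insert.prems(4) insert.hyps(2) by (auto simp: disjoint_family_on_def)
    then show "f w \<in> borel_measurable (noise (- B v))"
      using insert.prems(3)[of v] w by (intro measurable_noise_mono[OF insert.prems(1)[of w]]) auto
  qed
  have 1: "R (\<integral>\<^sup>+\<omega>. (H \<omega> * (\<Prod>v\<in>U. f v \<omega>)) * f v \<omega> \<partial>M) (\<integral>\<^sup>+\<omega>. (H \<omega> * (\<Prod>v\<in>U. f v \<omega>)) * g v \<omega> \<partial>M)"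
    by (rule insert.prems(5)[OF _ H']) simp
  have 2: "R (\<integral>\<^sup>+\<omega>. (H \<omega> * g v \<omega>) * (\<Prod>v\<in>U. f v \<omega>) \<partial>M) (\<integral>\<^sup>+\<omega>. (H \<omega> * g v \<omega>) * (\<Prod>v\<in>U. g v \<omega>) \<partial>M)"
  proof (rule insert.IH)
    show "(\<lambda>\<omega>. H \<omega> * g v \<omega>) \<in> borel_measurable (noise I)"
      using insert.prems(6) insert.prems(2)[of v] by (intro borel_measurable_times_ennreal) auto
    show "disjoint_family_on B U" using insert.prems(4) by (rule disjoint_family_on_mono[rotated]) auto
  qed (use insert.prems(1,2,3,5) in auto)
  have 3: "(\<integral>\<^sup>+\<omega>. (H \<omega> * (\<Prod>v\<in>U. f v \<omega>)) * g v \<omega> \<partial>M) = (\<integral>\<^sup>+\<omega>. (H \<omega> * g v \<omega>) * (\<Prod>v\<in>U. f v \<omega>) \<partial>M)"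
    by (rule nn_integral_cong) (simp only: mult_ac)
  have 4: "(\<integral>\<^sup>+\<omega>. H \<omega> * (\<Prod>v\<in>insert v U. f v \<omega>) \<partial>M) = (\<integral>\<^sup>+\<omega>. (H \<omega> * (\<Prod>v\<in>U. f v \<omega>)) * f v \<omega> \<partial>M)"
    by (rule nn_integral_cong) (simp only: prod.insert[OF insert.hyps] mult_ac)
  have 5: "(\<integral>\<^sup>+\<omega>. H \<omega> * (\<Prod>v\<in>insert v U. g v \<omega>) \<partial>M) = (\<integral>\<^sup>+\<omega>. (H \<omega> * g v \<omega>) * (\<Prod>v\<in>U. g v \<omega>) \<partial>M)"
    by (rule nn_integral_cong) (simp only: prod.insert[OF insert.hyps] mult_ac)
  show ?case unfolding 4 5 by (rule transpD[OF R(2) 1[unfolded 3] 2])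
qed

text \<open>The first integer strictly after the birth. Being determined by earlier generations and
  integer-valued, it allows windows that start at a random time to be treated cell by cell, at the
  price of a delay of at most 1.\<close>

definition clock :: "label \<Rightarrow> 'w \<Rightarrow> nat" where
  "clock v \<omega> = cell 1 (bt v \<omega>) + 1"

lemma clock_bounds: "bt v \<omega> < real (clock v \<omega>)" "real (clock v \<omega>) \<le> bt v \<omega> + 1"
  using cell_le[of 1 "bt v \<omega>"] cell_gt[of 1 "bt v \<omega>"] bt_nonneg[of v \<omega>] by (auto simp: clock_def)

lemma measurable_clock: "past (length u) \<subseteq> I \<Longrightarrow> clock u \<in> measurable (noise I) (count_space UNIV)"
proof -
  assume p: "past (length u) \<subseteq> I"
  have m: "(\<lambda>\<omega>. Suc (cell 1 (bt u \<omega>))) \<in> measurable (noise I) (count_space UNIV)"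
    by (rule measurable_compose[OF measurable_cell_bt[OF p, where h = 1], where g = Suc]) simp
  have eq: "clock u = (\<lambda>\<omega>. Suc (cell 1 (bt u \<omega>)))" by (rule ext) (simp add: clock_def)
  show ?thesis unfolding eq by (rule m)
qed

lemma measure_strip:
  assumes "0 \<le> s" "0 \<le> T"
  shows "measure intens (strip s (s + T)) = T * measure \<Theta> (space \<Theta>)"
proof -
  have "emeasure intens (strip s (s + T)) = ennreal T * ennreal (measure \<Theta> (space \<Theta>))"
    unfolding strip_def using emeasure_strip[of s "s + T" "space \<Theta>"] assms
    by (simp add: mark.emeasure_eq_measure)
  then have "measure intens (strip s (s + T)) = enn2real (ennreal T * ennreal (measure \<Theta> (space \<Theta>)))"
    by (simp only: measure_def)
  then show ?thesis using assms by (simp only: enn2real_mult enn2real_ennreal measure_nonneg)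
qed

lemma emeasure_strip_less: "0 \<le> s \<Longrightarrow> emeasure intens (strip s t) < \<infinity>"
  unfolding strip_def by (intro emeasure_strip_finite) auto

lemma nn_integral_count_strip:
  assumes "0 \<le> s" "0 \<le> T" and g: "g \<in> borel_measurable borel"
  shows "(\<integral>\<^sup>+\<omega>. g (point_count (pts u \<omega>) (strip s (s + T))) \<partial>M) =
    (\<Sum>k. g (of_nat k) * ennreal (exp (- (T * measure \<Theta> (space \<Theta>))) * (T * measure \<Theta> (space \<Theta>)) ^ k / fact k))"
proof -
  have st: "strip s (s + T) \<in> sets intens" using assms by (intro strip_in_sets)
  have "(\<integral>\<^sup>+\<omega>. g (point_count (P u \<omega>) (strip s (s + T))) \<partial>M) =
    (\<Sum>k. g (of_nat k) * ennreal (exp (- (T * measure \<Theta> (space \<Theta>))) * (T * measure \<Theta> (space \<Theta>)) ^ k / fact k))"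
    using poisson[of u] st emeasure_strip_less[OF assms(1), of "s + T"] assms
    unfolding poisson_process_def
    by (intro poisson_nn_integral) (auto simp: measure_strip)
  then show ?thesis by (simp add: nn_integral_pts[where g = "\<lambda>S. g (point_count S (strip s (s + T)))"])
qed

section \<open>A binary tree of well-behaved descendants\<close>

context
  fixes T K :: real
  assumes T: "0 < T" and K: "0 < K"
begin

text \<open>Two points in the window [n, n + T) provide two children. The motion is controlled up to
  age T + 1 because the window starts up to one unit after birth when n is the clock of v.\<close>

definition good_step :: "label \<Rightarrow> nat \<Rightarrow> 'w \<Rightarrow> bool" where
  "good_step v n \<omega> \<longleftrightarrow> 2 \<le> point_count (pts v \<omega>) (strip (real n) (real n + T)) \<and> \<xi> v (T + 1) \<omega> \<le> K"

lemma good_step_sets: "{\<omega> \<in> space M. good_step v n \<omega>} \<in> sets (noise {Inl v, Inr v})"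
proof -
  have [measurable]: "(\<lambda>\<omega>. point_count (pts v \<omega>) (strip (real n) (real n + T))) \<in> borel_measurable (noise {Inl v, Inr v})"
    by (intro measurable_pts strip_in_sets) auto
  have [measurable]: "\<xi> v (T + 1) \<in> borel_measurable (noise {Inl v, Inr v})"
    using T by (intro measurable_xi) auto
  have "{\<omega> \<in> space (noise {Inl v, Inr v}). 2 \<le> point_count (pts v \<omega>) (strip (real n) (real n + T)) \<and> \<xi> v (T + 1) \<omega> \<le> K} \<in> sets (noise {Inl v, Inr v})"
    by measurable
  then show ?thesis by (simp add: good_step_def)
qed

definition good_prob :: "label \<Rightarrow> real" where
  "good_prob v = prob {\<omega> \<in> space M. good_step v 0 \<omega>}"

text \<open>Stationarity of the Poisson points in time: the probability does not depend on where the
  window starts, so the random clock can be integrated out.\<close>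

lemma emeasure_good_step: "emeasure M {\<omega> \<in> space M. good_step v n \<omega>} = ennreal (good_prob v)"
proof -
  have gM: "{\<omega> \<in> space M. good_step v n \<omega>} \<in> sets M" for n using good_step_sets noise_sets_M by blast
  have eq: "emeasure M {\<omega> \<in> space M. good_step v n \<omega>} =
      (\<Sum>k. indicator {2..} (of_nat k :: ennreal) * ennreal (exp (- (T * measure \<Theta> (space \<Theta>))) * (T * measure \<Theta> (space \<Theta>)) ^ k / fact k)) *
      (\<integral>\<^sup>+\<omega>. indicator {..K} (\<xi> v (T + 1) \<omega>) \<partial>M)" for n
  proof -
    let ?c = "\<lambda>\<omega>. indicator {2..} (point_count (pts v \<omega>) (strip (real n) (real n + T))) :: ennreal"
    let ?x = "\<lambda>\<omega>. indicator {..K} (\<xi> v (T + 1) \<omega>) :: ennreal"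
    have c: "?c \<in> borel_measurable (noise {Inr v})"
      by (rule measurable_compose[OF measurable_pts[OF strip_in_sets]]) auto
    have x: "?x \<in> borel_measurable (noise {Inl v})"
      using T by (intro measurable_compose[OF measurable_xi]) auto
    have "emeasure M {\<omega> \<in> space M. good_step v n \<omega>} = (\<integral>\<^sup>+\<omega>. indicator {\<omega> \<in> space M. good_step v n \<omega>} \<omega> \<partial>M)"
      using gM by simp
    also have "\<dots> = (\<integral>\<^sup>+\<omega>. ?c \<omega> * ?x \<omega> \<partial>M)"
      by (rule nn_integral_cong) (simp add: good_step_def indicator_def)
    also have "\<dots> = (\<integral>\<^sup>+\<omega>. ?c \<omega> \<partial>M) * (\<integral>\<^sup>+\<omega>. ?x \<omega> \<partial>M)"
      by (rule nn_integral_noise_mult[OF _ c x]) simp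
    also have "(\<integral>\<^sup>+\<omega>. ?c \<omega> \<partial>M) = (\<Sum>k. indicator {2..} (of_nat k :: ennreal) *
        ennreal (exp (- (T * measure \<Theta> (space \<Theta>))) * (T * measure \<Theta> (space \<Theta>)) ^ k / fact k))"
      using T by (intro nn_integral_count_strip) auto
    finally show ?thesis .
  qed
  show ?thesis unfolding good_prob_def emeasure_eq_measure[symmetric] eq[of n] eq[of 0] ..
qed

lemma good_prob_bounds: "0 \<le> good_prob v" "good_prob v \<le> 1"
  by (simp_all add: good_prob_def)

text \<open>With y equal to T times the mass of \<Theta>, fewer than two points occur with
  probability exp (- y) (1 + y), and exp y >= (1 + y / 2) squared turns this into 4 / y; the
  remaining failure is the tail of the motion.\<close>

lemma good_prob_ge:
  "1 - good_prob v \<le> 4 / (T * measure \<Theta> (space \<Theta>)) + 2 * (T + 1) * laplace_exponent \<nu> (1 / K)"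
proof -
  define y where "y = T * measure \<Theta> (space \<Theta>)"
  have y: "0 < y"
    using T mark_pos by (auto simp: y_def mark.emeasure_eq_measure)
  let ?c = "\<lambda>\<omega>. point_count (P v \<omega>) (strip 0 (0 + T))"
  have st: "strip 0 (0 + T) \<in> sets intens" by (intro strip_in_sets) simp
  have law: "prob {\<omega> \<in> space M. ?c \<omega> = of_nat k} = exp (- y) * y ^ k / fact k" for k
    using poisson[of v] st emeasure_strip_less[of 0 "0 + T"] T measure_strip[of 0 T]
    unfolding poisson_process_def y_def by auto
  have c [measurable]: "?c \<in> borel_measurable M" using poisson[of v] st by (auto simp: poisson_process_def)
  have [measurable]: "\<xi> v (T + 1) \<in> borel_measurable M" using T subordinator_measurable[OF sub] by simp
  have gM: "{\<omega> \<in> space M. good_step v 0 \<omega>} \<in> sets M" using good_step_sets noise_sets_M by blast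
  have "1 - good_prob v = prob (space M - {\<omega> \<in> space M. good_step v 0 \<omega>})"
    unfolding good_prob_def by (rule prob_compl[OF gM, symmetric])
  also have "\<dots> \<le> prob ({\<omega> \<in> space M. ?c \<omega> = of_nat 0} \<union> {\<omega> \<in> space M. ?c \<omega> = of_nat 1} \<union> {\<omega> \<in> space M. K < \<xi> v (T + 1) \<omega>})"
  proof (rule finite_measure_mono_AE)
    show "AE \<omega> in M. \<omega> \<in> space M - {\<omega> \<in> space M. good_step v 0 \<omega>} \<longrightarrow>
        \<omega> \<in> {\<omega> \<in> space M. ?c \<omega> = of_nat 0} \<union> {\<omega> \<in> space M. ?c \<omega> = of_nat 1} \<union> {\<omega> \<in> space M. K < \<xi> v (T + 1) \<omega>}"
      using AE_pts
    proof eventually_elim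
      fix \<omega> assume eq: "\<forall>u. pts u \<omega> = P u \<omega>"
      have "?c \<omega> = of_nat 0 \<or> ?c \<omega> = of_nat 1" if "\<not> 2 \<le> ?c \<omega>"
      proof -
        have lt: "?c \<omega> < 2" using that by simp
        then have "?c \<omega> < \<infinity>" by (rule order_less_trans) simp
        then have cc: "?c \<omega> = of_nat (card (P v \<omega> \<inter> strip 0 (0 + T)))"
          by (intro point_count_finite) (simp only: point_count_finite_iff)
        then have "card (P v \<omega> \<inter> strip 0 (0 + T)) < 2" using lt by (metis of_nat_less_iff of_nat_numeral)
        then show ?thesis using cc by (auto simp: less_2_cases_iff)
      qed
      then show "\<omega> \<in> space M - {\<omega> \<in> space M. good_step v 0 \<omega>} \<longrightarrow>
        \<omega> \<in> {\<omega> \<in> space M. ?c \<omega> = of_nat 0} \<union> {\<omega> \<in> space M. ?c \<omega> = of_nat 1} \<union> {\<omega> \<in> space M. K < \<xi> v (T + 1) \<omega>}"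
        using eq by (auto simp: good_step_def not_le)
    qed
  qed measurable
  also have "\<dots> \<le> prob {\<omega> \<in> space M. ?c \<omega> = of_nat 0} + prob {\<omega> \<in> space M. ?c \<omega> = of_nat 1} + prob {\<omega> \<in> space M. K < \<xi> v (T + 1) \<omega>}"
    by (intro order_trans[OF measure_Un_le] add_mono measure_Un_le order_refl) measurable
  also have "prob {\<omega> \<in> space M. K < \<xi> v (T + 1) \<omega>} \<le> 2 * (T + 1) * laplace_exponent \<nu> (1 / K)"
    using T K by (intro subordinator_tail[OF sub]) auto
  also have "prob {\<omega> \<in> space M. ?c \<omega> = of_nat 0} + prob {\<omega> \<in> space M. ?c \<omega> = of_nat 1} \<le> 4 / y"
  proof -
    have e: "1 + y / 2 \<le> exp (y / 2)" by (rule exp_ge_add_one_self)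
    have "(1 + y) * y \<le> 4 * ((1 + y / 2) * (1 + y / 2))" using y by (simp add: field_simps)
    also have "\<dots> \<le> 4 * (exp (y / 2) * exp (y / 2))" using y e by (intro mult_left_mono mult_mono) auto
    also have "exp (y / 2) * exp (y / 2) = exp y" by (simp add: exp_add[symmetric])
    finally have "(1 + y) * y \<le> 4 * exp y" .
    then have "exp (- y) * (1 + y) \<le> 4 / y" using y by (simp add: exp_minus field_simps)
    then show ?thesis unfolding law by (simp add: algebra_simps)
  qed
  finally show ?thesis unfolding y_def by simp
qed

text \<open>The ancestor is exempt: labels of length 1 count as good whatever the ancestor did, and
  only their descendants must come from good steps.\<close>

fun anc_good :: "label \<Rightarrow> 'w \<Rightarrow> bool" where
  "anc_good [] \<omega> = True"
| "anc_good (e # v) \<omega> \<longleftrightarrow> v = [] \<or> (anc_good v \<omega> \<and> good_step v (clock v \<omega>) \<omega>)"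

lemma good_clock_sets:
  assumes "past (length v) \<subseteq> I" "Inl v \<in> I" "Inr v \<in> I"
  shows "{\<omega> \<in> space M. good_step v (clock v \<omega>) \<omega>} \<in> sets (noise I)"
proof -
  have [measurable]: "Measurable.pred (noise I) (good_step v n)" for n
    using good_step_sets[of v n] noise_mono[of "{Inl v, Inr v}" I] assms by (auto simp: pred_def)
  have "Measurable.pred (noise I) (\<lambda>\<omega>. good_step v (clock v \<omega>) \<omega>)"
    by (rule measurable_compose_countable[OF _ measurable_clock[OF assms(1)]]) measurable
  then show ?thesis by (simp add: pred_def)
qed

lemma anc_good_sets: "{\<omega> \<in> space M. anc_good v \<omega>} \<in> sets (noise (past (length v)))"
proof (induction v)
  case Nil
  then show ?case using sets.top[of "noise (past (length []))"] by simp
next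
  case (Cons e v)
  have sub: "past (length v) \<subseteq> past (length (e # v))" "Inl v \<in> past (length (e # v))" "Inr v \<in> past (length (e # v))"
    by (simp_all add: past_mono)
  have "{\<omega> \<in> space M. anc_good v \<omega>} \<inter> {\<omega> \<in> space M. good_step v (clock v \<omega>) \<omega>} \<in> sets (noise (past (length (e # v))))"
    using Cons noise_mono[OF sub(1)] good_clock_sets[OF sub] by blast
  moreover have "{\<omega> \<in> space M. anc_good (e # v) \<omega>} =
      (if v = [] then space (noise (past (length (e # v)))) else {\<omega> \<in> space M. anc_good v \<omega>} \<inter> {\<omega> \<in> space M. good_step v (clock v \<omega>) \<omega>})"
    by auto
  ultimately show ?case by (simp only: sets.top split: if_split) blast
qed

text \<open>Generating function at s of the number of good descendants of v after k generations, for
  a branching process with two children with probability \<open>good_prob\<close> and none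
  otherwise. The success probability may vary with the label, hence the argument v instead of the
  k-th iterate of one function.\<close>

fun value_fn :: "real \<Rightarrow> nat \<Rightarrow> label \<Rightarrow> real" where
  "value_fn s 0 v = s"
| "value_fn s (Suc k) v = (1 - good_prob v) + good_prob v * (value_fn s k ((0, 1) # v) * value_fn s k ((1, 1) # v))"

text \<open>The sources of v are integrated out. Whether the ancestors were good and where the
  window starts are determined by the past, and for each possible start the step succeeds with the
  same probability; the factor H may depend on anything except the sources of v.\<close>

lemma good_step_average:
  assumes H: "H \<in> borel_measurable (noise (- {Inl v, Inr v}))" and c: "0 \<le> c"
  shows "(\<integral>\<^sup>+\<omega>. H \<omega> * (if anc_good v \<omega> then if good_step v (clock v \<omega>) \<omega> then ennreal c else 1 else 1) \<partial>M) =
    (\<integral>\<^sup>+\<omega>. H \<omega> * (if anc_good v \<omega> then ennreal ((1 - good_prob v) + good_prob v * c) else 1) \<partial>M)"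
proof -
  let ?J = "{Inl v, Inr v} :: (label + label) set"
  have past: "past (length v) \<subseteq> - ?J" by (auto simp: past_def)
  define A where "A = {\<omega> \<in> space M. anc_good v \<omega>}"
  have A: "A \<in> sets (noise (- ?J))" using anc_good_sets[of v] noise_mono[OF past] unfolding A_def by blast
  define f where "f = (\<lambda>n \<omega>. ennreal c * indicator {\<omega> \<in> space M. good_step v n \<omega>} \<omega> + indicator (space M - {\<omega> \<in> space M. good_step v n \<omega>}) \<omega>)"
  have f: "f n \<in> borel_measurable (noise ?J)" for n
  proof -
    have "space M - {\<omega> \<in> space M. good_step v n \<omega>} \<in> sets (noise ?J)"
      using sets.compl_sets[OF good_step_sets[of v n]] by simp
    then show ?thesis
      unfolding f_def using good_step_sets[of v n]
      by (intro borel_measurable_add borel_measurable_times_ennreal borel_measurable_indicator) simp_all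
  qed
  have Ef: "(\<integral>\<^sup>+\<omega>. f n \<omega> \<partial>M) = ennreal ((1 - good_prob v) + good_prob v * c)" for n
  proof -
    have gM: "{\<omega> \<in> space M. good_step v n \<omega>} \<in> sets M" using good_step_sets noise_sets_M by blast
    have "(\<integral>\<^sup>+\<omega>. f n \<omega> \<partial>M) = ennreal c * ennreal (good_prob v) + emeasure M (space M - {\<omega> \<in> space M. good_step v n \<omega>})"
      unfolding f_def using gM by (subst nn_integral_add) (auto simp: nn_integral_cmult emeasure_good_step)
    also have "emeasure M (space M - {\<omega> \<in> space M. good_step v n \<omega>}) = ennreal (1 - good_prob v)"
      using gM emeasure_good_step[of v n] good_prob_bounds(1)[of v]
      by (simp add: emeasure_eq_measure prob_compl)
    finally show ?thesis
      using c good_prob_bounds[of v] by (simp add: ennreal_mult[symmetric] ennreal_plus[symmetric] mult.commute add.commute del: ennreal_plus)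
  qed
  have HA: "(\<lambda>\<omega>. H \<omega> * indicator A \<omega>) \<in> borel_measurable (noise (- ?J))"
    using H A by (intro borel_measurable_times_ennreal borel_measurable_indicator)
  have HB: "(\<lambda>\<omega>. H \<omega> * indicator (space M - A) \<omega>) \<in> borel_measurable (noise (- ?J))"
    using H sets.compl_sets[OF A] by (intro borel_measurable_times_ennreal borel_measurable_indicator) simp_all
  have clk: "clock v \<in> measurable (noise (- ?J)) (count_space UNIV)" by (rule measurable_clock[OF past])
  have fM: "(\<lambda>\<omega>. f (clock v \<omega>) \<omega>) \<in> borel_measurable M"
    by (rule measurable_compose_countable[OF measurable_noise_M[OF f] measurable_noise_M[OF clk]])
  have "(\<integral>\<^sup>+\<omega>. H \<omega> * (if anc_good v \<omega> then if good_step v (clock v \<omega>) \<omega> then ennreal c else 1 else 1) \<partial>M) =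
    (\<integral>\<^sup>+\<omega>. H \<omega> * indicator (space M - A) \<omega> + (H \<omega> * indicator A \<omega>) * f (clock v \<omega>) \<omega> \<partial>M)"
    by (rule nn_integral_cong) (auto simp: A_def f_def indicator_def)
  also have "\<dots> = (\<integral>\<^sup>+\<omega>. H \<omega> * indicator (space M - A) \<omega> \<partial>M) + (\<integral>\<^sup>+\<omega>. (H \<omega> * indicator A \<omega>) * f (clock v \<omega>) \<omega> \<partial>M)"
    by (rule nn_integral_add[OF measurable_noise_M[OF HB] borel_measurable_times_ennreal[OF measurable_noise_M[OF HA] fM]])
  also have "(\<integral>\<^sup>+\<omega>. (H \<omega> * indicator A \<omega>) * f (clock v \<omega>) \<omega> \<partial>M) =
      (\<Sum>n. (\<integral>\<^sup>+\<omega>. (H \<omega> * indicator A \<omega>) * indicator {n} (clock v \<omega>) \<partial>M) * (\<integral>\<^sup>+\<omega>. f n \<omega> \<partial>M))"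
    by (rule nn_integral_cells[OF _ HA clk f]) simp
  also have "\<dots> = (\<integral>\<^sup>+\<omega>. H \<omega> * indicator A \<omega> \<partial>M) * ennreal ((1 - good_prob v) + good_prob v * c)"
    unfolding Ef ennreal_suminf_multc
    by (simp only: nn_integral_split_cells[OF measurable_noise_M[OF HA] measurable_noise_M[OF clk]])
  also have "\<dots> = (\<integral>\<^sup>+\<omega>. (H \<omega> * indicator A \<omega>) * ennreal ((1 - good_prob v) + good_prob v * c) \<partial>M)"
    by (rule nn_integral_multc[symmetric, OF measurable_noise_M[OF HA]])
  also have "(\<integral>\<^sup>+\<omega>. H \<omega> * indicator (space M - A) \<omega> \<partial>M) + \<dots> =
      (\<integral>\<^sup>+\<omega>. H \<omega> * indicator (space M - A) \<omega> + (H \<omega> * indicator A \<omega>) * ennreal ((1 - good_prob v) + good_prob v * c) \<partial>M)"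
    by (rule nn_integral_add[symmetric, OF measurable_noise_M[OF HB]
          borel_measurable_times_ennreal[OF measurable_noise_M[OF HA] borel_measurable_const]])
  also have "\<dots> = (\<integral>\<^sup>+\<omega>. H \<omega> * (if anc_good v \<omega> then ennreal ((1 - good_prob v) + good_prob v * c) else 1) \<partial>M)"
    by (rule nn_integral_cong) (auto simp: A_def indicator_def)
  finally show ?thesis .
qed

end

end

text \<open>Binary trees grafted on the first m children of the ancestor: each further generation
  uses the branchings number 0 and 1, and in each of them the child of index 1, which exists because
  good marks have \<open>x 1 < \<infinity>\<close>.\<close>

fun gen :: "nat \<Rightarrow> nat \<Rightarrow> label set" where
  "gen m 0 = (\<lambda>k. [(k, 1)]) ` {..<m}"
| "gen m (Suc n) = (#) (0, 1) ` gen m n \<union> (#) (1, 1) ` gen m n"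

lemma finite_gen: "finite (gen m n)"
  by (induction n) auto

lemma length_gen: "v \<in> gen m n \<Longrightarrow> length v = Suc n"
  by (induction n arbitrary: v) auto

lemma prod_gen_Suc:
  "(\<Prod>v\<in>gen m (Suc n). f v) = (\<Prod>v\<in>gen m n. f ((0, 1) # v) * (f ((1, 1) # v) :: 'a :: comm_monoid_mult))"
proof -
  have "(\<Prod>v\<in>gen m (Suc n). f v) = (\<Prod>v\<in>(#) (0, 1) ` gen m n. f v) * (\<Prod>v\<in>(#) (1, 1) ` gen m n. f v)"
    unfolding gen.simps using finite_gen by (intro prod.union_disjoint) auto
  also have "\<dots> = (\<Prod>v\<in>gen m n. f ((0, 1) # v)) * (\<Prod>v\<in>gen m n. f ((1, 1) # v))"
    by (simp add: prod.reindex inj_on_def)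
  finally show ?thesis by (simp add: prod.distrib)
qed

section \<open>Generating functions of the binary tree\<close>

context branching_noise
begin

context
  fixes T K :: real
  assumes T: "0 < T" and K: "0 < K" and good: "\<And>v. 31 / 32 \<le> good_prob T K v"
begin

abbreviation "anc \<equiv> anc_good T K"
abbreviation "val \<equiv> value_fn T K"

text \<open>The interval [0, 1/16] is stable: the recursion gives at most 1/32 + (1/16) (1/16),
  which is below 1/16. This is where the bound 31/32 on the success probability comes from.\<close>

lemma value_fn_bounds:
  assumes "0 \<le> s" "s \<le> 1 / 16"
  shows "0 \<le> val s k v \<and> val s k v \<le> 1 / 16"
proof (induction k arbitrary: v)
  case (Suc k)
  let ?x = "val s k ((0, 1) # v)" and ?y = "val s k ((1, 1) # v)"
  have xy: "0 \<le> ?x" "?x \<le> 1/16" "0 \<le> ?y" "?y \<le> 1/16" using Suc by auto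
  have "?x * ?y \<le> (1/16) * (1/16)" using xy by (intro mult_mono) auto
  moreover have "0 \<le> ?x * ?y" using xy by simp
  moreover have "good_prob T K v * (?x * ?y) \<le> 1 * (?x * ?y)"
    using good_prob_bounds(2)[OF T K, of v] xy by (intro mult_right_mono) auto
  moreover have "0 \<le> good_prob T K v * (?x * ?y)"
    using good_prob_bounds(1)[OF T K, of v] xy by simp
  ultimately show ?case using good[of v] good_prob_bounds(2)[OF T K, of v]
    by (simp add: value_fn.simps(2)[OF T K])
qed (use assms in \<open>simp add: value_fn.simps(1)[OF T K]\<close>)

text \<open>On [0, 1/16] the product of two variables has Lipschitz constant 1/16 in each of them,
  so one generation contracts by 1/8. The starting values differ by 1/16, which is below 1.\<close>

lemma value_fn_contraction:
  "\<bar>val (1/16) k v - val 0 k v\<bar> \<le> (1/8) ^ k"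
proof (induction k arbitrary: v)
  case (Suc k)
  let ?x = "val (1/16) k ((0, 1) # v)" and ?y = "val (1/16) k ((1, 1) # v)"
  let ?x' = "val 0 k ((0, 1) # v)" and ?y' = "val 0 k ((1, 1) # v)"
  have b: "0 \<le> ?x" "?x \<le> 1/16" "0 \<le> ?y'" "?y' \<le> 1/16"
    using value_fn_bounds[of "1/16" k] value_fn_bounds[of 0 k] by auto
  have eq: "?x * ?y - ?x' * ?y' = ?x * (?y - ?y') + ?y' * (?x - ?x')" by (simp only: right_diff_distrib) simp
  have "\<bar>?x * ?y - ?x' * ?y'\<bar> \<le> \<bar>?x\<bar> * \<bar>?y - ?y'\<bar> + \<bar>?y'\<bar> * \<bar>?x - ?x'\<bar>"
    unfolding eq abs_mult[symmetric] by (rule abs_triangle_ineq)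
  also have "\<dots> \<le> (1/16) * (1/8) ^ k + (1/16) * (1/8) ^ k"
    using b by (intro add_mono mult_mono Suc) auto
  also have "\<dots> = (1/8) ^ Suc k" by simp
  finally have le: "\<bar>?x * ?y - ?x' * ?y'\<bar> \<le> (1/8) ^ Suc k" .
  have "val (1/16) (Suc k) v - val 0 (Suc k) v = good_prob T K v * (?x * ?y - ?x' * ?y')"
    by (simp add: value_fn.simps(2)[OF T K] algebra_simps)
  then have "\<bar>val (1/16) (Suc k) v - val 0 (Suc k) v\<bar> = good_prob T K v * \<bar>?x * ?y - ?x' * ?y'\<bar>"
    using good_prob_bounds(1)[OF T K, of v] by (simp add: abs_mult del: value_fn.simps)
  also have "\<dots> \<le> 1 * \<bar>?x * ?y - ?x' * ?y'\<bar>"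
    using good_prob_bounds(2)[OF T K, of v] by (intro mult_right_mono) auto
  also have "1 * \<bar>?x * ?y - ?x' * ?y'\<bar> = \<bar>?x * ?y - ?x' * ?y'\<bar>" by simp
  also note le
  finally show ?case .
qed (simp add: value_fn.simps(1)[OF T K])

text \<open>One generation is integrated out at once: labels of equal length have disjoint private
  sources, and each factor becomes the value one generation higher up.\<close>

lemma gen_step:
  assumes s: "0 \<le> s" "s \<le> 1 / 16"
  shows "(\<integral>\<^sup>+\<omega>. (\<Prod>v\<in>gen m (Suc n). if anc v \<omega> then ennreal (val s k v) else 1) \<partial>M) =
    (\<integral>\<^sup>+\<omega>. (\<Prod>v\<in>gen m n. if anc v \<omega> then ennreal (val s (Suc k) v) else 1) \<partial>M)"
proof -
  define c where "c = (\<lambda>v. val s k ((0, 1) # v) * val s k ((1, 1) # v))"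
  have c0: "0 \<le> c v" for v
    unfolding c_def using value_fn_bounds[OF s, of k] by (intro mult_nonneg_nonneg) auto
  define f where "f = (\<lambda>v \<omega>. if anc v \<omega> then if good_step T K v (clock v \<omega>) \<omega> then ennreal (c v) else 1 else 1)"
  define g where "g = (\<lambda>v \<omega>. if anc v \<omega> then ennreal ((1 - good_prob T K v) + good_prob T K v * c v) else 1)"
  have ancI: "{\<omega> \<in> space (noise (past (Suc n))). anc v \<omega>} \<in> sets (noise (past (Suc n)))" if "v \<in> gen m n" for v
    using anc_good_sets[OF T K, of v] length_gen[OF that] by simp
  have anc_meas: "Measurable.pred (noise J) (anc v)" if "v \<in> gen m n" "past (Suc n) \<subseteq> J" for v J
    using ancI[OF that(1)] noise_mono[OF that(2)] by (auto simp: pred_def)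
  have gm: "g v \<in> borel_measurable (noise (past (Suc n)))" if "v \<in> gen m n" for v
    using anc_meas[OF that order_refl] unfolding g_def by measurable
  have fm: "f v \<in> borel_measurable (noise (past (Suc n) \<union> {Inl v, Inr v}))" if "v \<in> gen m n" for v
  proof -
    have "Measurable.pred (noise (past (Suc n) \<union> {Inl v, Inr v})) (\<lambda>\<omega>. good_step T K v (clock v \<omega>) \<omega>)"
    proof -
      have "{\<omega> \<in> space M. good_step T K v (clock v \<omega>) \<omega>} \<in> sets (noise (past (Suc n) \<union> {Inl v, Inr v}))"
      proof (rule good_clock_sets[OF T K])
        show "past (length v) \<subseteq> past (Suc n) \<union> {Inl v, Inr v}" using length_gen[OF that] by auto
      qed simp_all
      then show ?thesis by (simp add: pred_def)
    qed
    then show ?thesis using anc_meas[OF that Un_upper1[of _ "{Inl v, Inr v}"]] unfolding f_def by measurable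
  qed
  have split: "(\<Prod>v\<in>gen m (Suc n). if anc v \<omega> then ennreal (val s k v) else 1) = (\<Prod>v\<in>gen m n. f v \<omega>)" for \<omega>
    unfolding prod_gen_Suc
  proof (rule prod.cong)
    fix v assume "v \<in> gen m n"
    then have "v \<noteq> []" using length_gen by force
    then show "(if anc ((0, 1) # v) \<omega> then ennreal (val s k ((0, 1) # v)) else 1) *
      (if anc ((1, 1) # v) \<omega> then ennreal (val s k ((1, 1) # v)) else 1) = f v \<omega>"
      using value_fn_bounds[OF s, of k] by (simp add: f_def c_def ennreal_mult anc_good.simps(2)[OF T K])
  qed simp
  have "(\<integral>\<^sup>+\<omega>. 1 * (\<Prod>v\<in>gen m n. f v \<omega>) \<partial>M) = (\<integral>\<^sup>+\<omega>. 1 * (\<Prod>v\<in>gen m n. g v \<omega>) \<partial>M)"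
  proof (rule nn_integral_prod_iterate[where R = "(=)" and I = "past (Suc n)" and B = "\<lambda>v. {Inl v, Inr v}"])
    show "past (Suc n) \<inter> {Inl v, Inr v} = {}" if "v \<in> gen m n" for v
      using length_gen[OF that] by simp
    show "disjoint_family_on (\<lambda>v. {Inl v, Inr v}) (gen m n)" by (auto simp: disjoint_family_on_def)
    show "(\<integral>\<^sup>+\<omega>. H \<omega> * f v \<omega> \<partial>M) = (\<integral>\<^sup>+\<omega>. H \<omega> * g v \<omega> \<partial>M)" if "H \<in> borel_measurable (noise (- {Inl v, Inr v}))" for v H
      unfolding f_def g_def by (rule good_step_average[OF T K that c0])
  qed (use fm gm finite_gen in \<open>auto simp: reflp_def transp_def\<close>)
  then show ?thesis
    unfolding split by (simp only: mult_1_left g_def c_def value_fn.simps(2)[OF T K] cong: if_cong)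
qed

text \<open>Iterating \<open>gen_step\<close> down to the first generation, where all labels are
  good, leaves a product of deterministic values over the m trees.\<close>

lemma gen_integral:
  assumes s: "0 \<le> s" "s \<le> 1 / 16"
  shows "(\<integral>\<^sup>+\<omega>. (\<Prod>v\<in>gen m n. if anc v \<omega> then ennreal (val s k v) else 1) \<partial>M) = ennreal (\<Prod>j<m. val s (n + k) [(j, 1)])"
proof (induction n arbitrary: k)
  case 0
  have "(\<Prod>v\<in>gen m 0. if anc v \<omega> then ennreal (val s k v) else 1) = ennreal (\<Prod>j<m. val s k [(j, 1)])" for \<omega>
    using value_fn_bounds[OF s, of k] by (simp add: prod.reindex inj_on_def prod_ennreal anc_good.simps(2)[OF T K])
  then show ?case by (simp add: emeasure_space_1)
next
  case (Suc n)
  show ?case unfolding gen_step[OF s] Suc by simp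
qed

definition gsize :: "nat \<Rightarrow> nat \<Rightarrow> 'w \<Rightarrow> nat" where
  "gsize m n \<omega> = card {v \<in> gen m n. anc v \<omega>}"

lemma gsize_integral:
  assumes s: "0 \<le> s" "s \<le> 1 / 16"
  shows "(\<integral>\<^sup>+\<omega>. ennreal (s ^ gsize m n \<omega>) \<partial>M) = ennreal (\<Prod>j<m. val s n [(j, 1)])"
proof -
  have "ennreal (s ^ gsize m n \<omega>) = (\<Prod>v\<in>gen m n. if anc v \<omega> then ennreal (val s 0 v) else 1)" for \<omega>
  proof -
    have "(\<Prod>v\<in>gen m n. if anc v \<omega> then ennreal s else 1) = (\<Prod>v\<in>{v \<in> gen m n. anc v \<omega>}. ennreal s)"
      using finite_gen by (intro prod.inter_filter[symmetric]) simp
    then show ?thesis using s by (simp add: gsize_def ennreal_power value_fn.simps(1)[OF T K] cong: if_cong)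
  qed
  then show ?thesis using gen_integral[OF s, where m = m and n = n and k = 0] by simp
qed

lemma measurable_gsize: "gsize m n \<in> measurable M (count_space UNIV)"
proof -
  have a: "Measurable.pred M (anc v)" if "v \<in> gen m n" for v
    using anc_good_sets[OF T K, of v] noise_sets_M by (auto simp: pred_def)
  have "gsize m n \<omega> = (\<Sum>v\<in>gen m n. if anc v \<omega> then 1 else 0)" for \<omega>
    using finite_gen[of m n] by (simp add: gsize_def sum.If_cases Int_def)
  then have eq: "gsize m n = (\<lambda>\<omega>. \<Sum>v\<in>gen m n. if anc v \<omega> then 1 else 0)" by (rule ext)
  show ?thesis unfolding eq
  proof (rule measurable_sum_nat)
    fix v assume "v \<in> gen m n"
    then show "(\<lambda>\<omega>. if anc v \<omega> then 1 else 0) \<in> measurable M (count_space UNIV)" using a by measurable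
  qed
qed

lemma gsize_zero_Suc: "gsize m n \<omega> = 0 \<Longrightarrow> gsize m (Suc n) \<omega> = 0"
proof -
  assume "gsize m n \<omega> = 0"
  then have none: "\<not> anc v \<omega>" if "v \<in> gen m n" for v
    using that finite_gen[of m n] by (auto simp: gsize_def)
  have "{v \<in> gen m (Suc n). anc v \<omega>} = {}"
  proof -
    have "\<not> anc (e # v) \<omega>" if "v \<in> gen m n" for e v
      using none[OF that] length_gen[OF that] by (auto simp: anc_good.simps(2)[OF T K])
    then show ?thesis by auto
  qed
  then show ?thesis by (simp only: gsize_def card.empty)
qed

text \<open>The generating function at 0 is a product of m extinction probabilities, each at most
  1/16.\<close>

lemma prob_gsize_zero: "prob {\<omega> \<in> space M. gsize m n \<omega> = 0} \<le> (1/16) ^ m"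
proof -
  note [measurable] = measurable_gsize[of m n]
  have "emeasure M {\<omega> \<in> space M. gsize m n \<omega> = 0} = (\<integral>\<^sup>+\<omega>. indicator {\<omega> \<in> space M. gsize m n \<omega> = 0} \<omega> \<partial>M)"
    by (rule nn_integral_indicator[symmetric]) measurable
  also have "\<dots> = (\<integral>\<^sup>+\<omega>. ennreal (0 ^ gsize m n \<omega>) \<partial>M)"
    by (rule nn_integral_cong) (simp add: indicator_def)
  also have "\<dots> = ennreal (\<Prod>j<m. val 0 n [(j, 1)])" by (rule gsize_integral) auto
  also have "\<dots> \<le> ennreal (\<Prod>j<m. 1/16)"
    using value_fn_bounds[of 0 n] by (intro ennreal_leI prod_mono) auto
  finally show ?thesis by (simp add: emeasure_eq_measure)
qed

text \<open>The difference of the generating functions at 1/16 and at 0 is the mean of (1/16) ^ Z on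
  Z > 0, with Z the size of generation n. On the event this power is at least (1/4) ^ n, while the
  contraction bounds the difference by m (1/8) ^ n; the quotient is summable in n.\<close>

lemma prob_gsize_small: "prob {\<omega> \<in> space M. gsize m n \<omega> \<noteq> 0 \<and> 2 * gsize m n \<omega> \<le> n} \<le> real m * (1/2) ^ n"
proof -
  note [measurable] = measurable_gsize[of m n]
  let ?E = "{\<omega> \<in> space M. gsize m n \<omega> \<noteq> 0 \<and> 2 * gsize m n \<omega> \<le> n}"
  have E: "?E \<in> sets M" by measurable
  let ?p = "\<lambda>s. \<Prod>j<m. val s n [(j, 1)]"
  have pn: "0 \<le> ?p s" if "0 \<le> s" "s \<le> 1/16" for s
    using value_fn_bounds[OF that, of n] by (intro prod_nonneg) auto
  have m0: "(\<lambda>\<omega>. ennreal (0 ^ gsize m n \<omega>)) \<in> borel_measurable M" by measurable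
  have "ennreal ((1/4) ^ n * prob ?E + ?p 0) = ennreal ((1/4) ^ n) * emeasure M ?E + ennreal (?p 0)"
    using pn[of 0] by (simp add: emeasure_eq_measure ennreal_mult)
  also have "\<dots> = (\<integral>\<^sup>+\<omega>. ennreal ((1/4) ^ n) * indicator ?E \<omega> \<partial>M) + (\<integral>\<^sup>+\<omega>. ennreal (0 ^ gsize m n \<omega>) \<partial>M)"
    using E gsize_integral[where s = 0 and m = m and n = n] by (simp add: nn_integral_cmult_indicator)
  also have "\<dots> = (\<integral>\<^sup>+\<omega>. ennreal ((1/4) ^ n) * indicator ?E \<omega> + ennreal (0 ^ gsize m n \<omega>) \<partial>M)"
    using E by (intro nn_integral_add[symmetric] m0) auto
  also have "\<dots> \<le> (\<integral>\<^sup>+\<omega>. ennreal ((1/16) ^ gsize m n \<omega>) \<partial>M)"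
  proof (rule nn_integral_mono)
    fix \<omega>
    show "ennreal ((1/4) ^ n) * indicator ?E \<omega> + ennreal (0 ^ gsize m n \<omega>) \<le> ennreal ((1/16) ^ gsize m n \<omega>)"
    proof (cases "gsize m n \<omega> = 0")
      case False
      have "(1/4) ^ n \<le> ((1/16) ^ gsize m n \<omega> :: real)" if "2 * gsize m n \<omega> \<le> n"
      proof -
        have "(1/4) ^ n \<le> ((1/4) ^ (2 * gsize m n \<omega>) :: real)" using that by (intro power_decreasing) auto
        also have "\<dots> = (1/16) ^ gsize m n \<omega>" unfolding power_mult by (simp add: power2_eq_square)
        finally show ?thesis .
      qed
      then show ?thesis using False by (auto simp: indicator_def power_0_left intro!: ennreal_leI)
    qed (simp add: indicator_def)
  qed
  also have "\<dots> = ennreal (?p (1/16))" by (rule gsize_integral) auto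
  finally have "(1/4) ^ n * prob ?E + ?p 0 \<le> ?p (1/16)"
    using pn[of "1/16"] by (simp add: ennreal_le_iff)
  then have "(1/4) ^ n * prob ?E \<le> \<bar>?p (1/16) - ?p 0\<bar>" by simp
  also have "\<dots> \<le> (\<Sum>j<m. \<bar>val (1/16) n [(j, 1)] - val 0 n [(j, 1)]\<bar>)"
  proof -
    have "norm (val s n v) \<le> 1" if "s = 0 \<or> s = 1/16" for s v
      using that value_fn_bounds[of s n v] by auto
    then show ?thesis using norm_prod_diff[of "{..<m}" "\<lambda>j. val (1/16) n [(j, 1)]" "\<lambda>j. val 0 n [(j, 1)]"] by simp
  qed
  also have "\<dots> \<le> (\<Sum>j<m. (1/8) ^ n)" by (intro sum_mono value_fn_contraction)
  also have "\<dots> = real m * (1/8) ^ n" by simp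
  also have "(1/8 :: real) ^ n = (1/4) ^ n * (1/2) ^ n" by (simp add: power_mult_distrib[symmetric])
  finally show ?thesis by (simp add: field_simps)
qed

text \<open>Borel-Cantelli excludes, for each m, small but positive generations in the long run; and
  almost surely some m gives trees that never die out, since extinction for all m has probability
  below every (1/16) ^ m. Hence m is random.\<close>

lemma AE_gsize_large: "AE \<omega> in M. \<exists>m. eventually (\<lambda>n. n < 2 * gsize m n \<omega>) sequentially"
proof -
  note [measurable] = measurable_gsize
  let ?Z = "\<lambda>m n. {\<omega> \<in> space M. gsize m n \<omega> = 0}"
  have 1: "AE \<omega> in M. \<forall>m. eventually (\<lambda>n. \<omega> \<in> space M - {\<omega> \<in> space M. gsize m n \<omega> \<noteq> 0 \<and> 2 * gsize m n \<omega> \<le> n}) sequentially"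
    unfolding AE_all_countable
  proof
    fix m
    show "AE \<omega> in M. eventually (\<lambda>n. \<omega> \<in> space M - {\<omega> \<in> space M. gsize m n \<omega> \<noteq> 0 \<and> 2 * gsize m n \<omega> \<le> n}) sequentially"
    proof (rule borel_cantelli_AE1)
      have "summable (\<lambda>n. real m * (1/2) ^ n)" by (intro summable_mult summable_geometric) simp
      then show "summable (\<lambda>n. prob {\<omega> \<in> space M. gsize m n \<omega> \<noteq> 0 \<and> 2 * gsize m n \<omega> \<le> n})"
        by (rule summable_comparison_test'[where N = 0]) (use prob_gsize_small[of m] in simp)
    qed (auto simp: emeasure_eq_measure)
  qed
  have 2: "AE \<omega> in M. \<exists>m. \<forall>n. gsize m n \<omega> \<noteq> 0"
  proof -
    have Zm: "?Z m n \<in> sets M" for m n by measurable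
    have U: "prob (\<Union>n. ?Z m n) \<le> (1/16) ^ m" for m
    proof (rule LIMSEQ_le_const2)
      show "(\<lambda>n. prob (?Z m n)) \<longlonglongrightarrow> prob (\<Union>n. ?Z m n)"
        using Zm by (intro finite_Lim_measure_incseq incseq_SucI) (auto simp: gsize_zero_Suc)
      show "\<exists>N. \<forall>n\<ge>N. prob (?Z m n) \<le> (1/16) ^ m" using prob_gsize_zero by blast
    qed
    have UM: "(\<Union>n. ?Z m n) \<in> sets M" for m using Zm by blast
    have "prob (\<Inter>m. \<Union>n. ?Z m n) \<le> 0"
    proof (rule LIMSEQ_le_const)
      show "(\<lambda>m. (1/16 :: real) ^ m) \<longlonglongrightarrow> 0" by (rule LIMSEQ_power_zero) simp
      have "prob (\<Inter>m. \<Union>n. ?Z m n) \<le> (1/16) ^ m" for m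
      proof (rule order_trans[OF _ U])
        show "prob (\<Inter>m. \<Union>n. ?Z m n) \<le> prob (\<Union>n. ?Z m n)"
          by (rule finite_measure_mono[OF _ UM]) (rule INF_lower, simp)
      qed
      then show "\<exists>N. \<forall>m\<ge>N. prob (\<Inter>m. \<Union>n. ?Z m n) \<le> (1/16) ^ m" by blast
    qed
    then have "(\<Inter>m. \<Union>n. ?Z m n) \<in> null_sets M"
      using UM by (intro null_setsI sets.countable_INT) (auto simp: emeasure_eq_measure measure_le_0_iff)
    then show ?thesis by (rule AE_I') auto
  qed
  show ?thesis using 1 2
  proof eventually_elim
    fix \<omega>
    assume *: "\<forall>m. eventually (\<lambda>n. \<omega> \<in> space M - {\<omega> \<in> space M. gsize m n \<omega> \<noteq> 0 \<and> 2 * gsize m n \<omega> \<le> n}) sequentially"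
      and "\<exists>m. \<forall>n. gsize m n \<omega> \<noteq> 0"
    then obtain m where m: "\<forall>n. gsize m n \<omega> \<noteq> 0" by blast
    have "eventually (\<lambda>n. n < 2 * gsize m n \<omega>) sequentially"
      using *[rule_format, of m] by eventually_elim (use m in auto)
    then show "\<exists>m. eventually (\<lambda>n. n < 2 * gsize m n \<omega>) sequentially" by blast
  qed
qed

text \<open>If branching number 1 happened after the window, every point of the window would have
  rank 0 among the points since birth, so there could be only one. The time T + 1 and the distance K
  + a are the costs of one generation.\<close>

lemma good_step_children:
  assumes \<omega>: "nice \<omega>" and g: "good_step T K v (clock v \<omega>) \<omega>" and j: "j \<le> 1"
  shows "bt ((j, 1) # v) \<omega> \<le> bt v \<omega> + (T + 1)"
    and "bp \<infinity> ((j, 1) # v) \<omega> \<le> bp \<infinity> v \<omega> + ennreal K + ennreal a"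
proof -
  let ?S = "points_from (bt v \<omega>) (pts v \<omega>)"
  let ?st = "strip (real (clock v \<omega>)) (real (clock v \<omega>) + T)"
  have two: "2 \<le> point_count (pts v \<omega>) ?st" using g by (simp add: good_step_def[OF T K])
  have sub: "pts v \<omega> \<inter> ?st \<subseteq> ?S" using clock_bounds[of v \<omega>] by (auto simp: strip_def points_from_def)
  have fin: "finite (pts v \<omega> \<inter> ?st)"
    by (rule finite_subset[of _ "{p \<in> pts v \<omega>. fst p < real (clock v \<omega>) + T}"])
       (use regular_pts[of v \<omega>] in \<open>auto simp: regular_def strip_def\<close>)
  have card: "2 \<le> card (pts v \<omega> \<inter> ?st)"
    using two unfolding point_count_finite[OF fin] by (metis of_nat_le_iff of_nat_numeral)
  have lt1: "fst (br v 1 \<omega>) < real (clock v \<omega>) + T"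
  proof (rule ccontr)
    assume ge: "\<not> fst (br v 1 \<omega>) < real (clock v \<omega>) + T"
    have "rank ?S p = 0" if p: "p \<in> pts v \<omega> \<inter> ?st" for p
    proof -
      have "fst p < fst (br v 1 \<omega>)" using p ge by (auto simp: strip_def)
      then have "rank ?S p < rank ?S (nth_point ?S 1)"
        using p sub unfolding br_def by (intro rank_strict_mono[OF regular_from]) auto
      then show ?thesis by (simp add: rank_nth_point[OF regular_from])
    qed
    moreover have "inj_on (rank ?S) (pts v \<omega> \<inter> ?st)"
      using rank_bij[OF regular_from, of v \<omega>] sub by (auto simp: bij_betw_def intro: inj_on_subset)
    ultimately have "card (pts v \<omega> \<inter> ?st) \<le> card {0::nat}"
      by (intro card_inj_on_le[where f = "rank ?S"]) auto
    then show False using card by simp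
  qed
  have lt: "fst (br v j \<omega>) < real (clock v \<omega>) + T"
  proof (cases "j = 1")
    case False
    then have "fst (br v j \<omega>) < fst (br v 1 \<omega>)"
      using j unfolding br_def by (intro nth_point_strict_mono[OF regular_from]) simp
    then show ?thesis using lt1 by simp
  qed (use lt1 in simp)
  then show "bt ((j, 1) # v) \<omega> \<le> bt v \<omega> + (T + 1)" using clock_bounds(2)[of v \<omega>] by simp
  have L: "left_limit v (fst (br v j \<omega>) - bt v \<omega>) \<omega> \<le> ennreal K"
  proof -
    have r: "0 \<le> fst (br v j \<omega>) - bt v \<omega>" "fst (br v j \<omega>) - bt v \<omega> \<le> T + 1"
      using br_ge[of v \<omega> j] lt clock_bounds(2)[of v \<omega>] by auto
    have "\<xi> v (fst (br v j \<omega>) - bt v \<omega>) \<omega> \<le> K"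
      using nice_mono[OF \<omega> r, of v] g by (simp add: good_step_def[OF T K])
    then show ?thesis using left_limit_le[OF \<omega> r(1), of v] by (meson ennreal_leI order_trans)
  qed
  have "good_mark (snd (br v j \<omega>))" using pts_good_mark[OF br_in] .
  then have x: "snd (br v j \<omega>) 1 < \<infinity>" "snd (br v j \<omega>) 1 < ennreal a" by (auto simp: good_mark_def)
  have "bp \<infinity> ((j, 1) # v) \<omega> = bp \<infinity> v \<omega> + left_limit v (fst (br v j \<omega>) - bt v \<omega>) \<omega> + snd (br v j \<omega>) 1"
    using x(1) by simp
  also have "\<dots> \<le> bp \<infinity> v \<omega> + ennreal K + ennreal a"
    using x(2) by (intro add_mono L) auto
  finally show "bp \<infinity> ((j, 1) # v) \<omega> \<le> bp \<infinity> v \<omega> + ennreal K + ennreal a" .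
qed

end

end

lemma le_ennrealI: "X < \<infinity> \<Longrightarrow> enn2real X \<le> d \<Longrightarrow> X \<le> ennreal d"
  by (cases X) (auto intro: ennreal_leI)

section \<open>Choice of T and K, linear growth along the generations\<close>

context branching_noise
begin

text \<open>Read off the Laplace transform of \<xi> at time 1 by dominated convergence as its
  argument tends to 0, followed by a logarithm.\<close>

lemma laplace_exponent_small:
  assumes "0 < e"
  shows "\<exists>K>0. laplace_exponent \<nu> (1 / K) < e"
proof -
  define l where "l = (\<lambda>n. 1 / real (Suc n))"
  have l0: "l \<longlonglongrightarrow> 0" unfolding l_def by (rule LIMSEQ_Suc[OF lim_const_over_n])
  have xi [measurable]: "\<xi> [] 1 \<in> borel_measurable M" using subordinator_measurable[OF sub] by simp
  have lim: "(\<lambda>n. \<integral>\<omega>. exp (- l n * \<xi> [] 1 \<omega>) \<partial>M) \<longlonglongrightarrow> (\<integral>\<omega>. 1 \<partial>M)"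
  proof (rule integral_dominated_convergence[where w = "\<lambda>_. 1"])
    show "AE \<omega> in M. (\<lambda>n. exp (- l n * \<xi> [] 1 \<omega>)) \<longlonglongrightarrow> 1"
    proof (rule AE_I2)
      fix \<omega>
      have "(\<lambda>n. exp (- l n * \<xi> [] 1 \<omega>)) \<longlonglongrightarrow> exp (- 0 * \<xi> [] 1 \<omega>)" by (intro tendsto_intros l0)
      then show "(\<lambda>n. exp (- l n * \<xi> [] 1 \<omega>)) \<longlonglongrightarrow> 1" by simp
    qed
    show "AE \<omega> in M. norm (exp (- l n * \<xi> [] 1 \<omega>)) \<le> 1" for n
      using subordinator_nonneg[OF sub[of "[]"] zero_le_one]
      by eventually_elim (simp add: l_def)
  qed auto
  have eq: "(\<integral>\<omega>. exp (- l n * \<xi> [] 1 \<omega>) \<partial>M) = exp (- laplace_exponent \<nu> (l n))" for n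
  proof -
    have "0 \<le> l n" by (simp add: l_def)
    have "(\<integral>\<omega>. exp (- l n * \<xi> [] 1 \<omega>) \<partial>M) = exp (- 1 * laplace_exponent \<nu> (l n))"
      by (rule subordinator_laplace(1)[OF sub zero_le_one \<open>0 \<le> l n\<close>])
    then show ?thesis by (simp only: mult_minus1)
  qed
  have one: "(\<integral>\<omega>. 1 \<partial>M) = (1 :: real)" by (simp add: prob_space)
  have "(\<lambda>n. exp (- laplace_exponent \<nu> (l n))) \<longlonglongrightarrow> 1" using lim unfolding eq one .
  then have "(\<lambda>n. ln (exp (- laplace_exponent \<nu> (l n)))) \<longlonglongrightarrow> ln 1" by (rule tendsto_ln) simp
  then have "(\<lambda>n. - laplace_exponent \<nu> (l n)) \<longlonglongrightarrow> 0" by (simp only: ln_exp ln_one)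
  then have "eventually (\<lambda>n. - e < - laplace_exponent \<nu> (l n)) sequentially"
    by (rule order_tendstoD(1)) (simp add: assms)
  then obtain n where "- e < - laplace_exponent \<nu> (l n)" 
    using eventually_happens[of _ sequentially] by (metis sequentially_bot)
  then have "laplace_exponent \<nu> (l n) < e" by (simp only: neg_less_iff_less)
  then have "laplace_exponent \<nu> (1 / real (Suc n)) < e" unfolding l_def .
  moreover have "0 < real (Suc n)" by simp
  ultimately show ?thesis by (intro exI[of _ "real (Suc n)"] conjI)
qed

text \<open>The failure probability 1/32 is split evenly: T = 256 / r makes the Poisson part 1/64,
  and K is taken large enough, given T, for the tail part to be at most 1/64.\<close>

lemma ex_good_parameters: "\<exists>T>0. \<exists>K>0. \<forall>v. 31 / 32 \<le> good_prob T K v"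
proof -
  define r where "r = measure \<Theta> (space \<Theta>)"
  have r: "0 < r" using mark_pos by (auto simp: r_def mark.emeasure_eq_measure)
  define T where "T = 256 / r"
  have T: "0 < T" "4 / (T * r) = 1 / 64" using r by (auto simp: T_def)
  obtain K where K: "0 < K" "laplace_exponent \<nu> (1 / K) < 1 / (128 * (T + 1))"
    using laplace_exponent_small[of "1 / (128 * (T + 1))"] T(1) by auto
  have "2 * (T + 1) * laplace_exponent \<nu> (1 / K) \<le> 2 * (T + 1) * (1 / (128 * (T + 1)))"
    using K(2) T(1) by (intro mult_left_mono) auto
  also have "\<dots> = 1 / 64" using T(1) by (simp add: field_simps)
  finally have le: "2 * (T + 1) * laplace_exponent \<nu> (1 / K) \<le> 1 / 64" .
  have "31 / 32 \<le> good_prob T K v" for v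
    using good_prob_ge[OF T(1) K(1), of v] T(2) le unfolding r_def by simp
  then show ?thesis using T(1) K(1) by blast
qed

lemma root_child_finite:
  assumes "nice \<omega>" shows "bp \<infinity> [(k, 1)] \<omega> < \<infinity>"
proof -
  have "left_limit [] (fst (br [] k \<omega>) - bt [] \<omega>) \<omega> < \<infinity>"
    using left_limit_finite[OF assms] br_ge[of "[]" \<omega> k] by simp
  moreover have "snd (br [] k \<omega>) 1 < \<infinity>" using pts_good_mark[OF br_in] by (simp add: good_mark_def)
  ultimately show ?thesis by (simp add: less_top)
qed

text \<open>The ancestor is immortal, so that some child of it starts a family tree of well-behaved
  particles that never dies out, even though the ancestor itself may have a heavy-tailed motion.\<close>

lemma many_particles_nearby:
  "\<exists>\<kappa>>0. AE \<omega> in M. \<exists>D::nat. eventually (\<lambda>n. \<exists>F. finite F \<and> n < 2 * card F \<and>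
    (\<forall>u\<in>F. length u = Suc n \<and> bt u \<omega> \<le> real D + \<kappa> * real n \<and> bp \<infinity> u \<omega> \<le> ennreal (real D + \<kappa> * real n))) sequentially"
proof -
  obtain T K where T: "0 < T" and K: "0 < K" and good: "\<And>v. 31 / 32 \<le> good_prob T K v"
    using ex_good_parameters by blast
  \<comment> \<open>Cost per generation in time, T + 1, and in space, K + a; \<open>max a 0\<close>
    appears since no sign of a is assumed.\<close>
  define \<kappa> where "\<kappa> = max (T + 1) (K + max a 0)"
  have \<kappa>: "0 < \<kappa>" "T + 1 \<le> \<kappa>" "K + max a 0 \<le> \<kappa>" using T by (auto simp: \<kappa>_def)
  have step: "bt u \<omega> \<le> D + \<kappa> * real n \<and> bp \<infinity> u \<omega> \<le> ennreal (D + \<kappa> * real n)"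
    if \<omega>: "nice \<omega>" and D: "0 \<le> D" "\<And>k. k < m \<Longrightarrow> bt [(k, 1)] \<omega> \<le> D \<and> bp \<infinity> [(k, 1)] \<omega> \<le> ennreal D"
      and u: "u \<in> gen m n" "anc_good T K u \<omega>" for \<omega> D m n u
    using u
  proof (induction n arbitrary: u)
    case 0
    then show ?case using D(2) by auto
  next
    case (Suc n)
    then obtain j v where jv: "u = (j, 1) # v" "j \<le> 1" "v \<in> gen m n" by auto
    have ne: "v \<noteq> []" using length_gen[OF jv(3)] by auto
    then have v: "anc_good T K v \<omega>" "good_step T K v (clock v \<omega>) \<omega>"
      using Suc.prems(2) unfolding jv(1) anc_good.simps(2)[OF T K] by auto
    have IH: "bt v \<omega> \<le> D + \<kappa> * real n" "bp \<infinity> v \<omega> \<le> ennreal (D + \<kappa> * real n)"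
      using Suc.IH[OF jv(3) v(1)] by auto
    have "bt u \<omega> \<le> D + \<kappa> * real (Suc n)"
      using good_step_children(1)[OF T K good \<omega> v(2) jv(2)] IH(1) \<kappa>(2) unfolding jv(1) by (simp add: algebra_simps)
    moreover have "bp \<infinity> u \<omega> \<le> ennreal (D + \<kappa> * real (Suc n))"
    proof -
      have "bp \<infinity> u \<omega> \<le> ennreal (D + \<kappa> * real n) + ennreal K + ennreal (max a 0)"
        unfolding jv(1)
        by (rule order_trans[OF good_step_children(2)[OF T K good \<omega> v(2) jv(2)]]) (intro add_mono IH(2) order_refl ennreal_leI, simp)
      also have "\<dots> = ennreal (D + \<kappa> * real n + K + max a 0)"
        using D(1) \<kappa>(1) K by (simp add: ennreal_plus)
      also have "\<dots> \<le> ennreal (D + \<kappa> * real (Suc n))"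
        using \<kappa>(3) by (intro ennreal_leI) (simp add: algebra_simps)
      finally show ?thesis .
    qed
    ultimately show ?case by simp
  qed
  have "AE \<omega> in M. \<exists>D::nat. eventually (\<lambda>n. \<exists>F. finite F \<and> n < 2 * card F \<and>
    (\<forall>u\<in>F. length u = Suc n \<and> bt u \<omega> \<le> real D + \<kappa> * real n \<and> bp \<infinity> u \<omega> \<le> ennreal (real D + \<kappa> * real n))) sequentially"
    using AE_gsize_large[OF T K good] AE_nice
  proof eventually_elim
    fix \<omega> assume "\<exists>m. eventually (\<lambda>n. n < 2 * gsize T K m n \<omega>) sequentially" and \<omega>: "nice \<omega>"
    then obtain m where m: "eventually (\<lambda>n. n < 2 * gsize T K m n \<omega>) sequentially" by blast
    define c where "c = (\<lambda>k. bt [(k, 1)] \<omega> + enn2real (bp \<infinity> [(k, 1)] \<omega>))"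
    have c0: "0 \<le> c k" for k unfolding c_def using bt_nonneg[of "[(k, 1)]" \<omega>] by simp
    \<comment> \<open>A single D dominates birth times and birth positions of the roots of all m
      trees; it is an integer so that its random value can later be handled by countably many almost
      sure statements.\<close>
    obtain D :: nat where D: "(\<Sum>k<m. c k) < real D" using reals_Archimedean2 by blast
    have ck: "bt [(k, 1)] \<omega> \<le> real D \<and> bp \<infinity> [(k, 1)] \<omega> \<le> ennreal (real D)" if "k < m" for k
    proof -
      have "c k \<le> (\<Sum>k<m. c k)" using that c0 by (intro member_le_sum) auto
      then have le: "c k \<le> real D" using D by simp
      have fin: "bp \<infinity> [(k, 1)] \<omega> < \<infinity>" by (rule root_child_finite[OF \<omega>])
      have 1: "bt [(k, 1)] \<omega> \<le> real D" using le unfolding c_def by (meson enn2real_nonneg add_increasing2 order_trans order_refl)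
      have "enn2real (bp \<infinity> [(k, 1)] \<omega>) \<le> real D"
        using le bt_nonneg[of "[(k, 1)]" \<omega>] unfolding c_def by linarith
      then have "bp \<infinity> [(k, 1)] \<omega> \<le> ennreal (real D)" 
        by (rule le_ennrealI[OF fin])
      then show ?thesis using 1 by blast
    qed
    show "\<exists>D::nat. eventually (\<lambda>n. \<exists>F. finite F \<and> n < 2 * card F \<and>
      (\<forall>u\<in>F. length u = Suc n \<and> bt u \<omega> \<le> real D + \<kappa> * real n \<and> bp \<infinity> u \<omega> \<le> ennreal (real D + \<kappa> * real n))) sequentially"
    proof (rule exI[of _ D], rule eventually_mono[OF m])
      fix n assume n: "n < 2 * gsize T K m n \<omega>"
      show "\<exists>F. finite F \<and> n < 2 * card F \<and>
        (\<forall>u\<in>F. length u = Suc n \<and> bt u \<omega> \<le> real D + \<kappa> * real n \<and> bp \<infinity> u \<omega> \<le> ennreal (real D + \<kappa> * real n))"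
      proof (intro exI conjI ballI)
        show "finite {v \<in> gen m n. anc_good T K v \<omega>}" using finite_gen by simp
        show "n < 2 * card {v \<in> gen m n. anc_good T K v \<omega>}" using n unfolding gsize_def[OF T K good] .
        fix u assume u: "u \<in> {v \<in> gen m n. anc_good T K v \<omega>}"
        then show "length u = Suc n" using length_gen by blast
        show "bt u \<omega> \<le> real D + \<kappa> * real n" "bp \<infinity> u \<omega> \<le> ennreal (real D + \<kappa> * real n)"
          using step[OF \<omega> of_nat_0_le_iff ck, of m u n] u by auto
      qed
    qed
  qed
  then show ?thesis using \<kappa>(1) by blast
qed

end

section \<open>Slow children\<close>

lemma measurable_indicator_pred:
  "Measurable.pred N Q \<Longrightarrow> (indicator {\<omega>. Q \<omega>} :: 'a \<Rightarrow> ennreal) \<in> borel_measurable N"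
  by (subst borel_measurable_indicator_iff) (simp add: pred_def Int_def conj_commute)

definition kid_count :: "conf \<Rightarrow> nat" where
  "kid_count x = card {i. 1 \<le> i \<and> x i < \<infinity>}"

text \<open>The number of children is read off two coordinates, which gives its measurability. The
  cardinality 0 is also assigned to infinite sets, hence 1 <= k.\<close>

lemma kid_count_eq_iff:
  assumes "x \<in> Qset" "1 \<le> k"
  shows "kid_count x = k \<longleftrightarrow> x k < \<infinity> \<and> x (Suc k) = \<infinity>"
proof -
  have mono: "x j < \<infinity>" if "x i < \<infinity>" "j \<le> i" for i j
    using Qset_ge[OF assms(1) that(2)] that(1) by (rule order_le_less_trans)
  let ?A = "{i. 1 \<le> i \<and> x i < \<infinity>}"
  have A: "?A = {1..l}" if "x (Suc l) = \<infinity>" "l = 0 \<or> x l < \<infinity>" for l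
  proof (intro equalityI subsetI)
    fix i assume "i \<in> ?A"
    then have "\<not> Suc l \<le> i" using mono[of i "Suc l"] that(1) by auto
    then show "i \<in> {1..l}" using \<open>i \<in> ?A\<close> by simp
  next
    fix i assume "i \<in> {1..l}"
    then show "i \<in> ?A" using mono[of l i] that(2) by auto
  qed
  show ?thesis
  proof
    assume *: "x k < \<infinity> \<and> x (Suc k) = \<infinity>"
    then show "kid_count x = k" using A[of k] by (simp add: kid_count_def)
  next
    assume c: "kid_count x = k"
    then have fin: "finite ?A" using assms(2) by (metis card.infinite kid_count_def not_one_le_zero)
    define l where "l = Max (insert 0 ?A)"
    have l: "l \<in> insert 0 ?A" unfolding l_def using fin by (intro Max_in) auto
    have "Suc l \<notin> ?A"
    proof
      assume "Suc l \<in> ?A"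
      then have "Suc l \<le> l" unfolding l_def using fin by (intro Max_ge) auto
      then show False by simp
    qed
    then have "x (Suc l) = \<infinity>" by (simp add: less_top[symmetric])
    then have "?A = {1..l}" using A[of l] l by auto
    then have "l = k" using c by (simp add: kid_count_def)
    then show "x k < \<infinity> \<and> x (Suc k) = \<infinity>" using l assms(2) \<open>x (Suc l) = \<infinity>\<close> by auto
  qed
qed

context branching_noise
begin

lemma measurable_kid_count: "kid_count \<in> measurable \<Theta> (count_space UNIV)"
proof -
  have pre: "kid_count -` {k} \<inter> space \<Theta> \<in> sets \<Theta>" if "1 \<le> k" for k
  proof -
    have "{x \<in> space \<Theta>. x k < \<infinity> \<and> x (Suc k) = \<infinity>} \<in> sets \<Theta>"
    proof -
      have [measurable]: "(\<lambda>x. x k) \<in> borel_measurable \<Theta>" "(\<lambda>x. x (Suc k)) \<in> borel_measurable \<Theta>"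
        by (rule mark_coordinate)+
      show ?thesis by measurable
    qed
    moreover have "kid_count -` {k} \<inter> space \<Theta> = {x \<in> space \<Theta>. x k < \<infinity> \<and> x (Suc k) = \<infinity>}"
      using kid_count_eq_iff[OF _ that] mark_Qset by auto
    ultimately show ?thesis by simp
  qed
  have "kid_count -` {k} \<inter> space \<Theta> \<in> sets \<Theta>" for k
  proof (cases "k = 0")
    case True
    have "kid_count -` {0} \<inter> space \<Theta> = space \<Theta> - (\<Union>j\<in>{1..}. kid_count -` {j} \<inter> space \<Theta>)"
      by (auto simp: not_le)
    moreover have "\<dots> \<in> sets \<Theta>" using pre by (intro sets.Diff sets.countable_UN') auto
    ultimately show ?thesis using True by simp
  qed (use pre in simp)
  then show ?thesis by (subst measurable_count_space_eq2_countable) auto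
qed

definition kids :: "label \<Rightarrow> nat \<Rightarrow> 'w \<Rightarrow> (nat \<times> nat) set" where
  "kids v n \<omega> = {(k, i). fst (br v k \<omega>) \<in> {real n..<real n + 1} \<and> 1 \<le> i \<and> snd (br v k \<omega>) i < \<infinity>}"

definition kid_fun :: "nat \<Rightarrow> real \<times> conf \<Rightarrow> nat" where
  "kid_fun n p = (if fst p \<in> {real n..<real n + 1} then kid_count (snd p) else 0)"

lemma finite_marks: "x \<in> space \<Theta> \<Longrightarrow> good_mark x \<Longrightarrow> finite {i. 1 \<le> i \<and> x i < \<infinity>}"
proof -
  assume x: "x \<in> space \<Theta>" "good_mark x"
  have "{i. 1 \<le> i \<and> x i < \<infinity>} \<subseteq> {i. x i < ennreal a}" using x(2) by (auto simp: good_mark_def)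
  then show ?thesis using Qset_finite_less[of x a] mark_Qset x(1) finite_subset by blast
qed

text \<open>As n is not before the birth, all points of v in [n, n + 1) are branchings of v, so the
  random set of children is counted by a sum over the points, to which the Poisson formulas
  apply.\<close>

lemma kids_facts:
  assumes n: "bt v \<omega> \<le> real n"
  shows finite_kids: "finite (kids v n \<omega>)"
    and card_kids: "of_nat (card (kids v n \<omega>)) = point_sum (pts v \<omega>) (\<lambda>p. of_nat (kid_fun n p))"
proof -
  let ?S = "points_from (bt v \<omega>) (pts v \<omega>)"
  let ?p = "nth_point ?S"
  have br: "br v k \<omega> = ?p k" for k by (simp add: br_def)
  define Kx where "Kx = {k. fst (?p k) \<in> {real n..<real n + 1}}"
  have bij: "bij_betw ?p UNIV ?S" by (rule nth_point_bij[OF regular_from])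
  have fin: "finite {p \<in> ?S. fst p \<in> {real n..<real n + 1}}"
    by (rule finite_subset[of _ "{p \<in> ?S. fst p < real n + 1}"]) (use regular_from[of v \<omega>] in \<open>auto simp: regular_def\<close>)
  have bijK: "bij_betw ?p Kx {p \<in> ?S. fst p \<in> {real n..<real n + 1}}"
  proof (rule bij_betw_subset[OF bij])
    have im: "range ?p = ?S" using bij by (simp only: bij_betw_def)
    show "?p ` Kx = {p \<in> ?S. fst p \<in> {real n..<real n + 1}}"
    proof (intro equalityI subsetI)
      fix p assume "p \<in> ?p ` Kx"
      then show "p \<in> {p \<in> ?S. fst p \<in> {real n..<real n + 1}}" using im unfolding Kx_def by force
    next
      fix p assume p: "p \<in> {p \<in> ?S. fst p \<in> {real n..<real n + 1}}"
      then have "p \<in> range ?p" unfolding im by simp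
      then obtain k where k: "p = ?p k" by blast
      then have "k \<in> Kx" using p unfolding Kx_def by simp
      then show "p \<in> ?p ` Kx" unfolding k by (rule imageI)
    qed
  qed simp
  then have finK: "finite Kx" using fin bij_betw_finite by blast
  have marks: "finite {i. 1 \<le> i \<and> snd (?p k) i < \<infinity>}" for k
    using finite_marks pts_space[OF br_in, of v k \<omega>] pts_good_mark[OF br_in, of v k \<omega>] by (simp add: br)
  have eq: "kids v n \<omega> = Sigma Kx (\<lambda>k. {i. 1 \<le> i \<and> snd (?p k) i < \<infinity>})"
    by (auto simp: kids_def Kx_def br)
  show "finite (kids v n \<omega>)" unfolding eq using finK marks by blast
  have "card (kids v n \<omega>) = (\<Sum>k\<in>Kx. kid_count (snd (?p k)))"
    unfolding eq using finK marks by (subst card_SigmaI) (auto simp: kid_count_def)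
  then have "(of_nat (card (kids v n \<omega>)) :: ennreal) = (\<Sum>k\<in>Kx. of_nat (kid_count (snd (?p k))))" by simp
  also have "\<dots> = (\<Sum>p\<in>{p \<in> ?S. fst p \<in> {real n..<real n + 1}}. of_nat (kid_count (snd p)))"
    by (rule sum.reindex_bij_betw[OF bijK])
  also have "\<dots> = (\<integral>\<^sup>+p. of_nat (kid_count (snd p)) \<partial>count_space {p \<in> ?S. fst p \<in> {real n..<real n + 1}})"
    using fin by (subst nn_integral_count_space_finite) simp_all
  also have "\<dots> = (\<integral>\<^sup>+p. of_nat (kid_fun n p) \<partial>count_space (pts v \<omega>))"
    by (subst (1 2) nn_integral_count_space_indicator)
       (use n in \<open>auto intro!: nn_integral_cong simp: kid_fun_def indicator_def points_from_def\<close>)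
  finally show "of_nat (card (kids v n \<omega>)) = point_sum (pts v \<omega>) (\<lambda>p. of_nat (kid_fun n p))"
    by (simp add: point_sum_def)
qed

lemma measurable_kid_fun: "kid_fun n \<in> measurable intens (count_space UNIV)"
proof -
  have "(\<lambda>p. kid_count (snd p)) \<in> measurable intens (count_space UNIV)"
    by (rule measurable_compose[OF measurable_snd measurable_kid_count])
  moreover have "{p \<in> space intens. fst p \<in> {real n..<real n + 1}} \<in> sets intens"
  proof -
    have "{p \<in> space intens. fst p \<in> {real n..<real n + 1}} = strip (real n) (real n + 1)"
      by (auto simp: space_intens strip_def)
    then show ?thesis by (simp only:) (intro strip_in_sets of_nat_0_le_iff)
  qed
  ultimately show ?thesis
    unfolding kid_fun_def[abs_def] by (intro measurable_If) simp_all
qed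

lemma kid_laplace:
  assumes \<rho>: "0 < \<rho>" and c: "0 \<le> c" "ennreal c < (\<integral>\<^sup>+x. ennreal (1 - exp (- \<rho> * real (kid_count x))) \<partial>\<Theta>)"
  shows "(\<integral>\<^sup>+\<omega>. ennreal (exp_neg \<rho> (point_sum (pts v \<omega>) (\<lambda>p. of_nat (kid_fun n p)))) \<partial>M) \<le> ennreal (exp (- c))"
proof -
  let ?I = "{real n..<real n + 1}"
  let ?g = "\<lambda>x. ennreal (1 - exp (- \<rho> * real (kid_count x)))"
  have g: "?g \<in> borel_measurable \<Theta>" by (rule measurable_compose[OF measurable_kid_count]) simp
  have I_sets: "?I \<in> sets (restrict_space lborel {0..})"
    by (subst sets_restrict_space_iff) auto
  have f: "(\<lambda>p. indicator ?I (fst p) * ?g (snd p)) \<in> borel_measurable intens"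
    by (intro borel_measurable_times_ennreal measurable_compose[OF measurable_fst borel_measurable_indicator[OF I_sets]]
      measurable_compose[OF measurable_snd g])
  have "(\<integral>\<^sup>+p. ennreal (1 - exp (- \<rho> * real (kid_fun n p))) \<partial>intens) = (\<integral>\<^sup>+p. indicator ?I (fst p) * ?g (snd p) \<partial>intens)"
    by (rule nn_integral_cong) (simp add: kid_fun_def indicator_def)
  also have "\<dots> = (\<integral>\<^sup>+s. \<integral>\<^sup>+y. indicator ?I s * ?g y \<partial>\<Theta> \<partial>restrict_space lborel {0..})"
    by (subst mark.nn_integral_fst[OF f, symmetric]) simp
  also have "\<dots> = (\<integral>\<^sup>+s. indicator ?I s * (\<integral>\<^sup>+y. ?g y \<partial>\<Theta>) \<partial>restrict_space lborel {0..})"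
    by (simp only: nn_integral_cmult[OF g])
  also have "\<dots> = (\<integral>\<^sup>+s. indicator ?I s \<partial>restrict_space lborel {0..}) * (\<integral>\<^sup>+y. ?g y \<partial>\<Theta>)"
    by (rule nn_integral_multc[OF borel_measurable_indicator[OF I_sets]])
  also have "(\<integral>\<^sup>+s. indicator ?I s \<partial>restrict_space lborel {0..}) = emeasure (restrict_space lborel {0..}) ?I"
    by (rule nn_integral_indicator[OF I_sets])
  also have "\<dots> = emeasure lborel ?I" by (intro emeasure_restrict_space) auto
  also have "\<dots> = 1" by simp
  finally have eq: "(\<integral>\<^sup>+p. ennreal (1 - exp (- \<rho> * real (kid_fun n p))) \<partial>intens) = (\<integral>\<^sup>+y. ?g y \<partial>\<Theta>)" by simp
  have lt: "ennreal c < (\<integral>\<^sup>+p. ennreal (1 - exp (- \<rho> * real (kid_fun n p))) \<partial>intens)"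
    unfolding eq by (rule c(2))
  have fin: "emeasure intens {p \<in> space intens. kid_fun n p = k} < \<infinity>" if "0 < k" for k
  proof -
    have "{p \<in> space intens. kid_fun n p = k} \<subseteq> strip (real n) (real n + 1)"
      using that by (auto simp: kid_fun_def strip_def space_intens split: if_splits)
    then have "emeasure intens {p \<in> space intens. kid_fun n p = k} \<le> emeasure intens (strip (real n) (real n + 1))"
      by (rule emeasure_mono) (intro strip_in_sets of_nat_0_le_iff)
    then show ?thesis using emeasure_strip_less[of "real n" "real n + 1"] by (simp add: order_le_less_trans)
  qed
  have "(\<integral>\<^sup>+\<omega>. ennreal (exp_neg \<rho> (point_sum (P v \<omega>) (\<lambda>p. of_nat (kid_fun n p)))) \<partial>M) \<le> ennreal (exp (- c))"
    by (rule poisson_process_laplace_le[OF poisson measurable_kid_fun \<rho> fin lt c(1)])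
  then show ?thesis by (simp add: nn_integral_pts[where g = "\<lambda>S. ennreal (exp_neg \<rho> (point_sum S (\<lambda>p. of_nat (kid_fun n p))))"])
qed

section \<open>At least one slow child\<close>

context
  fixes t y K0 \<rho> c :: real
  assumes t: "0 \<le> t" and \<rho>: "0 < \<rho>" "\<rho> \<le> 1"
    and reach: "\<And>u. \<rho> \<le> prob {\<omega> \<in> space M. \<xi> u t \<omega> \<le> y}"
    and slow: "\<And>u. prob {\<omega> \<in> space M. K0 < \<xi> u 2 \<omega>} \<le> 1 / 2"
    and c: "0 \<le> c" "ennreal c < (\<integral>\<^sup>+x. ennreal (1 - exp (- \<rho> * real (kid_count x))) \<partial>\<Theta>)"
begin

text \<open>As \<open>clock v\<close> exceeds the birth time of \<open>v\<close> by at most 1, the children \<open>kids v (clock v \<omega>) \<omega>\<close>, born in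
  the following unit of time, are born before \<open>v\<close> has reached age 2.\<close>

definition fail :: "label \<Rightarrow> 'w \<Rightarrow> bool" where
  "fail v \<omega> \<longleftrightarrow> K0 < \<xi> v 2 \<omega> \<or> (\<forall>e\<in>kids v (clock v \<omega>) \<omega>. y < \<xi> (e # v) t \<omega>)"

text \<open>Everything beyond the past that decides whether v fails: its motion, its points, and the
  motions of all its potential children. Blocks of distinct labels of the same length do not
  meet.\<close>

definition block :: "label \<Rightarrow> (label + label) set" where
  "block v = {Inl v, Inr v} \<union> range (\<lambda>e. Inl (e # v))"

lemma block_disjoint:
  assumes "length u = length w" "u \<noteq> w"
  shows "block u \<inter> block w = {}"
proof -
  have ne: "e # w \<noteq> u" "e # u \<noteq> w" for e using assms(1) by (metis length_Cons n_not_Suc_n)+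
  have "i \<notin> block w" if "i \<in> block u" for i
    using that ne assms(2) by (auto simp: block_def)
  then show ?thesis by blast
qed

lemma kid_pred:
  assumes "past (length v) \<subseteq> I" "Inr v \<in> I"
  shows "Measurable.pred (noise I) (\<lambda>\<omega>. e \<in> kids v (clock v \<omega>) \<omega>)"
proof -
  obtain k i where e: "e = (k, i)" by (cases e)
  have [measurable]: "(\<lambda>\<omega>. fst (br v k \<omega>)) \<in> borel_measurable (noise I)" by (rule measurable_time[OF assms])
  have [measurable]: "(\<lambda>\<omega>. snd (br v k \<omega>) i) \<in> borel_measurable (noise I)" by (rule measurable_mark[OF assms])
  have "Measurable.pred (noise I) (\<lambda>\<omega>. e \<in> kids v n \<omega>)" for n
    unfolding e kids_def by (simp only: mem_Collect_eq prod.case atLeastLessThan_iff) measurable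
  then show ?thesis by (rule measurable_compose_countable[OF _ measurable_clock[OF assms(1)]])
qed

lemma xi_pred: "0 \<le> s \<Longrightarrow> Inl u \<in> I \<Longrightarrow> Measurable.pred (noise I) (\<lambda>\<omega>. z < \<xi> u s \<omega>)"
proof -
  assume "0 \<le> s" "Inl u \<in> I"
  then have [measurable]: "\<xi> u s \<in> borel_measurable (noise I)" by (rule measurable_xi)
  show ?thesis by measurable
qed

lemma all_kids_pred:
  assumes "past (length v) \<subseteq> I" "Inr v \<in> I" "range (\<lambda>e. Inl (e # v)) \<subseteq> I"
  shows "Measurable.pred (noise I) (\<lambda>\<omega>. \<forall>e\<in>kids v (clock v \<omega>) \<omega>. y < \<xi> (e # v) t \<omega>)"
proof -
  have [measurable]: "Measurable.pred (noise I) (\<lambda>\<omega>. e \<in> kids v (clock v \<omega>) \<omega>)" for e by (rule kid_pred[OF assms(1,2)])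
  have [measurable]: "Measurable.pred (noise I) (\<lambda>\<omega>. y < \<xi> (e # v) t \<omega>)" for e using assms(3) by (intro xi_pred t) blast
  have "Measurable.pred (noise I) (\<lambda>\<omega>. \<forall>e. e \<in> kids v (clock v \<omega>) \<omega> \<longrightarrow> y < \<xi> (e # v) t \<omega>)" by measurable
  then show ?thesis by (simp only: Ball_def)
qed

lemma fail_pred:
  assumes "past (length v) \<subseteq> I" "block v \<subseteq> I"
  shows "Measurable.pred (noise I) (fail v)"
proof -
  have [measurable]: "Measurable.pred (noise I) (\<lambda>\<omega>. \<forall>e\<in>kids v (clock v \<omega>) \<omega>. y < \<xi> (e # v) t \<omega>)"
    using assms by (intro all_kids_pred) (auto simp: block_def)
  have [measurable]: "Measurable.pred (noise I) (\<lambda>\<omega>. K0 < \<xi> v 2 \<omega>)" using assms by (intro xi_pred) (auto simp: block_def)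
  show ?thesis unfolding fail_def[abs_def] by measurable
qed

text \<open>Given the set of children, their motions are independent and each exceeds y with
  probability at most 1 - \<rho> <= exp (- \<rho>) = q. This leaves q to the power of the number of
  children, whose mean is a Laplace functional bounded by exp (- c). The number of children has no
  deterministic bound, so the labels are restricted to finite boxes and the box is enlarged by
  decreasing monotone convergence; this is where H must have a finite integral.\<close>

lemma kids_all_fail_le:
  assumes H: "H \<in> borel_measurable (noise (- block v))" and fin: "(\<integral>\<^sup>+\<omega>. H \<omega> \<partial>M) < \<infinity>"
  shows "(\<integral>\<^sup>+\<omega>. H \<omega> * indicator {\<omega>. \<forall>e\<in>kids v (clock v \<omega>) \<omega>. y < \<xi> (e # v) t \<omega>} \<omega> \<partial>M) \<le> ennreal (exp (- c)) * (\<integral>\<^sup>+\<omega>. H \<omega> \<partial>M)"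
proof -
  let ?C = "\<lambda>\<omega>. kids v (clock v \<omega>) \<omega>"
  let ?J = "- range (\<lambda>e. Inl (e # v)) :: (label + label) set"
  define q where "q = exp (- \<rho>)"
  have q: "0 < q" "q \<le> 1" using \<rho> by (auto simp: q_def)
  define U where "U = (\<lambda>N::nat. (\<lambda>e. e # v) ` ({..<N} \<times> {..<N}))"
  have past: "past (length v) \<subseteq> - block v" by (auto simp: past_def block_def)
  have pastJ: "past (length v) \<subseteq> ?J" by (auto simp: past_def)
  have HJ: "H \<in> borel_measurable (noise ?J)" by (rule measurable_noise_mono[OF H]) (auto simp: block_def)
  have HM: "H \<in> borel_measurable M" by (rule measurable_noise_M[OF H])
  define f where "f = (\<lambda>w \<omega>. if hd w \<in> ?C \<omega> then indicator {\<omega>. y < \<xi> w t \<omega>} \<omega> else 1 :: ennreal)"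
  define g where "g = (\<lambda>w \<omega>. if hd w \<in> ?C \<omega> then ennreal q else 1)"
  have Cpred: "Measurable.pred (noise I) (\<lambda>\<omega>. e \<in> ?C \<omega>)" if "?J \<subseteq> I" for I e
    using that pastJ by (intro kid_pred) auto
  have step1: "(\<integral>\<^sup>+\<omega>. H \<omega> * (\<Prod>w\<in>U N. f w \<omega>) \<partial>M) \<le> (\<integral>\<^sup>+\<omega>. H \<omega> * (\<Prod>w\<in>U N. g w \<omega>) \<partial>M)" for N
  proof (rule nn_integral_prod_iterate[where R = "(\<le>)" and I = ?J and B = "\<lambda>w. {Inl w}"])
    show "reflp ((\<le>) :: ennreal \<Rightarrow> ennreal \<Rightarrow> bool)" "transp ((\<le>) :: ennreal \<Rightarrow> ennreal \<Rightarrow> bool)"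
      by (auto simp: reflp_def transp_def)
    show "finite (U N)" by (simp add: U_def)
    fix w assume w: "w \<in> U N"
    then obtain e where e: "w = e # v" by (auto simp: U_def)
    have xp: "Measurable.pred (noise I) (\<lambda>\<omega>. y < \<xi> w t \<omega>)" if "Inl w \<in> I" for I using t that by (rule xi_pred)
    show "f w \<in> borel_measurable (noise (?J \<union> {Inl w}))"
    proof -
      have [measurable]: "Measurable.pred (noise (?J \<union> {Inl w})) (\<lambda>\<omega>. hd w \<in> ?C \<omega>)" by (rule Cpred) blast
      have [measurable]: "Measurable.pred (noise (?J \<union> {Inl w})) (\<lambda>\<omega>. y < \<xi> w t \<omega>)" by (rule xp) simp
      have "f w = (\<lambda>\<omega>. if hd w \<in> ?C \<omega> then (if y < \<xi> w t \<omega> then 1 else 0) else 1)"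
        by (rule ext) (simp add: f_def indicator_def)
      then show ?thesis by (simp only:) measurable
    qed
    show "g w \<in> borel_measurable (noise ?J)"
      using Cpred[OF order_refl, of "hd w"] unfolding g_def by measurable
    show "?J \<inter> {Inl w} = {}" using e by auto
    show "(\<integral>\<^sup>+\<omega>. H \<omega> * f w \<omega> \<partial>M) \<le> (\<integral>\<^sup>+\<omega>. H \<omega> * g w \<omega> \<partial>M)"
      if H: "H \<in> borel_measurable (noise (- {Inl w}))" for H
    proof -
      have subJ: "?J \<subseteq> - {Inl w}" using e by auto
      have cp [measurable]: "Measurable.pred (noise (- {Inl w})) (\<lambda>\<omega>. hd w \<in> ?C \<omega>)" by (rule Cpred[OF subJ])
      define h where "h = (\<lambda>\<omega>. H \<omega> * (if hd w \<in> ?C \<omega> then 1 else 0))"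
      define h' where "h' = (\<lambda>\<omega>. H \<omega> * (if hd w \<in> ?C \<omega> then 0 else 1))"
      have h: "h \<in> borel_measurable (noise (- {Inl w}))" "h' \<in> borel_measurable (noise (- {Inl w}))"
        unfolding h_def h'_def using H by measurable
      define z where "z = (\<lambda>\<omega>. if y < \<xi> w t \<omega> then 1 else 0 :: ennreal)"
      have z: "z \<in> borel_measurable (noise {Inl w})"
        using xp[of "{Inl w}"] unfolding z_def by measurable
      have Ez: "(\<integral>\<^sup>+\<omega>. z \<omega> \<partial>M) \<le> ennreal q"
      proof -
        have [measurable]: "\<xi> w t \<in> borel_measurable M" using t subordinator_measurable[OF sub] by simp
        have "(\<integral>\<^sup>+\<omega>. z \<omega> \<partial>M) = (\<integral>\<^sup>+\<omega>. indicator (space M - {\<omega> \<in> space M. \<xi> w t \<omega> \<le> y}) \<omega> \<partial>M)"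
          by (rule nn_integral_cong) (auto simp: z_def indicator_def)
        also have "\<dots> = emeasure M (space M - {\<omega> \<in> space M. \<xi> w t \<omega> \<le> y})" by (rule nn_integral_indicator) measurable
        also have "\<dots> = ennreal (1 - prob {\<omega> \<in> space M. \<xi> w t \<omega> \<le> y})"
          by (subst emeasure_eq_measure, subst prob_compl) simp_all
        also have "\<dots> \<le> ennreal q"
          using reach[of w] exp_ge_add_one_self[of "- \<rho>"] by (intro ennreal_leI) (simp add: q_def)
        finally show ?thesis .
      qed
      have "(\<integral>\<^sup>+\<omega>. H \<omega> * f w \<omega> \<partial>M) = (\<integral>\<^sup>+\<omega>. h \<omega> * z \<omega> + h' \<omega> \<partial>M)"
        by (rule nn_integral_cong) (simp add: f_def h_def h'_def z_def indicator_def)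
      also have "\<dots> = (\<integral>\<^sup>+\<omega>. h \<omega> * z \<omega> \<partial>M) + (\<integral>\<^sup>+\<omega>. h' \<omega> \<partial>M)"
        by (rule nn_integral_add[OF borel_measurable_times_ennreal[OF measurable_noise_M[OF h(1)] measurable_noise_M[OF z]] measurable_noise_M[OF h(2)]])
      also have "(\<integral>\<^sup>+\<omega>. h \<omega> * z \<omega> \<partial>M) = (\<integral>\<^sup>+\<omega>. h \<omega> \<partial>M) * (\<integral>\<^sup>+\<omega>. z \<omega> \<partial>M)"
        by (rule nn_integral_noise_mult[OF _ h(1) z]) simp
      also have "\<dots> \<le> (\<integral>\<^sup>+\<omega>. h \<omega> \<partial>M) * ennreal q" by (rule mult_left_mono[OF Ez]) simp
      also have "(\<integral>\<^sup>+\<omega>. h \<omega> \<partial>M) * ennreal q = (\<integral>\<^sup>+\<omega>. h \<omega> * ennreal q \<partial>M)"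
        by (rule nn_integral_multc[symmetric, OF measurable_noise_M[OF h(1)]])
      also have "(\<integral>\<^sup>+\<omega>. h \<omega> * ennreal q \<partial>M) + (\<integral>\<^sup>+\<omega>. h' \<omega> \<partial>M) = (\<integral>\<^sup>+\<omega>. h \<omega> * ennreal q + h' \<omega> \<partial>M)"
        by (rule nn_integral_add[symmetric, OF borel_measurable_times_ennreal[OF measurable_noise_M[OF h(1)] borel_measurable_const] measurable_noise_M[OF h(2)]])
      also have "\<dots> = (\<integral>\<^sup>+\<omega>. H \<omega> * g w \<omega> \<partial>M)"
        by (rule nn_integral_cong) (simp add: g_def h_def h'_def)
      finally show ?thesis by (simp add: add_right_mono)
    qed
  next
    show "disjoint_family_on (\<lambda>w. {Inl w}) (U N)" by (auto simp: disjoint_family_on_def)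
  qed (rule HJ)
  define G where "G = (\<lambda>N \<omega>. H \<omega> * (\<Prod>w\<in>U N. g w \<omega>))"
  have step2: "(\<integral>\<^sup>+\<omega>. H \<omega> * indicator {\<omega>. \<forall>e\<in>?C \<omega>. y < \<xi> (e # v) t \<omega>} \<omega> \<partial>M) \<le> (\<integral>\<^sup>+\<omega>. G N \<omega> \<partial>M)" for N
  proof -
    have "(\<integral>\<^sup>+\<omega>. H \<omega> * indicator {\<omega>. \<forall>e\<in>?C \<omega>. y < \<xi> (e # v) t \<omega>} \<omega> \<partial>M) \<le> (\<integral>\<^sup>+\<omega>. H \<omega> * (\<Prod>w\<in>U N. f w \<omega>) \<partial>M)"
    proof (rule nn_integral_mono, rule mult_left_mono)
      fix \<omega>
      show "indicator {\<omega>. \<forall>e\<in>?C \<omega>. y < \<xi> (e # v) t \<omega>} \<omega> \<le> (\<Prod>w\<in>U N. f w \<omega>)"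
      proof (cases "\<forall>e\<in>?C \<omega>. y < \<xi> (e # v) t \<omega>")
        case True
        then have "(\<Prod>w\<in>U N. f w \<omega>) = 1" by (intro prod.neutral) (auto simp: U_def f_def)
        then show ?thesis by (simp add: indicator_def)
      qed (auto simp: indicator_def)
    qed simp
    then show ?thesis using step1[of N] unfolding G_def by (rule order_trans)
  qed
  have prod_g: "(\<Prod>w\<in>U N. g w \<omega>) = ennreal (q ^ card (?C \<omega> \<inter> ({..<N} \<times> {..<N})))" for N \<omega>
  proof -
    have "(\<Prod>w\<in>U N. g w \<omega>) = (\<Prod>e\<in>{..<N} \<times> {..<N}. if e \<in> ?C \<omega> then ennreal q else 1)"
      unfolding U_def by (subst prod.reindex) (auto simp: inj_on_def g_def)
    also have "\<dots> = (\<Prod>e\<in>{e \<in> {..<N} \<times> {..<N}. e \<in> ?C \<omega>}. ennreal q)"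
      by (rule prod.inter_filter[symmetric]) simp
    also have "{e \<in> {..<N} \<times> {..<N}. e \<in> ?C \<omega>} = ?C \<omega> \<inter> ({..<N} \<times> {..<N})" by blast
    finally show ?thesis using q by (simp add: ennreal_power)
  qed
  have finC: "finite (?C \<omega>)" for \<omega> using clock_bounds(1)[of v \<omega>] by (intro finite_kids) simp
  have dec: "decseq G"
  proof (rule decseq_SucI, rule le_funI)
    fix N \<omega>
    have "card (?C \<omega> \<inter> ({..<N} \<times> {..<N})) \<le> card (?C \<omega> \<inter> ({..<Suc N} \<times> {..<Suc N}))"
      using finC[of \<omega>] by (intro card_mono) auto
    then show "G (Suc N) \<omega> \<le> G N \<omega>"
      unfolding G_def prod_g using q by (intro mult_left_mono ennreal_leI power_decreasing) simp_all
  qed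
  have GM: "G N \<in> borel_measurable M" for N
  proof -
    have "g w \<in> borel_measurable M" for w
    proof -
      have "g w \<in> borel_measurable (noise ?J)"
        using Cpred[OF order_refl, of "hd w"] unfolding g_def by measurable
      then show ?thesis by (rule measurable_noise_M)
    qed
    then show ?thesis unfolding G_def by (intro borel_measurable_times_ennreal borel_measurable_prod_ennreal HM)
  qed
  have "(\<integral>\<^sup>+\<omega>. H \<omega> * indicator {\<omega>. \<forall>e\<in>?C \<omega>. y < \<xi> (e # v) t \<omega>} \<omega> \<partial>M) \<le> (INF N. \<integral>\<^sup>+\<omega>. G N \<omega> \<partial>M)"
    by (rule INF_greatest) (rule step2)
  also have "\<dots> = (\<integral>\<^sup>+\<omega>. (INF N. G N \<omega>) \<partial>M)"
  proof (rule nn_integral_monotone_convergence_INF_decseq[symmetric, where i = 0, OF dec GM])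
    have "G 0 = H" by (rule ext) (simp add: G_def U_def)
    then show "(\<integral>\<^sup>+\<omega>. G 0 \<omega> \<partial>M) < \<infinity>" using fin by simp
  qed
  also have "\<dots> \<le> (\<integral>\<^sup>+\<omega>. H \<omega> * ennreal (exp_neg \<rho> (point_sum (pts v \<omega>) (\<lambda>p. of_nat (kid_fun (clock v \<omega>) p)))) \<partial>M)"
  proof (rule nn_integral_mono)
    fix \<omega>
    have "\<exists>N. ?C \<omega> \<subseteq> {..<N} \<times> {..<N}"
    proof -
      obtain N1 where N1: "fst ` ?C \<omega> \<subseteq> {..<N1}" using finC[of \<omega>] by (meson finite_imageI finite_nat_iff_bounded)
      obtain N2 where N2: "snd ` ?C \<omega> \<subseteq> {..<N2}" using finC[of \<omega>] by (meson finite_imageI finite_nat_iff_bounded)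
      show ?thesis using N1 N2 by (intro exI[of _ "max N1 N2"]) force
    qed
    then obtain N where N: "?C \<omega> \<subseteq> {..<N} \<times> {..<N}" by blast
    have "(INF N. G N \<omega>) \<le> G N \<omega>" by (rule INF_lower) simp
    also have "G N \<omega> = H \<omega> * ennreal (q ^ card (?C \<omega>))" unfolding G_def prod_g using N by (simp add: Int_absorb2)
    also have "q ^ card (?C \<omega>) = exp_neg \<rho> (of_nat (card (?C \<omega>)))" by (simp add: q_def exp_neg_of_nat)
    also have "of_nat (card (?C \<omega>)) = point_sum (pts v \<omega>) (\<lambda>p. of_nat (kid_fun (clock v \<omega>) p))"
      using clock_bounds(1)[of v \<omega>] by (intro card_kids) simp
    finally show "(INF N. G N \<omega>) \<le> H \<omega> * ennreal (exp_neg \<rho> (point_sum (pts v \<omega>) (\<lambda>p. of_nat (kid_fun (clock v \<omega>) p))))" .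
  qed
  also have "\<dots> = (\<Sum>n. (\<integral>\<^sup>+\<omega>. H \<omega> * indicator {n} (clock v \<omega>) \<partial>M) *
      (\<integral>\<^sup>+\<omega>. ennreal (exp_neg \<rho> (point_sum (pts v \<omega>) (\<lambda>p. of_nat (kid_fun n p)))) \<partial>M))"
  proof (rule nn_integral_cells[where J = "{Inr v}", OF _ H measurable_clock[OF past]])
    show "- block v \<inter> {Inr v} = {}" by (auto simp: block_def)
    fix n
    have "(\<lambda>p. of_nat (kid_fun n p) :: ennreal) \<in> borel_measurable intens"
      by (rule measurable_compose[OF measurable_kid_fun]) simp
    then have "(\<lambda>\<omega>. point_sum (pts v \<omega>) (\<lambda>p. of_nat (kid_fun n p))) \<in> borel_measurable (noise {Inr v})"
      by (rule measurable_point_sum_pts) simp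
    then show "(\<lambda>\<omega>. ennreal (exp_neg \<rho> (point_sum (pts v \<omega>) (\<lambda>p. of_nat (kid_fun n p))))) \<in> borel_measurable (noise {Inr v})"
      by (rule measurable_compose[OF measurable_compose[OF _ measurable_exp_neg] measurable_ennreal])
  qed
  also have "\<dots> \<le> (\<Sum>n. (\<integral>\<^sup>+\<omega>. H \<omega> * indicator {n} (clock v \<omega>) \<partial>M) * ennreal (exp (- c)))"
    by (intro suminf_le mult_left_mono kid_laplace[OF \<rho>(1) c]) simp_all
  also have "\<dots> = ennreal (exp (- c)) * (\<integral>\<^sup>+\<omega>. H \<omega> \<partial>M)"
    unfolding ennreal_suminf_multc nn_integral_split_cells[OF HM measurable_noise_M[OF measurable_clock[OF past]]]
    by (rule mult.commute)
  finally show ?thesis .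
qed

text \<open>Largest value of s + (1 - s) exp (- c) for s <= 1/2, where s is the probability that v
  itself moves more than K0 by age 2.\<close>

definition fail_prob :: ennreal where
  "fail_prob = ennreal ((1 + exp (- c)) / 2)"

text \<open>The event splits into a fast motion of v and, on the complement, the failure of all
  children. The latter does not involve the motion of v, so the two probabilities combine as s + (1
  - s) exp (- c). An infinite integral of H is treated apart, as \<open>kids_all_fail_le\<close>
  needs a finite one.\<close>

lemma fail_le:
  assumes H: "H \<in> borel_measurable (noise (- block v))"
  shows "(\<integral>\<^sup>+\<omega>. H \<omega> * indicator {\<omega>. fail v \<omega>} \<omega> \<partial>M) \<le> fail_prob * (\<integral>\<^sup>+\<omega>. H \<omega> \<partial>M)"
proof (cases "(\<integral>\<^sup>+\<omega>. H \<omega> \<partial>M) < \<infinity>")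
  case False
  have "0 < (1 + exp (- c)) / 2" by (intro divide_pos_pos add_pos_pos) simp_all
  then have "fail_prob \<noteq> 0" by (simp add: fail_prob_def)
  moreover have "(\<integral>\<^sup>+\<omega>. H \<omega> \<partial>M) = \<infinity>" using False by (simp add: less_top[symmetric])
  ultimately show ?thesis by (simp add: ennreal_mult_top)
next
  case True
  let ?F = "{\<omega>. \<forall>e\<in>kids v (clock v \<omega>) \<omega>. y < \<xi> (e # v) t \<omega>}"
  let ?X = "\<lambda>\<omega>. if K0 < \<xi> v 2 \<omega> then 1 else 0 :: ennreal"
  let ?X' = "\<lambda>\<omega>. if K0 < \<xi> v 2 \<omega> then 0 else 1 :: ennreal"
  define s where "s = prob {\<omega> \<in> space M. K0 < \<xi> v 2 \<omega>}"
  have s: "0 \<le> s" "s \<le> 1/2" using slow[of v] by (auto simp: s_def)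
  have [measurable]: "\<xi> v 2 \<in> borel_measurable M" using subordinator_measurable[OF sub] by simp
  have xp: "Measurable.pred (noise {Inl v}) (\<lambda>\<omega>. K0 < \<xi> v 2 \<omega>)" by (rule xi_pred) simp_all
  have X: "?X \<in> borel_measurable (noise {Inl v})" "?X' \<in> borel_measurable (noise {Inl v})"
    using xp by measurable
  have EX: "(\<integral>\<^sup>+\<omega>. ?X \<omega> \<partial>M) = ennreal s"
  proof -
    have "(\<integral>\<^sup>+\<omega>. ?X \<omega> \<partial>M) = (\<integral>\<^sup>+\<omega>. indicator {\<omega> \<in> space M. K0 < \<xi> v 2 \<omega>} \<omega> \<partial>M)"
      by (rule nn_integral_cong) (simp add: indicator_def)
    also have "\<dots> = emeasure M {\<omega> \<in> space M. K0 < \<xi> v 2 \<omega>}" by (rule nn_integral_indicator) measurable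
    finally show ?thesis by (simp add: s_def emeasure_eq_measure)
  qed
  have EX': "(\<integral>\<^sup>+\<omega>. ?X' \<omega> \<partial>M) = ennreal (1 - s)"
  proof -
    have "(\<integral>\<^sup>+\<omega>. ?X' \<omega> \<partial>M) = (\<integral>\<^sup>+\<omega>. indicator (space M - {\<omega> \<in> space M. K0 < \<xi> v 2 \<omega>}) \<omega> \<partial>M)"
      by (rule nn_integral_cong) (simp add: indicator_def)
    also have "\<dots> = emeasure M (space M - {\<omega> \<in> space M. K0 < \<xi> v 2 \<omega>})" by (rule nn_integral_indicator) measurable
    also have "\<dots> = ennreal (1 - s)"
      unfolding s_def by (subst emeasure_eq_measure, subst prob_compl) simp_all
    finally show ?thesis .
  qed
  have sub1: "- block v \<subseteq> - {Inl v}" by (auto simp: block_def)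
  have H1: "H \<in> borel_measurable (noise (- {Inl v}))" by (rule measurable_noise_mono[OF H sub1])
  have Fp: "Measurable.pred (noise (- {Inl v})) (\<lambda>\<omega>. \<forall>e\<in>kids v (clock v \<omega>) \<omega>. y < \<xi> (e # v) t \<omega>)"
    by (rule all_kids_pred) (auto simp: past_def)
  have HF: "(\<lambda>\<omega>. H \<omega> * indicator ?F \<omega>) \<in> borel_measurable (noise (- {Inl v}))"
    by (rule borel_measurable_times_ennreal[OF H1 measurable_indicator_pred[OF Fp]])
  have disj: "- {Inl v} \<inter> {Inl v} = ({} :: (label + label) set)" by simp
  have "(\<integral>\<^sup>+\<omega>. H \<omega> * indicator {\<omega>. fail v \<omega>} \<omega> \<partial>M) = (\<integral>\<^sup>+\<omega>. H \<omega> * ?X \<omega> + (H \<omega> * indicator ?F \<omega>) * ?X' \<omega> \<partial>M)"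
    by (rule nn_integral_cong) (simp add: fail_def indicator_def)
  also have "\<dots> = (\<integral>\<^sup>+\<omega>. H \<omega> * ?X \<omega> \<partial>M) + (\<integral>\<^sup>+\<omega>. (H \<omega> * indicator ?F \<omega>) * ?X' \<omega> \<partial>M)"
    by (rule nn_integral_add[OF borel_measurable_times_ennreal[OF measurable_noise_M[OF H1] measurable_noise_M[OF X(1)]]
          borel_measurable_times_ennreal[OF measurable_noise_M[OF HF] measurable_noise_M[OF X(2)]]])
  also have "(\<integral>\<^sup>+\<omega>. H \<omega> * ?X \<omega> \<partial>M) = (\<integral>\<^sup>+\<omega>. H \<omega> \<partial>M) * ennreal s"
    using nn_integral_noise_mult[OF disj H1 X(1)] unfolding EX .
  also have "(\<integral>\<^sup>+\<omega>. (H \<omega> * indicator ?F \<omega>) * ?X' \<omega> \<partial>M) = (\<integral>\<^sup>+\<omega>. H \<omega> * indicator ?F \<omega> \<partial>M) * ennreal (1 - s)"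
    using nn_integral_noise_mult[OF disj HF X(2)] unfolding EX' .
  also have "\<dots> \<le> (ennreal (exp (- c)) * (\<integral>\<^sup>+\<omega>. H \<omega> \<partial>M)) * ennreal (1 - s)"
    by (rule mult_right_mono[OF kids_all_fail_le[OF H True]]) simp
  also have "(\<integral>\<^sup>+\<omega>. H \<omega> \<partial>M) * ennreal s + (ennreal (exp (- c)) * (\<integral>\<^sup>+\<omega>. H \<omega> \<partial>M)) * ennreal (1 - s) =
      (ennreal s + ennreal (exp (- c)) * ennreal (1 - s)) * (\<integral>\<^sup>+\<omega>. H \<omega> \<partial>M)"
    by (simp only: distrib_right) (simp only: mult_ac)
  also have "ennreal s + ennreal (exp (- c)) * ennreal (1 - s) = ennreal (s + exp (- c) * (1 - s))"
    using s by (simp only: ennreal_mult[symmetric] ennreal_plus[symmetric] exp_ge_zero mult_nonneg_nonneg diff_ge_0_iff_ge)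
  also have "\<dots> \<le> fail_prob"
    unfolding fail_prob_def
  proof (rule ennreal_leI)
    have "s * (1 - exp (- c)) \<le> (1/2) * (1 - exp (- c))" using s(2) c(1) by (intro mult_right_mono) simp_all
    then show "s + exp (- c) * (1 - s) \<le> (1 + exp (- c)) / 2" by (simp add: algebra_simps)
  qed
  finally show ?thesis by (simp add: add_left_mono mult_right_mono)
qed

lemma fail_average:
  assumes H: "H \<in> borel_measurable (noise (- block v))" and A: "Measurable.pred (noise (past (length v))) A"
  shows "(\<integral>\<^sup>+\<omega>. H \<omega> * (if A \<omega> then indicator {\<omega>. fail v \<omega>} \<omega> else 1) \<partial>M) \<le>
    (\<integral>\<^sup>+\<omega>. H \<omega> * (if A \<omega> then fail_prob else 1) \<partial>M)"
proof -
  have past: "past (length v) \<subseteq> - block v" by (auto simp: past_def block_def)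
  have A': "Measurable.pred (noise (- block v)) A" by (rule measurable_noise_mono[OF A past])
  define h where "h = (\<lambda>\<omega>. H \<omega> * (if A \<omega> then 1 else 0))"
  define h' where "h' = (\<lambda>\<omega>. H \<omega> * (if A \<omega> then 0 else 1))"
  have h: "h \<in> borel_measurable (noise (- block v))" "h' \<in> borel_measurable (noise (- block v))"
    unfolding h_def h'_def using H A' by measurable
  have hM: "h \<in> borel_measurable M" "h' \<in> borel_measurable M" using h measurable_noise_M by blast+
  have "Measurable.pred M (fail v)" by (rule measurable_noise_M[OF fail_pred[of v UNIV]]) auto
  then have F: "(indicator {\<omega>. fail v \<omega>} :: 'w \<Rightarrow> ennreal) \<in> borel_measurable M"
    by (rule measurable_indicator_pred)
  have "(\<integral>\<^sup>+\<omega>. H \<omega> * (if A \<omega> then indicator {\<omega>. fail v \<omega>} \<omega> else 1) \<partial>M) =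
      (\<integral>\<^sup>+\<omega>. h \<omega> * indicator {\<omega>. fail v \<omega>} \<omega> + h' \<omega> \<partial>M)"
    by (rule nn_integral_cong) (simp add: h_def h'_def)
  also have "\<dots> = (\<integral>\<^sup>+\<omega>. h \<omega> * indicator {\<omega>. fail v \<omega>} \<omega> \<partial>M) + (\<integral>\<^sup>+\<omega>. h' \<omega> \<partial>M)"
    by (rule nn_integral_add[OF borel_measurable_times_ennreal[OF hM(1) F] hM(2)])
  also have "\<dots> \<le> fail_prob * (\<integral>\<^sup>+\<omega>. h \<omega> \<partial>M) + (\<integral>\<^sup>+\<omega>. h' \<omega> \<partial>M)"
    by (rule add_right_mono[OF fail_le[OF h(1)]])
  also have "fail_prob * (\<integral>\<^sup>+\<omega>. h \<omega> \<partial>M) = (\<integral>\<^sup>+\<omega>. fail_prob * h \<omega> \<partial>M)"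
    by (rule nn_integral_cmult[symmetric, OF hM(1)])
  also have "\<dots> + (\<integral>\<^sup>+\<omega>. h' \<omega> \<partial>M) = (\<integral>\<^sup>+\<omega>. fail_prob * h \<omega> + h' \<omega> \<partial>M)"
    by (rule nn_integral_add[symmetric, OF borel_measurable_times_ennreal[OF borel_measurable_const hM(1)] hM(2)])
  also have "\<dots> = (\<integral>\<^sup>+\<omega>. H \<omega> * (if A \<omega> then fail_prob else 1) \<partial>M)"
    by (rule nn_integral_cong) (simp add: h_def h'_def mult.commute)
  finally show ?thesis .
qed

text \<open>The labels of generation g that are early and low are determined by earlier generations,
  and their failures involve disjoint blocks, so at least m candidates all fail with probability at
  most \<open>fail_prob ^ m\<close>. There are infinitely many labels, so the product is taken over
  those with code below N, and N tends to infinity.\<close>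

lemma many_failures_unlikely:
  fixes \<beta> :: real and x :: ennreal and g m :: nat
  shows "\<exists>E\<in>sets M. emeasure M E \<le> fail_prob ^ m \<and>
    (\<forall>\<omega>\<in>space M. (\<exists>F. finite F \<and> m \<le> card F \<and> (\<forall>u\<in>F. length u = g \<and> bt u \<omega> \<le> \<beta> \<and> bp \<infinity> u \<omega> \<le> x)) \<and>
      (\<forall>u. length u = g \<and> bt u \<omega> \<le> \<beta> \<and> bp \<infinity> u \<omega> \<le> x \<longrightarrow> fail u \<omega>) \<longrightarrow> \<omega> \<in> E)"
proof -
  define A where "A = (\<lambda>u \<omega>. bt u \<omega> \<le> \<beta> \<and> bp \<infinity> u \<omega> \<le> x)"
  define U where "U = (\<lambda>N::nat. {u :: label. length u = g \<and> to_nat u < N})"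
  have finU: "finite (U N)" for N
    by (rule finite_subset[of _ "from_nat ` {..<N}"]) (auto simp: U_def intro!: image_eqI[of _ from_nat "to_nat _"])
  have A: "Measurable.pred (noise (past g)) (A u)" if "length u = g" for u
  proof -
    have [measurable]: "bt u \<in> borel_measurable (noise (past g))" "bp \<infinity> u \<in> borel_measurable (noise (past g))"
      using measurable_bt[of u] measurable_bp[of \<infinity> u] that by simp_all
    show ?thesis unfolding A_def by measurable
  qed
  define E where "E = (\<lambda>N. {\<omega> \<in> space M. m \<le> card {u \<in> U N. A u \<omega>} \<and> (\<forall>u\<in>U N. A u \<omega> \<longrightarrow> fail u \<omega>)})"
  have card_meas: "(\<lambda>\<omega>. card {u \<in> U N. A u \<omega>}) \<in> measurable (noise (past g)) (count_space UNIV)" for N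
  proof -
    have "card {u \<in> U N. A u \<omega>} = (\<Sum>u\<in>U N. if A u \<omega> then 1 else 0)" for \<omega>
      using finU[of N] by (simp add: sum.If_cases Int_def)
    then have eq: "(\<lambda>\<omega>. card {u \<in> U N. A u \<omega>}) = (\<lambda>\<omega>. \<Sum>u\<in>U N. if A u \<omega> then 1 else 0)" by (rule ext)
    show ?thesis unfolding eq
    proof (rule measurable_sum_nat)
      fix u assume "u \<in> U N"
      then have "Measurable.pred (noise (past g)) (A u)" by (intro A) (simp add: U_def)
      then show "(\<lambda>\<omega>. if A u \<omega> then 1 else 0) \<in> measurable (noise (past g)) (count_space UNIV)" by measurable
    qed
  qed
  have cardp: "Measurable.pred (noise (past g)) (\<lambda>\<omega>. m \<le> card {u \<in> U N. A u \<omega>})" for N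
    by (rule measurable_compose[OF card_meas]) simp
  have failM: "Measurable.pred M (fail u)" for u by (rule measurable_noise_M[OF fail_pred[of u UNIV]]) auto
  have AM: "Measurable.pred M (A u)" if "length u = g" for u by (rule measurable_noise_M[OF A[OF that]])
  have EM: "E N \<in> sets M" for N
  proof -
    have "Measurable.pred M (\<lambda>\<omega>. A u \<omega> \<longrightarrow> fail u \<omega>)" if "u \<in> U N" for u
      using failM[of u] AM[of u] that by (auto simp: U_def)
    then have "Measurable.pred M (\<lambda>\<omega>. \<forall>u\<in>U N. A u \<omega> \<longrightarrow> fail u \<omega>)"
      using finU by (intro pred_intros_finite) auto
    then have "Measurable.pred M (\<lambda>\<omega>. m \<le> card {u \<in> U N. A u \<omega>} \<and> (\<forall>u\<in>U N. A u \<omega> \<longrightarrow> fail u \<omega>))"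
      using measurable_noise_M[OF cardp] by (intro pred_intros_logic) auto
    then show ?thesis by (simp add: E_def pred_def)
  qed
  have cc: "fail_prob \<le> 1" using c(1) by (simp add: fail_prob_def)
  have PE: "emeasure M (E N) \<le> fail_prob ^ m" for N
  proof -
    define H where "H = (\<lambda>\<omega>. if m \<le> card {u \<in> U N. A u \<omega>} then 1 else 0 :: ennreal)"
    define f where "f = (\<lambda>u \<omega>. if A u \<omega> then indicator {\<omega>. fail u \<omega>} \<omega> else 1 :: ennreal)"
    define f' where "f' = (\<lambda>u \<omega>. if A u \<omega> then fail_prob else 1)"
    have H: "H \<in> borel_measurable (noise (past g))" using cardp unfolding H_def by measurable
    have "emeasure M (E N) = (\<integral>\<^sup>+\<omega>. indicator (E N) \<omega> \<partial>M)" using EM by simp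
    also have "\<dots> \<le> (\<integral>\<^sup>+\<omega>. H \<omega> * (\<Prod>u\<in>U N. f u \<omega>) \<partial>M)"
    proof (rule nn_integral_mono)
      fix \<omega>
      show "indicator (E N) \<omega> \<le> H \<omega> * (\<Prod>u\<in>U N. f u \<omega>)"
      proof (cases "\<omega> \<in> E N")
        case True
        then have "(\<Prod>u\<in>U N. f u \<omega>) = 1" by (intro prod.neutral) (auto simp: E_def f_def)
        moreover have "H \<omega> = 1" using True by (simp add: E_def H_def)
        ultimately show ?thesis by (simp add: indicator_def)
      qed simp
    qed
    also have "\<dots> \<le> (\<integral>\<^sup>+\<omega>. H \<omega> * (\<Prod>u\<in>U N. f' u \<omega>) \<partial>M)"
    proof (rule nn_integral_prod_iterate[where R = "(\<le>)" and I = "past g" and B = block])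
      show "reflp ((\<le>) :: ennreal \<Rightarrow> ennreal \<Rightarrow> bool)" "transp ((\<le>) :: ennreal \<Rightarrow> ennreal \<Rightarrow> bool)"
        by (auto simp: reflp_def transp_def)
      show "disjoint_family_on block (U N)"
        unfolding disjoint_family_on_def
      proof (intro ballI impI)
        fix u w assume "u \<in> U N" "w \<in> U N" "u \<noteq> w"
        then show "block u \<inter> block w = {}" by (intro block_disjoint) (simp_all add: U_def)
      qed
      fix u assume "u \<in> U N"
      then have u: "length u = g" by (simp add: U_def)
      show "past g \<inter> block u = {}" using u by (auto simp: past_def block_def)
      show "f' u \<in> borel_measurable (noise (past g))" using A[OF u] unfolding f'_def by measurable
      show "f u \<in> borel_measurable (noise (past g \<union> block u))"
      proof -
        have fp: "Measurable.pred (noise (past g \<union> block u)) (fail u)" using u by (intro fail_pred) auto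
        have ap: "Measurable.pred (noise (past g \<union> block u)) (A u)" by (rule measurable_noise_mono[OF A[OF u]]) blast
        show ?thesis
          unfolding f_def by (rule measurable_If[OF measurable_indicator_pred[OF fp] borel_measurable_const ap[unfolded pred_def]])
      qed
      show "(\<integral>\<^sup>+\<omega>. H \<omega> * f u \<omega> \<partial>M) \<le> (\<integral>\<^sup>+\<omega>. H \<omega> * f' u \<omega> \<partial>M)" if "H \<in> borel_measurable (noise (- block u))" for H
        unfolding f_def f'_def using A[OF u] u by (intro fail_average that) simp
    qed (use finU H in auto)
    also have "\<dots> \<le> (\<integral>\<^sup>+\<omega>. fail_prob ^ m \<partial>M)"
    proof (rule nn_integral_mono)
      fix \<omega>
      show "H \<omega> * (\<Prod>u\<in>U N. f' u \<omega>) \<le> fail_prob ^ m"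
      proof (cases "m \<le> card {u \<in> U N. A u \<omega>}")
        case True
        have "(\<Prod>u\<in>U N. f' u \<omega>) = (\<Prod>u\<in>{u \<in> U N. A u \<omega>}. fail_prob)"
          unfolding f'_def using finU by (intro prod.inter_filter[symmetric])
        also have "\<dots> = fail_prob ^ card {u \<in> U N. A u \<omega>}" by simp
        also have "\<dots> \<le> fail_prob ^ m" using True cc by (intro power_decreasing) simp_all
        finally show ?thesis using True by (simp add: H_def)
      qed (simp add: H_def)
    qed
    also have "\<dots> = fail_prob ^ m" by (simp add: emeasure_space_1)
    finally show ?thesis .
  qed
  \<comment> \<open>The events \<open>E N\<close> need not be monotone in N: enlarging the set of
    labels adds candidates that must fail as well. A relevant outcome lies in \<open>E N\<close> for
    all large N, hence in the increasing union of the tails.\<close>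
  define L where "L = (\<lambda>n. \<Inter>N\<in>{n..}. E N)"
  have LM: "L n \<in> sets M" for n unfolding L_def using EM by (intro sets.countable_INT') auto
  have "emeasure M (\<Union>n. L n) = (SUP n. emeasure M (L n))"
  proof (rule SUP_emeasure_incseq[symmetric])
    show "incseq L" unfolding incseq_def L_def by force
  qed (use LM in auto)
  also have "\<dots> \<le> fail_prob ^ m"
  proof (rule SUP_least)
    fix n
    have "emeasure M (L n) \<le> emeasure M (E n)" by (rule emeasure_mono[OF _ EM]) (auto simp: L_def)
    then show "emeasure M (L n) \<le> fail_prob ^ m" using PE by (rule order_trans)
  qed
  finally have PL: "emeasure M (\<Union>n. L n) \<le> fail_prob ^ m" .
  show ?thesis
  proof (intro bexI[of _ "\<Union>n. L n"] conjI ballI impI PL)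
    show "(\<Union>n. L n) \<in> sets M" using LM by blast
    fix \<omega> assume \<omega>: "\<omega> \<in> space M"
    assume *: "(\<exists>F. finite F \<and> m \<le> card F \<and> (\<forall>u\<in>F. length u = g \<and> bt u \<omega> \<le> \<beta> \<and> bp \<infinity> u \<omega> \<le> x)) \<and>
      (\<forall>u. length u = g \<and> bt u \<omega> \<le> \<beta> \<and> bp \<infinity> u \<omega> \<le> x \<longrightarrow> fail u \<omega>)"
    then obtain F where F: "finite F" "m \<le> card F" "\<And>u. u \<in> F \<Longrightarrow> length u = g \<and> A u \<omega>" unfolding A_def by blast
    obtain n where n: "to_nat ` F \<subseteq> {..<n}" using F(1) by (meson finite_imageI finite_nat_iff_bounded)
    have "\<omega> \<in> E N" if "n \<le> N" for N
    proof -
      have "F \<subseteq> {u \<in> U N. A u \<omega>}" using n F(3) that by (force simp: U_def)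
      then have "card F \<le> card {u \<in> U N. A u \<omega>}" using finU by (intro card_mono) auto
      moreover have "\<forall>u\<in>U N. A u \<omega> \<longrightarrow> fail u \<omega>" using * by (simp add: A_def U_def)
      ultimately show ?thesis using \<omega> F(2) by (simp add: E_def)
    qed
    then show "\<omega> \<in> (\<Union>n. L n)" unfolding L_def by blast
  qed
qed

lemma not_fail_witness:
  assumes \<omega>: "nice \<omega>" and nf: "\<not> fail u \<omega>" and fin: "bp \<infinity> u \<omega> \<le> ennreal x" "0 \<le> x" and a: "0 \<le> a" and K0: "0 \<le> K0"
  shows "\<exists>w. bt w \<omega> \<le> bt u \<omega> + 2 \<and> bp \<infinity> w \<omega> \<le> ennreal (x + K0 + a) \<and> \<xi> w t \<omega> \<le> y"
proof -
  obtain k i where e: "(k, i) \<in> kids u (clock u \<omega>) \<omega>" "\<xi> ((k, i) # u) t \<omega> \<le> y" and slow: "\<xi> u 2 \<omega> \<le> K0"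
    using nf unfolding fail_def by (auto simp: not_less)
  have k: "fst (br u k \<omega>) < real (clock u \<omega>) + 1" "1 \<le> i" "snd (br u k \<omega>) i < \<infinity>"
    using e(1) by (auto simp: kids_def)
  have r: "0 \<le> fst (br u k \<omega>) - bt u \<omega>" "fst (br u k \<omega>) - bt u \<omega> \<le> 2"
    using br_ge[of u \<omega> k] k(1) clock_bounds(2)[of u \<omega>] by auto
  have "left_limit u (fst (br u k \<omega>) - bt u \<omega>) \<omega> \<le> ennreal K0"
    by (rule order_trans[OF left_limit_le[OF \<omega> r(1)]]) (intro ennreal_leI order_trans[OF nice_mono[OF \<omega> r] slow])
  moreover have "snd (br u k \<omega>) i \<le> ennreal a"
  proof -
    have "good_mark (snd (br u k \<omega>))" using pts_good_mark[OF br_in] .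
    then have "snd (br u k \<omega>) i < ennreal a" using k by (auto simp: good_mark_def)
    then show ?thesis by simp
  qed
  moreover have "bp \<infinity> ((k, i) # u) \<omega> = bp \<infinity> u \<omega> + left_limit u (fst (br u k \<omega>) - bt u \<omega>) \<omega> + snd (br u k \<omega>) i"
    using k by simp
  ultimately have "bp \<infinity> ((k, i) # u) \<omega> \<le> ennreal x + ennreal K0 + ennreal a"
    using fin(1) by (simp only:) (intro add_mono)
  also have "\<dots> = ennreal (x + K0 + a)" using fin(2) K0 a by (simp add: ennreal_plus)
  finally have "bp \<infinity> ((k, i) # u) \<omega> \<le> ennreal (x + K0 + a)" .
  moreover have "bt ((k, i) # u) \<omega> \<le> bt u \<omega> + 2" using r(2) by simp
  ultimately show ?thesis using e(2) by blast
qed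

end

text \<open>Dictionary between the labels of one level and the particles: statements can then be
  phrased through T and Y, which are comparable across levels, while labels stay inside the
  proofs.\<close>

definition view :: "('w \<Rightarrow> particle set) \<Rightarrow> (particle \<Rightarrow> 'w \<Rightarrow> real \<Rightarrow> real) \<Rightarrow> 'w \<Rightarrow> bool" where
  "view T Y \<omega> \<longleftrightarrow> nice \<omega> \<and> T \<omega> = identity (\<lambda>v. pts v \<omega>) ` {u. bp \<infinity> u \<omega> < \<infinity>} \<and>
    (\<forall>u t. bp \<infinity> u \<omega> < \<infinity> \<and> bt u \<omega> \<le> t \<longrightarrow>
       Y (identity (\<lambda>v. pts v \<omega>) u) \<omega> t = enn2real (bp \<infinity> u \<omega>) + \<xi> u (t - bt u \<omega>) \<omega>)"

lemma AE_view:
  assumes "AE \<omega> in M. T \<omega> = identity (\<lambda>u. P u \<omega>) ` {u. is_particle (\<lambda>u. P u \<omega>) u} \<and>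
    (\<forall>u. is_particle (\<lambda>u. P u \<omega>) u \<longrightarrow>
      (\<forall>t\<ge>0. Y (identity (\<lambda>u. P u \<omega>) u) \<omega> t = position (\<lambda>u s. \<xi> u s \<omega>) (\<lambda>u. P u \<omega>) u t))"
  shows "AE \<omega> in M. view T Y \<omega>"
  using assms AE_nice
proof eventually_elim
  fix \<omega>
  assume *: "T \<omega> = identity (\<lambda>u. P u \<omega>) ` {u. is_particle (\<lambda>u. P u \<omega>) u} \<and>
    (\<forall>u. is_particle (\<lambda>u. P u \<omega>) u \<longrightarrow>
      (\<forall>t\<ge>0. Y (identity (\<lambda>u. P u \<omega>) u) \<omega> t = position (\<lambda>u s. \<xi> u s \<omega>) (\<lambda>u. P u \<omega>) u t))" and \<omega>: "nice \<omega>"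
  have eq: "(\<lambda>u. P u \<omega>) = (\<lambda>v. pts v \<omega>)" using \<omega> by (auto simp: nice_def)
  note * = *[unfolded eq is_particle_iff[OF \<omega>]]
  have "Y (identity (\<lambda>v. pts v \<omega>) u) \<omega> t = enn2real (bp \<infinity> u \<omega>) + \<xi> u (t - bt u \<omega>) \<omega>"
    if u: "bp \<infinity> u \<omega> < \<infinity>" "bt u \<omega> \<le> t" for u t
  proof -
    have "0 \<le> t" using bt_nonneg[of u \<omega>] u(2) by simp
    then have "Y (identity (\<lambda>v. pts v \<omega>) u) \<omega> t = position (\<lambda>u s. \<xi> u s \<omega>) (\<lambda>v. pts v \<omega>) u t"
      using * u(1) by blast
    also have "\<dots> = enn2real (bp \<infinity> u \<omega>) + \<xi> u (t - bt u \<omega>) \<omega>" by (rule position_eq[OF \<omega> u])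
    finally show ?thesis .
  qed
  then show "view T Y \<omega>" unfolding view_def using * \<omega> by blast
qed

lemma view_particle:
  assumes "view T Y \<omega>" "v \<in> T \<omega>"
  obtains u where "v = identity (\<lambda>v. pts v \<omega>) u" "bp \<infinity> u \<omega> < \<infinity>" "length u = length v" "bt u \<omega> = birth_time v"
    "\<And>t. bt u \<omega> \<le> t \<Longrightarrow> Y v \<omega> t = enn2real (bp \<infinity> u \<omega>) + \<xi> u (t - bt u \<omega>) \<omega>"
    "Y v \<omega> (birth_time v) = enn2real (bp \<infinity> u \<omega>)"
proof -
  obtain u where u: "v = identity (\<lambda>v. pts v \<omega>) u" "bp \<infinity> u \<omega> < \<infinity>" using assms unfolding view_def by blast
  have Y: "Y v \<omega> t = enn2real (bp \<infinity> u \<omega>) + \<xi> u (t - bt u \<omega>) \<omega>" if "bt u \<omega> \<le> t" for t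
    using assms(1) u that unfolding view_def by blast
  have b: "bt u \<omega> = birth_time v" using u(1) birth_time_identity by simp
  have "\<xi> u 0 \<omega> = 0" using assms(1) by (simp add: view_def nice_def)
  then have "Y v \<omega> (birth_time v) = enn2real (bp \<infinity> u \<omega>)" using Y[of "bt u \<omega>"] b by simp
  then show thesis using that[OF u _ b Y] length_identity[of \<omega> u] u(1) by simp
qed

lemma view_label:
  assumes "view T Y \<omega>" "bp \<infinity> u \<omega> < \<infinity>"
  shows "identity (\<lambda>v. pts v \<omega>) u \<in> T \<omega>"
  using assms unfolding view_def by blast

lemma early_low_particles_unlikely:
  assumes view: "AE \<omega> in M. view T Y \<omega>" and l: "0 \<le> l" and \<phi>: "0 < laplace_exponent \<nu> l" and t: "0 \<le> t"
    and ratio: "grid_const * (ennreal (1 / laplace_exponent \<nu> l) * (\<integral>\<^sup>+y. trunc_laplace x l y \<partial>\<Theta>)) \<le> ennreal (1/2)"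
  shows "\<exists>L\<in>sets M. emeasure M L \<le> ennreal (2 * exp (l * x - t * laplace_exponent \<nu> l / 2 + 3 / 2)) \<and>
    (AE \<omega> in M. (\<exists>v\<in>T \<omega>. \<exists>s\<ge>t. birth_time v \<le> s \<and> Y v \<omega> s < x) \<longrightarrow> \<omega> \<in> L)"
proof -
  obtain L where L: "L \<in> sets M" "emeasure M L \<le> ennreal (2 * exp (l * x - t * laplace_exponent \<nu> l / 2 + 3 / 2))"
    "\<And>\<omega> u s. nice \<omega> \<and> t \<le> s \<and> bt u \<omega> \<le> s \<and> bp \<infinity> u \<omega> < \<infinity> \<and> enn2real (bp \<infinity> u \<omega>) + \<xi> u (s - bt u \<omega>) \<omega> < x \<Longrightarrow> \<omega> \<in> L"
    using lower_event[OF l \<phi> ratio t] by blast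
  have "AE \<omega> in M. (\<exists>v\<in>T \<omega>. \<exists>s\<ge>t. birth_time v \<le> s \<and> Y v \<omega> s < x) \<longrightarrow> \<omega> \<in> L"
    using view
  proof eventually_elim
    fix \<omega> assume view: "view T Y \<omega>"
    show "(\<exists>v\<in>T \<omega>. \<exists>s\<ge>t. birth_time v \<le> s \<and> Y v \<omega> s < x) \<longrightarrow> \<omega> \<in> L"
    proof
      assume "\<exists>v\<in>T \<omega>. \<exists>s\<ge>t. birth_time v \<le> s \<and> Y v \<omega> s < x"
      then obtain v s where v: "v \<in> T \<omega>" "t \<le> s" "birth_time v \<le> s" "Y v \<omega> s < x" by blast
      obtain u where u: "bp \<infinity> u \<omega> < \<infinity>" "bt u \<omega> = birth_time v"
        "\<And>t. bt u \<omega> \<le> t \<Longrightarrow> Y v \<omega> t = enn2real (bp \<infinity> u \<omega>) + \<xi> u (t - bt u \<omega>) \<omega>"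
        using view_particle[OF view v(1)] by metis
      have s: "bt u \<omega> \<le> s" using u(2) v(3) by simp
      have "nice \<omega>" using view by (simp add: view_def)
      moreover have "enn2real (bp \<infinity> u \<omega>) + \<xi> u (s - bt u \<omega>) \<omega> < x" using u(3)[OF s] v(4) by simp
      ultimately show "\<omega> \<in> L" using L(3) v(2) s u(1) by blast
    qed
  qed
  then show ?thesis using L(1,2) by blast
qed

lemma many_particles_nearby_view:
  assumes view: "AE \<omega> in M. view T Y \<omega>"
  shows "\<exists>\<kappa>>0. AE \<omega> in M. \<exists>D::nat. eventually (\<lambda>n. \<exists>F\<subseteq>T \<omega>. finite F \<and> n < 2 * card F \<and>
    (\<forall>v\<in>F. length v = Suc n \<and> birth_time v \<le> real D + \<kappa> * real n \<and> Y v \<omega> (birth_time v) \<le> real D + \<kappa> * real n)) sequentially"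
proof -
  obtain \<kappa> where \<kappa>: "0 < \<kappa>" and AE: "AE \<omega> in M. \<exists>D::nat. eventually (\<lambda>n. \<exists>F. finite F \<and> n < 2 * card F \<and>
    (\<forall>u\<in>F. length u = Suc n \<and> bt u \<omega> \<le> real D + \<kappa> * real n \<and> bp \<infinity> u \<omega> \<le> ennreal (real D + \<kappa> * real n))) sequentially"
    using many_particles_nearby by blast
  have "AE \<omega> in M. \<exists>D::nat. eventually (\<lambda>n. \<exists>F\<subseteq>T \<omega>. finite F \<and> n < 2 * card F \<and>
    (\<forall>v\<in>F. length v = Suc n \<and> birth_time v \<le> real D + \<kappa> * real n \<and> Y v \<omega> (birth_time v) \<le> real D + \<kappa> * real n)) sequentially"
    using AE view
  proof eventually_elim
    fix \<omega>
    assume "\<exists>D::nat. eventually (\<lambda>n. \<exists>F. finite F \<and> n < 2 * card F \<and>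
      (\<forall>u\<in>F. length u = Suc n \<and> bt u \<omega> \<le> real D + \<kappa> * real n \<and> bp \<infinity> u \<omega> \<le> ennreal (real D + \<kappa> * real n))) sequentially"
      and view: "view T Y \<omega>"
    then obtain D :: nat where ev: "eventually (\<lambda>n. \<exists>F. finite F \<and> n < 2 * card F \<and>
      (\<forall>u\<in>F. length u = Suc n \<and> bt u \<omega> \<le> real D + \<kappa> * real n \<and> bp \<infinity> u \<omega> \<le> ennreal (real D + \<kappa> * real n))) sequentially"
      by blast
    have "eventually (\<lambda>n. \<exists>F\<subseteq>T \<omega>. finite F \<and> n < 2 * card F \<and>
      (\<forall>v\<in>F. length v = Suc n \<and> birth_time v \<le> real D + \<kappa> * real n \<and> Y v \<omega> (birth_time v) \<le> real D + \<kappa> * real n)) sequentially"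
    proof (rule eventually_mono[OF ev])
      fix n
      let ?d = "real D + \<kappa> * real n"
      let ?id = "identity (\<lambda>v. pts v \<omega>)"
      assume "\<exists>F. finite F \<and> n < 2 * card F \<and> (\<forall>u\<in>F. length u = Suc n \<and> bt u \<omega> \<le> ?d \<and> bp \<infinity> u \<omega> \<le> ennreal ?d)"
      then obtain F where F: "finite F" "n < 2 * card F"
        "\<And>u. u \<in> F \<Longrightarrow> length u = Suc n \<and> bt u \<omega> \<le> ?d \<and> bp \<infinity> u \<omega> \<le> ennreal ?d" by blast
      have fin: "bp \<infinity> u \<omega> < \<infinity>" if "u \<in> F" for u
      proof -
        have "bp \<infinity> u \<omega> \<le> ennreal ?d" using F(3)[OF that] by blast
        then show ?thesis by (rule order_le_less_trans) simp
      qed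
      have d: "0 \<le> ?d" using \<kappa> by simp
      show "\<exists>F\<subseteq>T \<omega>. finite F \<and> n < 2 * card F \<and>
        (\<forall>v\<in>F. length v = Suc n \<and> birth_time v \<le> ?d \<and> Y v \<omega> (birth_time v) \<le> ?d)"
      proof (intro exI[of _ "?id ` F"] conjI ballI)
        show "?id ` F \<subseteq> T \<omega>" using view_label[OF view] fin by blast
        show "finite (?id ` F)" using F(1) by simp
        show "n < 2 * card (?id ` F)" using F(2) card_image[OF inj_on_subset[OF inj_identity subset_UNIV], of \<omega> F] by simp
        fix v assume "v \<in> ?id ` F"
        then obtain u where u: "u \<in> F" "v = ?id u" by blast
        show "length v = Suc n" using F(3)[OF u(1)] u(2) length_identity by simp
        have b: "birth_time v = bt u \<omega>" using u(2) birth_time_identity by simp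
        then show "birth_time v \<le> ?d" using F(3)[OF u(1)] by simp
        have "Y v \<omega> (birth_time v) = enn2real (bp \<infinity> u \<omega>) + \<xi> u (bt u \<omega> - bt u \<omega>) \<omega>"
          using view fin[OF u(1)] b u(2) unfolding view_def by auto
        moreover have "\<xi> u 0 \<omega> = 0" using view by (simp add: view_def nice_def)
        moreover have "enn2real (bp \<infinity> u \<omega>) \<le> ?d"
          using F(3)[OF u(1)] d by (intro enn2real_leI) auto
        ultimately show "Y v \<omega> (birth_time v) \<le> ?d" by simp
      qed
    qed
    then show "\<exists>D::nat. eventually (\<lambda>n. \<exists>F\<subseteq>T \<omega>. finite F \<and> n < 2 * card F \<and>
      (\<forall>v\<in>F. length v = Suc n \<and> birth_time v \<le> real D + \<kappa> * real n \<and> Y v \<omega> (birth_time v) \<le> real D + \<kappa> * real n)) sequentially"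
      by blast
  qed
  then show ?thesis using \<kappa> by blast
qed

text \<open>Translation of \<open>many_failures_unlikely\<close> to particles. A candidate that does
  not fail has a child born at most 2 later, at distance at most K0 + a, whose motion during t is at
  most y; monotone paths keep this child below the bound at all times up to t.\<close>

lemma candidates_reach:
  assumes view: "AE \<omega> in M. view T Y \<omega>"
    and t: "0 \<le> t" and \<rho>: "0 < \<rho>" "\<rho> \<le> 1"
    and reach: "\<And>u. \<rho> \<le> prob {\<omega> \<in> space M. \<xi> u t \<omega> \<le> y}"
    and slow: "\<And>u. prob {\<omega> \<in> space M. K0 < \<xi> u 2 \<omega>} \<le> 1 / 2"
    and c: "0 \<le> c" "ennreal c < (\<integral>\<^sup>+x. ennreal (1 - exp (- \<rho> * real (kid_count x))) \<partial>\<Theta>)"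
    and pos: "0 \<le> x" "0 \<le> a" "0 \<le> K0"
  shows "\<exists>E\<in>sets M. emeasure M E \<le> ennreal (((1 + exp (- c)) / 2) ^ m) \<and>
    (AE \<omega> in M. \<omega> \<notin> E \<and> (\<exists>F\<subseteq>T \<omega>. finite F \<and> m \<le> card F \<and>
        (\<forall>v\<in>F. length v = g \<and> birth_time v \<le> \<beta> \<and> Y v \<omega> (birth_time v) \<le> x)) \<longrightarrow>
      (\<exists>v\<in>T \<omega>. birth_time v \<le> \<beta> + 2 \<and> (\<forall>s. birth_time v \<le> s \<and> s \<le> t \<longrightarrow> Y v \<omega> s \<le> x + K0 + a + y)))"
proof -
  note ctx = t \<rho> reach slow c
  from many_failures_unlikely[OF ctx, where \<beta> = \<beta> and x = "ennreal x" and g = g and m = m]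
  obtain E where EM: "E \<in> sets M" and E23: "emeasure M E \<le> fail_prob c ^ m \<and>
    (\<forall>\<omega>\<in>space M. (\<exists>F. finite F \<and> m \<le> card F \<and> (\<forall>u\<in>F. length u = g \<and> bt u \<omega> \<le> \<beta> \<and> bp \<infinity> u \<omega> \<le> ennreal x)) \<and>
      (\<forall>u. length u = g \<and> bt u \<omega> \<le> \<beta> \<and> bp \<infinity> u \<omega> \<le> ennreal x \<longrightarrow> fail t y K0 u \<omega>) \<longrightarrow> \<omega> \<in> E)"
    by (rule bexE)
  note E2 = conjunct1[OF E23] and E3 = conjunct2[OF E23, rule_format]
  have "emeasure M E \<le> ennreal (((1 + exp (- c)) / 2) ^ m)"
    using E2 unfolding fail_prob_def[OF ctx] by (subst (asm) ennreal_power) simp_all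
  moreover have "AE \<omega> in M. \<omega> \<notin> E \<and> (\<exists>F\<subseteq>T \<omega>. finite F \<and> m \<le> card F \<and>
        (\<forall>v\<in>F. length v = g \<and> birth_time v \<le> \<beta> \<and> Y v \<omega> (birth_time v) \<le> x)) \<longrightarrow>
      (\<exists>v\<in>T \<omega>. birth_time v \<le> \<beta> + 2 \<and> (\<forall>s. birth_time v \<le> s \<and> s \<le> t \<longrightarrow> Y v \<omega> s \<le> x + K0 + a + y))"
    using view
  proof (eventually_elim, intro impI)
    fix \<omega>
    let ?id = "identity (\<lambda>v. pts v \<omega>)"
    assume view: "view T Y \<omega>" and *: "\<omega> \<notin> E \<and> (\<exists>F\<subseteq>T \<omega>. finite F \<and> m \<le> card F \<and>
        (\<forall>v\<in>F. length v = g \<and> birth_time v \<le> \<beta> \<and> Y v \<omega> (birth_time v) \<le> x))"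
    have \<omega>: "nice \<omega>" using view by (simp add: view_def)
    then have sp: "\<omega> \<in> space M" by (simp add: nice_def)
    obtain F where F: "F \<subseteq> T \<omega>" "finite F" "m \<le> card F"
      "\<And>v. v \<in> F \<Longrightarrow> length v = g \<and> birth_time v \<le> \<beta> \<and> Y v \<omega> (birth_time v) \<le> x" using * by blast
    have lab: "?id ` (?id -` F) = F" using F(1) view unfolding view_def by (auto simp: image_iff)
    have inj: "inj_on ?id (?id -` F)" by (rule inj_on_subset[OF inj_identity subset_UNIV])
    have finF: "finite (?id -` F)" by (rule finite_vimageI[OF F(2) inj_identity])
    have cardF: "card (?id -` F) = card F" using card_image[OF inj] lab by simp
    have props: "length u = g \<and> bt u \<omega> \<le> \<beta> \<and> bp \<infinity> u \<omega> \<le> ennreal x" if "u \<in> ?id -` F" for u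
    proof -
      have v: "?id u \<in> F" using that by simp
      then have "?id u \<in> T \<omega>" using F(1) by blast
      then obtain u' where u': "?id u = ?id u'" "bp \<infinity> u' \<omega> < \<infinity>" "Y (?id u) \<omega> (birth_time (?id u)) = enn2real (bp \<infinity> u' \<omega>)"
        using view_particle[OF view] by metis
      have "u = u'" using u'(1) inj_identity by (rule injD[rotated])
      then have "bp \<infinity> u \<omega> \<le> ennreal x" using u'(2,3) F(4)[OF v] by (intro le_ennrealI) auto
      then show ?thesis using F(4)[OF v] length_identity[of \<omega> u] birth_time_identity[of \<omega> u] by simp
    qed
    have "\<not> (\<forall>u. length u = g \<and> bt u \<omega> \<le> \<beta> \<and> bp \<infinity> u \<omega> \<le> ennreal x \<longrightarrow> fail t y K0 u \<omega>)"
    proof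
      assume all: "\<forall>u. length u = g \<and> bt u \<omega> \<le> \<beta> \<and> bp \<infinity> u \<omega> \<le> ennreal x \<longrightarrow> fail t y K0 u \<omega>"
      have "\<exists>F. finite F \<and> m \<le> card F \<and> (\<forall>u\<in>F. length u = g \<and> bt u \<omega> \<le> \<beta> \<and> bp \<infinity> u \<omega> \<le> ennreal x)"
        using finF cardF F(3) props by (intro exI[of _ "?id -` F"]) simp
      then have "\<omega> \<in> E" by (intro E3[OF sp] conjI all)
      then show False using * by blast
    qed
    then obtain u where u: "bt u \<omega> \<le> \<beta>" "bp \<infinity> u \<omega> \<le> ennreal x" "\<not> fail t y K0 u \<omega>" by blast
    obtain w where w: "bt w \<omega> \<le> bt u \<omega> + 2" "bp \<infinity> w \<omega> \<le> ennreal (x + K0 + a)" "\<xi> w t \<omega> \<le> y"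
      using not_fail_witness[OF ctx \<omega> u(3,2) pos] by blast
    have fin: "bp \<infinity> w \<omega> < \<infinity>" using w(2) by (rule order_le_less_trans) simp
    have bpw: "enn2real (bp \<infinity> w \<omega>) \<le> x + K0 + a" using w(2) pos by (intro enn2real_leI) auto
    show "\<exists>v\<in>T \<omega>. birth_time v \<le> \<beta> + 2 \<and> (\<forall>s. birth_time v \<le> s \<and> s \<le> t \<longrightarrow> Y v \<omega> s \<le> x + K0 + a + y)"
    proof (intro bexI[of _ "?id w"] conjI allI impI)
      show "?id w \<in> T \<omega>" by (rule view_label[OF view fin])
      show "birth_time (?id w) \<le> \<beta> + 2" using w(1) u(1) birth_time_identity[of \<omega> w] by simp
      fix s assume s: "birth_time (?id w) \<le> s \<and> s \<le> t"
      then have bs: "bt w \<omega> \<le> s" using birth_time_identity[of \<omega> w] by simp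
      have "Y (?id w) \<omega> s = enn2real (bp \<infinity> w \<omega>) + \<xi> w (s - bt w \<omega>) \<omega>"
        using view fin bs unfolding view_def by blast
      also have "\<xi> w (s - bt w \<omega>) \<omega> \<le> \<xi> w t \<omega>"
        using bs s bt_nonneg[of w \<omega>] by (intro nice_mono[OF \<omega>]) auto
      finally show "Y (?id w) \<omega> s \<le> x + K0 + a + y" using bpw w(3) by simp
    qed
  qed
  ultimately show ?thesis by (intro bexI[OF _ EM] conjI)
qed

end

section \<open>Truncations of the branching measure\<close>

locale branching_measure =
  fixes \<Lambda> :: "conf measure"
  assumes sets_eq: "sets \<Lambda> = sets Qspace"
    and trivial_null: "emeasure \<Lambda> {conf_zero} + emeasure \<Lambda> {conf_empty} = 0"
    and mean_finite: "\<And>a::real. 0 < a \<Longrightarrow> (\<integral>\<^sup>+x. ennreal \<bar>real (card {n. x n < ennreal a}) - 1\<bar> \<partial>\<Lambda>) < \<infinity>"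
    and no_jump_at_branching: "emeasure \<Lambda> {x \<in> Qset. 0 < x 0 \<and> x 0 \<le> x 1 \<and> x 1 < \<infinity>} = 0"
begin

lemma space_eq: "space \<Lambda> = Qset"
  using sets_eq_imp_space_eq[OF sets_eq] by simp

lemma measurable_eq: "measurable \<Lambda> N = measurable Qspace N"
  by (rule measurable_cong_sets[OF sets_eq refl])

lemma coordinate: "(\<lambda>x. x i) \<in> borel_measurable \<Lambda>"
  unfolding measurable_eq by (rule measurable_coordinate)

lemma AE_parent_still: "AE x in \<Lambda>. x 1 < \<infinity> \<longrightarrow> x 0 = 0"
proof -
  note [measurable] = coordinate
  have m: "{x \<in> space \<Lambda>. \<not> (x 1 < \<infinity> \<longrightarrow> x 0 = 0)} \<in> sets \<Lambda>" by measurable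
  have eq: "{x \<in> space \<Lambda>. \<not> (x 1 < \<infinity> \<longrightarrow> x 0 = 0)} = {x \<in> Qset. 0 < x 0 \<and> x 0 \<le> x 1 \<and> x 1 < \<infinity>}"
    using Qset_ge[of _ 0 1] by (auto simp: space_eq zero_less_iff_neq_zero)
  have "{x \<in> space \<Lambda>. \<not> (x 1 < \<infinity> \<longrightarrow> x 0 = 0)} \<in> null_sets \<Lambda>"
    using m no_jump_at_branching unfolding eq by (rule null_setsI[rotated])
  then show ?thesis using m by (subst AE_iff_null) auto
qed

lemma AE_nontrivial: "AE x in \<Lambda>. x \<noteq> conf_zero \<and> x 0 < \<infinity>"
proof -
  have 0: "{conf_zero} \<in> null_sets \<Lambda>" "{conf_empty} \<in> null_sets \<Lambda>"
    using trivial_null singleton_sets_Qspace conf_zero_Qset conf_empty_Qset sets_eq by (auto intro!: null_setsI)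
  have empty: "x = conf_empty" if "x \<in> Qset" "x 0 = \<infinity>" for x
  proof
    fix n show "x n = conf_empty n" using Qset_ge[OF that(1), of 0 n] that(2) by (simp add: conf_empty_def top_unique)
  qed
  show ?thesis using AE_not_in[OF 0(1)] AE_not_in[OF 0(2)] AE_space
  proof eventually_elim
    fix x assume x: "x \<notin> {conf_zero}" "x \<notin> {conf_empty}" "x \<in> space \<Lambda>"
    have "x 0 \<noteq> \<infinity>" using empty[of x] x space_eq by blast
    then show "x \<noteq> conf_zero \<and> x 0 < \<infinity>" using x by (simp add: less_top)
  qed
qed

definition marks :: "real \<Rightarrow> conf measure" where
  "marks a = restrict_space (trunc_measure \<Lambda> a) Qstar"

definition levy :: "real \<Rightarrow> real measure" where
  "levy a = distr (restrict_space (trunc_measure \<Lambda> a) (Qset - Qstar)) borel (\<lambda>x. enn2real (x 0))"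

lemma sets_trunc_measure: "sets (trunc_measure \<Lambda> a) = sets Qspace"
  by (simp add: trunc_measure_def)

lemma trunc_measurable': "trunc a \<in> measurable \<Lambda> Qspace"
  unfolding measurable_eq by (rule trunc_measurable)

lemma nonzero_measurable: "(indicator {x. x \<noteq> conf_zero} :: conf \<Rightarrow> ennreal) \<in> borel_measurable Qspace"
proof -
  have eq: "{x. x \<noteq> conf_zero} \<inter> space Qspace = space Qspace - {conf_zero}" by blast
  show ?thesis unfolding borel_measurable_indicator_iff eq
    by (intro sets.Diff sets.top singleton_sets_Qspace conf_zero_Qset)
qed

lemma trunc_Qstar_iff: "x \<in> Qset \<Longrightarrow> trunc a x \<in> Qstar \<longleftrightarrow> x 1 < ennreal a"
  using trunc_Qset[of x a] by (auto simp: Qstar_def trunc_def intro: order_less_trans)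

lemma conf_zero_not_Qstar: "conf_zero \<notin> Qstar"
  by (simp add: Qstar_def conf_zero_def)

lemma nn_integral_trunc_measure:
  assumes f: "f \<in> borel_measurable Qspace"
  shows "(\<integral>\<^sup>+x. f x \<partial>trunc_measure \<Lambda> a) = (\<integral>\<^sup>+x. indicator {x. x \<noteq> conf_zero} (trunc a x) * f (trunc a x) \<partial>\<Lambda>)"
proof -
  have f': "f \<in> borel_measurable (distr \<Lambda> Qspace (trunc a))" using f by simp
  have n': "(indicator {x. x \<noteq> conf_zero} :: conf \<Rightarrow> ennreal) \<in> borel_measurable (distr \<Lambda> Qspace (trunc a))"
    using nonzero_measurable by simp
  have "(\<integral>\<^sup>+x. f x \<partial>trunc_measure \<Lambda> a) = (\<integral>\<^sup>+x. indicator {x. x \<noteq> conf_zero} x * f x \<partial>distr \<Lambda> Qspace (trunc a))"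
    unfolding trunc_measure_def by (rule nn_integral_density[OF n' f'])
  also have "\<dots> = (\<integral>\<^sup>+x. indicator {x. x \<noteq> conf_zero} (trunc a x) * f (trunc a x) \<partial>\<Lambda>)"
    by (rule nn_integral_distr[OF trunc_measurable' borel_measurable_times_ennreal[OF n' f']])
  finally show ?thesis .
qed

lemma space_marks: "space (marks a) = Qstar"
  by (auto simp: marks_def space_restrict_space trunc_measure_def Qstar_def)

lemma measurable_marksI: "f \<in> measurable Qspace N \<Longrightarrow> f \<in> measurable (marks a) N"
  unfolding marks_def using measurable_cong_sets[OF sets_trunc_measure refl]
  by (intro measurable_restrict_space1) blast

text \<open>Truncation leaves x in \<open>Qstar\<close> exactly when \<open>x 1 < a\<close>, and the
  removed configuration \<open>conf_zero\<close> is outside \<open>Qstar\<close>, so the integral is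
  one over \<Lambda> itself.\<close>

lemma nn_integral_marks:
  assumes f: "f \<in> borel_measurable Qspace"
  shows "(\<integral>\<^sup>+x. f x \<partial>marks a) = (\<integral>\<^sup>+x. f (trunc a x) * indicator {x. x 1 < ennreal a} x \<partial>\<Lambda>)"
proof -
  have "(\<integral>\<^sup>+x. f x \<partial>marks a) = (\<integral>\<^sup>+x. f x * indicator Qstar x \<partial>trunc_measure \<Lambda> a)"
    unfolding marks_def
    by (rule nn_integral_restrict_space) (use Qstar_sets sets.sets_into_space[OF Qstar_sets] in \<open>simp add: sets_trunc_measure trunc_measure_def Int_absorb2\<close>)
  also have "\<dots> = (\<integral>\<^sup>+x. indicator {x. x \<noteq> conf_zero} (trunc a x) * (f (trunc a x) * indicator Qstar (trunc a x)) \<partial>\<Lambda>)"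
    by (rule nn_integral_trunc_measure) (intro borel_measurable_times_ennreal f borel_measurable_indicator Qstar_sets)
  also have "\<dots> = (\<integral>\<^sup>+x. f (trunc a x) * indicator {x. x 1 < ennreal a} x \<partial>\<Lambda>)"
  proof (rule nn_integral_cong)
    fix x assume "x \<in> space \<Lambda>"
    then have "trunc a x \<in> Qstar \<longleftrightarrow> x 1 < ennreal a" using trunc_Qstar_iff space_eq by auto
    moreover have "trunc a x \<noteq> conf_zero" if "trunc a x \<in> Qstar" using that conf_zero_not_Qstar by auto
    ultimately show "indicator {x. x \<noteq> conf_zero} (trunc a x) * (f (trunc a x) * indicator Qstar (trunc a x)) =
      f (trunc a x) * indicator {x. x 1 < ennreal a} x"
      by (auto simp: indicator_def)
  qed
  finally show ?thesis .
qed

lemma card_ge_two: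
  assumes "x \<in> Qset" "x 1 < ennreal a"
  shows "2 \<le> card {n. x n < ennreal a}"
proof -
  have "x 0 < ennreal a" using Qset_ge[OF assms(1), of 0 1] assms(2) by (auto intro: order_le_less_trans)
  then have "{0, 1} \<subseteq> {n. x n < ennreal a}" using assms(2) by auto
  then have "card {0, 1 :: nat} \<le> card {n. x n < ennreal a}"
    using Qset_finite_less[OF assms(1)] by (intro card_mono)
  then show ?thesis by simp
qed

lemma finite_marks_measure:
  assumes "0 < a"
  shows "finite_measure (marks a)"
proof (rule finite_measureI)
  have "emeasure (marks a) (space (marks a)) = (\<integral>\<^sup>+x. 1 \<partial>marks a)" by simp
  also have "\<dots> = (\<integral>\<^sup>+x. 1 * indicator {x. x 1 < ennreal a} x \<partial>\<Lambda>)"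
    by (rule nn_integral_marks) simp
  also have "\<dots> \<le> (\<integral>\<^sup>+x. ennreal \<bar>real (card {n. x n < ennreal a}) - 1\<bar> \<partial>\<Lambda>)"
  proof (rule nn_integral_mono)
    fix x assume x: "x \<in> space \<Lambda>"
    show "1 * indicator {x. x 1 < ennreal a} x \<le> ennreal \<bar>real (card {n. x n < ennreal a}) - 1\<bar>"
    proof (cases "x 1 < ennreal a")
      case True
      then have "1 \<le> \<bar>real (card {n. x n < ennreal a}) - 1\<bar>" using card_ge_two[of x a] x space_eq by auto
      then show ?thesis using True by (simp add: indicator_def)
    qed (simp add: indicator_def)
  qed
  also have "\<dots> < \<infinity>" by (rule mean_finite[OF assms])
  finally show "emeasure (marks a) (space (marks a)) \<noteq> \<infinity>" by simp
qed

lemma AE_marks: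
  "AE x in marks a. x 0 = 0 \<and> x 1 < \<infinity> \<and> (\<forall>i\<ge>1. x i < ennreal a \<or> x i = \<infinity>)"
proof -
  define G :: "conf \<Rightarrow> bool" where "G = (\<lambda>x. x 0 = 0 \<and> x 1 < \<infinity> \<and> (\<forall>i\<ge>1. x i < ennreal a \<or> x i = \<infinity>))"
  note [measurable] = measurable_coordinate
  have G: "{x \<in> space Qspace. \<not> G x} \<in> sets Qspace" unfolding G_def by measurable
  have f: "(indicator {x \<in> space Qspace. \<not> G x} :: conf \<Rightarrow> ennreal) \<in> borel_measurable Qspace" using G by simp
  have "(\<integral>\<^sup>+x. indicator {x \<in> space Qspace. \<not> G x} x \<partial>marks a) =
      (\<integral>\<^sup>+x. indicator {x \<in> space Qspace. \<not> G x} (trunc a x) * indicator {x. x 1 < ennreal a} x \<partial>\<Lambda>)"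
    by (rule nn_integral_marks[OF f])
  also have "\<dots> = (\<integral>\<^sup>+x. 0 \<partial>\<Lambda>)"
  proof (rule nn_integral_cong_AE)
    show "AE x in \<Lambda>. indicator {x \<in> space Qspace. \<not> G x} (trunc a x) * indicator {x. x 1 < ennreal a} x = (0 :: ennreal)"
      using AE_parent_still
    proof eventually_elim
      fix x :: conf assume *: "x 1 < \<infinity> \<longrightarrow> x 0 = 0"
      have "G (trunc a x)" if "x 1 < ennreal a"
      proof -
        have "x 1 < \<infinity>" using that by (rule order_less_trans) simp
        then show ?thesis using * that by (auto simp: G_def trunc_def)
      qed
      then show "indicator {x \<in> space Qspace. \<not> G x} (trunc a x) * indicator {x. x 1 < ennreal a} x = (0 :: ennreal)"
        by (auto simp: indicator_def)
    qed
  qed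
  finally have 0: "(\<integral>\<^sup>+x. indicator {x \<in> space Qspace. \<not> G x} x \<partial>marks a) = 0" by simp
  have "AE x in marks a. indicator {x \<in> space Qspace. \<not> G x} x = (0 :: ennreal)"
    using 0 measurable_marksI[OF f] by (subst (asm) nn_integral_0_iff_AE) auto
  then have "AE x in marks a. G x"
    using AE_space by eventually_elim (auto simp: indicator_def space_marks Qstar_def split: if_splits)
  then show ?thesis unfolding G_def .
qed

text \<open>All levels share the exponent \<phi>. Almost everywhere a configuration with
  \<open>x 0 > 0\<close> has \<open>x 1 = \<infinity>\<close>, by the absence of jumps at
  branchings, so truncation does not change it and it contributes to the Levy measure at every
  level; configurations with \<open>x 0 = 0\<close> contribute nothing to either integral.\<close>

lemma laplace_exponent_levy:
  assumes l: "0 \<le> l"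
  shows "laplace_exponent (levy a) l = phi \<Lambda> l"
proof -
  let ?f = "\<lambda>x::conf. 1 - exp (- l * enn2real (x 0))"
  let ?ind = "indicator {x. x \<noteq> conf_zero} :: conf \<Rightarrow> real"
  let ?R = "restrict_space (trunc_measure \<Lambda> a) (Qset - Qstar)"
  note [measurable] = measurable_coordinate
  have QQ: "Qset - Qstar \<in> sets Qspace" using sets.compl_sets[OF Qstar_sets] by simp
  have x0: "(\<lambda>x::conf. enn2real (x 0)) \<in> borel_measurable Qspace" by measurable
  have x0T: "(\<lambda>x::conf. enn2real (x 0)) \<in> borel_measurable (trunc_measure \<Lambda> a)"
    using x0 measurable_cong_sets[OF sets_trunc_measure refl] by blast
  have f: "?f \<in> borel_measurable Qspace" using x0 by measurable
  have g: "(\<lambda>x. indicator (Qset - Qstar) x *\<^sub>R ?f x) \<in> borel_measurable Qspace"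
    using f QQ by (intro borel_measurable_scaleR borel_measurable_indicator)
  have ind: "?ind \<in> borel_measurable Qspace"
  proof -
    have eq: "{x. x \<noteq> conf_zero} \<inter> space Qspace = space Qspace - {conf_zero}" by blast
    show ?thesis unfolding borel_measurable_indicator_iff eq
      by (intro sets.Diff sets.top singleton_sets_Qspace conf_zero_Qset)
  qed
  have "laplace_exponent (levy a) l = (\<integral>x. ?f x \<partial>?R)"
    unfolding laplace_exponent_def levy_def
    by (rule integral_distr[OF measurable_restrict_space1[OF x0T]]) measurable
  also have "\<dots> = (\<integral>x. indicator (Qset - Qstar) x *\<^sub>R ?f x \<partial>trunc_measure \<Lambda> a)"
    by (rule integral_restrict_space)
       (use QQ sets.sets_into_space[OF QQ] in \<open>simp add: sets_trunc_measure trunc_measure_def Int_absorb2\<close>)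
  also have "trunc_measure \<Lambda> a = density (distr \<Lambda> Qspace (trunc a)) (\<lambda>x. ennreal (?ind x))"
    unfolding trunc_measure_def by (intro arg_cong[where f = "density (distr \<Lambda> Qspace (trunc a))"] ext) (simp add: indicator_def)
  also have "(\<integral>x. indicator (Qset - Qstar) x *\<^sub>R ?f x \<partial>density (distr \<Lambda> Qspace (trunc a)) (\<lambda>x. ennreal (?ind x))) =
      (\<integral>x. ?ind x *\<^sub>R (indicator (Qset - Qstar) x *\<^sub>R ?f x) \<partial>distr \<Lambda> Qspace (trunc a))"
    by (rule integral_density) (use g ind in simp_all)
  also have "\<dots> = (\<integral>x. ?ind (trunc a x) *\<^sub>R (indicator (Qset - Qstar) (trunc a x) *\<^sub>R ?f (trunc a x)) \<partial>\<Lambda>)"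
    by (rule integral_distr[OF trunc_measurable']) (intro borel_measurable_scaleR ind g)
  also have "\<dots> = (\<integral>x. 1 - exp_neg l (x 0) \<partial>\<Lambda>)"
  proof (rule integral_cong_AE)
    have "(\<lambda>x. ?ind x *\<^sub>R (indicator (Qset - Qstar) x *\<^sub>R ?f x)) \<in> borel_measurable Qspace"
      by (intro borel_measurable_scaleR ind g)
    then show "(\<lambda>x. ?ind (trunc a x) *\<^sub>R (indicator (Qset - Qstar) (trunc a x) *\<^sub>R ?f (trunc a x))) \<in> borel_measurable \<Lambda>"
      by (rule measurable_compose[OF trunc_measurable'])
    have "(\<lambda>x::conf. exp_neg l (x 0)) \<in> borel_measurable \<Lambda>"
      by (rule measurable_compose[OF coordinate measurable_exp_neg])
    then show "(\<lambda>x::conf. 1 - exp_neg l (x 0)) \<in> borel_measurable \<Lambda>" by measurable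
    show "AE x in \<Lambda>. ?ind (trunc a x) *\<^sub>R (indicator (Qset - Qstar) (trunc a x) *\<^sub>R ?f (trunc a x)) = 1 - exp_neg l (x 0)"
      using AE_parent_still AE_nontrivial AE_space
    proof eventually_elim
      fix x :: conf assume still: "x 1 < \<infinity> \<longrightarrow> x 0 = 0" and nt: "x \<noteq> conf_zero \<and> x 0 < \<infinity>" and sp: "x \<in> space \<Lambda>"
      have t0: "trunc a x 0 = x 0" by (simp add: trunc_def)
      have f_eq: "?f (trunc a x) = 1 - exp_neg l (x 0)" using nt by (auto simp: t0 exp_neg_def)
      show "?ind (trunc a x) *\<^sub>R (indicator (Qset - Qstar) (trunc a x) *\<^sub>R ?f (trunc a x)) = 1 - exp_neg l (x 0)"
      proof (cases "x 0 = 0")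
        case True
        then show ?thesis by (simp add: t0)
      next
        case False
        then have "x 1 = \<infinity>" using still by (auto simp: less_top[symmetric])
        then have "trunc a x \<notin> Qstar" using trunc_Qstar_iff[of x a] sp space_eq by auto
        moreover have "trunc a x \<in> Qset" using trunc_Qset sp space_eq by auto
        moreover have "trunc a x \<noteq> conf_zero" using False t0 by (auto simp: conf_zero_def)
        ultimately show ?thesis unfolding f_eq by simp
      qed
    qed
  qed
  finally show ?thesis by (simp add: phi_def)
qed

lemma level_noise:
  assumes "prob_space M" and a: "0 < a" and pos: "0 < emeasure (trunc_measure \<Lambda> a) Qstar"
    and tbs: "truncated_branching_subordinator M 0 \<Lambda> a T Y"
  obtains \<xi> P where "branching_noise M (marks a) a (levy a) \<xi> P"
    "AE \<omega> in M. branching_noise.view M (marks a) a \<xi> P T Y \<omega>"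
proof -
  obtain \<xi> P where sub: "\<And>u. subordinator M 0 (levy a) (\<xi> u)"
    and poi: "\<And>u. poisson_process M (restrict_space lborel {0..} \<Otimes>\<^sub>M marks a) (P u)"
    and ind: "prob_space.indep_sets M (case_sum (\<lambda>u. process_events M (\<xi> u))
      (\<lambda>u. point_events M (restrict_space lborel {0..} \<Otimes>\<^sub>M marks a) (P u))) UNIV"
    and AE: "AE \<omega> in M. T \<omega> = identity (\<lambda>u. P u \<omega>) ` {u. is_particle (\<lambda>u. P u \<omega>) u} \<and>
      (\<forall>u. is_particle (\<lambda>u. P u \<omega>) u \<longrightarrow>
        (\<forall>t\<ge>0. Y (identity (\<lambda>u. P u \<omega>) u) \<omega> t = position (\<lambda>u s. \<xi> u s \<omega>) (\<lambda>u. P u \<omega>) u t))"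
    using tbs unfolding truncated_branching_subordinator_def Let_def levy_def marks_def by blast
  have "branching_noise M (marks a) a (levy a) \<xi> P"
  proof (intro branching_noise.intro branching_noise_axioms.intro assms(1) finite_marks_measure[OF a] AE_marks sub poi ind)
    have "emeasure (marks a) (space (marks a)) = emeasure (trunc_measure \<Lambda> a) Qstar"
      unfolding space_marks unfolding marks_def
      by (rule emeasure_restrict_space)
         (use Qstar_sets sets.sets_into_space[OF Qstar_sets] in \<open>simp_all add: sets_trunc_measure trunc_measure_def Int_absorb2\<close>)
    then show "0 < emeasure (marks a) (space (marks a))" using pos by simp
    show "space (marks a) \<subseteq> Qset" by (auto simp: space_marks Qstar_def)
    show "(\<lambda>x. x i) \<in> borel_measurable (marks a)" for i by (rule measurable_marksI[OF measurable_coordinate])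
  qed
  moreover from this have "AE \<omega> in M. branching_noise.view M (marks a) a \<xi> P T Y \<omega>"
    using AE by (rule branching_noise.AE_view)
  ultimately show thesis by (rule that)
qed

lemma nn_integral_marks_trunc_laplace:
  assumes "x \<le> a"
  shows "(\<integral>\<^sup>+y. trunc_laplace x l y \<partial>marks a) \<le> M1 \<Lambda> x l"
    and "(\<integral>\<^sup>+y. trunc_laplace a l y \<partial>marks a) = M1 \<Lambda> a l"
    and "(\<integral>\<^sup>+y. (trunc_laplace a l y)\<^sup>2 \<partial>marks a) = M2 \<Lambda> a l"
proof -
  note [measurable] = measurable_coordinate
  have tl: "trunc_laplace x l \<in> borel_measurable Qspace" for x unfolding trunc_laplace_def by measurable
  have trunc_eq: "trunc_laplace x l (trunc a y) = trunc_laplace x l y" if "x \<le> a" for x y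
    unfolding trunc_laplace_def
  proof (rule suminf_cong)
    fix k
    have "ennreal x \<le> ennreal a" using that by (rule ennreal_leI)
    then have "y (Suc k) < ennreal x \<Longrightarrow> y (Suc k) < ennreal a" by (rule order_less_le_trans[rotated])
    then show "(if trunc a y (Suc k) < ennreal x then ennreal (exp_neg l (trunc a y (Suc k))) else 0) =
      (if y (Suc k) < ennreal x then ennreal (exp_neg l (y (Suc k))) else 0)"
      by (auto simp: trunc_def)
  qed
  have zero: "trunc_laplace a l y = 0" if "y \<in> space \<Lambda>" "\<not> y 1 < ennreal a" for y
  proof -
    have "\<not> y (Suc k) < ennreal a" for k
      using Qset_ge[of y 1 "Suc k"] that space_eq by (auto intro: order_le_less_trans)
    then show ?thesis by (simp add: trunc_laplace_def)
  qed
  have "(\<integral>\<^sup>+y. trunc_laplace x l y \<partial>marks a) = (\<integral>\<^sup>+y. trunc_laplace x l (trunc a y) * indicator {x. x 1 < ennreal a} y \<partial>\<Lambda>)"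
    by (rule nn_integral_marks[OF tl])
  also have "\<dots> \<le> (\<integral>\<^sup>+y. trunc_laplace x l y \<partial>\<Lambda>)"
    unfolding trunc_eq[OF assms] by (rule nn_integral_mono) (simp add: indicator_def)
  finally show "(\<integral>\<^sup>+y. trunc_laplace x l y \<partial>marks a) \<le> M1 \<Lambda> x l" by (simp add: M1_def)
  have "(\<integral>\<^sup>+y. trunc_laplace a l y \<partial>marks a) = (\<integral>\<^sup>+y. trunc_laplace a l (trunc a y) * indicator {x. x 1 < ennreal a} y \<partial>\<Lambda>)"
    by (rule nn_integral_marks[OF tl])
  also have "\<dots> = (\<integral>\<^sup>+y. trunc_laplace a l y \<partial>\<Lambda>)"
    unfolding trunc_eq[OF order_refl] by (rule nn_integral_cong) (use zero in \<open>auto simp: indicator_def\<close>)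
  finally show "(\<integral>\<^sup>+y. trunc_laplace a l y \<partial>marks a) = M1 \<Lambda> a l" by (simp add: M1_def)
  have "(\<integral>\<^sup>+y. (trunc_laplace a l y)\<^sup>2 \<partial>marks a) = (\<integral>\<^sup>+y. (trunc_laplace a l (trunc a y))\<^sup>2 * indicator {x. x 1 < ennreal a} y \<partial>\<Lambda>)"
    by (rule nn_integral_marks) (use tl in measurable)
  also have "\<dots> = (\<integral>\<^sup>+y. (trunc_laplace a l y)\<^sup>2 \<partial>\<Lambda>)"
    unfolding trunc_eq[OF order_refl] by (rule nn_integral_cong) (use zero in \<open>auto simp: indicator_def\<close>)
  finally show "(\<integral>\<^sup>+y. (trunc_laplace a l y)\<^sup>2 \<partial>marks a) = M2 \<Lambda> a l" by (simp add: M2_def)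
qed

end

section \<open>Growth of the leftmost position\<close>

lemma powr_at_top: "0 < q \<Longrightarrow> 0 < k \<Longrightarrow> filterlim (\<lambda>x::real. k * x powr q) at_top at_top"
  unfolding filterlim_at_top
proof
  fix Z :: real assume q: "0 < q" and k: "0 < k"
  show "eventually (\<lambda>x. Z \<le> k * x powr q) at_top"
    using eventually_ge_at_top[of "(\<bar>Z\<bar> / k) powr (1 / q)"]
  proof eventually_elim
    fix x assume x: "(\<bar>Z\<bar> / k) powr (1 / q) \<le> x"
    have "\<bar>Z\<bar> / k = ((\<bar>Z\<bar> / k) powr (1 / q)) powr q" using q k by (simp add: powr_powr)
    also have "\<dots> \<le> x powr q" using x q by (intro powr_mono2) auto
    finally show "Z \<le> k * x powr q" using k by (simp add: pos_divide_le_eq mult.commute)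
  qed
qed

lemma ennreal_image_less: "0 < a \<Longrightarrow> ennreal ` {0..<a} = {..<ennreal a}"
proof (intro equalityI subsetI)
  fix y assume a: "0 < a" and "y \<in> {..<ennreal a}"
  then show "y \<in> ennreal ` {0..<a}"
    by (cases y) (auto simp: ennreal_less_iff intro!: imageI)
qed (auto simp: ennreal_less_iff)

locale branching_asymptotics = branching_measure \<Lambda> for \<Lambda> :: "conf measure" +
  fixes \<alpha> C \<sigma> \<gamma> :: real
  assumes \<alpha>: "0 < \<alpha>" "\<alpha> < 1" and C: "0 < C"
    and phi_asymp: "asymp_equiv (phi \<Lambda>) at_top (\<lambda>l. C * l powr \<alpha>)"
    and \<sigma>: "0 < \<sigma>"
    and mu_liminf: "0 < Liminf at_top (\<lambda>a::real. ereal (ln (enn2real (mu \<Lambda> {0..<a})) / a powr (1 + \<sigma>)))"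
    and mu_limsup: "Limsup at_top (\<lambda>a::real. ereal (ln (enn2real (mu \<Lambda> {0..<a})) / a powr (1 + \<sigma>))) < \<infinity>"
    and M2_bound: "\<exists>c0>0. \<forall>c::real. 0 < c \<and> c \<le> c0 \<longrightarrow>
           Limsup at_top (\<lambda>a::real. M2 \<Lambda> a (c * a powr \<sigma>) / (M1 \<Lambda> a (c * a powr \<sigma>))\<^sup>2) < \<infinity>"
    and \<gamma>_def: "\<gamma> = 1 / (\<alpha> + (1 - \<alpha>) * (1 + \<sigma>))"
begin

text \<open>The reciprocal of \<gamma>. In the form 1 + \<sigma> - \<alpha> \<sigma> it is the
  exponent of the balance behind the lower bound, in the form \<alpha> + (1 - \<alpha>) (1 +
  \<sigma>) that of the upper bound.\<close>

definition p :: real where "p = \<alpha> + (1 - \<alpha>) * (1 + \<sigma>)"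

lemma p_facts: "0 < p" "\<gamma> = 1 / p" "p = 1 + \<sigma> - \<alpha> * \<sigma>" "p \<le> 1 + \<sigma>" "0 < \<gamma>"
proof -
  have "0 < (1 - \<alpha>) * (1 + \<sigma>)" using \<alpha> \<sigma> by simp
  then show "0 < p" using \<alpha> by (simp add: p_def)
  then show "\<gamma> = 1 / p" "0 < \<gamma>" by (simp_all add: \<gamma>_def p_def)
  show "p = 1 + \<sigma> - \<alpha> * \<sigma>" by (simp add: p_def algebra_simps)
  then show "p \<le> 1 + \<sigma>" using \<alpha> \<sigma> by simp
qed

lemma phi_bounds: "\<exists>l0>0. \<forall>l\<ge>l0. C / 2 * l powr \<alpha> \<le> phi \<Lambda> l \<and> phi \<Lambda> l \<le> 2 * C * l powr \<alpha>"
proof -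
  have ne: "eventually (\<lambda>l. phi \<Lambda> l \<noteq> 0 \<or> C * l powr \<alpha> \<noteq> 0) at_top"
    using eventually_gt_at_top[of "0::real"] by eventually_elim (use C in simp)
  have lim: "((\<lambda>l. phi \<Lambda> l / (C * l powr \<alpha>)) \<longlongrightarrow> 1) at_top"
    by (rule asymp_equivD_strong[OF phi_asymp ne])
  have "eventually (\<lambda>l. 1/2 < phi \<Lambda> l / (C * l powr \<alpha>)) at_top" "eventually (\<lambda>l. phi \<Lambda> l / (C * l powr \<alpha>) < 2) at_top"
    by (rule order_tendstoD[OF lim], simp)+
  then have "eventually (\<lambda>l. C / 2 * l powr \<alpha> \<le> phi \<Lambda> l \<and> phi \<Lambda> l \<le> 2 * C * l powr \<alpha>) at_top"
    using eventually_gt_at_top[of "0::real"]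
  proof eventually_elim
    fix l :: real assume *: "1/2 < phi \<Lambda> l / (C * l powr \<alpha>)" "phi \<Lambda> l / (C * l powr \<alpha>) < 2" "0 < l"
    have "0 < C * l powr \<alpha>" using C *(3) by simp
    then show "C / 2 * l powr \<alpha> \<le> phi \<Lambda> l \<and> phi \<Lambda> l \<le> 2 * C * l powr \<alpha>"
      using *(1,2) by (simp add: pos_less_divide_eq pos_divide_less_eq)
  qed
  then obtain l0 where "\<forall>l\<ge>l0. C / 2 * l powr \<alpha> \<le> phi \<Lambda> l \<and> phi \<Lambda> l \<le> 2 * C * l powr \<alpha>"
    by (auto simp: eventually_at_top_linorder)
  then show ?thesis by (intro exI[of _ "max l0 1"]) auto
qed

section \<open>Moments of the branching measure\<close>

definition count_below :: "real \<Rightarrow> conf \<Rightarrow> ennreal" where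
  "count_below a x = (\<Sum>k. indicator {..<ennreal a} (x (Suc k)))"

lemma mu_eq: "0 < a \<Longrightarrow> mu \<Lambda> {0..<a} = (\<integral>\<^sup>+x. count_below a x \<partial>\<Lambda>)"
  by (simp add: mu_def count_below_def ennreal_image_less)

lemma measurable_count_below: "count_below a \<in> borel_measurable \<Lambda>"
proof -
  have "(\<lambda>x. indicator {..<ennreal a} (x (Suc k)) :: ennreal) \<in> borel_measurable \<Lambda>" for k
    by (rule measurable_compose[OF coordinate]) simp
  then show ?thesis unfolding count_below_def[abs_def] by (rule borel_measurable_suminf_order)
qed

lemma count_below_le:
  assumes "x \<in> Qset"
  shows "count_below a x \<le> ennreal \<bar>real (card {n. x n < ennreal a}) - 1\<bar>"
proof (cases "x 0 < ennreal a")
  case True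
  have fin: "finite {n. x n < ennreal a}" by (rule Qset_finite_less[OF assms])
  then have fin': "finite {k. x (Suc k) < ennreal a}"
    using finite_vimageI[of "{n. x n < ennreal a}" Suc] by (simp add: vimage_def)
  have "{n. x n < ennreal a} = insert 0 (Suc ` {k. x (Suc k) < ennreal a})"
    using True by (auto simp: image_iff) (metis not0_implies_Suc)
  then have card: "card {n. x n < ennreal a} = Suc (card {k. x (Suc k) < ennreal a})"
    using fin' by (simp add: card_image)
  have "count_below a x = (\<Sum>k\<in>{k. x (Suc k) < ennreal a}. indicator {..<ennreal a} (x (Suc k)))"
    unfolding count_below_def using fin' by (intro suminf_finite) auto
  also have "\<dots> = (\<Sum>k\<in>{k. x (Suc k) < ennreal a}. 1)" by (intro sum.cong) auto
  also have "\<dots> = ennreal (real (card {k. x (Suc k) < ennreal a}))" by (simp add: ennreal_of_nat_eq_real_of_nat)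
  finally show ?thesis using card by simp
next
  case False
  then have "\<not> x (Suc k) < ennreal a" for k using Qset_ge[OF assms, of 0 "Suc k"] by (auto intro: order_le_less_trans)
  then show ?thesis by (simp add: count_below_def)
qed

lemma mu_finite: "0 < a \<Longrightarrow> mu \<Lambda> {0..<a} < \<infinity>"
proof -
  assume a: "0 < a"
  have "mu \<Lambda> {0..<a} \<le> (\<integral>\<^sup>+x. ennreal \<bar>real (card {n. x n < ennreal a}) - 1\<bar> \<partial>\<Lambda>)"
    unfolding mu_eq[OF a] using count_below_le space_eq by (intro nn_integral_mono) auto
  then show ?thesis using mean_finite[OF a] by (rule order_le_less_trans)
qed

text \<open>The limsup controls large a; smaller a are absorbed into C0 by monotonicity of \<mu>. A
  bound for all a > 0 is wanted because it is applied to every layer, including those near the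
  origin.\<close>

lemma mu_upper: "\<exists>K>0. \<exists>C0\<ge>1. \<forall>a>0. mu \<Lambda> {0..<a} \<le> ennreal (C0 * exp (K * a powr (1 + \<sigma>)))"
proof -
  let ?f = "\<lambda>a::real. ereal (ln (enn2real (mu \<Lambda> {0..<a})) / a powr (1 + \<sigma>))"
  obtain K0 :: real where K0: "Limsup at_top ?f < ereal K0"
    using mu_limsup ereal_dense2 by (metis less_ereal.simps(4) ereal_less_eq(1) less_le_trans infinity_ereal_def ereal_infty_less(1))
  define K where "K = max K0 1"
  have "Limsup at_top ?f < ereal K" using K0 by (rule order_less_le_trans) (simp add: K_def)
  then have "eventually (\<lambda>a. ?f a < ereal K) at_top" by (rule Limsup_lessD)
  then obtain a1 where a1: "\<And>a. a \<ge> a1 \<Longrightarrow> ?f a < ereal K" by (auto simp: eventually_at_top_linorder)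
  define A where "A = max a1 1"
  define C0 where "C0 = max 1 (enn2real (mu \<Lambda> {0..<A}))"
  have "mu \<Lambda> {0..<a} \<le> ennreal (C0 * exp (K * a powr (1 + \<sigma>)))" if a: "0 < a" for a
  proof (cases "a \<ge> A")
    case True
    have fin: "mu \<Lambda> {0..<a} = ennreal (enn2real (mu \<Lambda> {0..<a}))" using mu_finite[OF a] by (simp add: less_top)
    have "ln (enn2real (mu \<Lambda> {0..<a})) / a powr (1 + \<sigma>) < K" using a1[of a] True by (simp add: A_def)
    then have ln: "ln (enn2real (mu \<Lambda> {0..<a})) \<le> K * a powr (1 + \<sigma>)"
      using a by (simp add: pos_divide_less_eq)
    have "enn2real (mu \<Lambda> {0..<a}) \<le> exp (K * a powr (1 + \<sigma>))"
    proof (cases "enn2real (mu \<Lambda> {0..<a}) = 0")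
      case False
      then have "0 < enn2real (mu \<Lambda> {0..<a})" using enn2real_nonneg[of "mu \<Lambda> {0..<a}"] by linarith
      then show ?thesis using ln ln_le_cancel_iff[of "enn2real (mu \<Lambda> {0..<a})" "exp (K * a powr (1 + \<sigma>))"] by simp
    qed simp
    also have "\<dots> \<le> C0 * exp (K * a powr (1 + \<sigma>))"
      using mult_right_mono[of 1 C0 "exp (K * a powr (1 + \<sigma>))"] by (simp add: C0_def)
    finally show ?thesis using fin by (metis ennreal_leI)
  next
    case False
    have A: "0 < A" by (simp add: A_def)
    have "mu \<Lambda> {0..<a} \<le> mu \<Lambda> {0..<A}"
      unfolding mu_eq[OF a] mu_eq[OF A] count_below_def
    proof (intro nn_integral_mono suminf_le)
      fix x k
      have "ennreal a \<le> ennreal A" using False by (intro ennreal_leI) simp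
      then show "indicator {..<ennreal a} (x (Suc k)) \<le> (indicator {..<ennreal A} (x (Suc k)) :: ennreal)"
        by (auto simp: indicator_def intro: order_less_le_trans)
    qed simp_all
    also have "\<dots> = ennreal (enn2real (mu \<Lambda> {0..<A}))" using mu_finite[OF A] by (simp add: less_top)
    also have "\<dots> \<le> ennreal (C0 * exp (K * a powr (1 + \<sigma>)))"
    proof (rule ennreal_leI)
      have "enn2real (mu \<Lambda> {0..<A}) \<le> C0 * 1" by (simp add: C0_def)
      also have "\<dots> \<le> C0 * exp (K * a powr (1 + \<sigma>))" by (intro mult_left_mono) (simp_all add: C0_def K_def)
      finally show "enn2real (mu \<Lambda> {0..<A}) \<le> C0 * exp (K * a powr (1 + \<sigma>))" .
    qed
    finally show ?thesis .
  qed
  moreover have "0 < K" "1 \<le> C0" by (simp_all add: K_def C0_def)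
  ultimately show ?thesis by blast
qed

lemma mu_lower: "\<exists>k>0. \<exists>A>0. \<forall>a\<ge>A. ennreal (exp (k * a powr (1 + \<sigma>))) \<le> mu \<Lambda> {0..<a}"
proof -
  let ?f = "\<lambda>a::real. ereal (ln (enn2real (mu \<Lambda> {0..<a})) / a powr (1 + \<sigma>))"
  obtain k :: real where k: "0 < k" "ereal k < Liminf at_top ?f"
    using ereal_dense2[OF mu_liminf] by auto
  have "eventually (\<lambda>a. ereal k < ?f a) at_top" by (rule less_LiminfD[OF k(2)])
  then obtain a1 where a1: "\<And>a. a \<ge> a1 \<Longrightarrow> ereal k < ?f a" by (auto simp: eventually_at_top_linorder)
  have "ennreal (exp (k * a powr (1 + \<sigma>))) \<le> mu \<Lambda> {0..<a}" if "a \<ge> max a1 1" for a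
  proof -
    have a: "0 < a" using that by simp
    have "k < ln (enn2real (mu \<Lambda> {0..<a})) / a powr (1 + \<sigma>)" using a1[of a] that by simp
    then have ln: "k * a powr (1 + \<sigma>) < ln (enn2real (mu \<Lambda> {0..<a}))" using a by (simp add: pos_less_divide_eq)
    moreover have "0 < k * a powr (1 + \<sigma>)" using k(1) a by simp
    ultimately have "enn2real (mu \<Lambda> {0..<a}) \<noteq> 0" by (metis ln_0 order_less_asym)
    then have pos: "0 < enn2real (mu \<Lambda> {0..<a})" using enn2real_nonneg[of "mu \<Lambda> {0..<a}"] by linarith
    have "exp (k * a powr (1 + \<sigma>)) \<le> exp (ln (enn2real (mu \<Lambda> {0..<a})))" using ln by simp
    then have "exp (k * a powr (1 + \<sigma>)) \<le> enn2real (mu \<Lambda> {0..<a})" using pos by simp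
    moreover have "mu \<Lambda> {0..<a} = ennreal (enn2real (mu \<Lambda> {0..<a}))" using mu_finite[OF a] by (simp add: less_top)
    ultimately show ?thesis by (metis ennreal_leI)
  qed
  then show ?thesis using k(1) by (intro exI[of _ k] conjI exI[of _ "max a1 1"]) auto
qed

lemma M1_lower: "0 < a \<Longrightarrow> 0 \<le> l \<Longrightarrow> ennreal (exp (- l * a)) * mu \<Lambda> {0..<a} \<le> M1 \<Lambda> a l"
proof -
  assume a: "0 < a" and l: "0 \<le> l"
  have "ennreal (exp (- l * a)) * mu \<Lambda> {0..<a} = (\<integral>\<^sup>+x. ennreal (exp (- l * a)) * count_below a x \<partial>\<Lambda>)"
    unfolding mu_eq[OF a] by (rule nn_integral_cmult[symmetric, OF measurable_count_below])
  also have "\<dots> \<le> M1 \<Lambda> a l"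
    unfolding M1_def
  proof (rule nn_integral_mono)
    fix x
    have "ennreal (exp (- l * a)) * count_below a x = (\<Sum>k. ennreal (exp (- l * a)) * indicator {..<ennreal a} (x (Suc k)))"
      unfolding count_below_def by (rule ennreal_suminf_cmult[symmetric])
    also have "\<dots> \<le> trunc_laplace a l x"
      unfolding trunc_laplace_def
    proof (intro suminf_le)
      fix k
      show "ennreal (exp (- l * a)) * indicator {..<ennreal a} (x (Suc k)) \<le>
        (if x (Suc k) < ennreal a then ennreal (exp_neg l (x (Suc k))) else 0)"
      proof (cases "x (Suc k) < ennreal a")
        case True
        have "exp_neg l (ennreal a) \<le> exp_neg l (x (Suc k))" using True by (intro exp_neg_antimono l) simp
        then show ?thesis using True a by (simp add: exp_neg_ennreal ennreal_leI)
      qed simp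
    qed simp_all
    finally show "ennreal (exp (- l * a)) * count_below a x \<le> trunc_laplace a l x" .
  qed
  finally show ?thesis .
qed

lemma M1_finite: "0 < a \<Longrightarrow> 0 \<le> l \<Longrightarrow> M1 \<Lambda> a l < \<infinity>"
proof -
  assume a: "0 < a" and l: "0 \<le> l"
  have "M1 \<Lambda> a l \<le> mu \<Lambda> {0..<a}"
    unfolding M1_def mu_eq[OF a] trunc_laplace_def count_below_def
    by (intro nn_integral_mono suminf_le) (auto simp: indicator_def exp_neg_le_1[OF l])
  then show ?thesis using mu_finite[OF a] by (rule order_le_less_trans)
qed

text \<open>Atoms are grouped by integer part, and on layer i the exponential is at most exp (- l
  i). The upper end is capped at x so that the last layer uses the mass of [0, x), not that of a
  longer interval.\<close>

lemma M1_layers: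
  assumes x: "0 < x" and l: "0 \<le> l"
  shows "M1 \<Lambda> x l \<le> (\<Sum>i<nat \<lceil>x\<rceil>. ennreal (exp (- l * real i)) * mu \<Lambda> {0..<min (real i + 1) x})"
proof -
  let ?b = "\<lambda>i::nat. min (real i + 1) x"
  have b: "0 < ?b i" for i using x by simp
  have "trunc_laplace x l y \<le> (\<Sum>i<nat \<lceil>x\<rceil>. ennreal (exp (- l * real i)) * count_below (?b i) y)" for y
  proof -
    have "trunc_laplace x l y \<le> (\<Sum>k. \<Sum>i<nat \<lceil>x\<rceil>. ennreal (exp (- l * real i)) * indicator {..<ennreal (?b i)} (y (Suc k)))"
      unfolding trunc_laplace_def
    proof (intro suminf_le)
      fix k
      show "(if y (Suc k) < ennreal x then ennreal (exp_neg l (y (Suc k))) else 0) \<le>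
        (\<Sum>i<nat \<lceil>x\<rceil>. ennreal (exp (- l * real i)) * indicator {..<ennreal (?b i)} (y (Suc k)))"
      proof (cases "y (Suc k) < ennreal x")
        case True
        then obtain r where r: "y (Suc k) = ennreal r" "0 \<le> r" "r < x"
          by (cases "y (Suc k)") (auto simp: ennreal_less_iff)
        define i where "i = nat \<lfloor>r\<rfloor>"
        have i: "real i \<le> r" "r < real i + 1" unfolding i_def using r(2) by linarith+
        have iN: "i < nat \<lceil>x\<rceil>" using i(1) r(3) by linarith
        have "ennreal (exp_neg l (y (Suc k))) \<le> ennreal (exp (- l * real i)) * indicator {..<ennreal (?b i)} (y (Suc k))"
          using r i l b[of i] by (auto simp: exp_neg_ennreal indicator_def ennreal_less_iff intro!: ennreal_leI mult_left_mono)
        also have "\<dots> \<le> (\<Sum>i<nat \<lceil>x\<rceil>. ennreal (exp (- l * real i)) * indicator {..<ennreal (?b i)} (y (Suc k)))"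
          using iN by (intro member_le_sum) auto
        finally show ?thesis using True by simp
      qed simp
    qed simp_all
    also have "\<dots> = (\<Sum>i<nat \<lceil>x\<rceil>. ennreal (exp (- l * real i)) * count_below (?b i) y)"
      unfolding count_below_def by (subst suminf_sum) (simp_all only: ennreal_suminf_cmult summableI)
    finally show ?thesis .
  qed
  then have "M1 \<Lambda> x l \<le> (\<integral>\<^sup>+y. (\<Sum>i<nat \<lceil>x\<rceil>. ennreal (exp (- l * real i)) * count_below (?b i) y) \<partial>\<Lambda>)"
    unfolding M1_def by (intro nn_integral_mono)
  also have "\<dots> = (\<Sum>i<nat \<lceil>x\<rceil>. \<integral>\<^sup>+y. ennreal (exp (- l * real i)) * count_below (?b i) y \<partial>\<Lambda>)"
    by (rule nn_integral_sum) (intro borel_measurable_times_ennreal borel_measurable_const measurable_count_below)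
  also have "\<dots> = (\<Sum>i<nat \<lceil>x\<rceil>. ennreal (exp (- l * real i)) * mu \<Lambda> {0..<?b i})"
    by (intro sum.cong refl) (simp only: nn_integral_cmult[OF measurable_count_below] mu_eq[OF b])
  finally show ?thesis .
qed

text \<open>With b = min (i + 1) x, layer i has mass at most C0 exp (K b powr (1 + \<sigma>)), and b
  powr (1 + \<sigma>) <= (i + 1) x powr \<sigma> <= 2 i x powr \<sigma> for i >= 1. The choice c = 2
  K + 1 makes the exponential win by x powr \<sigma> times i, which is at least i, so the layers
  form a geometric series; layer 0 accounts for exp K.\<close>

lemma M1_bounded: "\<exists>c>0. \<exists>B>0. \<forall>x\<ge>1. M1 \<Lambda> x (c * x powr \<sigma>) \<le> ennreal B"
proof -
  obtain K C0 where K: "0 < K" and C0: "1 \<le> C0" and mu: "\<And>a. 0 < a \<Longrightarrow> mu \<Lambda> {0..<a} \<le> ennreal (C0 * exp (K * a powr (1 + \<sigma>)))"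
    using mu_upper by blast
  define c where "c = 2 * K + 1"
  define B where "B = C0 * exp K * (1 / (1 - exp (- 1)))"
  have e1: "exp (- 1 :: real) < 1" by simp
  have B: "0 < B" using C0 e1 by (simp add: B_def)
  have "M1 \<Lambda> x (c * x powr \<sigma>) \<le> ennreal B" if x: "1 \<le> x" for x
  proof -
    have x0: "0 < x" using x by simp
    have l: "0 \<le> c * x powr \<sigma>" using K by (simp add: c_def)
    have xs: "1 \<le> x powr \<sigma>" using x \<sigma> by (simp add: ge_one_powr_ge_zero)
    have "M1 \<Lambda> x (c * x powr \<sigma>) \<le> (\<Sum>i<nat \<lceil>x\<rceil>. ennreal (exp (- (c * x powr \<sigma>) * real i)) * mu \<Lambda> {0..<min (real i + 1) x})"
      by (rule M1_layers[OF x0 l])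
    also have "\<dots> \<le> (\<Sum>i<nat \<lceil>x\<rceil>. ennreal (C0 * exp K * exp (- 1) ^ i))"
    proof (rule sum_mono)
      fix i
      let ?b = "min (real i + 1) x"
      have b: "0 < ?b" using x0 by simp
      have le: "K * ?b powr (1 + \<sigma>) \<le> K + 2 * K * x powr \<sigma> * real i"
      proof (cases "i = 0")
        case True
        then have "?b = 1" using x by simp
        then show ?thesis using True by simp
      next
        case False
        have "?b powr (1 + \<sigma>) = ?b * ?b powr \<sigma>" using b by (simp add: powr_add)
        also have "\<dots> \<le> (real i + 1) * x powr \<sigma>"
          using b \<sigma> by (intro mult_mono powr_mono2) auto
        also have "\<dots> \<le> (2 * real i) * x powr \<sigma>" using False by (intro mult_right_mono) auto
        finally have "K * ?b powr (1 + \<sigma>) \<le> K * ((2 * real i) * x powr \<sigma>)" using K by (intro mult_left_mono) auto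
        also have "K * ((2 * real i) * x powr \<sigma>) = 2 * K * x powr \<sigma> * real i" by (simp only: mult_ac)
        finally show ?thesis using K by linarith
      qed
      have "ennreal (exp (- (c * x powr \<sigma>) * real i)) * mu \<Lambda> {0..<?b} \<le>
          ennreal (exp (- (c * x powr \<sigma>) * real i)) * ennreal (C0 * exp (K * ?b powr (1 + \<sigma>)))"
        by (intro mult_left_mono mu b) simp
      also have "\<dots> = ennreal (C0 * (exp (- (c * x powr \<sigma>) * real i) * exp (K * ?b powr (1 + \<sigma>))))"
        using C0 by (simp add: ennreal_mult[symmetric] mult_ac)
      also have "\<dots> \<le> ennreal (C0 * exp K * exp (- 1) ^ i)"
      proof -
        have "- (c * x powr \<sigma>) * real i + K * ?b powr (1 + \<sigma>) \<le> K - x powr \<sigma> * real i"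
          using le by (simp add: c_def algebra_simps)
        also have "\<dots> \<le> K - 1 * real i" using xs by (intro diff_left_mono mult_right_mono) auto
        finally have "exp (- (c * x powr \<sigma>) * real i + K * ?b powr (1 + \<sigma>)) \<le> exp (K + real i * (- 1))" by simp
        then have "exp (- (c * x powr \<sigma>) * real i) * exp (K * ?b powr (1 + \<sigma>)) \<le> exp K * exp (- 1) ^ i"
          by (simp only: exp_add exp_of_nat_mult)
        then have "C0 * (exp (- (c * x powr \<sigma>) * real i) * exp (K * ?b powr (1 + \<sigma>))) \<le> C0 * (exp K * exp (- 1) ^ i)"
          using C0 by (intro mult_left_mono) auto
        then show ?thesis by (intro ennreal_leI) (simp only: mult.assoc)
      qed
      finally show "ennreal (exp (- (c * x powr \<sigma>) * real i)) * mu \<Lambda> {0..<?b} \<le> ennreal (C0 * exp K * exp (- 1) ^ i)" .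
    qed
    also have "\<dots> = ennreal (\<Sum>i<nat \<lceil>x\<rceil>. C0 * exp K * exp (- 1) ^ i)" using C0 by (intro sum_ennreal) auto
    also have "\<dots> \<le> ennreal B"
    proof (rule ennreal_leI)
      have "(\<Sum>i<nat \<lceil>x\<rceil>. C0 * exp K * exp (- 1) ^ i) = C0 * exp K * (\<Sum>i<nat \<lceil>x\<rceil>. exp (- 1) ^ i)"
        by (simp only: sum_distrib_left)
      also have "\<dots> \<le> B" unfolding B_def
      proof (intro mult_left_mono)
        have "(\<Sum>i<nat \<lceil>x\<rceil>. exp (- 1) ^ i) \<le> (\<Sum>i. exp (- 1 :: real) ^ i)"
          by (intro sum_le_suminf summable_geometric) auto
        also have "\<dots> = 1 / (1 - exp (- 1))" by (rule suminf_geometric) simp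
        finally show "(\<Sum>i<nat \<lceil>x\<rceil>. exp (- 1) ^ i) \<le> 1 / (1 - exp (- 1 :: real))" .
      qed (use C0 in simp)
      finally show "(\<Sum>i<nat \<lceil>x\<rceil>. C0 * exp K * exp (- 1) ^ i) \<le> B" .
    qed
    finally show ?thesis .
  qed
  moreover have "0 < c" using K by (simp add: c_def)
  ultimately show ?thesis using B by blast
qed

text \<open>A bounded quotient of extended reals is turned into an inequality; multiplying out needs
  the first moment to be finite, by \<open>M1_finite\<close>, and positive, which is kept as a
  premise until a lower bound is at hand.\<close>

lemma M2_le:
  "\<exists>c0>0. \<forall>c. 0 < c \<and> c \<le> c0 \<longrightarrow> (\<exists>K>0. \<exists>A>0. \<forall>a\<ge>A. 0 < M1 \<Lambda> a (c * a powr \<sigma>) \<longrightarrow>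
     M2 \<Lambda> a (c * a powr \<sigma>) \<le> ennreal K * (M1 \<Lambda> a (c * a powr \<sigma>))\<^sup>2)"
proof -
  obtain c0 where c0: "0 < c0" "\<And>c. 0 < c \<and> c \<le> c0 \<Longrightarrow>
    Limsup at_top (\<lambda>a::real. M2 \<Lambda> a (c * a powr \<sigma>) / (M1 \<Lambda> a (c * a powr \<sigma>))\<^sup>2) < \<infinity>" using M2_bound by blast
  have "\<exists>K>0. \<exists>A>0. \<forall>a\<ge>A. 0 < M1 \<Lambda> a (c * a powr \<sigma>) \<longrightarrow>
     M2 \<Lambda> a (c * a powr \<sigma>) \<le> ennreal K * (M1 \<Lambda> a (c * a powr \<sigma>))\<^sup>2" if c: "0 < c \<and> c \<le> c0" for c
  proof -
    obtain n :: nat where n: "Limsup at_top (\<lambda>a::real. M2 \<Lambda> a (c * a powr \<sigma>) / (M1 \<Lambda> a (c * a powr \<sigma>))\<^sup>2) < of_nat n"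
      using c0(2)[OF c] ennreal_Ex_less_of_nat by (auto simp: infinity_ennreal_def)
    have "eventually (\<lambda>a. M2 \<Lambda> a (c * a powr \<sigma>) / (M1 \<Lambda> a (c * a powr \<sigma>))\<^sup>2 < of_nat n) at_top"
      by (rule Limsup_lessD[OF n])
    then obtain a1 where a1: "\<And>a. a \<ge> a1 \<Longrightarrow> M2 \<Lambda> a (c * a powr \<sigma>) / (M1 \<Lambda> a (c * a powr \<sigma>))\<^sup>2 < of_nat n"
      by (auto simp: eventually_at_top_linorder)
    have "M2 \<Lambda> a (c * a powr \<sigma>) \<le> ennreal (real (Suc n)) * (M1 \<Lambda> a (c * a powr \<sigma>))\<^sup>2"
      if a: "a \<ge> max a1 1" and pos: "0 < M1 \<Lambda> a (c * a powr \<sigma>)" for a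
    proof -
      let ?m = "(M1 \<Lambda> a (c * a powr \<sigma>))\<^sup>2"
      have fin: "M1 \<Lambda> a (c * a powr \<sigma>) < \<infinity>" using a c by (intro M1_finite) auto
      have m: "?m \<noteq> 0" "?m \<noteq> \<infinity>" using pos fin by (auto simp: power2_eq_square ennreal_mult_eq_top_iff)
      have "M2 \<Lambda> a (c * a powr \<sigma>) = M2 \<Lambda> a (c * a powr \<sigma>) / ?m * ?m"
        using m ennreal_divide_self[of ?m] by (simp add: ennreal_divide_times ennreal_times_divide[symmetric] less_top[symmetric] del: ennreal_divide_eq_0_iff)
      also have "\<dots> \<le> ennreal (real (Suc n)) * ?m"
      proof (rule mult_right_mono)
        have "M2 \<Lambda> a (c * a powr \<sigma>) / ?m \<le> of_nat n" using a1[of a] a by simp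
        also have "\<dots> \<le> ennreal (real (Suc n))" by (simp add: ennreal_of_nat_eq_real_of_nat ennreal_leI)
        finally show "M2 \<Lambda> a (c * a powr \<sigma>) / ?m \<le> ennreal (real (Suc n))" .
      qed simp
      finally show ?thesis .
    qed
    then show ?thesis by (intro exI[of _ "real (Suc n)"] conjI exI[of _ "max a1 1"]) auto
  qed
  then show ?thesis using c0(1) by blast
qed

end

text \<open>Multiplying by 1 + u + u^2 / 2 <= exp u reduces the claim to (1 - u + u^2 / 2) (1 + u +
  u^2 / 2) = 1 + u^4 / 4 >= 1.\<close>

lemma one_minus_exp_ge:
  fixes u :: real
  assumes "0 \<le> u"
  shows "u - u\<^sup>2 / 2 \<le> 1 - exp (- u)"
proof -
  have pos: "0 < 1 + u + u\<^sup>2 / 2" using assms by (intro add_pos_nonneg) auto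
  have "exp (- u) * (1 + u + u\<^sup>2 / 2) \<le> exp (- u) * exp u"
    by (intro mult_left_mono exp_lower_Taylor_quadratic assms) simp
  also have "\<dots> = 1" by (simp add: exp_minus)
  also have "1 \<le> 1 + (u\<^sup>2)\<^sup>2 / 4" by simp
  also have "\<dots> = (1 - u + u\<^sup>2 / 2) * (1 + u + u\<^sup>2 / 2)" by (simp add: algebra_simps power2_eq_square)
  finally have "exp (- u) \<le> 1 - u + u\<^sup>2 / 2" using pos by (simp only: mult_le_cancel_right_pos)
  then show ?thesis by simp
qed

lemma (in branching_noise) trunc_laplace_le_kid_count:
  assumes "0 \<le> l" "x \<in> space \<Theta>" "good_mark x"
  shows "trunc_laplace a l x \<le> ennreal (real (kid_count x))"
proof -
  let ?I = "{k. x (Suc k) < ennreal a}"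
  have sub: "Suc ` ?I \<subseteq> {i. 1 \<le> i \<and> x i < \<infinity>}" by (auto intro: order_less_trans)
  have "finite (Suc ` ?I)" by (rule finite_subset[OF sub finite_marks[OF assms(2,3)]])
  then have fin: "finite ?I" by (rule finite_imageD) simp
  have card: "card ?I \<le> kid_count x"
    using card_mono[OF finite_marks[OF assms(2,3)] sub] by (simp add: card_image kid_count_def)
  have "trunc_laplace a l x = (\<Sum>k\<in>?I. if x (Suc k) < ennreal a then ennreal (exp_neg l (x (Suc k))) else 0)"
    unfolding trunc_laplace_def by (rule suminf_finite[OF fin]) simp
  also have "\<dots> \<le> (\<Sum>k\<in>?I. 1)"
    by (intro sum_mono) (simp add: exp_neg_le_1[OF assms(1)])
  also have "\<dots> \<le> ennreal (real (kid_count x))"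
    using card by (simp add: ennreal_of_nat_eq_real_of_nat ennreal_leI)
  finally show ?thesis .
qed

text \<open>Second moment method: \<open>1 - exp (- u) \<ge> u - u\<^sup>2 / 2\<close> turns the bound on the ratio of the
  moments into a lower bound for the mean of \<open>1 - exp (- \<rho> N)\<close>.\<close>

lemma (in branching_noise) kid_count_bound:
  assumes l: "0 \<le> l" and s: "0 < s" "(\<integral>\<^sup>+x. trunc_laplace a l x \<partial>\<Theta>) = ennreal s"
    and K: "0 < K" "(\<integral>\<^sup>+x. (trunc_laplace a l x)\<^sup>2 \<partial>\<Theta>) \<le> ennreal (K * s\<^sup>2)"
    and \<rho>: "1 / (K * s) \<le> \<rho>"
  shows "ennreal (1 / (4 * K)) < (\<integral>\<^sup>+x. ennreal (1 - exp (- \<rho> * real (kid_count x))) \<partial>\<Theta>)"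
proof -
  \<comment> \<open>The value of r that maximises r s - r^2 K s^2 / 2; the maximum is 1 / (2 K), and
    1 / (4 K) leaves room for the strict inequality. A larger \<rho> only increases 1 - exp (-
    \<rho> N).\<close>
  define r where "r = 1 / (K * s)"
  have r: "0 < r" "r \<le> \<rho>" using s K \<rho> by (simp_all add: r_def)
  let ?f = "\<lambda>x. ennreal (1 - exp (- \<rho> * real (kid_count x)))"
  note [measurable] = measurable_trunc_laplace measurable_kid_count
  have f: "?f \<in> borel_measurable \<Theta>" by measurable
  have "ennreal (1 / K) = ennreal r * ennreal s" using r s K by (simp add: ennreal_mult[symmetric] r_def)
  also have "\<dots> = (\<integral>\<^sup>+x. ennreal r * trunc_laplace a l x \<partial>\<Theta>)"
    unfolding s(2)[symmetric] by (rule nn_integral_cmult[symmetric]) measurable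
  also have "\<dots> \<le> (\<integral>\<^sup>+x. ?f x + ennreal (r\<^sup>2 / 2) * (trunc_laplace a l x)\<^sup>2 \<partial>\<Theta>)"
  proof (rule nn_integral_mono_AE)
    show "AE x in \<Theta>. ennreal r * trunc_laplace a l x \<le> ?f x + ennreal (r\<^sup>2 / 2) * (trunc_laplace a l x)\<^sup>2"
      using AE_good_mark AE_space
    proof eventually_elim
      fix x assume x: "good_mark x" "x \<in> space \<Theta>"
      have le: "trunc_laplace a l x \<le> ennreal (real (kid_count x))" by (rule trunc_laplace_le_kid_count[OF l x(2,1)])
      then obtain w where w: "trunc_laplace a l x = ennreal w" "0 \<le> w"
        by (cases "trunc_laplace a l x") (auto simp: top_unique)
      have "w \<le> real (kid_count x)" using le w by simp
      then have "r * w \<le> \<rho> * real (kid_count x)" using r w(2) by (intro mult_mono) auto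
      then have e: "exp (- \<rho> * real (kid_count x)) \<le> exp (- (r * w))" by simp
      have "r * w - (r * w)\<^sup>2 / 2 \<le> 1 - exp (- (r * w))" using r w(2) by (intro one_minus_exp_ge) simp
      moreover have "(r * w)\<^sup>2 / 2 = r\<^sup>2 / 2 * w\<^sup>2" by (simp add: power_mult_distrib)
      ultimately have main: "r * w \<le> (1 - exp (- \<rho> * real (kid_count x))) + r\<^sup>2 / 2 * w\<^sup>2" using e by linarith
      have nn: "0 \<le> 1 - exp (- \<rho> * real (kid_count x))" using r by (simp add: mult_nonneg_nonneg)
      have "ennreal r * trunc_laplace a l x = ennreal (r * w)" using r w by (simp add: ennreal_mult)
      also have "\<dots> \<le> ennreal ((1 - exp (- \<rho> * real (kid_count x))) + r\<^sup>2 / 2 * w\<^sup>2)" by (rule ennreal_leI[OF main])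
      also have "\<dots> = ?f x + ennreal (r\<^sup>2 / 2 * w\<^sup>2)" using nn by (intro ennreal_plus) auto
      also have "ennreal (r\<^sup>2 / 2 * w\<^sup>2) = ennreal (r\<^sup>2 / 2) * (trunc_laplace a l x)\<^sup>2"
        unfolding w(1) ennreal_power[OF w(2)] by (rule ennreal_mult) auto
      finally show "ennreal r * trunc_laplace a l x \<le> ?f x + ennreal (r\<^sup>2 / 2) * (trunc_laplace a l x)\<^sup>2" .
    qed
  qed
  also have "\<dots> = (\<integral>\<^sup>+x. ?f x \<partial>\<Theta>) + ennreal (r\<^sup>2 / 2) * (\<integral>\<^sup>+x. (trunc_laplace a l x)\<^sup>2 \<partial>\<Theta>)"
    by (subst nn_integral_add) (measurable, simp add: nn_integral_cmult)
  also have "\<dots> \<le> (\<integral>\<^sup>+x. ?f x \<partial>\<Theta>) + ennreal (r\<^sup>2 / 2) * ennreal (K * s\<^sup>2)"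
    by (intro add_left_mono mult_left_mono K(2)) simp
  also have "ennreal (r\<^sup>2 / 2) * ennreal (K * s\<^sup>2) = ennreal (1 / (2 * K))"
    using s K by (subst ennreal_mult[symmetric]) (simp_all add: r_def power2_eq_square field_simps)
  finally have *: "ennreal (1 / K) \<le> (\<integral>\<^sup>+x. ?f x \<partial>\<Theta>) + ennreal (1 / (2 * K))" .
  show ?thesis
  proof (rule ccontr)
    assume "\<not> ?thesis"
    then have "(\<integral>\<^sup>+x. ?f x \<partial>\<Theta>) \<le> ennreal (1 / (4 * K))" by simp
    then have "ennreal (1 / K) \<le> ennreal (1 / (4 * K)) + ennreal (1 / (2 * K))"
      using * by (meson add_right_mono order_trans)
    then have "ennreal (1 / K) \<le> ennreal (1 / (4 * K) + 1 / (2 * K))" using K(1) by (simp add: ennreal_plus[symmetric])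
    then have "1 / K \<le> 1 / (4 * K) + 1 / (2 * K)" using K(1) by (subst (asm) ennreal_le_iff) auto
    then show False using K(1) by (simp add: field_simps)
  qed
qed

text \<open>The events \<open>Q k\<close> are known only through measurable covers, which need not
  be nested. As Q is increasing in k, an outcome in some \<open>Q k\<close> lies in all later
  covers, hence in their limit inferior, whose measure is at most the common bound.\<close>

lemma increasing_events_cover:
  fixes Q :: "nat \<Rightarrow> 'w \<Rightarrow> bool"
  assumes ev: "\<And>k. k0 \<le> k \<Longrightarrow> \<exists>L\<in>sets M. emeasure M L \<le> b \<and> (AE \<omega> in M. Q k \<omega> \<longrightarrow> \<omega> \<in> L)"
    and mono: "AE \<omega> in M. \<forall>k\<ge>k0. Q k \<omega> \<longrightarrow> (\<forall>k'\<ge>k. Q k' \<omega>)"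
  shows "\<exists>N\<in>sets M. emeasure M N \<le> b \<and> (AE \<omega> in M. (\<exists>k\<ge>k0. Q k \<omega>) \<longrightarrow> \<omega> \<in> N)"
proof -
  have "\<forall>j. \<exists>L. L \<in> sets M \<and> emeasure M L \<le> b \<and> (AE \<omega> in M. Q (k0 + j) \<omega> \<longrightarrow> \<omega> \<in> L)"
    using ev by (meson le_add1)
  then obtain L where L: "\<And>j. L j \<in> sets M" "\<And>j. emeasure M (L j) \<le> b"
    "\<And>j. AE \<omega> in M. Q (k0 + j) \<omega> \<longrightarrow> \<omega> \<in> L j" by metis
  define B where "B = (\<lambda>j. \<Inter>i\<in>{j..}. L i)"
  have B: "B j \<in> sets M" for j unfolding B_def using L(1) by (intro sets.countable_INT') auto
  have inc: "incseq B" by (auto simp: B_def incseq_def)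
  have "emeasure M (\<Union>j. B j) = (SUP j. emeasure M (B j))"
    using B by (intro SUP_emeasure_incseq[symmetric] inc) auto
  also have "\<dots> \<le> b"
  proof (rule SUP_least)
    fix j
    have "emeasure M (B j) \<le> emeasure M (L j)" using L(1) by (intro emeasure_mono) (auto simp: B_def)
    then show "emeasure M (B j) \<le> b" using L(2) by (rule order_trans)
  qed
  finally have le: "emeasure M (\<Union>j. B j) \<le> b" .
  have all: "AE \<omega> in M. \<forall>j. Q (k0 + j) \<omega> \<longrightarrow> \<omega> \<in> L j" using L(3) by (simp add: AE_all_countable)
  have "AE \<omega> in M. (\<exists>k\<ge>k0. Q k \<omega>) \<longrightarrow> \<omega> \<in> (\<Union>j. B j)"
    using all mono
  proof eventually_elim
    fix \<omega> assume all: "\<forall>j. Q (k0 + j) \<omega> \<longrightarrow> \<omega> \<in> L j" and mono: "\<forall>k\<ge>k0. Q k \<omega> \<longrightarrow> (\<forall>k'\<ge>k. Q k' \<omega>)"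
    show "(\<exists>k\<ge>k0. Q k \<omega>) \<longrightarrow> \<omega> \<in> (\<Union>j. B j)"
    proof
      assume "\<exists>k\<ge>k0. Q k \<omega>"
      then obtain k where k: "k0 \<le> k" "Q k \<omega>" by blast
      have "\<omega> \<in> L i" if "k - k0 \<le> i" for i
      proof -
        have "k \<le> k0 + i" using that by simp
        then have "Q (k0 + i) \<omega>" using mono k by blast
        then show ?thesis using all by blast
      qed
      then have "\<omega> \<in> B (k - k0)" by (simp add: B_def)
      then show "\<omega> \<in> (\<Union>j. B j)" by blast
    qed
  qed
  moreover have "(\<Union>j. B j) \<in> sets M" using B by auto
  ultimately show ?thesis using le by blast
qed

text \<open>Borel-Cantelli for implications that hold off small sets, a form in which Q and R may be
  non-measurable. The events start at j0, hence the shift of the index.\<close>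

lemma geometric_borel_cantelli:
  fixes Q R :: "nat \<Rightarrow> 'w \<Rightarrow> bool"
  assumes q: "0 \<le> q" "q < 1" and B: "0 \<le> B"
    and ev: "\<And>j. j0 \<le> j \<Longrightarrow> \<exists>E\<in>sets M. emeasure M E \<le> ennreal (B * q ^ j) \<and> (AE \<omega> in M. \<omega> \<notin> E \<and> Q j \<omega> \<longrightarrow> R j \<omega>)"
  shows "AE \<omega> in M. eventually (\<lambda>j. Q j \<omega> \<longrightarrow> R j \<omega>) sequentially"
proof -
  have "\<forall>i. \<exists>E. E \<in> sets M \<and> emeasure M E \<le> ennreal (B * q ^ (j0 + i)) \<and>
    (AE \<omega> in M. \<omega> \<notin> E \<and> Q (j0 + i) \<omega> \<longrightarrow> R (j0 + i) \<omega>)"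
    using ev[OF le_add1] by (simp only: Bex_def) blast
  from choice[OF this] obtain E where E': "\<forall>i. E i \<in> sets M \<and> emeasure M (E i) \<le> ennreal (B * q ^ (j0 + i)) \<and>
    (AE \<omega> in M. \<omega> \<notin> E i \<and> Q (j0 + i) \<omega> \<longrightarrow> R (j0 + i) \<omega>)" by (rule exE)
  have E: "E i \<in> sets M" "emeasure M (E i) \<le> ennreal (B * q ^ (j0 + i))"
    "AE \<omega> in M. \<omega> \<notin> E i \<and> Q (j0 + i) \<omega> \<longrightarrow> R (j0 + i) \<omega>" for i using E' by blast+
  have fin: "emeasure M (E i) < \<infinity>" for i using E(2)[of i] by (rule order_le_less_trans) simp
  have sum: "summable (\<lambda>i. measure M (E i))"
  proof (rule summable_comparison_test')
    show "summable (\<lambda>i. B * q ^ j0 * q ^ i)" using q by (intro summable_mult summable_geometric) simp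
    fix i
    have "measure M (E i) \<le> B * q ^ (j0 + i)"
      unfolding measure_def using E(2) q B by (intro enn2real_leI) auto
    then show "norm (measure M (E i)) \<le> B * q ^ j0 * q ^ i" by (simp add: power_add mult.assoc)
  qed
  have bc: "AE \<omega> in M. eventually (\<lambda>i. \<omega> \<in> space M - E i) sequentially"
    by (rule borel_cantelli_AE1[OF E(1) fin sum])
  have all: "AE \<omega> in M. \<forall>i. \<omega> \<notin> E i \<and> Q (j0 + i) \<omega> \<longrightarrow> R (j0 + i) \<omega>"
    using E(3) by (simp only: AE_all_countable) blast
  show ?thesis
    using bc all
  proof eventually_elim
    fix \<omega> assume bc: "eventually (\<lambda>i. \<omega> \<in> space M - E i) sequentially"
      and all: "\<forall>i. \<omega> \<notin> E i \<and> Q (j0 + i) \<omega> \<longrightarrow> R (j0 + i) \<omega>"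
    have "eventually (\<lambda>i. Q (i + j0) \<omega> \<longrightarrow> R (i + j0) \<omega>) sequentially"
      using bc
    proof eventually_elim
      fix i assume "\<omega> \<in> space M - E i"
      then show "Q (i + j0) \<omega> \<longrightarrow> R (i + j0) \<omega>" using all by (simp add: add.commute[of i])
    qed
    then show "eventually (\<lambda>j. Q j \<omega> \<longrightarrow> R j \<omega>) sequentially" 
      by (rule eventually_sequentially_seg[of "\<lambda>j. Q j \<omega> \<longrightarrow> R j \<omega>" j0, THEN iffD1])
  qed
qed

lemma (in branching_noise) view_nonneg:
  assumes "view T Y \<omega>" "v \<in> T \<omega>" "birth_time v \<le> t"
  shows "0 \<le> Y v \<omega> t"
proof -
  obtain u where u: "bt u \<omega> = birth_time v"
    "\<And>t. bt u \<omega> \<le> t \<Longrightarrow> Y v \<omega> t = enn2real (bp \<infinity> u \<omega>) + \<xi> u (t - bt u \<omega>) \<omega>"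
    using view_particle[OF assms(1,2)] by metis
  have \<omega>: "nice \<omega>" using assms(1) by (simp add: view_def)
  have "0 \<le> \<xi> u (t - bt u \<omega>) \<omega>"
    using nice_mono[OF \<omega>, of 0 "t - bt u \<omega>" u] \<omega> assms(3) u(1) by (simp add: nice_def)
  then show ?thesis using u assms(3) by simp
qed

lemma (in branching_noise) view_root:
  assumes "view T Y \<omega>"
  shows "[] \<in> T \<omega>"
  using view_label[OF assms, of "[]"] by simp

text \<open>Provides for each level a noise that represents \<open>Ta a\<close> together with the
  positions Y of the limiting system, since Y agrees with the level on its particles. Pruning yields
  the monotonicity in a, through which a statement about all of T reduces to integer levels.\<close>

lemma (in branching_measure) levels:
  assumes M: "prob_space M" and bs: "branching_subordinator M 0 \<Lambda> T Y"
  shows "\<exists>a0 Ta. 0 \<le> a0 \<and>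
    (\<forall>a>a0. \<exists>\<xi> P. branching_noise M (marks a) a (levy a) \<xi> P \<and>
      (AE \<omega> in M. branching_noise.view M (marks a) a \<xi> P (Ta a) Y \<omega>)) \<and>
    (AE \<omega> in M. T \<omega> = (\<Union>a\<in>{a0<..}. Ta a \<omega>)) \<and>
    (AE \<omega> in M. \<forall>a a'. a0 < a \<and> a \<le> a' \<longrightarrow> Ta a \<omega> \<subseteq> Ta a' \<omega>)"
proof -
  obtain a0 Ta Ya where a0: "0 \<le> a0" and pos: "\<And>a. a0 < a \<Longrightarrow> 0 < emeasure (trunc_measure \<Lambda> a) Qstar"
    and tbs: "\<And>a. a0 < a \<Longrightarrow> truncated_branching_subordinator M 0 \<Lambda> a (Ta a) (Ya a)"
    and prune: "AE \<omega> in M. \<forall>a a'. a0 < a \<and> a \<le> a' \<longrightarrow> Ta a \<omega> = pruned a (Ta a') (Ya a') \<omega> \<and>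
           (\<forall>v\<in>Ta a \<omega>. \<forall>t\<ge>0. Ya a v \<omega> t = Ya a' v \<omega> t)"
    and lim: "AE \<omega> in M. T \<omega> = (\<Union>a\<in>{a0<..}. Ta a \<omega>) \<and>
           (\<forall>a>a0. \<forall>v\<in>Ta a \<omega>. \<forall>t\<ge>0. Y v \<omega> t = Ya a v \<omega> t)"
    using bs unfolding branching_subordinator_def by blast
  show ?thesis
  proof (intro exI[of _ a0] exI[of _ Ta] conjI allI impI)
    show "0 \<le> a0" by (rule a0)
    fix a assume a: "a0 < a"
    then have "0 < a" using a0 by simp
    from level_noise[OF M this pos[OF a] tbs[OF a]] obtain \<xi> P where bn: "branching_noise M (marks a) a (levy a) \<xi> P"
      and view: "AE \<omega> in M. branching_noise.view M (marks a) a \<xi> P (Ta a) (Ya a) \<omega>" by blast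
    interpret bn: branching_noise M "marks a" a "levy a" \<xi> P by (rule bn)
    have "AE \<omega> in M. bn.view (Ta a) Y \<omega>"
      using view lim
    proof eventually_elim
      fix \<omega> assume view: "bn.view (Ta a) (Ya a) \<omega>"
        and lim: "T \<omega> = (\<Union>a\<in>{a0<..}. Ta a \<omega>) \<and> (\<forall>a>a0. \<forall>v\<in>Ta a \<omega>. \<forall>t\<ge>0. Y v \<omega> t = Ya a v \<omega> t)"
      have "Y (identity (\<lambda>v. bn.pts v \<omega>) u) \<omega> t = Ya a (identity (\<lambda>v. bn.pts v \<omega>) u) \<omega> t"
        if "bn.bp \<infinity> u \<omega> < \<infinity>" "bn.bt u \<omega> \<le> t" for u t
        using lim a bn.view_label[OF view that(1)] bn.bt_nonneg[of u \<omega>] that(2) by (meson order_trans)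
      then show "bn.view (Ta a) Y \<omega>" using view unfolding bn.view_def by auto
    qed
    then show "\<exists>\<xi> P. branching_noise M (marks a) a (levy a) \<xi> P \<and>
      (AE \<omega> in M. branching_noise.view M (marks a) a \<xi> P (Ta a) Y \<omega>)" using bn by blast
  next
    show "AE \<omega> in M. T \<omega> = (\<Union>a\<in>{a0<..}. Ta a \<omega>)" using lim by eventually_elim blast
    show "AE \<omega> in M. \<forall>a a'. a0 < a \<and> a \<le> a' \<longrightarrow> Ta a \<omega> \<subseteq> Ta a' \<omega>"
      using prune by eventually_elim (auto simp: pruned_def)
  qed
qed

section \<open>Lower bound for the leftmost position\<close>

context branching_asymptotics
begin

text \<open>\<open>M1_bounded\<close> keeps the first moment below B while \<phi>(c x powr \<sigma>)
  tends to infinity, so the ratio of successive generations is at most 1/2 once \<phi> exceeds 2 G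
  B.\<close>

lemma lower_regime:
  "\<exists>c>0. \<exists>X\<ge>1. \<forall>x\<ge>X. C / 2 * (c * x powr \<sigma>) powr \<alpha> \<le> phi \<Lambda> (c * x powr \<sigma>) \<and>
     grid_const * (ennreal (1 / phi \<Lambda> (c * x powr \<sigma>)) * M1 \<Lambda> x (c * x powr \<sigma>)) \<le> ennreal (1/2)"
proof -
  obtain c B where c: "0 < c" and B: "0 < B" "\<And>x. 1 \<le> x \<Longrightarrow> M1 \<Lambda> x (c * x powr \<sigma>) \<le> ennreal B"
    using M1_bounded by blast
  obtain l0 where l0: "0 < l0" "\<And>l. l0 \<le> l \<Longrightarrow> C / 2 * l powr \<alpha> \<le> phi \<Lambda> l" using phi_bounds by blast
  define G where "G = enn2real grid_const"
  have G: "grid_const = ennreal G" "0 \<le> G" using grid_const_finite by (simp_all add: G_def)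
  have tl: "filterlim (\<lambda>x::real. c * x powr \<sigma>) at_top at_top" by (rule powr_at_top[OF \<sigma> c])
  have tC: "filterlim (\<lambda>l::real. C / 2 * l powr \<alpha>) at_top at_top" using C by (intro powr_at_top \<alpha>) simp
  have "eventually (\<lambda>x. l0 \<le> c * x powr \<sigma>) at_top" "eventually (\<lambda>x. 2 * G * B + 1 \<le> C / 2 * (c * x powr \<sigma>) powr \<alpha>) at_top"
    using tl filterlim_compose[OF tC tl] unfolding filterlim_at_top by blast+
  then have "eventually (\<lambda>x. l0 \<le> c * x powr \<sigma> \<and> 2 * G * B + 1 \<le> C / 2 * (c * x powr \<sigma>) powr \<alpha>) at_top"
    by eventually_elim simp
  then obtain X where X: "\<And>x. X \<le> x \<Longrightarrow> l0 \<le> c * x powr \<sigma> \<and> 2 * G * B + 1 \<le> C / 2 * (c * x powr \<sigma>) powr \<alpha>"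
    unfolding eventually_at_top_linorder by blast
  show ?thesis
  proof (intro exI conjI allI impI)
    fix x assume x: "max X 1 \<le> x"
    let ?\<phi> = "phi \<Lambda> (c * x powr \<sigma>)"
    show 1: "C / 2 * (c * x powr \<sigma>) powr \<alpha> \<le> ?\<phi>" using X[of x] l0(2) x by simp
    then have \<phi>: "2 * G * B + 1 \<le> ?\<phi>" using X[of x] x by linarith
    then have \<phi>0: "0 < ?\<phi>" using G(2) B(1) by (smt (verit) mult_nonneg_nonneg)
    have "grid_const * (ennreal (1 / ?\<phi>) * M1 \<Lambda> x (c * x powr \<sigma>)) \<le> ennreal G * (ennreal (1 / ?\<phi>) * ennreal B)"
      unfolding G(1) using x by (intro mult_left_mono B(2)) auto
    also have "ennreal (1 / ?\<phi>) * ennreal B = ennreal (1 / ?\<phi> * B)"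
      using \<phi>0 B(1) by (intro ennreal_mult[symmetric]) auto
    also have "ennreal G * \<dots> = ennreal (G * (1 / ?\<phi> * B))"
      using G(2) \<phi>0 B(1) by (intro ennreal_mult[symmetric]) auto
    also have "\<dots> \<le> ennreal (1/2)"
    proof (rule ennreal_leI)
      have "G * B \<le> 1/2 * ?\<phi>" using \<phi> by simp
      then have "G * B / ?\<phi> \<le> 1 / 2" using \<phi>0 by (simp add: pos_divide_le_eq)
      then show "G * (1 / ?\<phi> * B) \<le> 1/2" by simp
    qed
    finally show "grid_const * (ennreal (1 / ?\<phi>) * M1 \<Lambda> x (c * x powr \<sigma>)) \<le> ennreal (1/2)" .
  qed (use c in simp_all)
qed

lemma \<gamma>_large: "1 \<le> \<gamma> * (1 + \<sigma>)" "\<gamma> * p = 1" 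
  using p_facts by (simp_all add: pos_le_divide_eq)

text \<open>With h = \<epsilon> powr p one has x powr p = h t, so t x powr (\<alpha> \<sigma>)
  equals x powr (1 + \<sigma>) / h. The value of h makes t \<phi> / 2 at least (c + 1) x powr (1 +
  \<sigma>), which exceeds l x = c x powr (1 + \<sigma>) by x powr (1 + \<sigma>). This surplus is
  at least linear in t because \<gamma> (1 + \<sigma>) >= 1.\<close>

lemma lower_exponent:
  assumes c: "0 < c" and \<epsilon>: "\<epsilon> = (C * c powr \<alpha> / (4 * (c + 1))) powr \<gamma>" and t: "1 \<le> t" and x: "x = \<epsilon> * t powr \<gamma>"
    and \<phi>: "C / 2 * (c * x powr \<sigma>) powr \<alpha> \<le> \<phi>"
  shows "c * x powr \<sigma> * x - t * \<phi> / 2 \<le> - (\<epsilon> powr (1 + \<sigma>)) * t"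
proof -
  define h where "h = C * c powr \<alpha> / (4 * (c + 1))"
  have h: "0 < h" using C c by (simp add: h_def)
  have \<epsilon>0: "0 < \<epsilon>" and \<epsilon>p: "\<epsilon> powr p = h" using h p_facts(1) \<gamma>_large(2) unfolding \<epsilon> h_def[symmetric] by (simp_all add: powr_powr)
  have x0: "0 < x" using \<epsilon>0 t by (simp add: x)
  have xp: "x powr p = h * t" using \<epsilon>0 t \<gamma>_large(2) by (simp add: x powr_mult powr_powr \<epsilon>p)
  have xx: "x powr \<sigma> * x = x powr (1 + \<sigma>)" using x0 by (simp add: powr_add)
  have "x powr (1 + \<sigma>) = x powr p * x powr (\<alpha> * \<sigma>)" by (simp add: powr_add[symmetric] p_facts(3))
  also have "\<dots> = h * t * x powr (\<alpha> * \<sigma>)" by (simp add: xp)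
  finally have x1: "x powr (1 + \<sigma>) = h * t * x powr (\<alpha> * \<sigma>)" .
  have "t * \<phi> / 2 \<ge> t * (C / 2 * (c * x powr \<sigma>) powr \<alpha>) / 2" using \<phi> t by (intro divide_right_mono mult_left_mono) auto
  also have "t * (C / 2 * (c * x powr \<sigma>) powr \<alpha>) / 2 = (C * c powr \<alpha> / 4) * t * x powr (\<alpha> * \<sigma>)"
    using c x0 by (simp add: powr_mult powr_powr mult.commute[of \<sigma>])
  also have "C * c powr \<alpha> / 4 = (c + 1) * h" using c by (simp add: h_def divide_simps)
  also have "(c + 1) * h * t * x powr (\<alpha> * \<sigma>) = (c + 1) * x powr (1 + \<sigma>)" by (simp add: x1)
  finally have "c * x powr \<sigma> * x - t * \<phi> / 2 \<le> - (x powr (1 + \<sigma>))" using xx by (simp add: algebra_simps)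
  also have "x powr (1 + \<sigma>) = \<epsilon> powr (1 + \<sigma>) * t powr (\<gamma> * (1 + \<sigma>))" using \<epsilon>0 t by (simp add: x powr_mult powr_powr)
  also have "- \<dots> \<le> - (\<epsilon> powr (1 + \<sigma>) * t powr 1)"
    using t \<gamma>_large(1) by (intro le_imp_neg_le mult_left_mono powr_mono) auto
  finally show ?thesis using t by simp
qed

lemma low_particle_events:
  assumes M: "prob_space M" and bs: "branching_subordinator M 0 \<Lambda> T Y"
  shows "\<exists>\<epsilon>>0. \<exists>n0. \<forall>n\<ge>n0. \<exists>N\<in>sets M. emeasure M N \<le> ennreal (2 * exp (3 / 2) * exp (- (\<epsilon> powr (1 + \<sigma>))) ^ n) \<and>
    (AE \<omega> in M. (\<exists>v\<in>T \<omega>. \<exists>s\<ge>real n. birth_time v \<le> s \<and> Y v \<omega> s < \<epsilon> * real n powr \<gamma>) \<longrightarrow> \<omega> \<in> N)"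
proof -
  obtain c X where c: "0 < c" and X: "1 \<le> X" "\<And>x. X \<le> x \<Longrightarrow> C / 2 * (c * x powr \<sigma>) powr \<alpha> \<le> phi \<Lambda> (c * x powr \<sigma>) \<and>
     grid_const * (ennreal (1 / phi \<Lambda> (c * x powr \<sigma>)) * M1 \<Lambda> x (c * x powr \<sigma>)) \<le> ennreal (1/2)"
    using lower_regime by blast
  obtain a0 Ta where a0: "0 \<le> a0" and noise: "\<forall>a>a0. \<exists>\<xi> P. branching_noise M (marks a) a (levy a) \<xi> P \<and>
      (AE \<omega> in M. branching_noise.view M (marks a) a \<xi> P (Ta a) Y \<omega>)"
    and T: "AE \<omega> in M. T \<omega> = (\<Union>a\<in>{a0<..}. Ta a \<omega>)"
    and mono: "AE \<omega> in M. \<forall>a a'. a0 < a \<and> a \<le> a' \<longrightarrow> Ta a \<omega> \<subseteq> Ta a' \<omega>"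
    using levels[OF M bs] by (elim exE conjE) (rule that)
  define \<epsilon> where "\<epsilon> = (C * c powr \<alpha> / (4 * (c + 1))) powr \<gamma>"
  have \<epsilon>: "0 < \<epsilon>" using C c by (simp add: \<epsilon>_def)
  have "eventually (\<lambda>t. X \<le> \<epsilon> * t powr \<gamma>) at_top"
    using powr_at_top[OF p_facts(5) \<epsilon>] unfolding filterlim_at_top by blast
  then obtain t0 where t0: "\<And>t. t0 \<le> t \<Longrightarrow> X \<le> \<epsilon> * t powr \<gamma>" unfolding eventually_at_top_linorder by blast
  define n0 where "n0 = max 1 (nat \<lceil>t0\<rceil>)"
  have "\<exists>N\<in>sets M. emeasure M N \<le> ennreal (2 * exp (3 / 2) * exp (- (\<epsilon> powr (1 + \<sigma>))) ^ n) \<and>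
    (AE \<omega> in M. (\<exists>v\<in>T \<omega>. \<exists>s\<ge>real n. birth_time v \<le> s \<and> Y v \<omega> s < \<epsilon> * real n powr \<gamma>) \<longrightarrow> \<omega> \<in> N)"
    if n: "n0 \<le> n" for n
  proof -
    define x where "x = \<epsilon> * real n powr \<gamma>"
    \<comment> \<open>From level k0 on the estimate applies with the same bound, since only
      displacements below x <= k enter; this uniformity is what allows the limit over
      levels.\<close>
    define k0 where "k0 = Suc (nat \<lceil>max a0 x\<rceil>)"
    have k0: "a0 < real k" "x \<le> real k" if "k0 \<le> k" for k using that unfolding k0_def by linarith+
    let ?Q = "\<lambda>k \<omega>. \<exists>v\<in>Ta (real k) \<omega>. \<exists>s\<ge>real n. birth_time v \<le> s \<and> Y v \<omega> s < x"
    have n1: "1 \<le> real n" and nt: "t0 \<le> real n" using n unfolding n0_def by linarith+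
    have xX: "X \<le> x" using t0[OF nt] by (simp add: x_def)
    define l where "l = c * x powr \<sigma>"
    have l: "0 < l" using c xX X(1) by (simp add: l_def)
    note X2 = X(2)[OF xX, folded l_def]
    have \<phi>: "0 < phi \<Lambda> l" using X2 C l by (smt (verit) divide_pos_pos mult_pos_pos powr_gt_zero)
    have "\<exists>L\<in>sets M. emeasure M L \<le> ennreal (2 * exp (3 / 2) * exp (- (\<epsilon> powr (1 + \<sigma>))) ^ n) \<and> (AE \<omega> in M. ?Q k \<omega> \<longrightarrow> \<omega> \<in> L)"
      if k: "k0 \<le> k" for k
    proof -
      obtain \<xi> P where bn: "branching_noise M (marks (real k)) (real k) (levy (real k)) \<xi> P"
        and view: "AE \<omega> in M. branching_noise.view M (marks (real k)) (real k) \<xi> P (Ta (real k)) Y \<omega>"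
        using noise[rule_format, OF k0(1)[OF k]] by blast
      interpret bn: branching_noise M "marks (real k)" "real k" "levy (real k)" \<xi> P by (rule bn)
      have e: "laplace_exponent (levy (real k)) l = phi \<Lambda> l" using l by (intro laplace_exponent_levy) simp
      have ratio: "grid_const * (ennreal (1 / laplace_exponent (levy (real k)) l) * (\<integral>\<^sup>+y. trunc_laplace x l y \<partial>marks (real k))) \<le> ennreal (1/2)"
        unfolding e
        by (rule order_trans[OF _ conjunct2[OF X2]]) (intro mult_left_mono nn_integral_marks_trunc_laplace(1)[OF k0(2)[OF k]], simp_all)
      obtain L where L: "L \<in> sets M" "emeasure M L \<le> ennreal (2 * exp (l * x - real n * phi \<Lambda> l / 2 + 3 / 2))"
        "AE \<omega> in M. ?Q k \<omega> \<longrightarrow> \<omega> \<in> L"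
        using bn.early_low_particles_unlikely[OF view _ _ _ ratio, of "real n"] l \<phi> unfolding e by auto
      have "l * x - real n * phi \<Lambda> l / 2 \<le> - (\<epsilon> powr (1 + \<sigma>)) * real n"
        unfolding l_def by (rule lower_exponent[OF c \<epsilon>_def n1 x_def]) (use X2 in \<open>simp add: l_def\<close>)
      then have "exp (l * x - real n * phi \<Lambda> l / 2 + 3 / 2) \<le> exp (3 / 2 + real n * (- (\<epsilon> powr (1 + \<sigma>))))"
        by (simp add: mult.commute)
      also have "\<dots> = exp (3 / 2) * exp (- (\<epsilon> powr (1 + \<sigma>))) ^ n" by (simp only: exp_add exp_of_nat_mult)
      finally have "2 * exp (l * x - real n * phi \<Lambda> l / 2 + 3 / 2) \<le> 2 * exp (3 / 2) * exp (- (\<epsilon> powr (1 + \<sigma>))) ^ n" by simp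
      then have "emeasure M L \<le> ennreal (2 * exp (3 / 2) * exp (- (\<epsilon> powr (1 + \<sigma>))) ^ n)"
        using L(2) by (meson ennreal_leI order_trans)
      then show ?thesis using L(1,3) by blast
    qed
    moreover have "AE \<omega> in M. \<forall>k\<ge>k0. ?Q k \<omega> \<longrightarrow> (\<forall>k'\<ge>k. ?Q k' \<omega>)"
      using mono
    proof (eventually_elim, intro allI impI)
      fix \<omega> k k' assume mono: "\<forall>a a'. a0 < a \<and> a \<le> a' \<longrightarrow> Ta a \<omega> \<subseteq> Ta a' \<omega>" and k: "k0 \<le> k" "?Q k \<omega>" "k \<le> k'"
      have "Ta (real k) \<omega> \<subseteq> Ta (real k') \<omega>" using mono k0(1)[OF k(1)] k(3) by simp
      then show "?Q k' \<omega>" using k(2) by blast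
    qed
    ultimately obtain N where N: "N \<in> sets M" "emeasure M N \<le> ennreal (2 * exp (3 / 2) * exp (- (\<epsilon> powr (1 + \<sigma>))) ^ n)"
      "AE \<omega> in M. (\<exists>k\<ge>k0. ?Q k \<omega>) \<longrightarrow> \<omega> \<in> N"
      using increasing_events_cover[of k0 M _ ?Q] by blast
    have "AE \<omega> in M. (\<exists>v\<in>T \<omega>. \<exists>s\<ge>real n. birth_time v \<le> s \<and> Y v \<omega> s < x) \<longrightarrow> \<omega> \<in> N"
      using N(3) T mono
    proof (eventually_elim, intro impI)
      fix \<omega> assume N: "(\<exists>k\<ge>k0. ?Q k \<omega>) \<longrightarrow> \<omega> \<in> N" and T: "T \<omega> = (\<Union>a\<in>{a0<..}. Ta a \<omega>)"
        and mono: "\<forall>a a'. a0 < a \<and> a \<le> a' \<longrightarrow> Ta a \<omega> \<subseteq> Ta a' \<omega>"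
        and *: "\<exists>v\<in>T \<omega>. \<exists>s\<ge>real n. birth_time v \<le> s \<and> Y v \<omega> s < x"
      then obtain v a where v: "v \<in> Ta a \<omega>" "a0 < a" "\<exists>s\<ge>real n. birth_time v \<le> s \<and> Y v \<omega> s < x" by auto
      define k where "k = max k0 (nat \<lceil>a\<rceil>)"
      have k: "k0 \<le> k" "a \<le> real k" unfolding k_def by linarith+
      then have "v \<in> Ta (real k) \<omega>" using mono v(1,2) by blast
      then have "?Q k \<omega>" using v(3) by blast
      then show "\<omega> \<in> N" using N k(1) by blast
    qed
    then show ?thesis using N(1,2) unfolding x_def by blast
  qed
  then show ?thesis using \<epsilon> by blast
qed

text \<open>The event at the integer n concerns all times s >= n, so integers suffice: at time t the
  integer part n is at least t / 2, which costs the factor (1/2) powr \<gamma>. The ancestor makes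
  the infimum one over a nonempty set.\<close>

lemma lower_bound:
  assumes M: "prob_space M" and bs: "branching_subordinator M 0 \<Lambda> T Y"
  shows "\<exists>\<epsilon>>0. AE \<omega> in M. eventually (\<lambda>t. \<epsilon> * t powr \<gamma> \<le> leftmost T Y \<omega> t) at_top"
proof -
  obtain \<epsilon> n0 where \<epsilon>: "0 < \<epsilon>" and ev: "\<And>n. n0 \<le> n \<Longrightarrow> \<exists>N\<in>sets M.
    emeasure M N \<le> ennreal (2 * exp (3 / 2) * exp (- (\<epsilon> powr (1 + \<sigma>))) ^ n) \<and>
    (AE \<omega> in M. (\<exists>v\<in>T \<omega>. \<exists>s\<ge>real n. birth_time v \<le> s \<and> Y v \<omega> s < \<epsilon> * real n powr \<gamma>) \<longrightarrow> \<omega> \<in> N)"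
    using low_particle_events[OF M bs] by blast
  let ?bad = "\<lambda>n \<omega>. \<exists>v\<in>T \<omega>. \<exists>s\<ge>real n. birth_time v \<le> s \<and> Y v \<omega> s < \<epsilon> * real n powr \<gamma>"
  have bc: "AE \<omega> in M. eventually (\<lambda>n. ?bad n \<omega> \<longrightarrow> False) sequentially"
  proof (rule geometric_borel_cantelli)
    show "0 \<le> exp (- (\<epsilon> powr (1 + \<sigma>)))" "exp (- (\<epsilon> powr (1 + \<sigma>))) < 1" "0 \<le> 2 * exp (3 / 2 :: real)"
      using \<epsilon> by simp_all
    fix n assume n: "n0 \<le> n"
    obtain N where N: "N \<in> sets M" "emeasure M N \<le> ennreal (2 * exp (3 / 2) * exp (- (\<epsilon> powr (1 + \<sigma>))) ^ n)"
      "AE \<omega> in M. ?bad n \<omega> \<longrightarrow> \<omega> \<in> N" using ev[OF n] by blast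
    have "AE \<omega> in M. \<omega> \<notin> N \<and> ?bad n \<omega> \<longrightarrow> False" using N(3) by eventually_elim blast
    then show "\<exists>E\<in>sets M. emeasure M E \<le> ennreal (2 * exp (3 / 2) * exp (- (\<epsilon> powr (1 + \<sigma>))) ^ n) \<and>
      (AE \<omega> in M. \<omega> \<notin> E \<and> ?bad n \<omega> \<longrightarrow> False)" using N(1,2) by blast
  qed
  have root: "AE \<omega> in M. [] \<in> T \<omega>"
  proof -
    obtain a0 Ta where "0 \<le> a0" and noise: "\<forall>a>a0. \<exists>\<xi> P. branching_noise M (marks a) a (levy a) \<xi> P \<and>
      (AE \<omega> in M. branching_noise.view M (marks a) a \<xi> P (Ta a) Y \<omega>)"
      and T: "AE \<omega> in M. T \<omega> = (\<Union>a\<in>{a0<..}. Ta a \<omega>)"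
      and "AE \<omega> in M. \<forall>a a'. a0 < a \<and> a \<le> a' \<longrightarrow> Ta a \<omega> \<subseteq> Ta a' \<omega>"
      using levels[OF M bs] by (elim exE conjE) (rule that)
    have a: "a0 < a0 + 1" by simp
    obtain \<xi> P where bn: "branching_noise M (marks (a0 + 1)) (a0 + 1) (levy (a0 + 1)) \<xi> P"
      and view: "AE \<omega> in M. branching_noise.view M (marks (a0 + 1)) (a0 + 1) \<xi> P (Ta (a0 + 1)) Y \<omega>"
      using noise[rule_format, OF a] by blast
    show ?thesis using view T
    proof eventually_elim
      fix \<omega> assume "branching_noise.view M (marks (a0 + 1)) (a0 + 1) \<xi> P (Ta (a0 + 1)) Y \<omega>"
      then have "[] \<in> Ta (a0 + 1) \<omega>" by (rule branching_noise.view_root[OF bn])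
      moreover assume "T \<omega> = (\<Union>a\<in>{a0<..}. Ta a \<omega>)"
      ultimately show "[] \<in> T \<omega>" using a by blast
    qed
  qed
  have "AE \<omega> in M. eventually (\<lambda>t. \<epsilon> * (1/2) powr \<gamma> * t powr \<gamma> \<le> leftmost T Y \<omega> t) at_top"
    using bc root
  proof eventually_elim
    fix \<omega> assume "eventually (\<lambda>n. ?bad n \<omega> \<longrightarrow> False) sequentially" and root: "[] \<in> T \<omega>"
    then obtain n1 where n1: "\<And>n. n1 \<le> n \<Longrightarrow> \<not> ?bad n \<omega>" unfolding eventually_sequentially by blast
    have "\<epsilon> * (1/2) powr \<gamma> * t powr \<gamma> \<le> leftmost T Y \<omega> t" if t: "real n1 + 2 \<le> t" for t
    proof -
      define n where "n = nat \<lfloor>t\<rfloor>"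
      have n: "n1 \<le> n" "real n \<le> t" "t / 2 \<le> real n" using t unfolding n_def by linarith+
      have "\<epsilon> * (1/2) powr \<gamma> * t powr \<gamma> = \<epsilon> * (t / 2) powr \<gamma>" using t by (simp add: powr_divide)
      also have "\<dots> \<le> \<epsilon> * real n powr \<gamma>"
        using \<epsilon> n t p_facts(5) by (intro mult_left_mono powr_mono2) auto
      also have "\<dots> \<le> leftmost T Y \<omega> t"
        unfolding leftmost_def
      proof (rule cINF_greatest)
        show "alive T \<omega> t \<noteq> {}" using root t by (auto simp: alive_def intro!: exI[of _ "[]"])
        fix v assume "v \<in> alive T \<omega> t"
        then have v: "v \<in> T \<omega>" "birth_time v \<le> t" by (simp_all add: alive_def)
        show "\<epsilon> * real n powr \<gamma> \<le> Y v \<omega> t"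
        proof (rule ccontr)
          assume "\<not> ?thesis"
          then have "?bad n \<omega>" using v n(2) by (meson not_le)
          then show False using n1[OF n(1)] by blast
        qed
      qed
      finally show ?thesis .
    qed
    then show "eventually (\<lambda>t. \<epsilon> * (1/2) powr \<gamma> * t powr \<gamma> \<le> leftmost T Y \<omega> t) at_top"
      unfolding eventually_at_top_linorder by blast
  qed
  moreover have "0 < \<epsilon> * (1/2) powr \<gamma>" using \<epsilon> by simp
  ultimately show ?thesis by blast
qed

end

section \<open>Upper bound for the leftmost position\<close>

lemma eventually_linear_le_exponential:
  fixes A B b K :: real
  assumes "1 < b" "0 < K"
  shows "eventually (\<lambda>j. A + B * real j \<le> K * b ^ j) sequentially"
proof -
  have inv: "norm (1 / b) < 1" using assms by simp
  have "(\<lambda>j. A * (1 / b) ^ j + B * (real j * (1 / b) ^ j)) \<longlonglongrightarrow> A * 0 + B * 0"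
    by (intro tendsto_add tendsto_mult tendsto_const powser_times_n_limit_0 LIMSEQ_power_zero inv)
  then have "eventually (\<lambda>j. A * (1 / b) ^ j + B * (real j * (1 / b) ^ j) < K) sequentially"
    by (rule order_tendstoD) (use assms in simp)
  then show ?thesis
  proof eventually_elim
    fix j assume *: "A * (1 / b) ^ j + B * (real j * (1 / b) ^ j) < K"
    have b: "0 < b ^ j" using assms by simp
    have "A * (1 / b) ^ j + B * (real j * (1 / b) ^ j) = (A + B * real j) / b ^ j"
      by (simp add: power_one_over add_divide_distrib)
    then show "A + B * real j \<le> K * b ^ j" using * b by (simp add: pos_divide_less_eq)
  qed
qed

context branching_asymptotics
begin

text \<open>At level a take l = c1 a powr \<sigma> with c1 <= k / 2: the first moment s is then at
  least exp (2 \<theta> a powr (1 + \<sigma>)). The number m of halvings is about \<theta> a powr (1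
  + \<sigma>), so 2 powr m stays below c s and the children make up for the loss.\<close>

lemma upper_regime:
  "\<exists>K>0. \<exists>c>0. \<exists>A>0. \<forall>a\<ge>A. \<exists>m l s. 0 < (m::nat) \<and> 0 \<le> l \<and> 0 < s \<and> M1 \<Lambda> a l = ennreal s \<and> M2 \<Lambda> a l \<le> ennreal (c * s\<^sup>2) \<and>
     1 / (c * s) \<le> (1 / 2) ^ m \<and> 4 * (a / K) powr p * phi \<Lambda> (real m / a) \<le> real m"
proof -
  obtain k A1 where k: "0 < k" and A1: "0 < A1" "\<And>a. A1 \<le> a \<Longrightarrow> ennreal (exp (k * a powr (1 + \<sigma>))) \<le> mu \<Lambda> {0..<a}"
    using mu_lower by blast
  obtain l0 where l0: "0 < l0" "\<And>l. l0 \<le> l \<Longrightarrow> phi \<Lambda> l \<le> 2 * C * l powr \<alpha>" using phi_bounds by blast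
  obtain c0 where c0: "0 < c0" "\<And>c. 0 < c \<and> c \<le> c0 \<Longrightarrow> \<exists>K>0. \<exists>A>0. \<forall>a\<ge>A. 0 < M1 \<Lambda> a (c * a powr \<sigma>) \<longrightarrow>
     M2 \<Lambda> a (c * a powr \<sigma>) \<le> ennreal K * (M1 \<Lambda> a (c * a powr \<sigma>))\<^sup>2" using M2_le by blast
  define c1 where "c1 = min c0 (k / 2)"
  have c1: "0 < c1" "c1 \<le> k / 2" "c1 \<le> c0" using c0(1) k by (simp_all add: c1_def)
  obtain c A2 where c: "0 < c" and A2: "0 < A2" "\<And>a. A2 \<le> a \<Longrightarrow> 0 < M1 \<Lambda> a (c1 * a powr \<sigma>) \<Longrightarrow>
     M2 \<Lambda> a (c1 * a powr \<sigma>) \<le> ennreal c * (M1 \<Lambda> a (c1 * a powr \<sigma>))\<^sup>2"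
    using c0(2)[of c1] c1 by blast
  define \<theta> where "\<theta> = k / 4"
  have \<theta>: "0 < \<theta>" using k by (simp add: \<theta>_def)
  \<comment> \<open>Chosen so that K powr p = 8 C / \<theta> powr (1 - \<alpha>): with \<phi>(m / a)
    at most 2 C (m / a) powr \<alpha>, the slow motion condition at time (a / K) powr p follows from
    (\<theta> a powr (1 + \<sigma>)) powr (1 - \<alpha>) <= m powr (1 - \<alpha>).\<close>
  define K where "K = (8 * C / \<theta> powr (1 - \<alpha>)) powr \<gamma>"
  have K: "0 < K" using C \<theta> by (simp add: K_def)
  have Kp: "K powr p = 8 * C / \<theta> powr (1 - \<alpha>)" using C \<theta> \<gamma>_large(2) by (simp add: K_def powr_powr)
  have "eventually (\<lambda>a. l0 \<le> \<theta> * a powr \<sigma>) at_top" "eventually (\<lambda>a. 1 - ln c \<le> \<theta> * a powr (1 + \<sigma>)) at_top"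
    using powr_at_top[OF \<sigma> \<theta>] powr_at_top[of "1 + \<sigma>" \<theta>] \<sigma> \<theta> unfolding filterlim_at_top by auto
  then have "eventually (\<lambda>a. l0 \<le> \<theta> * a powr \<sigma> \<and> 1 - ln c \<le> \<theta> * a powr (1 + \<sigma>)) at_top" by eventually_elim simp
  then obtain A3 where A3: "\<And>a. A3 \<le> a \<Longrightarrow> l0 \<le> \<theta> * a powr \<sigma> \<and> 1 - ln c \<le> \<theta> * a powr (1 + \<sigma>)"
    unfolding eventually_at_top_linorder by blast
  define A where "A = max (max A1 A2) A3"
  have "\<exists>m l s. 0 < (m::nat) \<and> 0 \<le> l \<and> 0 < s \<and> M1 \<Lambda> a l = ennreal s \<and> M2 \<Lambda> a l \<le> ennreal (c * s\<^sup>2) \<and>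
     1 / (c * s) \<le> (1 / 2) ^ m \<and> 4 * (a / K) powr p * phi \<Lambda> (real m / a) \<le> real m" if a: "A \<le> a" for a
  proof -
    have a0: "0 < a" and a1: "A1 \<le> a" and a2: "A2 \<le> a" and a3: "A3 \<le> a" using a A1(1) by (simp_all add: A_def)
    note A3' = A3[OF a3]
    define m where "m = nat \<lceil>\<theta> * a powr (1 + \<sigma>)\<rceil>"
    define l where "l = c1 * a powr \<sigma>"
    define s where "s = enn2real (M1 \<Lambda> a l)"
    have l: "0 \<le> l" using c1 by (simp add: l_def)
    have aa: "a powr (1 + \<sigma>) = a powr \<sigma> * a" using a0 by (simp add: powr_add)
    have pos: "0 < \<theta> * a powr (1 + \<sigma>)" using \<theta> a0 by simp
    have m: "\<theta> * a powr (1 + \<sigma>) \<le> real m" "real m \<le> \<theta> * a powr (1 + \<sigma>) + 1" "0 < m"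
      using pos unfolding m_def by linarith+
    have "M1 \<Lambda> a l < \<infinity>" by (rule M1_finite[OF a0 l])
    then have s: "M1 \<Lambda> a l = ennreal s" by (simp add: s_def)
    have "ennreal (exp (- l * a)) * ennreal (exp (k * a powr (1 + \<sigma>))) \<le> ennreal (exp (- l * a)) * mu \<Lambda> {0..<a}"
      by (intro mult_left_mono A1(2)[OF a1]) simp
    also have "\<dots> \<le> M1 \<Lambda> a l" by (rule M1_lower[OF a0 l])
    finally have "ennreal (exp (- l * a) * exp (k * a powr (1 + \<sigma>))) \<le> ennreal s"
      unfolding s by (subst ennreal_mult) auto
    then have "exp (- l * a) * exp (k * a powr (1 + \<sigma>)) \<le> s"
      by (subst (asm) ennreal_le_iff) (simp_all add: s_def)
    moreover have "2 * \<theta> * a powr (1 + \<sigma>) \<le> - l * a + k * a powr (1 + \<sigma>)"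
    proof -
      have "l * a = c1 * a powr (1 + \<sigma>)" by (simp add: l_def aa)
      also have "\<dots> \<le> k / 2 * a powr (1 + \<sigma>)" by (intro mult_right_mono c1) simp
      finally show ?thesis by (simp add: \<theta>_def)
    qed
    then have "exp (2 * \<theta> * a powr (1 + \<sigma>)) \<le> exp (- l * a) * exp (k * a powr (1 + \<sigma>))"
      by (simp only: exp_add[symmetric] exp_le_cancel_iff)
    ultimately have s_ge: "exp (2 * \<theta> * a powr (1 + \<sigma>)) \<le> s" by linarith
    have s0: "0 < s" using s_ge by (rule less_le_trans[rotated]) simp
    have M2: "M2 \<Lambda> a l \<le> ennreal (c * s\<^sup>2)"
    proof -
      have "M2 \<Lambda> a l \<le> ennreal c * (M1 \<Lambda> a l)\<^sup>2"
        using A2(2)[OF a2] s0 unfolding l_def[symmetric] s by simp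
      also have "\<dots> = ennreal (c * s\<^sup>2)" using c s0 unfolding s by (simp add: ennreal_power ennreal_mult)
      finally show ?thesis .
    qed
    have \<rho>: "1 / (c * s) \<le> (1 / 2) ^ m"
    proof -
      have "real m - 2 * \<theta> * a powr (1 + \<sigma>) \<le> ln c" using m(2) A3' by simp
      then have "exp (real m - 2 * \<theta> * a powr (1 + \<sigma>)) \<le> exp (ln c)" by simp
      then have "exp (real m) \<le> c * exp (2 * \<theta> * a powr (1 + \<sigma>))"
        using c by (simp add: exp_diff pos_divide_le_eq)
      also have "\<dots> \<le> c * s" using s_ge c by simp
      finally have "exp (real m) \<le> c * s" .
      moreover have "(2::real) ^ m \<le> exp (real m)"
      proof -
        have "(2::real) \<le> exp 1" using exp_ge_add_one_self[of 1] by simp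
        then have "(2::real) ^ m \<le> exp 1 ^ m" by (intro power_mono) auto
        also have "exp (1::real) ^ m = exp (real m)" using exp_of_nat_mult[of m "1::real"] by simp
        finally show ?thesis .
      qed
      ultimately have "2 ^ m \<le> c * s" by linarith
      then have "1 / (c * s) \<le> 1 / 2 ^ m" by (intro divide_left_mono) (use c s0 in auto)
      then show ?thesis by (simp add: power_one_over)
    qed
    have small: "4 * (a / K) powr p * phi \<Lambda> (real m / a) \<le> real m"
    proof -
      have "\<theta> * a powr \<sigma> \<le> real m / a" using m(1) a0 by (simp add: aa pos_le_divide_eq mult.assoc)
      then have "phi \<Lambda> (real m / a) \<le> 2 * C * (real m / a) powr \<alpha>" using A3' by (intro l0(2)) simp
      then have "4 * (a / K) powr p * phi \<Lambda> (real m / a) \<le> 4 * (a / K) powr p * (2 * C * (real m / a) powr \<alpha>)"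
        by (intro mult_left_mono) auto
      also have "\<dots> = (8 * C / K powr p) * (a powr p / a powr \<alpha>) * real m powr \<alpha>"
        using a0 K by (simp add: powr_divide)
      also have "8 * C / K powr p = \<theta> powr (1 - \<alpha>)" using C \<theta> unfolding Kp by simp
      also have "a powr p / a powr \<alpha> = (a powr (1 + \<sigma>)) powr (1 - \<alpha>)"
        using a0 by (simp add: powr_diff[symmetric] powr_powr p_def mult.commute)
      also have "\<theta> powr (1 - \<alpha>) * (a powr (1 + \<sigma>)) powr (1 - \<alpha>) = (\<theta> * a powr (1 + \<sigma>)) powr (1 - \<alpha>)"
        using \<theta> by (simp add: powr_mult)
      also have "\<dots> * real m powr \<alpha> \<le> real m powr (1 - \<alpha>) * real m powr \<alpha>"
        using m(1) pos \<alpha> by (intro mult_right_mono powr_mono2) auto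
      also have "\<dots> = real m" using m(3) by (simp add: powr_add[symmetric])
      finally show ?thesis .
    qed
    show ?thesis using m(3) l s0 s M2 \<rho> small by blast
  qed
  moreover have "0 < A" using A1(1) by (simp add: A_def)
  ultimately show ?thesis using K c by blast
qed

text \<open>Instance of \<open>candidates_reach\<close> at level a with y = a and \<rho> = (1/2) ^
  m: a child moves by at most a during t with probability at least \<rho> by
  \<open>subordinator_small\<close>, and the moment bounds let the exponent be 1 / (4 c), so the
  bound on the failure probability depends on the level only through c.\<close>

lemma upper_step:
  assumes bn: "branching_noise M (marks a) a (levy a) \<xi> P"
    and view: "AE \<omega> in M. branching_noise.view M (marks a) a \<xi> P Ta Y \<omega>"
    and a: "0 < a" and l: "0 \<le> l" and s: "0 < s" "M1 \<Lambda> a l = ennreal s" and c: "0 < c" "M2 \<Lambda> a l \<le> ennreal (c * s\<^sup>2)"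
    and m: "0 < m" "1 / (c * s) \<le> (1 / 2) ^ m" and t: "0 \<le> t" "4 * t * phi \<Lambda> (real m / a) \<le> real m"
    and K0: "0 < K0" "phi \<Lambda> (1 / K0) \<le> 1 / 8" and x: "0 \<le> x"
  shows "\<exists>E\<in>sets M. emeasure M E \<le> ennreal (((1 + exp (- (1 / (4 * c)))) / 2) ^ j) \<and>
    (AE \<omega> in M. \<omega> \<notin> E \<and> (\<exists>F\<subseteq>Ta \<omega>. finite F \<and> j \<le> card F \<and>
        (\<forall>v\<in>F. length v = g \<and> birth_time v \<le> \<beta> \<and> Y v \<omega> (birth_time v) \<le> x)) \<longrightarrow>
      (\<exists>v\<in>Ta \<omega>. birth_time v \<le> \<beta> + 2 \<and> (\<forall>s. birth_time v \<le> s \<and> s \<le> t \<longrightarrow> Y v \<omega> s \<le> x + K0 + a + a)))"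
proof -
  interpret bn: branching_noise M "marks a" a "levy a" \<xi> P by (rule bn)
  show ?thesis
  proof (rule bn.candidates_reach[OF view t(1), of "(1/2) ^ m"])
    show "(1/2) ^ m \<le> bn.prob {\<omega> \<in> space M. \<xi> u t \<omega> \<le> a}" for u
      by (rule bn.subordinator_small[OF bn.sub t(1) a m(1)]) (use laplace_exponent_levy t(2) a in simp)
    show "bn.prob {\<omega> \<in> space M. K0 < \<xi> u 2 \<omega>} \<le> 1 / 2" for u
      using bn.subordinator_tail[OF bn.sub _ K0(1), of 2 u] laplace_exponent_levy[of "1 / K0" a] K0 by simp
    show "ennreal (1 / (4 * c)) < (\<integral>\<^sup>+x. ennreal (1 - exp (- ((1 / 2) ^ m) * real (kid_count x))) \<partial>marks a)"
    proof (rule bn.kid_count_bound[OF l s(1) _ c(1) _ m(2)])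
      show "(\<integral>\<^sup>+x. trunc_laplace a l x \<partial>marks a) = ennreal s"
        unfolding nn_integral_marks_trunc_laplace(2)[OF order_refl] by (rule s(2))
      show "(\<integral>\<^sup>+x. (trunc_laplace a l x)\<^sup>2 \<partial>marks a) \<le> ennreal (c * s\<^sup>2)"
        unfolding nn_integral_marks_trunc_laplace(3)[OF order_refl] by (rule c(2))
    qed
  qed (use a c(1) x K0(1) in \<open>simp_all add: power_le_one\<close>)
qed

text \<open>The leftmost position is an infimum of reals, which is sure to lie below each member
  only when the set is bounded below; 0 is the bound used in the upper estimate.\<close>

lemma positions_nonneg:
  assumes M: "prob_space M" and bs: "branching_subordinator M 0 \<Lambda> T Y"
  shows "AE \<omega> in M. \<forall>v\<in>T \<omega>. \<forall>t\<ge>birth_time v. 0 \<le> Y v \<omega> t"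
proof -
  obtain a0 Ta where a0: "0 \<le> a0" and noise: "\<forall>a>a0. \<exists>\<xi> P. branching_noise M (marks a) a (levy a) \<xi> P \<and>
      (AE \<omega> in M. branching_noise.view M (marks a) a \<xi> P (Ta a) Y \<omega>)"
    and T: "AE \<omega> in M. T \<omega> = (\<Union>a\<in>{a0<..}. Ta a \<omega>)"
    and mono: "AE \<omega> in M. \<forall>a a'. a0 < a \<and> a \<le> a' \<longrightarrow> Ta a \<omega> \<subseteq> Ta a' \<omega>"
    using levels[OF M bs] by (elim exE conjE) (rule that)
  have "AE \<omega> in M. a0 < real k \<longrightarrow> (\<forall>v\<in>Ta (real k) \<omega>. \<forall>t\<ge>birth_time v. 0 \<le> Y v \<omega> t)" for k
  proof (cases "a0 < real k")
    case True
    obtain \<xi> P where bn: "branching_noise M (marks (real k)) (real k) (levy (real k)) \<xi> P"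
      and view: "AE \<omega> in M. branching_noise.view M (marks (real k)) (real k) \<xi> P (Ta (real k)) Y \<omega>"
      using noise[rule_format, OF True] by blast
    show ?thesis using view
      by eventually_elim (intro impI ballI allI branching_noise.view_nonneg[OF bn])
  qed simp
  then have "AE \<omega> in M. \<forall>k. a0 < real k \<longrightarrow> (\<forall>v\<in>Ta (real k) \<omega>. \<forall>t\<ge>birth_time v. 0 \<le> Y v \<omega> t)"
    by (simp only: AE_all_countable) blast
  then show ?thesis using T mono
  proof (eventually_elim, intro ballI)
    fix \<omega> v assume nn: "\<forall>k. a0 < real k \<longrightarrow> (\<forall>v\<in>Ta (real k) \<omega>. \<forall>t\<ge>birth_time v. 0 \<le> Y v \<omega> t)"
      and T: "T \<omega> = (\<Union>a\<in>{a0<..}. Ta a \<omega>)" and mono: "\<forall>a a'. a0 < a \<and> a \<le> a' \<longrightarrow> Ta a \<omega> \<subseteq> Ta a' \<omega>" and v: "v \<in> T \<omega>"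
    obtain a where a: "a0 < a" "v \<in> Ta a \<omega>" using v T by auto
    define k where "k = nat \<lceil>a\<rceil>"
    have k: "a \<le> real k" unfolding k_def by linarith
    then have "v \<in> Ta (real k) \<omega>" using mono a by blast
    moreover have "a0 < real k" using a(1) k by linarith
    ultimately show "\<forall>t\<ge>birth_time v. 0 \<le> Y v \<omega> t" using nn by blast
  qed
qed

text \<open>Two levels are combined. Level b is fixed and supplies more than j candidates in
  generation 2 j + 1 (n = 2 j in \<open>n < 2 * card F\<close>); the level \<open>lv j\<close>, of
  order 2 powr (\<gamma> j), supplies their slow children. The candidates exist at both levels by
  monotonicity, and \<open>lv j\<close> is chosen so that (\<open>lv j\<close> / K) powr p = 2 ^ j
  is the required time.\<close>

lemma fast_particles:
  assumes M: "prob_space M" and bs: "branching_subordinator M 0 \<Lambda> T Y"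
  shows "\<exists>K>0. \<exists>\<kappa>>0. \<exists>K0>0. AE \<omega> in M. \<exists>D::nat. eventually (\<lambda>j. \<exists>v\<in>T \<omega>. birth_time v \<le> (real D + \<kappa> * real (2 * j)) + 2 \<and>
      (\<forall>s. birth_time v \<le> s \<and> s \<le> 2 ^ j \<longrightarrow> Y v \<omega> s \<le> (real D + \<kappa> * real (2 * j)) + K0 + 2 * (K * (2 powr \<gamma>) ^ j))) sequentially"
proof -
  obtain a0 Ta where a0: "0 \<le> a0" and noise: "\<forall>a>a0. \<exists>\<xi> P. branching_noise M (marks a) a (levy a) \<xi> P \<and>
      (AE \<omega> in M. branching_noise.view M (marks a) a \<xi> P (Ta a) Y \<omega>)"
    and T: "AE \<omega> in M. T \<omega> = (\<Union>a\<in>{a0<..}. Ta a \<omega>)"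
    and mono: "AE \<omega> in M. \<forall>a a'. a0 < a \<and> a \<le> a' \<longrightarrow> Ta a \<omega> \<subseteq> Ta a' \<omega>"
    using levels[OF M bs] by (elim exE conjE) (rule that)
  define b where "b = a0 + 1"
  have b: "a0 < b" "0 < b" using a0 by (simp_all add: b_def)
  obtain \<xi> P where bn: "branching_noise M (marks b) b (levy b) \<xi> P"
    and view: "AE \<omega> in M. branching_noise.view M (marks b) b \<xi> P (Ta b) Y \<omega>"
    using noise[rule_format, OF b(1)] by blast
  interpret bn: branching_noise M "marks b" b "levy b" \<xi> P by (rule bn)
  obtain \<kappa> where \<kappa>: "0 < \<kappa>" and many: "AE \<omega> in M. \<exists>D::nat. eventually (\<lambda>n. \<exists>F\<subseteq>Ta b \<omega>. finite F \<and> n < 2 * card F \<and>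
    (\<forall>v\<in>F. length v = Suc n \<and> birth_time v \<le> real D + \<kappa> * real n \<and> Y v \<omega> (birth_time v) \<le> real D + \<kappa> * real n)) sequentially"
    using bn.many_particles_nearby_view[OF view] by blast
  obtain K0 where K0: "0 < K0" "laplace_exponent (levy b) (1 / K0) < 1 / 8"
    using bn.laplace_exponent_small[of "1 / 8"] by auto
  have K0': "phi \<Lambda> (1 / K0) \<le> 1 / 8" using K0 laplace_exponent_levy[of "1 / K0" b] by simp
  obtain K c A where K: "0 < K" and c: "0 < c" and A: "0 < A" and regime: "\<And>a. A \<le> a \<Longrightarrow>
     \<exists>m l s. 0 < (m::nat) \<and> 0 \<le> l \<and> 0 < s \<and> M1 \<Lambda> a l = ennreal s \<and> M2 \<Lambda> a l \<le> ennreal (c * s\<^sup>2) \<and>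
     1 / (c * s) \<le> (1 / 2) ^ m \<and> 4 * (a / K) powr p * phi \<Lambda> (real m / a) \<le> real m"
    using upper_regime by blast
  define lv where "lv = (\<lambda>j::nat. K * (2 powr \<gamma>) ^ j)"
  have g1: "1 < (2::real) powr \<gamma>" using p_facts(5) by simp
  have "eventually (\<lambda>j. max A b + 0 * real j \<le> lv j) sequentially"
    unfolding lv_def by (rule eventually_linear_le_exponential[OF g1 K])
  then obtain j0 where j0: "\<And>j. j0 \<le> j \<Longrightarrow> A \<le> lv j \<and> b \<le> lv j" unfolding eventually_sequentially by auto
  have lvp: "(lv j / K) powr p = 2 ^ j" for j
  proof -
    have "lv j / K = (2 powr \<gamma>) powr real j" using K by (simp add: lv_def powr_realpow)
    then have "(lv j / K) powr p = 2 powr (\<gamma> * p * real j)" by (simp add: powr_powr mult_ac)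
    then show ?thesis by (simp add: \<gamma>_large(2) powr_realpow)
  qed
  let ?x = "\<lambda>D j. real D + \<kappa> * real (2 * j)"
  let ?Q = "\<lambda>D j \<omega>. \<exists>F\<subseteq>Ta (lv j) \<omega>. finite F \<and> j \<le> card F \<and>
    (\<forall>v\<in>F. length v = Suc (2 * j) \<and> birth_time v \<le> ?x D j \<and> Y v \<omega> (birth_time v) \<le> ?x D j)"
  let ?R = "\<lambda>D j \<omega>. \<exists>v\<in>Ta (lv j) \<omega>. birth_time v \<le> ?x D j + 2 \<and>
    (\<forall>s. birth_time v \<le> s \<and> s \<le> 2 ^ j \<longrightarrow> Y v \<omega> s \<le> ?x D j + K0 + lv j + lv j)"
  \<comment> \<open>The constant D of the candidates is random; the estimate is made for each fixed
    natural number D, and all of them hold simultaneously outside a null set.\<close>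
  have "AE \<omega> in M. eventually (\<lambda>j. ?Q D j \<omega> \<longrightarrow> ?R D j \<omega>) sequentially" for D :: nat
  proof (rule geometric_borel_cantelli[where B = 1 and q = "(1 + exp (- (1 / (4 * c)))) / 2" and ?j0.0 = j0])
    fix j assume j: "j0 \<le> j"
    have lvj: "A \<le> lv j" "a0 < lv j" "0 < lv j" using j0[OF j] b by linarith+
    obtain \<xi> P where bn': "branching_noise M (marks (lv j)) (lv j) (levy (lv j)) \<xi> P"
      and view': "AE \<omega> in M. branching_noise.view M (marks (lv j)) (lv j) \<xi> P (Ta (lv j)) Y \<omega>"
      using noise[rule_format, OF lvj(2)] by blast
    obtain m l s where mls: "0 < (m::nat)" "0 \<le> l" "0 < s" "M1 \<Lambda> (lv j) l = ennreal s" "M2 \<Lambda> (lv j) l \<le> ennreal (c * s\<^sup>2)"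
      "1 / (c * s) \<le> (1 / 2) ^ m" "4 * 2 ^ j * phi \<Lambda> (real m / lv j) \<le> real m"
      using regime[OF lvj(1)] unfolding lvp by blast
    have x: "0 \<le> ?x D j" using \<kappa> by simp
    show "\<exists>E\<in>sets M. emeasure M E \<le> ennreal (1 * ((1 + exp (- (1 / (4 * c)))) / 2) ^ j) \<and>
      (AE \<omega> in M. \<omega> \<notin> E \<and> ?Q D j \<omega> \<longrightarrow> ?R D j \<omega>)"
      unfolding mult_1
      by (rule upper_step[OF bn' view' lvj(3) mls(2,3,4) c mls(5,1,6) _ mls(7) K0(1) K0' x]) simp
  qed (use c in simp_all)
  then have all: "AE \<omega> in M. \<forall>D. eventually (\<lambda>j. ?Q D j \<omega> \<longrightarrow> ?R D j \<omega>) sequentially"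
    by (simp only: AE_all_countable) blast
  have "AE \<omega> in M. \<exists>D::nat. eventually (\<lambda>j. \<exists>v\<in>T \<omega>. birth_time v \<le> ?x D j + 2 \<and>
    (\<forall>s. birth_time v \<le> s \<and> s \<le> 2 ^ j \<longrightarrow> Y v \<omega> s \<le> ?x D j + K0 + 2 * (K * (2 powr \<gamma>) ^ j))) sequentially"
    using all many T mono
  proof eventually_elim
    fix \<omega> assume all: "\<forall>D. eventually (\<lambda>j. ?Q D j \<omega> \<longrightarrow> ?R D j \<omega>) sequentially"
      and many: "\<exists>D::nat. eventually (\<lambda>n. \<exists>F\<subseteq>Ta b \<omega>. finite F \<and> n < 2 * card F \<and>
        (\<forall>v\<in>F. length v = Suc n \<and> birth_time v \<le> real D + \<kappa> * real n \<and> Y v \<omega> (birth_time v) \<le> real D + \<kappa> * real n)) sequentially"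
      and T: "T \<omega> = (\<Union>a\<in>{a0<..}. Ta a \<omega>)" and mono: "\<forall>a a'. a0 < a \<and> a \<le> a' \<longrightarrow> Ta a \<omega> \<subseteq> Ta a' \<omega>"
    obtain D n0 where n0: "\<And>n. n0 \<le> n \<Longrightarrow> \<exists>F\<subseteq>Ta b \<omega>. finite F \<and> n < 2 * card F \<and>
        (\<forall>v\<in>F. length v = Suc n \<and> birth_time v \<le> real D + \<kappa> * real n \<and> Y v \<omega> (birth_time v) \<le> real D + \<kappa> * real n)"
      using many unfolding eventually_sequentially by blast
    have "eventually (\<lambda>j. ?Q D j \<omega> \<longrightarrow> ?R D j \<omega>) sequentially" using all by blast
    then have "eventually (\<lambda>j. \<exists>v\<in>T \<omega>. birth_time v \<le> ?x D j + 2 \<and>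
      (\<forall>s. birth_time v \<le> s \<and> s \<le> 2 ^ j \<longrightarrow> Y v \<omega> s \<le> ?x D j + K0 + 2 * (K * (2 powr \<gamma>) ^ j))) sequentially"
      using eventually_ge_at_top[of "max j0 n0"]
    proof eventually_elim
      fix j assume QR: "?Q D j \<omega> \<longrightarrow> ?R D j \<omega>" and j: "max j0 n0 \<le> j"
      have lvj: "b \<le> lv j" using j0[of j] j by simp
      have "n0 \<le> 2 * j" using j by simp
      from n0[OF this] obtain F where F: "F \<subseteq> Ta b \<omega>" "finite F" "2 * j < 2 * card F"
        "\<forall>v\<in>F. length v = Suc (2 * j) \<and> birth_time v \<le> ?x D j \<and> Y v \<omega> (birth_time v) \<le> ?x D j"
        by blast
      have "Ta b \<omega> \<subseteq> Ta (lv j) \<omega>" using mono b(1) lvj by blast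
      then have "?Q D j \<omega>" using F by (intro exI[of _ F]) auto
      then obtain v where v: "v \<in> Ta (lv j) \<omega>" "birth_time v \<le> ?x D j + 2"
        "\<forall>s. birth_time v \<le> s \<and> s \<le> 2 ^ j \<longrightarrow> Y v \<omega> s \<le> ?x D j + K0 + lv j + lv j" using QR by blast
      have "a0 < lv j" using b(1) lvj by linarith
      then have vT: "v \<in> T \<omega>" using T v(1) by blast
      have eq: "?x D j + K0 + lv j + lv j = ?x D j + K0 + 2 * (K * (2 powr \<gamma>) ^ j)" by (simp add: lv_def)
      show "\<exists>v\<in>T \<omega>. birth_time v \<le> ?x D j + 2 \<and>
        (\<forall>s. birth_time v \<le> s \<and> s \<le> 2 ^ j \<longrightarrow> Y v \<omega> s \<le> ?x D j + K0 + 2 * (K * (2 powr \<gamma>) ^ j))"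
        using vT v(2) v(3)[unfolded eq] by blast
    qed
    then show "\<exists>D::nat. eventually (\<lambda>j. \<exists>v\<in>T \<omega>. birth_time v \<le> ?x D j + 2 \<and>
      (\<forall>s. birth_time v \<le> s \<and> s \<le> 2 ^ j \<longrightarrow> Y v \<omega> s \<le> ?x D j + K0 + 2 * (K * (2 powr \<gamma>) ^ j))) sequentially" by blast
  qed
  then show ?thesis using K \<kappa> K0(1) by blast
qed

text \<open>A large time t lies between 2 ^ j / 2 and 2 ^ j for some j, and the particle found for j
  is born before 2 ^ j / 2 because its birth time is bounded linearly in j. Its position is
  controlled from birth up to 2 ^ j, so dyadic times suffice; 2 ^ j <= 2 t gives the factor 2 powr
  \<gamma>, and the linear terms turn 2 K into 3 K.\<close>

lemma upper_bound:
  assumes M: "prob_space M" and bs: "branching_subordinator M 0 \<Lambda> T Y"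
  shows "\<exists>K>0. AE \<omega> in M. eventually (\<lambda>t. leftmost T Y \<omega> t \<le> K * t powr \<gamma>) at_top"
proof -
  obtain K \<kappa> K0 where K: "0 < K" "0 < \<kappa>" "0 < K0" and fast: "AE \<omega> in M. \<exists>D::nat. eventually (\<lambda>j. \<exists>v\<in>T \<omega>.
      birth_time v \<le> (real D + \<kappa> * real (2 * j)) + 2 \<and>
      (\<forall>s. birth_time v \<le> s \<and> s \<le> 2 ^ j \<longrightarrow> Y v \<omega> s \<le> (real D + \<kappa> * real (2 * j)) + K0 + 2 * (K * (2 powr \<gamma>) ^ j))) sequentially"
    using fast_particles[OF M bs] by blast
  have g1: "1 < (2::real) powr \<gamma>" using p_facts(5) by simp
  have "AE \<omega> in M. eventually (\<lambda>t. leftmost T Y \<omega> t \<le> 3 * K * 2 powr \<gamma> * t powr \<gamma>) at_top"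
    using fast positions_nonneg[OF M bs]
  proof eventually_elim
    fix \<omega> assume "\<exists>D::nat. eventually (\<lambda>j. \<exists>v\<in>T \<omega>. birth_time v \<le> (real D + \<kappa> * real (2 * j)) + 2 \<and>
      (\<forall>s. birth_time v \<le> s \<and> s \<le> 2 ^ j \<longrightarrow> Y v \<omega> s \<le> (real D + \<kappa> * real (2 * j)) + K0 + 2 * (K * (2 powr \<gamma>) ^ j))) sequentially"
      and nn: "\<forall>v\<in>T \<omega>. \<forall>t\<ge>birth_time v. 0 \<le> Y v \<omega> t"
    then obtain D :: nat where ev: "eventually (\<lambda>j. \<exists>v\<in>T \<omega>. birth_time v \<le> (real D + \<kappa> * real (2 * j)) + 2 \<and>
      (\<forall>s. birth_time v \<le> s \<and> s \<le> 2 ^ j \<longrightarrow> Y v \<omega> s \<le> (real D + \<kappa> * real (2 * j)) + K0 + 2 * (K * (2 powr \<gamma>) ^ j))) sequentially"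
      by blast
    have e1: "eventually (\<lambda>j. (real D + 2) + (2 * \<kappa>) * real j \<le> (1/2) * 2 ^ j) sequentially"
      by (rule eventually_linear_le_exponential) simp_all
    have e2: "eventually (\<lambda>j. (real D + K0) + (2 * \<kappa>) * real j \<le> K * (2 powr \<gamma>) ^ j) sequentially"
      by (rule eventually_linear_le_exponential[OF g1 K(1)])
    have "eventually (\<lambda>j. \<exists>v\<in>T \<omega>. birth_time v \<le> 2 ^ j / 2 \<and>
      (\<forall>s. birth_time v \<le> s \<and> s \<le> 2 ^ j \<longrightarrow> Y v \<omega> s \<le> 3 * (K * (2 powr \<gamma>) ^ j))) sequentially"
      using ev e1 e2
    proof eventually_elim
      fix j assume e1: "(real D + 2) + (2 * \<kappa>) * real j \<le> (1/2) * 2 ^ j"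
        and e2: "(real D + K0) + (2 * \<kappa>) * real j \<le> K * (2 powr \<gamma>) ^ j"
        and "\<exists>v\<in>T \<omega>. birth_time v \<le> (real D + \<kappa> * real (2 * j)) + 2 \<and>
          (\<forall>s. birth_time v \<le> s \<and> s \<le> 2 ^ j \<longrightarrow> Y v \<omega> s \<le> (real D + \<kappa> * real (2 * j)) + K0 + 2 * (K * (2 powr \<gamma>) ^ j))"
      then obtain v where v: "v \<in> T \<omega>" "birth_time v \<le> (real D + \<kappa> * real (2 * j)) + 2"
        "\<And>s. birth_time v \<le> s \<and> s \<le> 2 ^ j \<Longrightarrow> Y v \<omega> s \<le> (real D + \<kappa> * real (2 * j)) + K0 + 2 * (K * (2 powr \<gamma>) ^ j)"
        by blast
      have eq: "\<kappa> * real (2 * j) = (2 * \<kappa>) * real j" by simp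
      have "birth_time v \<le> 2 ^ j / 2" using v(2) e1 unfolding eq by linarith
      moreover have "Y v \<omega> s \<le> 3 * (K * (2 powr \<gamma>) ^ j)" if "birth_time v \<le> s \<and> s \<le> 2 ^ j" for s
        using v(3)[OF that] e2 unfolding eq by linarith
      ultimately show "\<exists>v\<in>T \<omega>. birth_time v \<le> 2 ^ j / 2 \<and>
        (\<forall>s. birth_time v \<le> s \<and> s \<le> 2 ^ j \<longrightarrow> Y v \<omega> s \<le> 3 * (K * (2 powr \<gamma>) ^ j))" using v(1) by blast
    qed
    then obtain j1 where j1: "\<And>j. j1 \<le> j \<Longrightarrow> \<exists>v\<in>T \<omega>. birth_time v \<le> 2 ^ j / 2 \<and>
      (\<forall>s. birth_time v \<le> s \<and> s \<le> 2 ^ j \<longrightarrow> Y v \<omega> s \<le> 3 * (K * (2 powr \<gamma>) ^ j))"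
      unfolding eventually_sequentially by blast
    have "leftmost T Y \<omega> t \<le> 3 * K * 2 powr \<gamma> * t powr \<gamma>" if t: "2 ^ j1 \<le> t" for t
    proof -
      have t1: "1 \<le> t" using t one_le_power[of "2::real" j1] by linarith
      define j where "j = nat \<lceil>log 2 t\<rceil>"
      have lt: "0 \<le> log 2 t" using t1 by simp
      have j: "log 2 t \<le> real j" "real j \<le> log 2 t + 1" using lt unfolding j_def by linarith+
      have tj: "t = 2 powr log 2 t" using t1 by simp
      have "2 powr log 2 t \<le> 2 powr real j" using j(1) by (intro powr_mono) auto
      then have up: "t \<le> 2 ^ j" using tj by (simp add: powr_realpow)
      have "2 powr real j \<le> 2 powr (log 2 t + 1)" using j(2) by (intro powr_mono) auto
      then have lo: "2 ^ j \<le> 2 * t" using tj by (simp add: powr_realpow powr_add)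
      have "(2::real) ^ j1 \<le> 2 ^ j" using t up by linarith
      then have "j1 \<le> j" by simp
      then obtain v where v: "v \<in> T \<omega>" "birth_time v \<le> 2 ^ j / 2"
        "\<forall>s. birth_time v \<le> s \<and> s \<le> 2 ^ j \<longrightarrow> Y v \<omega> s \<le> 3 * (K * (2 powr \<gamma>) ^ j)" using j1 by blast
      have bt: "birth_time v \<le> t" using v(2) lo by linarith
      have "leftmost T Y \<omega> t \<le> Y v \<omega> t"
        unfolding leftmost_def
      proof (rule cINF_lower)
        show "bdd_below ((\<lambda>v. Y v \<omega> t) ` alive T \<omega> t)"
          by (rule bdd_belowI[of _ 0]) (use nn in \<open>auto simp: alive_def\<close>)
        show "v \<in> alive T \<omega> t" using v(1) bt by (simp add: alive_def)
      qed
      also have "\<dots> \<le> 3 * (K * (2 powr \<gamma>) ^ j)" using v(3) bt up by blast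
      also have "(2 powr \<gamma>) ^ j = ((2::real) ^ j) powr \<gamma>"
        by (simp add: powr_realpow[symmetric] powr_powr mult.commute)
      also have "\<dots> \<le> (2 * t) powr \<gamma>" using lo p_facts(5) by (intro powr_mono2) auto
      also have "\<dots> = 2 powr \<gamma> * t powr \<gamma>" using t1 by (simp add: powr_mult)
      finally show ?thesis using K(1) by (simp add: mult_ac)
    qed
    then show "eventually (\<lambda>t. leftmost T Y \<omega> t \<le> 3 * K * 2 powr \<gamma> * t powr \<gamma>) at_top"
      unfolding eventually_at_top_linorder by blast
  qed
  moreover have "0 < 3 * K * 2 powr \<gamma>" using K by simp
  ultimately show ?thesis by blast
qed

end

theorem theorem1p5:
  fixes \<Lambda> :: "conf measure" and M :: "'w measure"
    and T :: "'w \<Rightarrow> particle set" and Y :: "particle \<Rightarrow> 'w \<Rightarrow> real \<Rightarrow> real"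
    and \<alpha> C \<sigma> \<gamma> :: real
  assumes "sets \<Lambda> = sets Qspace"
    and "emeasure \<Lambda> {conf_zero} + emeasure \<Lambda> {conf_empty} = 0"
    and "(\<integral>\<^sup>+x. min 1 (x 0) \<partial>\<Lambda>) < \<infinity>"
    and "0 < emeasure \<Lambda> Qstar"
    and "\<And>a::real. 0 < a \<Longrightarrow>
           (\<integral>\<^sup>+x. ennreal \<bar>real (card {n. x n < ennreal a}) - 1\<bar> \<partial>\<Lambda>) < \<infinity>"
    and "\<And>a::real. 0 < a \<Longrightarrow>
           (\<integral>\<^sup>+x. ennreal (\<bar>real (card {n. x n < ennreal a}) - 1\<bar>\<^sup>2) \<partial>\<Lambda>) < \<infinity>"
    and "0 < \<alpha>" "\<alpha> < 1" "0 < C"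
    and "asymp_equiv (phi \<Lambda>) at_top (\<lambda>l. C * l powr \<alpha>)"
    and "0 < \<sigma>"
    and "0 < Liminf at_top (\<lambda>a::real. ereal (ln (enn2real (mu \<Lambda> {0..<a})) / a powr (1 + \<sigma>)))"
    and "Limsup at_top (\<lambda>a::real. ereal (ln (enn2real (mu \<Lambda> {0..<a})) / a powr (1 + \<sigma>))) < \<infinity>"
    and "\<exists>c0>0. \<forall>c::real. 0 < c \<and> c \<le> c0 \<longrightarrow>
           Limsup at_top (\<lambda>a::real. M2 \<Lambda> a (c * a powr \<sigma>) / (M1 \<Lambda> a (c * a powr \<sigma>))\<^sup>2) < \<infinity>"
    and "emeasure \<Lambda> {x \<in> Qset. 0 < x 0 \<and> x 0 \<le> x 1 \<and> x 1 < \<infinity>} = 0"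
    and "\<gamma> = 1 / (\<alpha> + (1 - \<alpha>) * (1 + \<sigma>))"
    and "prob_space M"
    and "branching_subordinator M 0 \<Lambda> T Y"
  shows "AE \<omega> in M.
           0 < Liminf at_top (\<lambda>t::real. ereal (leftmost T Y \<omega> t / t powr \<gamma>)) \<and>
           Liminf at_top (\<lambda>t::real. ereal (leftmost T Y \<omega> t / t powr \<gamma>))
             \<le> Limsup at_top (\<lambda>t::real. ereal (leftmost T Y \<omega> t / t powr \<gamma>)) \<and>
           Limsup at_top (\<lambda>t::real. ereal (leftmost T Y \<omega> t / t powr \<gamma>)) < \<infinity>"
proof -
  interpret branching_asymptotics \<Lambda> \<alpha> C \<sigma> \<gamma>
    by (intro branching_asymptotics.intro branching_measure.intro branching_asymptotics_axioms.intro assms)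
  note M = assms(17) and bs = assms(18)
  obtain \<epsilon> where \<epsilon>: "0 < \<epsilon>" and lower: "AE \<omega> in M. eventually (\<lambda>t. \<epsilon> * t powr \<gamma> \<le> leftmost T Y \<omega> t) at_top"
    using lower_bound[OF M bs] by blast
  obtain K where K: "0 < K" and upper: "AE \<omega> in M. eventually (\<lambda>t. leftmost T Y \<omega> t \<le> K * t powr \<gamma>) at_top"
    using upper_bound[OF M bs] by blast
  show ?thesis
    using lower upper
  proof (eventually_elim, intro conjI)
    fix \<omega>
    assume lower: "eventually (\<lambda>t. \<epsilon> * t powr \<gamma> \<le> leftmost T Y \<omega> t) at_top"
      and upper: "eventually (\<lambda>t. leftmost T Y \<omega> t \<le> K * t powr \<gamma>) at_top"
    let ?f = "\<lambda>t::real. ereal (leftmost T Y \<omega> t / t powr \<gamma>)"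
    have "eventually (\<lambda>t. ereal \<epsilon> \<le> ?f t) at_top"
      using lower eventually_gt_at_top[of 0] by eventually_elim (simp add: pos_le_divide_eq)
    then have "ereal \<epsilon> \<le> Liminf at_top ?f" by (rule Liminf_bounded)
    then show "0 < Liminf at_top ?f" using \<epsilon> by (auto intro: less_le_trans[rotated])
    show "Liminf at_top ?f \<le> Limsup at_top ?f" by (rule Liminf_le_Limsup) simp
    have "eventually (\<lambda>t. ?f t \<le> ereal K) at_top"
      using upper eventually_gt_at_top[of 0] by eventually_elim (simp add: pos_divide_le_eq)
    then have "Limsup at_top ?f \<le> ereal K" by (rule Limsup_bounded)
    then show "Limsup at_top ?f < \<infinity>" by (rule le_less_trans) simp
  qed
qed

end
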